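(* Let $\mathcal G$ be a stratified Lie group with homogeneous dimension $Q$ and let $j\in\{1,2,\ldots,n\}$. There exist a large positive constant $r_o$ and a positive constant $C$ such that for every $g\in\mathcal G$ there exists a set $G_g\subset\mathcal G$ (a "twisted truncated sector") satisfying $\inf_{g'\in G_g}\rho(g,g')=r_o$ and such that for every $g_1\in B_\rho(g,1)$ and every $g_2\in G_g$, $$|K_j(g_1,g_2)|\geq C\,\rho(g_1,g_2)^{-Q},\qquad |K_j(g_2,g_1)|\geq C\,\rho(g_1,g_2)^{-Q},$$ all the values $K_j(g_1,g_2)$ ($g_1\in B_\rho(g,1)$, $g_2\in G_g$) have the same sign, and all the values $K_j(g_2,g_1)$ ($g_1\in B_\rho(g,1)$, $g_2\in G_g$) have the same sign. Moreover, the set $G_g$ is regular, in the sense that $|G_g|=\infty$ and that for any $R_2>R_1>2r_o$, $$\left|\left(B_\rho(g,R_2)\setminus B_\rho(g,R_1)\right)\cap G_g\right|\approx\left|B_\rho(g,R_2)\setminus B_\rho(g,R_1)\right|,$$ where the implicit constants are independent of $g$, $R_1$ and $R_2$.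
   Context: A connected, simply connected nilpotent Lie group $\mathcal G$ is stratified if its left-invariant Lie algebra $\mathfrak g$ (real, finite dimensional) has a direct sum decomposition $\mathfrak g=\bigoplus_{i=1}^sV_i$ with $[V_1,V_i]=V_{i+1}$ for $i\le s-1$ and $[V_1,V_s]=0$; $s$ is the step. Let $n_i=\dim V_i$, $n=n_1$, $N=\sum_i n_i$, and let $Q=\sum_{i=1}^s i\dim V_i$ be the homogeneous dimension. Fix a basis $X_1,\dots,X_N$ of $\mathfrak g$ adapted to the stratification (consecutive blocks are bases of $V_1,V_2,\dots,V_s$); in particular $X_1,\dots,X_n$ is a basis of $V_1$. Via exponential coordinates $g=\exp(x_1X_1+\cdots+x_NX_N)$, identify $\mathcal G$ with $(\mathbb R^N,\circ)$, with identity $0$ and Haar measure $dg$ equal to Lebesgue measure; $|E|$ denotes the measure of $E$. Write $g=(x^{(1)},\dots,x^{(s)})$ with $x^{(i)}\in\mathbb R^{n_i}$; the dilations are $\delta_r(g)=(rx^{(1)},r^2x^{(2)},\dots,r^sx^{(s)})$, $r>0$. The homogeneous norm $\rho$ is $$\rho(g)=\Big(\sum_{i=1}^s|x^{(i)}|^{2s!/i}\Big)^{1/(2s!)},$$ where $|x^{(i)}|$ is the Euclidean norm; $\rho(g,g')=\rho(g'^{-1}\circ g)=\rho(g^{-1}\circ g')$, and $B_\rho(g,r)=\{g':\rho(g,g')<r\}$. The sub-Laplacian is $\Delta=\sum_{i=1}^nX_i^2$, and the $j$th Riesz transform is $\mathcal R_j=X_j(-\Delta)^{-1/2}$, $1\le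 j\le n$. Let $p_h$ be the convolution kernel of $e^{h\Delta}$. The convolution kernel of $\mathcal R_j$ is $$K_j(g)=\frac1{\sqrt\pi}\int_0^\infty h^{-1/2}X_jp_h(g)\,dh,\qquad g\ne0,$$ which is $C^\infty$ on $\mathcal G\setminus\{0\}$ and satisfies $K_j(\delta_r(g))=r^{-Q}K_j(g)$. One writes $K_j(g,g')=K_j(g'^{-1}\circ g)$ for the integral kernel. $A\approx B$ means $cB\le A\le c'B$ for positive constants $c,c'$ (the implicit constants). *)

theory Defs
  imports "HOL-Analysis.Analysis"
begin

section \<open>Smooth functions\<close>

primrec Ck :: "nat \<Rightarrow> ('a::real_normed_vector \<Rightarrow> 'b::real_normed_vector) \<Rightarrow> bool" where
  "Ck 0 f = continuous_on UNIV f"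
| "Ck (Suc k) f =
    (\<exists>f'. (\<forall>x. (f has_derivative f' x) (at x)) \<and> (\<forall>v. Ck k (\<lambda>x. f' x v)))"

definition smooth :: "('a::real_normed_vector \<Rightarrow> 'b::real_normed_vector) \<Rightarrow> bool" where
  "smooth f \<longleftrightarrow> (\<forall>k. Ck k f)"


section \<open>Stratified Lie groups in exponential coordinates\<close>

text \<open>The group is \<open>\<real>\<^sup>N\<close>, with \<open>N = CARD('n)\<close>, under a smooth product \<open>mul\<close>. A tangent
  vector \<open>v\<close> at the identity \<open>0\<close> is identified with the left-invariant vector field \<open>X\<^sub>v\<close>; in
  exponential coordinates \<open>exp (t X\<^sub>v)\<close> is the point \<open>t v\<close>. Functions may be vector valued so
  that \<open>X\<^sub>v\<close> can be applied to all coordinate functions at once.\<close>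

definition lvf :: "('a::real_normed_vector \<Rightarrow> 'a \<Rightarrow> 'a) \<Rightarrow> 'a
    \<Rightarrow> ('a \<Rightarrow> 'b::real_normed_vector) \<Rightarrow> 'a \<Rightarrow> 'b" where
  "lvf mul v f g = vector_derivative (\<lambda>t. f (mul g (t *\<^sub>R v))) (at 0)"

text \<open>The value at \<open>0\<close> of the commutator \<open>X\<^sub>x X\<^sub>y - X\<^sub>y X\<^sub>x\<close>, read off by applying it to the
  coordinate functions.\<close>

definition bracket :: "('a::real_normed_vector \<Rightarrow> 'a \<Rightarrow> 'a) \<Rightarrow> 'a \<Rightarrow> 'a \<Rightarrow> 'a" where
  "bracket mul x y = lvf mul x (lvf mul y (\<lambda>g. g)) 0 - lvf mul y (lvf mul x (\<lambda>g. g)) 0"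

text \<open>The adapted basis is the standard basis \<open>axis k 1\<close>, indexed by \<open>k :: 'n\<close>; \<open>deg k\<close> is the
  number of the layer to which the basis vector belongs.\<close>

definition layer :: "('n \<Rightarrow> nat) \<Rightarrow> nat \<Rightarrow> (real ^ 'n) set" where
  "layer deg i = span ((\<lambda>k. axis k 1) ` {k. deg k = i})"

definition step :: "('n::finite \<Rightarrow> nat) \<Rightarrow> nat" where
  "step deg = Max (range deg)"

definition homdim :: "('n::finite \<Rightarrow> nat) \<Rightarrow> nat" where
  "homdim deg = (\<Sum>i = 1..step deg. i * dim (layer deg i :: (real ^ 'n) set))"

text \<open>The assumption \<open>exp_coords\<close> says that the lines through \<open>0\<close> are the one-parameter
  subgroups, i.e. that the coordinates are exponential; accordingly the inverse of \<open>g\<close> is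
  \<open>- g\<close>. The space \<open>\<real>\<^sup>N\<close> is connected and simply connected, and the Lie algebra is nilpotent by
  the bracket conditions. Directness of the sum of the layers is built into \<open>layer\<close>.\<close>

locale stratified_group = group mul "0 :: real ^ 'n" uminus
  for mul :: "real ^ 'n \<Rightarrow> real ^ 'n \<Rightarrow> real ^ 'n" +
  fixes deg :: "'n::finite \<Rightarrow> nat"
  assumes smooth_mul: "smooth (\<lambda>(x, y). mul x y)"
    and exp_coords: "mul (a *\<^sub>R x) (b *\<^sub>R x) = (a + b) *\<^sub>R x"
    and deg_pos: "deg k \<ge> 1"
    and bracket_layer: "1 \<le> i \<Longrightarrow> i < step deg \<Longrightarrow>
      span {bracket mul x y | x y. x \<in> layer deg 1 \<and> y \<in> layer deg i} = layer deg (Suc i)"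
    and bracket_top: "x \<in> layer deg 1 \<Longrightarrow> y \<in> layer deg (step deg) \<Longrightarrow> bracket mul x y = 0"


section \<open>Homogeneous norm\<close>

definition component :: "('n::finite \<Rightarrow> nat) \<Rightarrow> nat \<Rightarrow> real ^ 'n \<Rightarrow> real ^ 'n" where
  "component deg i x = (\<chi> k. if deg k = i then x $ k else 0)"

definition hnorm :: "('n::finite \<Rightarrow> nat) \<Rightarrow> real ^ 'n \<Rightarrow> real" where
  "hnorm deg x = root (2 * fact (step deg))
     (\<Sum>i = 1..step deg. norm (component deg i x) ^ (2 * fact (step deg) div i))"

definition hdist :: "(real ^ 'n \<Rightarrow> real ^ 'n \<Rightarrow> real ^ 'n) \<Rightarrow> ('n::finite \<Rightarrow> nat)
    \<Rightarrow> real ^ 'n \<Rightarrow> real ^ 'n \<Rightarrow> real" where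
  "hdist mul deg g g' = hnorm deg (mul (- g') g)"

definition hball :: "(real ^ 'n \<Rightarrow> real ^ 'n \<Rightarrow> real ^ 'n) \<Rightarrow> ('n::finite \<Rightarrow> nat)
    \<Rightarrow> real ^ 'n \<Rightarrow> real \<Rightarrow> (real ^ 'n) set" where
  "hball mul deg g r = {g'. hdist mul deg g g' < r}"


section \<open>The heat semigroup and its convolution kernel\<close>

definition sublaplacian :: "(real ^ 'n \<Rightarrow> real ^ 'n \<Rightarrow> real ^ 'n) \<Rightarrow> ('n::finite \<Rightarrow> nat)
    \<Rightarrow> (real ^ 'n \<Rightarrow> real) \<Rightarrow> real ^ 'n \<Rightarrow> real" where
  "sublaplacian mul deg f g =
     (\<Sum>k | deg k = 1. lvf mul (axis k 1) (lvf mul (axis k 1) f) g)"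

definition test_fun :: "('a::real_normed_vector \<Rightarrow> real) \<Rightarrow> bool" where
  "test_fun f \<longleftrightarrow> smooth f \<and> compact (closure {x. f x \<noteq> 0})"

text \<open>Elements of \<open>L\<^sup>2\<close> are represented by functions; identities between them hold almost
  everywhere.\<close>

definition L2 :: "('a::euclidean_space \<Rightarrow> real) set" where
  "L2 = {f \<in> borel_measurable lborel. integrable lborel (\<lambda>x. (f x)\<^sup>2)}"

definition L2_norm :: "('a::euclidean_space \<Rightarrow> real) \<Rightarrow> real" where
  "L2_norm f = sqrt (LINT x|lborel. (f x)\<^sup>2)"

definition contraction_semigroup ::
    "(real \<Rightarrow> ('a::euclidean_space \<Rightarrow> real) \<Rightarrow> ('a \<Rightarrow> real)) \<Rightarrow> bool" where
  "contraction_semigroup T \<longleftrightarrow>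
     (\<forall>h\<ge>0. \<forall>f\<in>L2. T h f \<in> L2 \<and> L2_norm (T h f) \<le> L2_norm f) \<and>
     (\<forall>h\<ge>0. \<forall>f\<in>L2. \<forall>u\<in>L2. \<forall>a b.
        AE x in lborel. T h (\<lambda>y. a * f y + b * u y) x = a * T h f x + b * T h u x) \<and>
     (\<forall>f\<in>L2. AE x in lborel. T 0 f x = f x) \<and>
     (\<forall>h\<ge>0. \<forall>k\<ge>0. \<forall>f\<in>L2. AE x in lborel. T (h + k) f x = T h (T k f) x) \<and>
     (\<forall>f\<in>L2. ((\<lambda>h. L2_norm (\<lambda>x. T h f x - f x)) \<longlongrightarrow> 0) (at_right 0))"

definition generator_graph ::
    "(real \<Rightarrow> ('a::euclidean_space \<Rightarrow> real) \<Rightarrow> ('a \<Rightarrow> real)) \<Rightarrow> (('a \<Rightarrow> real) \<times> ('a \<Rightarrow> real)) set"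
  where
  "generator_graph T = {(f, u). f \<in> L2 \<and> u \<in> L2 \<and>
     ((\<lambda>h. L2_norm (\<lambda>x. (T h f x - f x) / h - u x)) \<longlongrightarrow> 0) (at_right 0)}"

text \<open>Graph of the closure in \<open>L\<^sup>2\<close> of an operator given on \<open>C\<^sub>c\<^sup>\<infinity>\<close>.\<close>

definition closure_graph :: "(('a::euclidean_space \<Rightarrow> real) \<Rightarrow> ('a \<Rightarrow> real))
    \<Rightarrow> (('a \<Rightarrow> real) \<times> ('a \<Rightarrow> real)) set" where
  "closure_graph A = {(f, u). f \<in> L2 \<and> u \<in> L2 \<and>
     (\<exists>\<phi> :: nat \<Rightarrow> 'a \<Rightarrow> real. (\<forall>m. test_fun (\<phi> m)) \<and>
        (\<lambda>m. L2_norm (\<lambda>x. \<phi> m x - f x)) \<longlonglongrightarrow> 0 \<and>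
        (\<lambda>m. L2_norm (\<lambda>x. A (\<phi> m) x - u x)) \<longlonglongrightarrow> 0)}"

text \<open>\<open>T h = e\<^bsup>h\<Delta>\<^esup>\<close>. The sub-Laplacian is essentially self-adjoint on \<open>C\<^sub>c\<^sup>\<infinity>\<close>, so its closure
  is the self-adjoint operator meant by \<open>\<Delta>\<close>; a contraction semigroup is determined by its
  generator, up to almost everywhere equality.\<close>

definition heat_semigroup :: "(real ^ 'n \<Rightarrow> real ^ 'n \<Rightarrow> real ^ 'n) \<Rightarrow> ('n::finite \<Rightarrow> nat)
    \<Rightarrow> (real \<Rightarrow> (real ^ 'n \<Rightarrow> real) \<Rightarrow> (real ^ 'n \<Rightarrow> real)) \<Rightarrow> bool" where
  "heat_semigroup mul deg T \<longleftrightarrow>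
     contraction_semigroup T \<and> generator_graph T = closure_graph (sublaplacian mul deg)"

definition gconv :: "(real ^ 'n \<Rightarrow> real ^ 'n \<Rightarrow> real ^ 'n)
    \<Rightarrow> (real ^ 'n \<Rightarrow> real) \<Rightarrow> (real ^ 'n \<Rightarrow> real) \<Rightarrow> real ^ 'n \<Rightarrow> real" where
  "gconv mul f p g = (LINT g'|lborel. f g' * p (mul (- g') g))"

text \<open>The relation \<open>e\<^bsup>h\<Delta>\<^esup> f = f * p\<^sub>h\<close> determines \<open>p\<^sub>h\<close> only almost everywhere; smoothness selects
  the representative whose derivatives enter pointwise below.\<close>

definition heat_kernel :: "(real ^ 'n \<Rightarrow> real ^ 'n \<Rightarrow> real ^ 'n) \<Rightarrow> ('n::finite \<Rightarrow> nat)
    \<Rightarrow> (real \<Rightarrow> real ^ 'n \<Rightarrow> real) \<Rightarrow> bool" where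
  "heat_kernel mul deg p \<longleftrightarrow>
     (\<forall>h>0. smooth (p h)) \<and>
     (\<exists>T. heat_semigroup mul deg T \<and>
        (\<forall>h>0. \<forall>f\<in>L2. AE g in lborel. T h f g = gconv mul f (p h) g))"


section \<open>Riesz transform kernels\<close>

definition riesz_conv_kernel :: "(real ^ 'n \<Rightarrow> real ^ 'n \<Rightarrow> real ^ 'n)
    \<Rightarrow> (real \<Rightarrow> real ^ 'n \<Rightarrow> real) \<Rightarrow> 'n::finite \<Rightarrow> real ^ 'n \<Rightarrow> real" where
  "riesz_conv_kernel mul p j g =
     1 / sqrt pi * (LINT h:{0<..}|lborel. h powr (- (1 / 2)) * lvf mul (axis j 1) (p h) g)"

definition riesz_kernel :: "(real ^ 'n \<Rightarrow> real ^ 'n \<Rightarrow> real ^ 'n)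
    \<Rightarrow> (real \<Rightarrow> real ^ 'n \<Rightarrow> real) \<Rightarrow> 'n::finite \<Rightarrow> real ^ 'n \<Rightarrow> real ^ 'n \<Rightarrow> real" where
  "riesz_kernel mul p j g g' = riesz_conv_kernel mul p j (mul (- g') g)"

end

theory Submission
  imports Defs
begin

text \<open>The heat kernel inherits the symmetries of the generator: a contraction semigroup is determined
  by its generator, so \<open>p\<^sub>h\<close> is nonnegative, even, satisfies the semigroup law and scales as
  \<open>p\<^sub>h(x) = r\<^sup>Q p(r\<^sup>2 h, \<delta>\<^sub>r x)\<close>. Testing the generator against powers of \<open>1 + \<rho>\<^bsup>2 s!\<^esup>\<close>, suitably cut
  off, shows that all moments of \<open>p\<^sub>h\<close> are finite; with the semigroup law this gives rapid decay of
  \<open>p\<^sub>h\<close> and, through a weighted energy estimate, of its horizontal gradient. Hence the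
  integral defining \<open>K\<^sub>j\<close> converges uniformly away from the origin, and \<open>K\<^sub>j\<close> is continuous and homogeneous
  of degree \<open>-Q\<close>. At the basis vector \<open>e\<^sub>j\<close> the scaling turns the integral over \<open>h\<close> into
  one along the ray through \<open>e\<^sub>j\<close>, and an integration by parts gives \<open>K\<^sub>j(e\<^sub>j) < 0\<close>, while
  \<open>K\<^sub>j(- e\<^sub>j) = - K\<^sub>j(e\<^sub>j)\<close> because \<open>p\<^sub>h\<close> is even. By continuity and homogeneity \<open>K\<^sub>j\<close> and
  \<open>x \<mapsto> K\<^sub>j(x\<^bsup>-1\<^esup>)\<close> keep their signs on the cone over a small ball about \<open>e\<^sub>j\<close>. Far from the origin a
  left translation by a point of the unit ball barely moves this cone, so the sector may be
  taken to be the left translate by \<open>g\<close> of a smaller truncated cone; its measure in annuli is exact by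
  dilation.\<close>

section \<open>Calculus of smooth functions\<close>

text \<open>The heat kernel is given only by its smoothness in space and by an almost everywhere
  formula for the semigroup; nothing is assumed about its regularity in \<open>h\<close> or about
  Gaussian bounds. Pointwise facts on \<open>p h\<close> are therefore extracted by pairing with
  nonnegative bumps, and differential inequalities in time become one-step inequalities in L2. The
  semigroup law is delicate because the convolution of two kernels is not known to converge before
  it is identified. That dilations are automorphisms and that translations preserve Lebesgue measure
  have to be proved as well: the first follows by recovering the group law from its bracket, the
  second from the first, since dilations shrink every point to the identity. Scaling reduces all
  times to two: \<open>p 1\<close> carries the L2 estimates and p_2 = p_1 * p_1 turns them into
  pointwise ones. The energy estimate needs a bound for the sub-Laplacian of \<open>p 1\<close>; it
  comes from the semigroup law at the identity, where p_t(0) is an exact power of t. The sign of the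
  kernel at e_j then rests on p_2 >= 0, p_2(0) > 0 and the decay of p_2.\<close>

abbreviation fd :: "('a::real_normed_vector \<Rightarrow> 'b::real_normed_vector) \<Rightarrow> 'a \<Rightarrow> 'a \<Rightarrow> 'b" where
  "fd f x \<equiv> frechet_derivative f (at x)"

lemma fd_eq: "(f has_derivative f') (at x) \<Longrightarrow> fd f x = f'"
  by (simp add: frechet_derivative_at[symmetric])

text \<open>Uniqueness of the derivative forces the existential witness in \<open>Ck\<close> to be
  \<open>fd f\<close>, so iterated derivatives can be treated as functions.\<close>

lemma Ck_Suc_iff:
  "Ck (Suc k) f \<longleftrightarrow> (\<forall>x. f differentiable at x) \<and> (\<forall>v. Ck k (\<lambda>x. fd f x v))"
proof
  assume "Ck (Suc k) f"
  then obtain f' where f': "\<And>x. (f has_derivative f' x) (at x)" "\<And>v. Ck k (\<lambda>x. f' x v)"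
    by auto
  have "fd f = f'" using fd_eq[OF f'(1)] by blast
  then show "(\<forall>x. f differentiable at x) \<and> (\<forall>v. Ck k (\<lambda>x. fd f x v))"
    using f' by (auto simp: differentiable_def)
next
  assume "(\<forall>x. f differentiable at x) \<and> (\<forall>v. Ck k (\<lambda>x. fd f x v))"
  then show "Ck (Suc k) f"
    by (auto simp: frechet_derivative_works)
qed

lemma Ck_SucI:
  assumes "\<And>x. (f has_derivative f' x) (at x)" "\<And>v. Ck k (\<lambda>x. f' x v)"
  shows "Ck (Suc k) f"
  using assms by auto

lemma Ck_Suc_D: "Ck (Suc k) f \<Longrightarrow> Ck k f"
proof (induction k arbitrary: f)
  case 0
  then obtain f' where "\<And>x. (f has_derivative f' x) (at x)" by auto
  then show ?case
    using continuous_at_imp_continuous_on has_derivative_continuous by (metis Ck.simps(1))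
next
  case (Suc k)
  then show ?case unfolding Ck_Suc_iff[of "Suc k" f] Ck_Suc_iff[of k f] by blast
qed

lemma Ck_continuous: "Ck k f \<Longrightarrow> continuous_on UNIV f"
  by (induction k) (auto dest: Ck_Suc_D simp del: Ck.simps(2))

lemma Ck_const [simp]: "Ck k (\<lambda>x. c)"
proof (induction k arbitrary: c)
  case (Suc k)
  show ?case by (rule Ck_SucI[where f' = "\<lambda>_ _. 0"]) (auto simp: Suc simp del: Ck.simps)
qed auto

lemma Ck_bounded_linear:
  assumes "bounded_linear h" "Ck k f"
  shows "Ck k (\<lambda>x. h (f x))"
  using assms(2)
proof (induction k arbitrary: f)
  case 0
  then show ?case using assms(1) by (auto intro: bounded_linear.continuous_on)
next
  case (Suc k)
  then obtain f' where f': "\<And>x. (f has_derivative f' x) (at x)" "\<And>v. Ck k (\<lambda>x. f' x v)"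
    by auto
  show ?case
    by (rule Ck_SucI[OF bounded_linear.has_derivative[OF assms(1) f'(1)]]) (rule Suc.IH[OF f'(2)])
qed

lemma Ck_linear: "bounded_linear h \<Longrightarrow> Ck k h"
proof (cases k)
  case 0
  then show "bounded_linear h \<Longrightarrow> ?thesis" by (auto intro: linear_continuous_on)
next
  case (Suc m)
  then show "bounded_linear h \<Longrightarrow> ?thesis"
    by (auto simp del: Ck.simps intro!: Ck_SucI bounded_linear_imp_has_derivative)
qed

lemma Ck_add: "Ck k f \<Longrightarrow> Ck k g \<Longrightarrow> Ck k (\<lambda>x. f x + g x)"
proof (induction k arbitrary: f g)
  case 0
  then show ?case by (auto intro: continuous_on_add)
next
  case (Suc k)
  from Suc.prems obtain f' where f': "\<And>x. (f has_derivative f' x) (at x)" "\<And>v. Ck k (\<lambda>x. f' x v)"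
    by auto
  from Suc.prems obtain g' where g': "\<And>x. (g has_derivative g' x) (at x)" "\<And>v. Ck k (\<lambda>x. g' x v)"
    by auto
  show ?case
    by (rule Ck_SucI[OF has_derivative_add[OF f'(1) g'(1)]]) (rule Suc.IH[OF f'(2) g'(2)])
qed

lemma Ck_sum: "(\<And>i. i \<in> I \<Longrightarrow> Ck k (f i)) \<Longrightarrow> Ck k (\<lambda>x. \<Sum>i\<in>I. f i x)"
  by (induction I rule: infinite_finite_induct) (auto intro: Ck_add)

lemma Ck_bilinear:
  assumes b: "bounded_bilinear b" and "Ck k f" "Ck k g"
  shows "Ck k (\<lambda>x. b (f x) (g x))"
  using assms(2,3)
proof (induction k arbitrary: f g)
  case 0
  then show ?case using bounded_bilinear.continuous_on[OF b] by auto
next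
  case (Suc k)
  from Suc.prems obtain f' where f': "\<And>x. (f has_derivative f' x) (at x)" "\<And>v. Ck k (\<lambda>x. f' x v)"
    by auto
  from Suc.prems obtain g' where g': "\<And>x. (g has_derivative g' x) (at x)" "\<And>v. Ck k (\<lambda>x. g' x v)"
    by auto
  show ?case
    by (rule Ck_SucI[OF bounded_bilinear.FDERIV[OF b f'(1) g'(1)]])
      (intro Ck_add Suc.IH f' g' Ck_Suc_D[OF Suc.prems(1)] Ck_Suc_D[OF Suc.prems(2)])
qed

text \<open>\<open>Ck\<close> tests derivatives only in fixed directions. Expanding a moving
  direction over the basis reduces it to fixed ones with variable coefficients, which is what the
  chain rule and all derivatives along vector fields need.\<close>

lemma linear_euclidean_sum:
  fixes f :: "'a::euclidean_space \<Rightarrow> 'b::real_vector"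
  assumes "linear f"
  shows "f x = (\<Sum>i\<in>Basis. (x \<bullet> i) *\<^sub>R f i)"
proof -
  have "f x = f (\<Sum>i\<in>Basis. (x \<bullet> i) *\<^sub>R i)" by (simp add: euclidean_representation)
  also have "\<dots> = (\<Sum>i\<in>Basis. (x \<bullet> i) *\<^sub>R f i)" by (simp add: linear_sum[OF assms] linear_scale[OF assms])
  finally show ?thesis .
qed

lemma has_derivative_linear: "(f has_derivative f') (at x) \<Longrightarrow> linear f'"
  by (simp add: has_derivative_bounded_linear bounded_linear.linear)

lemma Ck_compose:
  fixes f :: "'b::euclidean_space \<Rightarrow> 'c::real_normed_vector" and g :: "'a::real_normed_vector \<Rightarrow> 'b"
  shows "Ck k f \<Longrightarrow> Ck k g \<Longrightarrow> Ck k (\<lambda>x. f (g x))"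
proof (induction k arbitrary: f)
  case 0
  then show ?case using continuous_on_compose[of UNIV g f]
    by (auto simp: o_def intro: continuous_on_subset)
next
  case (Suc k)
  from Suc.prems obtain f' where f': "\<And>x. (f has_derivative f' x) (at x)" "\<And>v. Ck k (\<lambda>x. f' x v)"
    by auto
  from Suc.prems obtain g' where g': "\<And>x. (g has_derivative g' x) (at x)" "\<And>v. Ck k (\<lambda>x. g' x v)"
    by auto
  have "((\<lambda>x. f (g x)) has_derivative (\<lambda>v. f' (g x) (g' x v))) (at x)" for x
    using diff_chain_at[OF g'(1) f'(1)] by (simp add: o_def)
  moreover have "Ck k (\<lambda>x. f' (g x) (g' x v))" for v
    unfolding linear_euclidean_sum[OF has_derivative_linear[OF f'(1)], of _ "g' _ v"]
    by (intro Ck_sum Ck_bilinear[OF bounded_bilinear_scaleR] Suc.IH f' Ck_Suc_D[OF Suc.prems(2)]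
        Ck_bounded_linear[OF bounded_linear_inner_left] g')
  ultimately show ?case by (rule Ck_SucI)
qed

lemma bounded_linear_Pair_0: "bounded_linear (\<lambda>x. (x, 0))" "bounded_linear (\<lambda>x. (0, x))"
  by (auto intro!: bounded_linear_Pair bounded_linear_ident bounded_linear_zero)

lemma Ck_Pair:
  assumes "Ck k f" "Ck k g"
  shows "Ck k (\<lambda>x. (f x, g x))"
  using Ck_add[OF Ck_bounded_linear[OF bounded_linear_Pair_0(1) assms(1)] Ck_bounded_linear[OF bounded_linear_Pair_0(2) assms(2)]]
  by simp

lemma smooth_const [simp]: "smooth (\<lambda>x. c)"
  and smooth_add: "smooth f \<Longrightarrow> smooth g \<Longrightarrow> smooth (\<lambda>x. f x + g x)"
  and smooth_sum: "(\<And>i. i \<in> I \<Longrightarrow> smooth (h i)) \<Longrightarrow> smooth (\<lambda>x. \<Sum>i\<in>I. h i x)"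
  and smooth_Pair: "smooth f \<Longrightarrow> smooth g' \<Longrightarrow> smooth (\<lambda>x. (f x, g' x))"
  unfolding smooth_def by (auto intro: Ck_add Ck_sum Ck_Pair simp del: Ck.simps)

lemma smooth_linear: "bounded_linear f \<Longrightarrow> smooth f"
  and smooth_bounded_linear: "bounded_linear h \<Longrightarrow> smooth g \<Longrightarrow> smooth (\<lambda>x. h (g x))"
  and smooth_bilinear: "bounded_bilinear b \<Longrightarrow> smooth g \<Longrightarrow> smooth g' \<Longrightarrow> smooth (\<lambda>x. b (g x) (g' x))"
  unfolding smooth_def by (auto intro: Ck_linear Ck_bounded_linear Ck_bilinear simp del: Ck.simps)

lemma smooth_compose:
  fixes f :: "'b::euclidean_space \<Rightarrow> 'c::real_normed_vector"
  shows "smooth f \<Longrightarrow> smooth g \<Longrightarrow> smooth (\<lambda>x. f (g x))"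
  unfolding smooth_def by (auto intro: Ck_compose simp del: Ck.simps)

lemmas smooth_scaleR = smooth_bilinear[OF bounded_bilinear_scaleR]
lemmas smooth_mult = smooth_bilinear[OF bounded_bilinear_mult]
lemmas smooth_id = smooth_linear[OF bounded_linear_ident]

lemma smooth_uminus: "smooth f \<Longrightarrow> smooth (\<lambda>x. - f x)"
  by (rule smooth_bounded_linear[OF bounded_linear_minus[OF bounded_linear_ident]])

lemma smooth_diff: "smooth f \<Longrightarrow> smooth g \<Longrightarrow> smooth (\<lambda>x. f x - g x)"
  using smooth_add[of f "\<lambda>x. - g x"] smooth_uminus[of g] by simp

lemma smooth_power: "smooth f \<Longrightarrow> smooth (\<lambda>x. f x ^ n)" for f :: "'a::real_normed_vector \<Rightarrow> real"
  by (induction n) (auto intro: smooth_mult)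

lemma smooth_has_derivative: "smooth f \<Longrightarrow> (f has_derivative fd f x) (at x)"
  unfolding smooth_def using Ck_Suc_iff[of 0 f] by (metis frechet_derivative_works)

lemma smooth_continuous_on: "smooth f \<Longrightarrow> continuous_on S f"
  unfolding smooth_def using Ck_continuous continuous_on_subset by blast

lemma smooth_fd: "smooth f \<Longrightarrow> smooth (\<lambda>x. fd f x v)"
  unfolding smooth_def using Ck_Suc_iff by blast

lemma smooth_fd_linear: "smooth f \<Longrightarrow> linear (fd f x)"
  using smooth_has_derivative has_derivative_linear by blast

lemma smooth_fd_compose:
  fixes f :: "'b::euclidean_space \<Rightarrow> 'c::real_normed_vector"
  assumes "smooth f" "smooth u" "smooth w"
  shows "smooth (\<lambda>x. fd f (u x) (w x))"
  unfolding linear_euclidean_sum[OF smooth_fd_linear[OF assms(1)], of _ "w _"]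
  by (intro smooth_sum smooth_scaleR smooth_bounded_linear[OF bounded_linear_inner_left] assms
      smooth_compose[OF smooth_fd[OF assms(1)] assms(2)])

text \<open>The second difference of \<open>f\<close> over a small parallelogram is symmetric in its
  two sides, and the mean value theorem used twice expresses it by either mixed derivative at a
  nearby point. Continuity of both derivatives then forces equality.\<close>

lemma second_derivative_symmetric:
  fixes f :: "'a::real_normed_vector \<Rightarrow> real"
  assumes f: "smooth f"
  shows "fd (\<lambda>y. fd f y v) x u = fd (\<lambda>y. fd f y u) x v"
proof -
  define Duv where "Duv = (\<lambda>u v y. fd (\<lambda>y. fd f y v) y u)"
  have cD: "isCont (Duv u v) y" for u v y
    unfolding Duv_def
    using smooth_continuous_on[OF smooth_fd[OF smooth_fd[OF f]], of UNIV]
    by (simp add: continuous_on_eq_continuous_at)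
  have line: "((\<lambda>s. h (y + s *\<^sub>R u)) has_real_derivative fd h (y + s *\<^sub>R u) u) (at s)"
    if h: "smooth h" for h :: "'a \<Rightarrow> real" and y u s
  proof -
    have "((\<lambda>s. y + s *\<^sub>R u) has_derivative (\<lambda>s. s *\<^sub>R u)) (at s)"
      by (auto intro!: derivative_eq_intros)
    from diff_chain_at[OF this smooth_has_derivative[OF h]]
    show ?thesis
      by (simp add: o_def has_field_derivative_def linear_cmul[OF smooth_fd_linear[OF h]] mult_commute_abs)
  qed
  \<comment> \<open>First the mean value theorem in direction \<open>v\<close> for the difference of
    two parallel lines, then in direction \<open>u\<close> for the derivative along
    \<open>v\<close>.\<close>
  have key: "\<exists>s t. 0 < s \<and> s < e \<and> 0 < t \<and> t < e \<and>
      f (x + e *\<^sub>R u + e *\<^sub>R v) - f (x + e *\<^sub>R u) - f (x + e *\<^sub>R v) + f x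
        = e * e * Duv u v (x + s *\<^sub>R u + t *\<^sub>R v)" if e: "e > 0" for e u v
  proof -
    let ?g = "\<lambda>t. f (x + e *\<^sub>R u + t *\<^sub>R v) - f (x + t *\<^sub>R v)"
    have "\<exists>t. 0 < t \<and> t < e \<and> ?g e - ?g 0 = (e - 0) *
        (fd f (x + e *\<^sub>R u + t *\<^sub>R v) v - fd f (x + t *\<^sub>R v) v)"
      by (rule MVT2[OF e]) (intro DERIV_diff line f)
    then obtain t where t: "0 < t" "t < e"
      "?g e - ?g 0 = e * (fd f (x + e *\<^sub>R u + t *\<^sub>R v) v - fd f (x + t *\<^sub>R v) v)" by auto
    let ?h = "\<lambda>y. fd f y v"
    have "\<exists>s. 0 < s \<and> s < e \<and> ?h ((x + t *\<^sub>R v) + e *\<^sub>R u) - ?h ((x + t *\<^sub>R v) + 0 *\<^sub>R u)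
        = (e - 0) * fd ?h ((x + t *\<^sub>R v) + s *\<^sub>R u) u"
      by (rule MVT2[OF e]) (intro line smooth_fd f)
    then obtain s where s: "0 < s" "s < e"
      "?h ((x + t *\<^sub>R v) + e *\<^sub>R u) - ?h ((x + t *\<^sub>R v)) = e * fd ?h ((x + t *\<^sub>R v) + s *\<^sub>R u) u" by auto
    show ?thesis
      using t s by (intro exI[of _ s] exI[of _ t]) (simp add: Duv_def algebra_simps)
  qed
  have "Duv u v x = Duv v u x"
  proof (rule ccontr)
    assume ne: "Duv u v x \<noteq> Duv v u x"
    define d where "d = \<bar>Duv u v x - Duv v u x\<bar> / 2"
    have d: "d > 0" using ne by (simp add: d_def)
    obtain r1 where r1: "r1 > 0" "\<And>y. dist y x < r1 \<Longrightarrow> dist (Duv u v y) (Duv u v x) < d"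
      using cD[of x u v] d by (auto simp: continuous_at_eps_delta dest!: spec[of _ d])
    obtain r2 where r2: "r2 > 0" "\<And>y. dist y x < r2 \<Longrightarrow> dist (Duv v u y) (Duv v u x) < d"
      using cD[of x v u] d by (auto simp: continuous_at_eps_delta dest!: spec[of _ d])
    \<comment> \<open>A point x + s u + t v with s, t < e is at distance less than e K from
      \<open>x\<close>; the summand 1 keeps \<open>K\<close> positive when both directions
      vanish.\<close>
    define K where "K = norm u + norm v + 1"
    have K: "K > 0" by (simp add: K_def add_nonneg_pos)
    define e where "e = min r1 r2 / K"
    have e: "e > 0" using r1(1) r2(1) K by (simp add: e_def)
    have near: "dist (x + s *\<^sub>R a + t *\<^sub>R b) x < min r1 r2"
      if "0 < s" "s < e" "0 < t" "t < e" "norm a + norm b + 1 = K" for s t a b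
    proof -
      have "dist (x + s *\<^sub>R a + t *\<^sub>R b) x = norm (s *\<^sub>R a + t *\<^sub>R b)" by (simp add: dist_norm)
      also have "\<dots> \<le> s * norm a + t * norm b" using that norm_triangle_ineq[of "s *\<^sub>R a" "t *\<^sub>R b"] by simp
      also have "\<dots> \<le> e * norm a + e * norm b" using that by (intro add_mono mult_right_mono) auto
      also have "\<dots> < e * K" using e that(5) by (simp add: algebra_simps flip: that(5))
      also have "\<dots> = min r1 r2" using K by (simp add: e_def)
      finally show ?thesis .
    qed
    obtain s t where st: "0 < s" "s < e" "0 < t" "t < e"
      "f (x + e *\<^sub>R u + e *\<^sub>R v) - f (x + e *\<^sub>R u) - f (x + e *\<^sub>R v) + f x
        = e * e * Duv u v (x + s *\<^sub>R u + t *\<^sub>R v)" using key[OF e] by blast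
    obtain s' t' where st': "0 < s'" "s' < e" "0 < t'" "t' < e"
      "f (x + e *\<^sub>R v + e *\<^sub>R u) - f (x + e *\<^sub>R v) - f (x + e *\<^sub>R u) + f x
        = e * e * Duv v u (x + s' *\<^sub>R v + t' *\<^sub>R u)" using key[OF e] by blast
    have "e * e * Duv u v (x + s *\<^sub>R u + t *\<^sub>R v) = e * e * Duv v u (x + s' *\<^sub>R v + t' *\<^sub>R u)"
      using st(5) st'(5) by (simp add: algebra_simps)
    then have eq: "Duv u v (x + s *\<^sub>R u + t *\<^sub>R v) = Duv v u (x + s' *\<^sub>R v + t' *\<^sub>R u)" using e by simp
    have "dist (Duv u v (x + s *\<^sub>R u + t *\<^sub>R v)) (Duv u v x) < d"
      using near[OF st(1-4)] by (intro r1) (simp add: K_def)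
    moreover have "dist (Duv v u (x + s' *\<^sub>R v + t' *\<^sub>R u)) (Duv v u x) < d"
      using near[OF st'(1-4)] by (intro r2) (simp add: K_def)
    ultimately show False using eq d by (simp add: d_def dist_real_def abs_if split: if_splits)
  qed
  then show ?thesis by (simp add: Duv_def)
qed

lemma second_derivative_symmetric_euclidean:
  fixes f :: "'a::real_normed_vector \<Rightarrow> 'b::euclidean_space"
  assumes f: "smooth f"
  shows "fd (\<lambda>y. fd f y v) x u = fd (\<lambda>y. fd f y u) x v"
proof (rule euclidean_eqI)
  fix b :: 'b assume "b \<in> Basis"
  have l: "bounded_linear (\<lambda>z. z \<bullet> b)" by (rule bounded_linear_inner_left)
  have *: "fd (\<lambda>y. g y \<bullet> b) y = (\<lambda>v. fd g y v \<bullet> b)" if "smooth g" for g :: "'a \<Rightarrow> 'b" and y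
    by (rule fd_eq) (rule bounded_linear.has_derivative[OF l smooth_has_derivative[OF that]])
  have "smooth (\<lambda>y. f y \<bullet> b)" by (rule smooth_bounded_linear[OF l f])
  from second_derivative_symmetric[OF this, of v x u]
  show "fd (\<lambda>y. fd f y v) x u \<bullet> b = fd (\<lambda>y. fd f y u) x v \<bullet> b"
    by (simp add: *[OF f] *[OF smooth_fd[OF f]])
qed

section \<open>Group laws in exponential coordinates\<close>

lemma hvd_compose:
  assumes "(c has_vector_derivative c') (at t)" "smooth f"
  shows "((\<lambda>t. f (c t)) has_vector_derivative fd f (c t) c') (at t)"
  using diff_chain_at[OF assms(1)[unfolded has_vector_derivative_def] smooth_has_derivative[OF assms(2)]]
  by (simp add: o_def has_vector_derivative_def linear_scale[OF smooth_fd_linear[OF assms(2)]])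

lemma hvd_line: "((\<lambda>t. a + t *\<^sub>R v) has_vector_derivative v) (at t)"
  by (auto intro!: derivative_eq_intros)

lemma hvd_line0: "((\<lambda>t. t *\<^sub>R v) has_vector_derivative v) (at t)"
  by (auto intro!: derivative_eq_intros)

lemma fd_eq_hvd:
  assumes "smooth f" "((\<lambda>t. f (a + t *\<^sub>R v)) has_vector_derivative d) (at 0)"
  shows "fd f a v = d"
  using vector_derivative_unique_at[OF hvd_compose[OF hvd_line[of a v 0] assms(1)] assms(2)] by simp

lemma hvd_Pair:
  assumes "(a has_vector_derivative a') (at t)" "(b has_vector_derivative b') (at t)"
  shows "((\<lambda>t. (a t, b t)) has_vector_derivative (a', b')) (at t)"
  using has_derivative_Pair[OF assms[unfolded has_vector_derivative_def]]
  by (simp add: has_vector_derivative_def)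

lemma fd_compose:
  assumes "smooth f" "smooth g"
  shows "fd (\<lambda>x. f (g x)) x v = fd f (g x) (fd g x v)"
proof -
  have "((\<lambda>x. f (g x)) has_derivative (\<lambda>v. fd f (g x) (fd g x v))) (at x)"
    using diff_chain_at[OF smooth_has_derivative[OF assms(2)] smooth_has_derivative[OF assms(1)]]
    by (simp add: o_def)
  from fun_cong[OF fd_eq[OF this]] show ?thesis .
qed

text \<open>The point enters twice, as base point of the derivative and through the direction. Over
  the basis this is an ordinary product rule.\<close>

lemma fd_fd:
  fixes f :: "'a::euclidean_space \<Rightarrow> 'b::real_normed_vector"
  assumes f: "smooth f" and w: "smooth w"
  shows "fd (\<lambda>x. fd f x (w x)) x u = fd (\<lambda>y. fd f y (w x)) x u + fd f x (fd w x u)"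
proof -
  have e: "fd f x c = (\<Sum>i\<in>Basis. (c \<bullet> i) *\<^sub>R fd f x i)" for x c
    by (rule linear_euclidean_sum[OF smooth_fd_linear[OF f]])
  have 1: "((\<lambda>x. fd f x (w x)) has_derivative
      (\<lambda>h. \<Sum>i\<in>Basis. (w x \<bullet> i) *\<^sub>R fd (\<lambda>y. fd f y i) x h + (fd w x h \<bullet> i) *\<^sub>R fd f x i)) (at x)"
    unfolding e[of _ "w _"]
    by (intro has_derivative_sum has_derivative_scaleR smooth_has_derivative smooth_fd f
        bounded_linear.has_derivative[OF bounded_linear_inner_left] w)
  have 2: "((\<lambda>y. fd f y c) has_derivative
      (\<lambda>h. \<Sum>i\<in>Basis. (c \<bullet> i) *\<^sub>R fd (\<lambda>y. fd f y i) x h)) (at x)" for c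
    unfolding e[of _ c]
    by (intro has_derivative_sum has_derivative_scaleR_right smooth_has_derivative smooth_fd f)
  show ?thesis
    unfolding fd_eq[OF 1] fd_eq[OF 2[of "w x"]] by (subst e[of x "fd w x u"]) (simp add: sum.distrib)
qed

text \<open>Energy form of Gronwall's argument: if \<open>K\<close> bounds \<open>A\<close>, then
  |d|^2 exp(-2 K s) is nonincreasing, nonnegative, and zero at the start.\<close>

lemma linear_ode_zero:
  fixes d :: "real \<Rightarrow> 'a::real_inner"
  assumes d: "\<And>s. (d has_vector_derivative A (d s)) (at s)" and A: "bounded_linear A"
    and "d 0 = 0" "t \<ge> 0"
  shows "d t = 0"
proof -
  obtain K where K: "\<And>x. norm (A x) \<le> norm x * K" using bounded_linear.bounded[OF A] by blast
  define e where "e = (\<lambda>s. (d s \<bullet> d s) * exp (- 2 * K * s))"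
  have "(e has_real_derivative (2 * (d s \<bullet> A (d s)) - 2 * K * (d s \<bullet> d s)) * exp (- 2 * K * s)) (at s)" for s
  proof -
    have "((\<lambda>s. d s \<bullet> d s) has_derivative (\<lambda>h. d s \<bullet> (h *\<^sub>R A (d s)) + (h *\<^sub>R A (d s)) \<bullet> d s)) (at s)"
      using has_derivative_inner d by (force simp: has_vector_derivative_def)
    then have "((\<lambda>s. d s \<bullet> d s) has_real_derivative 2 * (d s \<bullet> A (d s))) (at s)"
      by (rule has_derivative_imp_has_field_derivative) (simp add: inner_commute)
    then show ?thesis unfolding e_def
      by (auto intro!: derivative_eq_intros simp: algebra_simps)
  qed
  moreover have "(2 * (d s \<bullet> A (d s)) - 2 * K * (d s \<bullet> d s)) * exp (- 2 * K * s) \<le> 0" for s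
  proof -
    have "d s \<bullet> A (d s) \<le> norm (d s) * norm (A (d s))" by (rule norm_cauchy_schwarz)
    also have "\<dots> \<le> norm (d s) * (norm (d s) * K)" by (intro mult_left_mono K) auto
    also have "\<dots> = K * (d s \<bullet> d s)" by (simp add: dot_square_norm power2_eq_square)
    finally show ?thesis by (intro mult_nonpos_nonneg) auto
  qed
  ultimately have "e t \<le> e 0"
    using DERIV_nonpos_imp_nonincreasing[of 0 t e] assms(4) by blast
  then have "d t \<bullet> d t \<le> 0" using assms(3) by (simp add: e_def mult_le_0_iff)
  then show ?thesis by (metis inner_eq_zero_iff inner_ge_zero order_antisym)
qed

text \<open>Separated from the grading because the uniqueness argument compares two laws on one
  space, the second being the law conjugated by a dilation.\<close>

locale exp_group = group mul "0 :: 'a" uminus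
  for mul :: "'a::euclidean_space \<Rightarrow> 'a \<Rightarrow> 'a" +
  assumes smooth_mul: "smooth (\<lambda>(x, y). mul x y)"
    and exp_coords: "mul (a *\<^sub>R x) (b *\<^sub>R x) = (a + b) *\<^sub>R x"
begin

lemma mul_0 [simp]: "mul 0 x = x" "mul x 0 = x"
  and mul_inv [simp]: "mul (- x) x = 0" "mul x (- x) = 0"
  and mul_inv_cancel [simp]: "mul (- x) (mul x y) = y" "mul x (mul (- x) y) = y"
  and mul_inv_cancel' [simp]: "mul (mul y x) (- x) = y" "mul (mul y (- x)) x = y"
  and neg_mul: "- mul x y = mul (- y) (- x)"
proof -
  show 0: "mul 0 x = x" "mul x 0 = x" by (auto simp: group_left_neutral)
  show i: "mul (- x) x = 0" "mul x (- x) = 0" by (auto simp: left_inverse right_inverse)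
  show "mul (- x) (mul x y) = y" "mul x (mul (- x) y) = y"
    using i 0 by (simp_all add: group_left_neutral left_inverse right_inverse flip: assoc)
  show "mul (mul y x) (- x) = y" "mul (mul y (- x)) x = y"
    using i 0 by (simp_all add: assoc left_inverse right_inverse)
  show "- mul x y = mul (- y) (- x)" by (rule inverse_distrib_swap)
qed

definition P where "P = (\<lambda>(x, y). mul x y)"

text \<open>The value at \<open>x\<close> of the left-invariant field of \<open>v\<close>. It is a
  partial derivative of the whole product map, so that it is smooth in both arguments at
  once.\<close>

definition M where "M x v = fd P (x, 0) (0, v)"

lemma smooth_P: "smooth P" using smooth_mul by (simp add: P_def)

lemma P_Pair: "P (x, y) = mul x y" by (simp add: P_def)

lemma smooth_mul_compose: "smooth a \<Longrightarrow> smooth b \<Longrightarrow> smooth (\<lambda>x. mul (a x) (b x))"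
  using smooth_compose[OF smooth_P smooth_Pair] by (simp add: P_Pair)

lemma smooth_left: "smooth (mul a)" and smooth_right: "smooth (\<lambda>x. mul x a)"
  using smooth_mul_compose[OF smooth_const smooth_id] smooth_mul_compose[OF smooth_id smooth_const] by auto

lemma continuous_mul: "continuous_on S a \<Longrightarrow> continuous_on S b \<Longrightarrow> continuous_on S (\<lambda>x. mul (a x) (b x))"
  using continuous_on_compose2[OF smooth_continuous_on[OF smooth_P, of UNIV] continuous_on_Pair]
  by (auto simp: P_Pair)

lemma hvd_mul:
  assumes "(a has_vector_derivative a') (at t)" "(b has_vector_derivative b') (at t)"
  shows "((\<lambda>t. mul (a t) (b t)) has_vector_derivative fd P (a t, b t) (a', b')) (at t)"
  using hvd_compose[OF hvd_Pair[OF assms] smooth_P] by (simp add: P_Pair)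

lemma linear_fdP: "linear (fd P z)" by (rule smooth_fd_linear[OF smooth_P])

lemma smooth_M: "smooth a \<Longrightarrow> smooth b \<Longrightarrow> smooth (\<lambda>x. M (a x) (b x))"
  unfolding M_def by (intro smooth_fd_compose smooth_P smooth_Pair smooth_const)

lemma linear_M: "linear (M x)"
  unfolding M_def using linear_compose[OF bounded_linear.linear[OF bounded_linear_Pair_0(2)] linear_fdP]
  by (simp add: o_def)

text \<open>On a one-parameter subgroup the time \<open>t\<close> can be absorbed into the base
  point, which reduces the derivative at \<open>t\<close> to the derivative at 0.\<close>

lemma hvd_flow: "((\<lambda>t. mul x (t *\<^sub>R v)) has_vector_derivative M (mul x (t *\<^sub>R v)) v) (at t)"
proof -
  have "((\<lambda>s. mul (mul x (t *\<^sub>R v)) ((s - t) *\<^sub>R v)) has_vector_derivative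
      fd P (mul x (t *\<^sub>R v), (t - t) *\<^sub>R v) (0, v)) (at t)"
    by (rule hvd_mul) (auto intro!: derivative_eq_intros)
  moreover have "mul (mul x (t *\<^sub>R v)) ((s - t) *\<^sub>R v) = mul x (s *\<^sub>R v)" for s
    by (simp add: assoc exp_coords)
  ultimately show ?thesis by (simp add: M_def)
qed

lemma hvd_flow0: "((\<lambda>t. mul x (t *\<^sub>R v)) has_vector_derivative M x v) (at 0)"
  using hvd_flow[of x v 0] by simp

lemma M_0: "M 0 v = v"
  using vector_derivative_unique_at[OF hvd_flow0[of 0 v] ] hvd_line0[of v 0] by simp

lemma M_self: "M x x = x"
proof -
  have "((\<lambda>t. mul (1 *\<^sub>R x) (t *\<^sub>R x)) has_vector_derivative x) (at 0)"
    unfolding exp_coords by (auto intro!: derivative_eq_intros)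
  then show ?thesis using vector_derivative_unique_at[OF hvd_flow0] by simp
qed

lemma lvf_eq: "smooth f \<Longrightarrow> lvf mul v f g = fd f g (M g v)"
  unfolding lvf_def using vector_derivative_at[OF hvd_compose[OF hvd_flow0]] by simp

text \<open>Left invariance of the field, obtained by differentiating associativity.\<close>

lemma M_mul: "M (mul g h) v = fd P (g, h) (0, M h v)"
proof -
  have "((\<lambda>t. mul g (mul h (t *\<^sub>R v))) has_vector_derivative fd P (g, mul h (0 *\<^sub>R v)) (0, M h v)) (at 0)"
    by (rule hvd_mul[OF has_vector_derivative_const hvd_flow0])
  then show ?thesis using vector_derivative_unique_at[OF hvd_flow0[of "mul g h" v]] by (simp add: assoc)
qed

lemma fd_left: "fd (mul g) h v = fd P (g, h) (0, v)"
  by (rule fd_eq_hvd[OF smooth_left])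
    (use hvd_mul[OF has_vector_derivative_const hvd_line[of h v 0]] in simp)

text \<open>Differentiating the left invariance \<open>M_mul\<close> at the identity yields a second
  derivative of left translation and a term carried by \<open>M g\<close>. The first is symmetric in
  \<open>u\<close> and \<open>v\<close> and drops out of the commutator.\<close>

lemma commutator_field:
  "fd (\<lambda>x. M x v) g (M g u) - fd (\<lambda>x. M x u) g (M g v) =
    M g (fd (\<lambda>x. M x v) 0 u - fd (\<lambda>x. M x u) 0 v)"
proof -
  have *: "fd (\<lambda>x. M x v) g (M g u) = fd (\<lambda>h. fd (mul g) h v) 0 u + M g (fd (\<lambda>x. M x v) 0 u)" for u v
  proof -
    have "fd (\<lambda>h. M (mul g h) v) 0 u = fd (\<lambda>x. M x v) g (M g u)"
      by (subst fd_compose[OF smooth_M[OF smooth_id smooth_const] smooth_left]) (simp add: fd_left M_def)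
    moreover have "fd (\<lambda>h. fd (mul g) h (M h v)) 0 u = fd (\<lambda>h. fd (mul g) h v) 0 u + M g (fd (\<lambda>x. M x v) 0 u)"
      by (subst fd_fd[OF smooth_left smooth_M[OF smooth_id smooth_const]]) (simp only: M_0 fd_left, simp add: M_def)
    ultimately show ?thesis by (simp add: M_mul fd_left)
  qed
  show ?thesis unfolding *
    using second_derivative_symmetric_euclidean[OF smooth_left, of g v 0 u]
    by (simp add: linear_diff[OF linear_M])
qed

lemma bracket_eq: "bracket mul u v = fd (\<lambda>x. M x v) 0 u - fd (\<lambda>x. M x u) 0 v"
proof -
  have 1: "lvf mul v (\<lambda>g. g) = (\<lambda>g. M g v)" for v
    using lvf_eq[OF smooth_id] by (simp add: fun_eq_iff frechet_derivative_ident)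
  show ?thesis
    unfolding bracket_def 1 by (simp add: lvf_eq[OF smooth_M[OF smooth_id smooth_const]] M_0)
qed

lemma bracket_field: "fd (\<lambda>x. M x v) g (M g u) - fd (\<lambda>x. M x u) g (M g v) = M g (bracket mul u v)"
  unfolding bracket_eq by (rule commutator_field)

lemma M_combine: "fd (\<lambda>x. M x (u + v)) g w = fd (\<lambda>x. M x u) g w + fd (\<lambda>x. M x v) g w"
  "fd (\<lambda>x. M x (r *\<^sub>R v)) g w = r *\<^sub>R fd (\<lambda>x. M x v) g w"
proof -
  have d: "((\<lambda>x. M x v) has_derivative fd (\<lambda>x. M x v) g) (at g)" for v
    by (rule smooth_has_derivative[OF smooth_M[OF smooth_id smooth_const]])
  show "fd (\<lambda>x. M x (u + v)) g w = fd (\<lambda>x. M x u) g w + fd (\<lambda>x. M x v) g w"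
    using fun_cong[OF fd_eq[OF has_derivative_add[OF d[of u] d[of v]]], of w]
    by (simp add: linear_add[OF linear_M])
  show "fd (\<lambda>x. M x (r *\<^sub>R v)) g w = r *\<^sub>R fd (\<lambda>x. M x v) g w"
    using fun_cong[OF fd_eq[OF has_derivative_scaleR_right[OF d[of v], of r]], of w]
    by (simp add: linear_scale[OF linear_M])
qed

lemma linear_fdM: "linear (fd (\<lambda>x. M x v) g)"
  by (rule smooth_fd_linear[OF smooth_M[OF smooth_id smooth_const]])

lemma linear_bracket_right: "linear (bracket mul u)"
  by (rule linearI)
    (simp_all add: bracket_eq M_combine linear_add[OF linear_fdM] linear_scale[OF linear_fdM] scaleR_diff_right)

lemma bracket_antisym: "bracket mul u v = - bracket mul v u"
  by (simp add: bracket_eq)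

lemma linear_bracket_left: "linear (\<lambda>u. bracket mul u v)"
  using linear_bracket_right[of v]
  by (subst bracket_antisym) (rule linear_compose_neg)

text \<open>The Jacobi identity for the commutator of fields, read at the identity: each bracket is
  written with first derivatives \<open>D\<close> and second derivatives \<open>H\<close> of the
  fields, and the second derivatives cancel by symmetry.\<close>

lemma jacobi:
  "bracket mul (bracket mul u v) w = bracket mul u (bracket mul v w) - bracket mul v (bracket mul u w)"
proof -
  define F where "F = (\<lambda>u x. M x u)"
  define D where "D = (\<lambda>u z. fd (F u) 0 z)"
  define H where "H = (\<lambda>u a b. fd (\<lambda>y. fd (F u) y b) 0 a)"
  have sF: "smooth (F u)" for u unfolding F_def by (rule smooth_M[OF smooth_id smooth_const])
  have F0: "F u 0 = u" for u by (simp add: F_def M_0)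
  have lD: "D u (a - b) = D u a - D u b" for u a b
    unfolding D_def by (rule linear_diff[OF smooth_fd_linear[OF sF]])
  have Hs: "H u a b = H u b a" for u a b
    unfolding H_def by (rule second_derivative_symmetric_euclidean[OF sF])
  have br: "bracket mul a b = D b a - D a b" for a b
    by (simp add: bracket_eq D_def F_def)
  \<comment> \<open>The commutator of two left-invariant fields is the field of their bracket, so
    this equality of fields may itself be differentiated.\<close>
  have Dbr: "D (bracket mul a b) c = H b c a + D b (D a c) - H a c b - D a (D b c)" for a b c
  proof -
    have "F (bracket mul a b) = (\<lambda>x. fd (F b) x (F a x) - fd (F a) x (F b x))"
      using bracket_field by (simp add: F_def fun_eq_iff)
    moreover have s: "smooth (\<lambda>x. fd (F b) x (F a x))" for a b
      by (intro smooth_fd_compose sF smooth_id)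
    have "fd (\<lambda>x. fd (F b) x (F a x) - fd (F a) x (F b x)) 0 c =
       fd (\<lambda>x. fd (F b) x (F a x)) 0 c - fd (\<lambda>x. fd (F a) x (F b x)) 0 c"
      by (rule fun_cong[OF fd_eq[OF has_derivative_diff[OF smooth_has_derivative[OF s] smooth_has_derivative[OF s]]]])
    ultimately show ?thesis
      by (simp add: D_def H_def fd_fd[OF sF sF] F0)
  qed
  show ?thesis
    unfolding br[of "bracket mul u v" w] br[of u "bracket mul v w"] br[of v "bracket mul u w"] Dbr
    unfolding br lD using Hs[of v w u] Hs[of u w v] Hs[of w u v]
    by (simp add: algebra_simps)
qed

text \<open>The left Maurer-Cartan form: the differential at \<open>g\<close> of translation by the
  inverse of \<open>g\<close>. It inverts \<open>M g\<close>.\<close>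

definition Th where "Th g w = fd P (- g, g) (0, w)"

lemma Th_M: "Th g (M g v) = v"
  unfolding Th_def M_mul[symmetric] by (simp add: M_0)

lemma M_Th: "M g (Th g w) = w"
proof -
  have "((\<lambda>t. mul g (mul (- g) (g + t *\<^sub>R w))) has_vector_derivative
      fd P (g, mul (- g) (g + 0 *\<^sub>R w)) (0, fd P (- g, g + 0 *\<^sub>R w) (0, w))) (at 0)"
    by (intro hvd_mul has_vector_derivative_const hvd_line)
  then have "((\<lambda>t. g + t *\<^sub>R w) has_vector_derivative M g (Th g w)) (at 0)"
    by (simp add: Th_def M_def)
  then show ?thesis using vector_derivative_unique_at hvd_line by blast
qed

text \<open>The equation behind the formula (1 - exp(- ad x)) / ad x for the differential of the
  exponential map. It results from differentiating two identities, \<open>M\<close> applied to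
  \<open>b\<close> equals s y along the ray, and z is the value of its own field at s z.\<close>

lemma Th_ode:
  "((\<lambda>s. s *\<^sub>R Th (s *\<^sub>R x) y) has_vector_derivative (y - bracket mul x (s *\<^sub>R Th (s *\<^sub>R x) y))) (at s)"
proof -
  define b where "b = (\<lambda>s. s *\<^sub>R Th (s *\<^sub>R x) y)"
  have sb: "smooth b" unfolding b_def Th_def
    by (intro smooth_scaleR smooth_id smooth_fd_compose smooth_P smooth_Pair smooth_const smooth_uminus)
  have sx: "smooth (\<lambda>s. s *\<^sub>R x)" by (intro smooth_scaleR smooth_id smooth_const)
  have bd: "(b has_vector_derivative fd b s 1) (at s)"
    using hvd_compose[OF has_vector_derivative_id sb] .
  have Mb: "M (s *\<^sub>R x) (b s) = s *\<^sub>R y" for s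
    by (simp add: b_def linear_scale[OF linear_M] M_Th)
  let ?g = "s *\<^sub>R x"
  define DM where "DM = (\<lambda>c. fd (\<lambda>z. M z c) ?g)"
  have split: "M z c = (\<Sum>i\<in>Basis. (c \<bullet> i) *\<^sub>R M z i)" for z c
    by (rule linear_euclidean_sum[OF linear_M])
  have DMs: "DM c w = (\<Sum>i\<in>Basis. (c \<bullet> i) *\<^sub>R DM i w)" for c w
  proof -
    have "linear (\<lambda>c. DM c w)" unfolding DM_def by (rule linearI) (simp_all add: M_combine)
    then show ?thesis by (rule linear_euclidean_sum)
  qed
  have dM: "((\<lambda>t. M (t *\<^sub>R x) i) has_vector_derivative DM i x) (at s)" for i
    unfolding DM_def by (rule hvd_compose[OF hvd_line0 smooth_M[OF smooth_id smooth_const]])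
  have "((\<lambda>t. M (t *\<^sub>R x) (b t)) has_vector_derivative
      (\<Sum>i\<in>Basis. (b s \<bullet> i) *\<^sub>R DM i x + (fd b s 1 \<bullet> i) *\<^sub>R M ?g i)) (at s)"
  proof -
    have "((\<lambda>t. b t \<bullet> i) has_real_derivative fd b s 1 \<bullet> i) (at s)" for i
      using bounded_linear.has_vector_derivative[OF bounded_linear_inner_left bd]
      by (simp add: has_real_derivative_iff_has_vector_derivative)
    then show ?thesis unfolding split[of _ "b _"]
      by (intro has_vector_derivative_sum has_vector_derivative_scaleR dM)
  qed
  then have "((\<lambda>t. t *\<^sub>R y) has_vector_derivative DM (b s) x + M ?g (fd b s 1)) (at s)"
    unfolding Mb split[of ?g "fd b s 1"] DMs[of "b s"] by (simp add: sum.distrib)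
  \<comment> \<open>The derivative in \<open>s\<close> of the identity \<open>Mb\<close>.\<close>
  then have e1: "DM (b s) x + M ?g (fd b s 1) = y"
    using vector_derivative_unique_at hvd_line0 by blast
  \<comment> \<open>On its own ray the field of \<open>x\<close> has the constant value
    \<open>x\<close>, so the commutator formula applies with both field values known.\<close>
  have e2: "DM (b s) x - DM x (s *\<^sub>R y) = M ?g (bracket mul x (b s))"
  proof -
    have "M ?g x = x"
    proof (cases "s = 0")
      case False
      have "s *\<^sub>R M ?g x = s *\<^sub>R x" using M_self[of ?g] by (simp add: linear_scale[OF linear_M])
      with False show ?thesis by simp
    qed (simp add: M_0)
    then show ?thesis using bracket_field[of "b s" ?g x] by (simp add: Mb DM_def)
  qed
  \<comment> \<open>The identity M_{s z} z = z is differentiated at z = x in the direction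
    \<open>y\<close>.\<close>
  have e3: "DM x (s *\<^sub>R y) + M ?g y = y"
  proof -
    have "((\<lambda>t. M (s *\<^sub>R x + t *\<^sub>R (s *\<^sub>R y)) (x + t *\<^sub>R y)) has_vector_derivative
      (\<Sum>i\<in>Basis. (x \<bullet> i) *\<^sub>R DM i (s *\<^sub>R y) + (y \<bullet> i) *\<^sub>R M ?g i)) (at 0)"
    proof -
      have "((\<lambda>t. (x + t *\<^sub>R y) \<bullet> i) has_real_derivative y \<bullet> i) (at 0)" for i
        using bounded_linear.has_vector_derivative[OF bounded_linear_inner_left hvd_line]
        by (simp add: has_real_derivative_iff_has_vector_derivative)
      moreover have "((\<lambda>t. M (s *\<^sub>R x + t *\<^sub>R (s *\<^sub>R y)) i) has_vector_derivative DM i (s *\<^sub>R y)) (at 0)" for i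
        unfolding DM_def using hvd_compose[OF hvd_line[of "s *\<^sub>R x" "s *\<^sub>R y" 0] smooth_M[OF smooth_id smooth_const]]
        by simp
      ultimately have "((\<lambda>t. \<Sum>i\<in>Basis. ((x + t *\<^sub>R y) \<bullet> i) *\<^sub>R M (s *\<^sub>R x + t *\<^sub>R (s *\<^sub>R y)) i) has_vector_derivative
      (\<Sum>i\<in>Basis. ((x + 0 *\<^sub>R y) \<bullet> i) *\<^sub>R DM i (s *\<^sub>R y) + (y \<bullet> i) *\<^sub>R M (s *\<^sub>R x + 0 *\<^sub>R (s *\<^sub>R y)) i)) (at 0)"
        by (intro has_vector_derivative_sum has_vector_derivative_scaleR)
      then show ?thesis unfolding split[of _ "x + _"] by simp
    qed
    moreover have "M (s *\<^sub>R x + t *\<^sub>R (s *\<^sub>R y)) (x + t *\<^sub>R y) = x + t *\<^sub>R y" for t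
    proof -
      have "M (s *\<^sub>R z) z = z" for z
      proof (cases "s = 0")
        case False
        have "s *\<^sub>R M (s *\<^sub>R z) z = s *\<^sub>R z" using M_self[of "s *\<^sub>R z"] by (simp add: linear_scale[OF linear_M])
        with False show ?thesis by simp
      qed (simp add: M_0)
      from this[of "x + t *\<^sub>R y"] show ?thesis by (simp add: algebra_simps)
    qed
    ultimately have "((\<lambda>t. x + t *\<^sub>R y) has_vector_derivative DM x (s *\<^sub>R y) + M ?g y) (at 0)"
      unfolding split[of ?g y] DMs[of x] by (simp add: sum.distrib)
    then show ?thesis using vector_derivative_unique_at hvd_line by blast
  qed
  have "DM x (s *\<^sub>R y) + (M ?g (bracket mul x (b s)) + M ?g (fd b s 1)) = DM x (s *\<^sub>R y) + M ?g y"
    using e1 e2 e3 by (simp add: algebra_simps)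
  then have "M ?g (fd b s 1) = M ?g (y - bracket mul x (b s))"
    by (simp add: linear_diff[OF linear_M] eq_diff_eq add.commute)
  then have "fd b s 1 = y - bracket mul x (b s)" using Th_M by metis
  with bd show ?thesis by (simp add: b_def)
qed

text \<open>An integral curve of a left-invariant field, multiplied on the right by the inverse
  one-parameter subgroup, has derivative zero: the two contributions are the same vector, computed
  once from each factor.\<close>

lemma hvd_cancel:
  assumes c: "\<And>t. (c has_vector_derivative M (c t) v) (at t)"
  shows "c 1 = mul (c 0) v"
proof -
  have "((\<lambda>t. mul (c t) (t *\<^sub>R (- v))) has_vector_derivative 0) (at t)" for t
  proof -
    have "((\<lambda>e. mul (mul (c t) (e *\<^sub>R v)) (t *\<^sub>R (- v))) has_vector_derivative
        fd P (mul (c t) (0 *\<^sub>R v), t *\<^sub>R (- v)) (M (c t) v, 0)) (at 0)"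
      by (intro hvd_mul hvd_flow0 has_vector_derivative_const)
    moreover have "((\<lambda>e. mul (c t) ((- t) *\<^sub>R v + e *\<^sub>R v)) has_vector_derivative
        fd P (c t, (- t) *\<^sub>R v + 0 *\<^sub>R v) (0, v)) (at 0)"
      by (intro hvd_mul hvd_line has_vector_derivative_const)
    moreover have "mul (mul (c t) (e *\<^sub>R v)) (t *\<^sub>R (- v)) = mul (c t) ((- t) *\<^sub>R v + e *\<^sub>R v)" for e
    proof -
      have "mul (e *\<^sub>R v) (t *\<^sub>R (- v)) = (- t) *\<^sub>R v + e *\<^sub>R v"
        using exp_coords[of e v "- t"] by (simp add: scaleR_left_diff_distrib)
      then show ?thesis by (simp only: assoc)
    qed
    ultimately have "fd P (c t, t *\<^sub>R (- v)) (M (c t) v, 0) = fd P (c t, t *\<^sub>R (- v)) (0, v)"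
      using vector_derivative_unique_at by fastforce
    moreover have "fd P (c t, t *\<^sub>R (- v)) (M (c t) v, - v) =
        fd P (c t, t *\<^sub>R (- v)) (M (c t) v, 0) - fd P (c t, t *\<^sub>R (- v)) (0, v)"
      by (simp flip: linear_diff[OF linear_fdP])
    ultimately have "fd P (c t, t *\<^sub>R (- v)) (M (c t) v, - v) = 0" by simp
    then show ?thesis using hvd_mul[OF c[of t] hvd_line0[of "- v" t]] by simp
  qed
  then obtain k where "\<And>t. mul (c t) (t *\<^sub>R (- v)) = k"
    using has_vector_derivative_zero_constant[of UNIV "\<lambda>t. mul (c t) (t *\<^sub>R (- v))"] by auto
  from this[of 0] this[of 1] have "mul (c 1) (- v) = c 0" by simp
  then show ?thesis by (metis mul_inv_cancel'(2))
qed

end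

text \<open>Along a ray, \<open>s \<mapsto> s Th\<^bsub>sx\<^esub>\<close> solves a linear equation with the bracket as its only
  coefficient, so the bracket determines the left-invariant fields and these determine the law.\<close>

lemma exp_group_unique:
  assumes "exp_group mul" "exp_group mul'" "\<And>u v. bracket mul u v = bracket mul' u v"
  shows "mul = mul'"
proof -
  interpret A: exp_group mul by fact
  interpret B: exp_group mul' by fact
  have "A.Th x y = B.Th x y" for x y
  proof -
    define d where "d = (\<lambda>s. s *\<^sub>R A.Th (s *\<^sub>R x) y - s *\<^sub>R B.Th (s *\<^sub>R x) y)"
    have l: "linear (bracket mul x)" by (rule A.linear_bracket_right)
    have "(d has_vector_derivative - bracket mul x (d s)) (at s)" for s
    proof -
      have "- bracket mul x (d s) = (y - bracket mul x (s *\<^sub>R A.Th (s *\<^sub>R x) y)) -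
          (y - bracket mul' x (s *\<^sub>R B.Th (s *\<^sub>R x) y))"
        unfolding d_def linear_diff[OF l, of "s *\<^sub>R A.Th (s *\<^sub>R x) y" "s *\<^sub>R B.Th (s *\<^sub>R x) y"]
        by (simp add: assms(3) linear_diff[OF B.linear_bracket_right])
      then show ?thesis
        unfolding d_def using has_vector_derivative_diff[OF A.Th_ode[of x y s] B.Th_ode[of x y s]] by simp
    qed
    moreover have "bounded_linear (\<lambda>z. - bracket mul x z)"
      using l by (intro bounded_linear_minus) (simp add: linear_conv_bounded_linear)
    ultimately have "d 1 = 0"
      by (rule linear_ode_zero) (simp_all add: d_def)
    then show ?thesis by (simp add: d_def)
  qed
  then have M: "A.M x v = B.M x v" for x v
    by (metis A.M_Th B.Th_M)
  have "mul' x v = mul x v" for x v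
    using A.hvd_cancel[of "\<lambda>t. mul' x (t *\<^sub>R v)" v] B.hvd_flow[of x v] by (simp add: M)
  then show ?thesis by (simp add: fun_eq_iff)
qed

section \<open>Dilations are automorphisms\<close>

definition dil :: "('n::finite \<Rightarrow> nat) \<Rightarrow> real \<Rightarrow> real ^ 'n \<Rightarrow> real ^ 'n" where
  "dil deg r x = (\<chi> k. r ^ deg k * x $ k)"

lemma dil_nth [simp]: "dil deg r x $ k = r ^ deg k * x $ k"
  by (simp add: dil_def)

lemma dil_dil [simp]: "dil deg r (dil deg s x) = dil deg (r * s) x"
  by (simp add: vec_eq_iff power_mult_distrib)

lemma dil_1 [simp]: "dil deg 1 x = x"
  by (simp add: vec_eq_iff)

lemma dil_inverse [simp]: "r \<noteq> 0 \<Longrightarrow> dil deg (1 / r) (dil deg r x) = x"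
  "r \<noteq> 0 \<Longrightarrow> dil deg r (dil deg (1 / r) x) = x"
  by simp_all

lemma linear_dil: "linear (dil deg r)"
  by (rule linearI) (simp_all add: vec_eq_iff algebra_simps)

lemma bounded_linear_dil: "bounded_linear (dil deg r)"
  using linear_dil linear_conv_bounded_linear by blast

lemma dil_minus [simp]: "dil deg r (- x) = - dil deg r x"
  by (rule linear_neg[OF linear_dil])

lemma dil_scaleR: "dil deg r (a *\<^sub>R x) = a *\<^sub>R dil deg r x"
  by (rule linear_scale[OF linear_dil])

lemma dil_zero [simp]: "dil deg r 0 = 0"
  by (rule linear_0[OF linear_dil])

lemma dil_axis: "dil deg r (axis k c) = r ^ deg k *\<^sub>R axis k c"
  by (simp add: vec_eq_iff axis_def)

lemma layer_iff: "x \<in> layer deg i \<longleftrightarrow> (\<forall>k. deg k \<noteq> i \<longrightarrow> x $ k = 0)" for x :: "real ^ 'n::finite"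
proof
  assume "x \<in> layer deg i"
  then show "\<forall>k. deg k \<noteq> i \<longrightarrow> x $ k = 0" unfolding layer_def
    by (induction rule: span_induct_alt) (auto simp: axis_def split: if_splits)
next
  assume *: "\<forall>k. deg k \<noteq> i \<longrightarrow> x $ k = 0"
  have "x = (\<Sum>k\<in>UNIV. x $ k *\<^sub>R axis k 1)"
    using basis_expansion[of x] by (simp add: scalar_mult_eq_scaleR)
  also have "\<dots> \<in> layer deg i" unfolding layer_def
  proof (rule span_sum)
    fix k
    show "x $ k *\<^sub>R axis k 1 \<in> span ((\<lambda>k. axis k 1) ` {k. deg k = i})"
      using * by (cases "deg k = i") (auto intro: span_scale span_base span_zero)
  qed
  finally show "x \<in> layer deg i" .
qed

lemma subspace_layer: "subspace (layer deg i)"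
  unfolding layer_def by (rule subspace_span)

lemma axis_in_layer: "axis k c \<in> layer deg (deg k)"
  by (auto simp: layer_iff axis_def)

lemma dil_layer: "x \<in> layer deg i \<Longrightarrow> dil deg r x = r ^ i *\<^sub>R x"
  unfolding layer_iff by (auto simp: vec_eq_iff)

lemma deg_le_step: "deg k \<le> step deg" for k :: "'n::finite"
  by (simp add: step_def)

lemma layer_trivial: "step deg < i \<Longrightarrow> x \<in> layer deg i \<Longrightarrow> x = 0" for x :: "real ^ 'n::finite"
  using deg_le_step[of deg] by (auto simp: layer_iff vec_eq_iff not_le) (metis not_le)

context stratified_group
begin

sublocale exp_group mul
  by unfold_locales (use smooth_mul exp_coords in auto)

lemma bracket_layers_1:
  assumes x: "x \<in> layer deg 1" and y: "y \<in> layer deg i" and i: "i \<ge> 1"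
  shows "bracket mul x y \<in> layer deg (Suc i)"
proof -
  consider "i < step deg" | "i = step deg" | "i > step deg" by linarith
  then show ?thesis
  proof cases
    case 1
    have "bracket mul x y \<in> span {bracket mul x y | x y. x \<in> layer deg 1 \<and> y \<in> layer deg i}"
      using x y by (intro span_base) auto
    then show ?thesis using bracket_layer[OF i 1] by simp
  next
    case 2
    then show ?thesis using bracket_top x y by (simp add: subspace_0[OF subspace_layer])
  next
    case 3
    then have "y = 0" using layer_trivial y by blast
    then show ?thesis by (simp add: linear_0[OF linear_bracket_right] subspace_0[OF subspace_layer])
  qed
qed

text \<open>The axioms describe only brackets with the first layer. For the others, V_{i+1} is
  spanned by brackets [a, b] with \<open>a\<close> in V_1 and \<open>b\<close> in V_i, and the
  Jacobi identity expresses [[a, b], y] by brackets covered by the induction.\<close>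

lemma bracket_layers:
  "i \<ge> 1 \<Longrightarrow> j \<ge> 1 \<Longrightarrow> x \<in> layer deg i \<Longrightarrow> y \<in> layer deg j \<Longrightarrow> bracket mul x y \<in> layer deg (i + j)"
proof (induction i arbitrary: j x y rule: nat_induct_at_least[of 1])
  case base
  then show ?case using bracket_layers_1 by simp
next
  case (Suc i)
  show ?case
  proof (cases "i < step deg")
    case False
    then have "x = 0" using layer_trivial[of deg "Suc i" x] Suc.prems by simp
    then show ?thesis by (simp add: linear_0[OF linear_bracket_left] subspace_0[OF subspace_layer])
  next
    case True
    have "x \<in> span {bracket mul x y | x y. x \<in> layer deg 1 \<and> y \<in> layer deg i}"
      using bracket_layer[OF _ True] Suc.hyps Suc.prems by simp
    then show ?thesis
    proof (induction rule: span_induct)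
      case base
      have "{x. bracket mul x y \<in> layer deg (Suc i + j)} =
          (\<lambda>x. bracket mul x y) -` layer deg (Suc i + j)" by auto
      then show ?case
        using linear_subspace_vimage[OF linear_bracket_left subspace_layer] by simp
    next
      case (step z)
      then obtain a b where z: "z = bracket mul a b" "a \<in> layer deg 1" "b \<in> layer deg i" by blast
      have "bracket mul b y \<in> layer deg (i + j)" using Suc z by blast
      then have 1: "bracket mul a (bracket mul b y) \<in> layer deg (Suc (i + j))"
        using bracket_layers_1 z Suc by simp
      have "bracket mul a y \<in> layer deg (Suc j)" using bracket_layers_1 z Suc by simp
      then have "bracket mul b (bracket mul a y) \<in> layer deg (i + Suc j)"
        using Suc.IH[of "Suc j" b] z by simp
      with 1 show ?case unfolding z(1) jacobi
        by (simp add: subspace_diff[OF subspace_layer])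
    qed
  qed
qed

lemma bracket_dil: "bracket mul (dil deg r x) (dil deg r y) = dil deg r (bracket mul x y)"
proof -
  have lin: "linear (\<lambda>x. bracket mul (dil deg r x) z)" "linear (\<lambda>y. bracket mul z (dil deg r y))"
    "linear (\<lambda>x. dil deg r (bracket mul x z))" "linear (\<lambda>x. dil deg r (bracket mul z x))" for z
    using linear_compose[OF linear_dil linear_bracket_left] linear_compose[OF linear_dil linear_bracket_right]
      linear_compose[OF linear_bracket_left linear_dil] linear_compose[OF linear_bracket_right linear_dil]
    by (auto simp: o_def)
  have ax: "bracket mul (dil deg r (axis k 1)) (dil deg r (axis l 1)) = dil deg r (bracket mul (axis k 1) (axis l 1))" for k l
    using dil_layer[OF bracket_layers[OF deg_pos deg_pos axis_in_layer axis_in_layer], of r k 1 l 1]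
    by (simp add: dil_axis linear_scale[OF linear_bracket_left] linear_scale[OF linear_bracket_right] power_add)
  have B: "\<exists>k. b = axis k 1" if "b \<in> Basis" for b :: "real ^ 'n"
    using that by (auto simp: Basis_vec_def)
  have "(\<lambda>y. bracket mul (dil deg r (axis k 1)) (dil deg r y)) = (\<lambda>y. dil deg r (bracket mul (axis k 1) y))" for k
    by (rule linear_eq_stdbasis[OF lin(2,4)]) (use B ax in blast)
  then have *: "bracket mul (dil deg r (axis k 1)) (dil deg r y) = dil deg r (bracket mul (axis k 1) y)" for k
    by (simp add: fun_eq_iff)
  have "(\<lambda>x. bracket mul (dil deg r x) (dil deg r y)) = (\<lambda>x. dil deg r (bracket mul x y))"
    by (rule linear_eq_stdbasis[OF lin(1,3)]) (use B * in blast)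
  then show ?thesis by (simp add: fun_eq_iff)
qed

text \<open>Conjugating the product by the dilation gives another law in exponential coordinates.
  Its bracket is the original one, because dilations respect the grading of the bracket; hence the
  two laws agree by \<open>exp_group_unique\<close>.\<close>

lemma dil_mul:
  assumes r: "r > 0"
  shows "dil deg r (mul x y) = mul (dil deg r x) (dil deg r y)"
proof -
  let ?d = "dil deg r" and ?e = "dil deg (1 / r)"
  define mul' where "mul' = (\<lambda>x y. ?e (mul (?d x) (?d y)))"
  have sd: "smooth (\<lambda>x. dil deg r' (f x))" if "smooth f" for f :: "'z::real_normed_vector \<Rightarrow> real ^ 'n" and r'
    by (rule smooth_bounded_linear[OF bounded_linear_dil that])
  have eg: "exp_group mul'"
  proof unfold_locales
    show "mul' (mul' a b) c = mul' a (mul' b c)" for a b c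
      using r by (simp add: mul'_def assoc)
    show "mul' 0 a = a" "mul' (- a) a = 0" for a using r by (simp_all add: mul'_def)
    have "smooth (\<lambda>z. mul' (fst z) (snd z))" unfolding mul'_def
      by (intro sd smooth_mul_compose smooth_linear bounded_linear_fst bounded_linear_snd)
    then show "smooth (\<lambda>(x, y). mul' x y)" by (simp add: case_prod_unfold)
    show "mul' (a *\<^sub>R x) (b *\<^sub>R x) = (a + b) *\<^sub>R x" for a b x
      using r by (simp add: mul'_def dil_scaleR exp_coords)
  qed
  interpret B: exp_group mul' by (rule eg)
  have M': "B.M x v = ?e (M (?d x) (?d v))" for x v
  proof -
    have "((\<lambda>t. mul' x (t *\<^sub>R v)) has_vector_derivative ?e (M (?d x) (?d v))) (at 0)"
      using bounded_linear.has_vector_derivative[OF bounded_linear_dil hvd_flow0]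
      by (simp add: mul'_def dil_scaleR)
    then show ?thesis using vector_derivative_unique_at[OF B.hvd_flow0] by blast
  qed
  have fdM': "fd (\<lambda>x. B.M x v) 0 u = ?e (fd (\<lambda>x. M x (?d v)) 0 (?d u))" for u v
  proof -
    have s: "smooth (\<lambda>x. M x (?d v))" by (intro smooth_M smooth_id smooth_const)
    have d0: "(?d has_derivative ?d) (at 0)"
      by (rule bounded_linear_imp_has_derivative[OF bounded_linear_dil])
    have "((\<lambda>x. M (?d x) (?d v)) has_derivative (\<lambda>u. fd (\<lambda>x. M x (?d v)) 0 (?d u))) (at 0)"
      using diff_chain_at[OF d0 smooth_has_derivative[OF s]] by (simp add: o_def)
    from fd_eq[OF bounded_linear.has_derivative[OF bounded_linear_dil this]]
    show ?thesis unfolding M' by metis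
  qed
  have "bracket mul u v = bracket mul' u v" for u v
    unfolding B.bracket_eq fdM' using bracket_dil[of r u v] r
    by (simp add: bracket_eq[of "?d u" "?d v"] flip: linear_diff[OF linear_dil])
  then have "mul = mul'" using exp_group_unique[OF _ eg] exp_group_axioms by blast
  then have "mul x y = ?e (mul (?d x) (?d y))" using mul'_def by metis
  then have "?d (mul x y) = ?d (?e (mul (?d x) (?d y)))" by simp
  then show ?thesis using r by simp
qed

lemma M_dil:
  assumes "r > 0"
  shows "M (dil deg r x) (dil deg r v) = dil deg r (M x v)"
proof -
  have "((\<lambda>t. dil deg r (mul x (t *\<^sub>R v))) has_vector_derivative dil deg r (M x v)) (at 0)"
    by (rule bounded_linear.has_vector_derivative[OF bounded_linear_dil hvd_flow0])
  then show ?thesis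
    using vector_derivative_unique_at[OF hvd_flow0[of "dil deg r x" "dil deg r v"]]
    by (simp add: dil_mul[OF assms] dil_scaleR)
qed

end

section \<open>Invariance of Lebesgue measure\<close>

text \<open>The change of variables theorem of the library needs a well-ordered index type.\<close>

typedef 'n ordered_index = "UNIV :: 'n set" ..

instance ordered_index :: (finite) finite
proof
  have "UNIV = Abs_ordered_index ` (UNIV :: 'a set)"
    by (metis UNIV_eq_I image_eqI UNIV_I Rep_ordered_index_inverse)
  then show "finite (UNIV :: 'a ordered_index set)" by (metis finite finite_imageI)
qed

instantiation ordered_index :: (finite) wellorder
begin

definition less_eq_ordered_index :: "'a ordered_index \<Rightarrow> 'a ordered_index \<Rightarrow> bool" where
  "less_eq_ordered_index a b \<longleftrightarrow> to_nat (Rep_ordered_index a) \<le> to_nat (Rep_ordered_index b)"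

definition less_ordered_index :: "'a ordered_index \<Rightarrow> 'a ordered_index \<Rightarrow> bool" where
  "less_ordered_index a b \<longleftrightarrow> to_nat (Rep_ordered_index a) < to_nat (Rep_ordered_index b)"

instance
proof
  fix P :: "'a ordered_index \<Rightarrow> bool" and a
  assume *: "\<And>x. (\<And>y. y < x \<Longrightarrow> P y) \<Longrightarrow> P x"
  show "P a"
    by (induction a rule: measure_induct_rule[where f = "\<lambda>a. to_nat (Rep_ordered_index a)"])
      (use * in \<open>auto simp: less_ordered_index_def\<close>)
qed (auto simp: less_eq_ordered_index_def less_ordered_index_def Rep_ordered_index_inject)

end

definition to_ord :: "real ^ 'n \<Rightarrow> real ^ 'n ordered_index" where
  "to_ord x = (\<chi> i. x $ Rep_ordered_index i)"

definition from_ord :: "real ^ 'n ordered_index \<Rightarrow> real ^ 'n" where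
  "from_ord y = (\<chi> k. y $ Abs_ordered_index k)"

lemma to_from_ord [simp]: "to_ord (from_ord y) = y" "from_ord (to_ord x) = x"
  by (simp_all add: to_ord_def from_ord_def vec_eq_iff Rep_ordered_index_inverse Abs_ordered_index_inverse)

lemma linear_to_ord: "linear (to_ord :: real ^ 'n::finite \<Rightarrow> _)"
  and linear_from_ord: "linear (from_ord :: _ \<Rightarrow> real ^ 'n::finite)"
  by (auto intro!: linearI simp: to_ord_def from_ord_def vec_eq_iff)

lemma bounded_linear_to_ord: "bounded_linear (to_ord :: real ^ 'n::finite \<Rightarrow> _)"
  and bounded_linear_from_ord: "bounded_linear (from_ord :: _ \<Rightarrow> real ^ 'n::finite)"
  using linear_to_ord linear_from_ord linear_conv_bounded_linear by blast+

lemma measurable_to_ord [measurable]: "(to_ord :: real ^ 'n::finite \<Rightarrow> _) \<in> borel_measurable borel"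
  and measurable_from_ord [measurable]: "(from_ord :: _ \<Rightarrow> real ^ 'n::finite) \<in> borel_measurable borel"
  by (auto intro!: borel_measurable_continuous_onI linear_continuous_on bounded_linear_to_ord bounded_linear_from_ord)

lemma Basis_vec_image: "(Basis :: (real ^ 'n::finite) set) = (\<lambda>k. axis k 1) ` UNIV"
  by (auto simp: Basis_vec_def)

lemma prod_Basis_vec: "(\<Prod>b\<in>Basis. f b) = (\<Prod>k\<in>UNIV. f (axis k 1))"
  and sum_Basis_vec: "(\<Sum>b\<in>Basis. g b) = (\<Sum>k\<in>UNIV. g (axis k 1))"
  for f :: "real ^ 'n::finite \<Rightarrow> real" and g :: "real ^ 'n \<Rightarrow> real ^ 'n"
proof -
  have inj: "inj (\<lambda>k::'n. axis k (1::real))" by (auto simp: inj_def axis_eq_axis)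
  show "(\<Prod>b\<in>Basis. f b) = (\<Prod>k\<in>UNIV. f (axis k 1))"
    unfolding Basis_vec_image by (subst prod.reindex[OF inj]) (simp add: o_def)
  show "(\<Sum>b\<in>Basis. g b) = (\<Sum>k\<in>UNIV. g (axis k 1))"
    unfolding Basis_vec_image by (subst sum.reindex[OF inj]) (simp add: o_def)
qed

lemma distr_to_ord: "distr lborel borel (to_ord :: real ^ 'n::finite \<Rightarrow> _) = lborel"
proof (rule lborel_eqI[symmetric])
  fix l u :: "real ^ 'n ordered_index"
  assume le: "\<And>b. b \<in> Basis \<Longrightarrow> l \<bullet> b \<le> u \<bullet> b"
  have le': "l $ i \<le> u $ i" for i using le[of "axis i 1"] by (simp add: inner_axis)
  have "to_ord -` box l u = box (from_ord l) (from_ord u)"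
  proof -
    have "(\<forall>i. P (Rep_ordered_index i) i) \<longleftrightarrow> (\<forall>k. P k (Abs_ordered_index k))" for P :: "'n \<Rightarrow> _ \<Rightarrow> bool"
      by (metis Rep_ordered_index_inverse Abs_ordered_index_inverse UNIV_I)
    from this[of "\<lambda>k i. l $ i < x $ k \<and> x $ k < u $ i" for x] show ?thesis
      by (simp add: set_eq_iff mem_box_cart to_ord_def from_ord_def)
  qed
  then have "emeasure (distr lborel borel (to_ord :: real ^ 'n \<Rightarrow> _)) (box l u) = emeasure lborel (box (from_ord l) (from_ord u))"
    by (subst emeasure_distr) auto
  also have "\<dots> = (\<Prod>b\<in>Basis. (from_ord u - from_ord l) \<bullet> b)"
  proof (rule emeasure_lborel_box)
    fix b :: "real ^ 'n" assume "b \<in> Basis"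
    then show "from_ord l \<bullet> b \<le> from_ord u \<bullet> b"
      using le' by (auto simp: Basis_vec_def inner_axis from_ord_def)
  qed
  also have "(\<Prod>b\<in>Basis. (from_ord u - from_ord l) \<bullet> b) = (\<Prod>k\<in>UNIV. u $ Abs_ordered_index k - l $ Abs_ordered_index k)"
    by (simp add: prod_Basis_vec inner_axis from_ord_def)
  also have "\<dots> = (\<Prod>i\<in>UNIV. u $ i - l $ i)"
    by (rule prod.reindex_bij_witness[of _ Rep_ordered_index Abs_ordered_index])
      (auto simp: Rep_ordered_index_inverse Abs_ordered_index_inverse)
  also have "\<dots> = (\<Prod>b\<in>Basis. (u - l) \<bullet> b)"
    by (simp add: prod_Basis_vec inner_axis)
  finally show "emeasure (distr lborel borel (to_ord :: real ^ 'n \<Rightarrow> _)) (box l u) = (\<Prod>b\<in>Basis. (u - l) \<bullet> b)" .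
qed simp

lemma distr_from_ord: "distr lborel borel (from_ord :: _ \<Rightarrow> real ^ 'n::finite) = lborel"
proof -
  have "distr lborel borel (from_ord :: _ \<Rightarrow> real ^ 'n) =
      distr (distr lborel borel (to_ord :: real ^ 'n \<Rightarrow> _)) borel from_ord"
    by (simp add: distr_to_ord)
  also have "\<dots> = distr lborel borel (from_ord \<circ> (to_ord :: real ^ 'n \<Rightarrow> _))" by (rule distr_distr) auto
  also have "\<dots> = lborel" by (simp add: o_def distr_id2)
  finally show ?thesis .
qed

lemma lborel_distr_uminus_euclidean: "distr lborel borel uminus = (lborel :: 'a::euclidean_space measure)"
  using lborel_affine[of "-1" "0 :: 'a"] by (auto simp: density_1 one_ennreal_def[symmetric])

context stratified_group
begin

text \<open>The matrices at \<open>x\<close> and at a dilate of \<open>x\<close> are conjugate, so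
  the determinant is constant along dilations. Letting the dilates shrink to the identity gives the
  value there, which is 1.\<close>

lemma det_M: "det (matrix (\<lambda>w. to_ord (M x (from_ord w)))) = 1"
proof -
  define A where "A = (\<lambda>x w. to_ord (M x (from_ord w)))"
  define D where "D = (\<lambda>r w. to_ord (dil deg r (from_ord w)))"
  have lA: "linear (A x)" for x unfolding A_def
    using linear_compose[OF linear_from_ord linear_compose[OF linear_M linear_to_ord]] by (simp add: o_def)
  have lD: "linear (D r)" for r unfolding D_def
    using linear_compose[OF linear_from_ord linear_compose[OF linear_dil linear_to_ord]] by (simp add: o_def)
  have conj: "det (matrix (A (dil deg r x))) = det (matrix (A x))" if r: "r > 0" for r
  proof -
    have "A (dil deg r x) = D r \<circ> A x \<circ> D (1 / r)"
      using r M_dil[OF r, of x "dil deg (1 / r) (from_ord _)"] by (auto simp: A_def D_def fun_eq_iff)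
    moreover have "D r \<circ> D (1 / r) = id" using r by (auto simp: D_def fun_eq_iff)
    then have "det (matrix (D r)) * det (matrix (D (1 / r))) = 1"
      by (simp flip: det_mul matrix_compose[OF lD lD] add: matrix_id)
    ultimately show ?thesis
      by (simp add: matrix_compose[OF lD linear_compose[OF lA lD]] matrix_compose[OF lA lD]
          det_mul)
  qed
  have cont: "continuous_on UNIV (\<lambda>x. det (matrix (A x)))"
  proof -
    have "continuous_on UNIV (\<lambda>x. A x w)" for w
      unfolding A_def
      by (intro continuous_intros bounded_linear.continuous_on[OF bounded_linear_to_ord]
          smooth_continuous_on smooth_M smooth_id smooth_const)
    then show ?thesis unfolding det_def matrix_def by (auto intro!: continuous_intros)
  qed
  have lim: "(\<lambda>n. dil deg (1 / real (Suc n)) x) \<longlonglongrightarrow> 0"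
  proof (rule vec_tendstoI)
    fix k
    have "(\<lambda>n. (1 / real (Suc n)) ^ deg k * x $ k) \<longlonglongrightarrow> 0 ^ deg k * x $ k"
      by (intro tendsto_intros) (use LIMSEQ_inverse_real_of_nat in \<open>simp add: inverse_eq_divide\<close>)
    then show "(\<lambda>n. dil deg (1 / real (Suc n)) x $ k) \<longlonglongrightarrow> 0 $ k"
      using deg_pos[of k] by (simp add: zero_power del: of_nat_Suc)
  qed
  have "(\<lambda>n. det (matrix (A (dil deg (1 / real (Suc n)) x)))) \<longlonglongrightarrow> det (matrix (A 0))"
    by (rule continuous_on_tendsto_compose[OF cont lim]) auto
  then have "det (matrix (A x)) = det (matrix (A 0))"
    by (simp add: conj LIMSEQ_const_iff)
  moreover have "A 0 = id" by (auto simp: A_def M_0)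
  ultimately have "det (matrix (A x)) = 1" by (simp add: matrix_id)
  then show ?thesis by (simp add: A_def)
qed

text \<open>The differential of a left translation carries the invariant frame at \<open>y\<close>
  to the invariant frame at \<open>mul a y\<close>, and both frames have determinant 1.\<close>

lemma det_left: "det (matrix (\<lambda>w. to_ord (fd (mul a) y (from_ord w)))) = 1"
proof -
  let ?F = "\<lambda>w. to_ord (fd (mul a) y (from_ord w))"
  let ?A = "\<lambda>x w. to_ord (M x (from_ord w))"
  have lA: "linear (?A x)" for x
    using linear_compose[OF linear_from_ord linear_compose[OF linear_M linear_to_ord]] by (simp add: o_def)
  have lF: "linear ?F"
    using linear_compose[OF linear_from_ord linear_compose[OF smooth_fd_linear[OF smooth_left] linear_to_ord]]
    by (simp add: o_def)
  have "?A (mul a y) = ?F \<circ> ?A y" by (simp add: fun_eq_iff M_mul fd_left)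
  then have "det (matrix (?A (mul a y))) = det (matrix ?F) * det (matrix (?A y))"
    by (simp only: matrix_compose[OF lA lF] det_mul)
  then show ?thesis by (simp add: det_M)
qed

lemma measurable_mul [measurable]:
  "f \<in> borel_measurable N \<Longrightarrow> g \<in> borel_measurable N \<Longrightarrow> (\<lambda>x. mul (f x) (g x)) \<in> borel_measurable N"
  using measurable_compose[OF borel_measurable_Pair borel_measurable_continuous_onI[OF smooth_continuous_on[OF smooth_P]]]
  by (simp add: P_def)

lemma distr_left: "distr lborel borel (mul a) = lborel"
proof -
  define F where "F = (\<lambda>a w. to_ord (mul a (from_ord w)))"
  have inv: "F (- a) (F a w) = w" "F a (F (- a) w) = w" for a w by (simp_all add: F_def)
  have dF: "(F a has_derivative (\<lambda>w. to_ord (fd (mul a) (from_ord y) (from_ord w)))) (at y within S)" for a y S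
  proof -
    have d0: "(from_ord has_derivative from_ord) (at y)"
      by (rule bounded_linear_imp_has_derivative[OF bounded_linear_from_ord])
    have "((\<lambda>w. mul a (from_ord w)) has_derivative (\<lambda>w. fd (mul a) (from_ord y) (from_ord w))) (at y)"
      using diff_chain_at[OF d0 smooth_has_derivative[OF smooth_left]] by (simp add: o_def)
    from bounded_linear.has_derivative[OF bounded_linear_to_ord this]
    show ?thesis unfolding F_def by (rule has_derivative_at_withinI)
  qed
  have cF: "continuous_on S (F a)" for a S
    by (rule has_derivative_continuous_on[OF dF])
  have mF: "F a \<in> borel_measurable borel" for a by (rule borel_measurable_continuous_onI[OF cF])
  have "distr lborel borel (F a) = lborel"
  proof (rule lborel_eqI[symmetric])
    fix l u :: "real ^ 'n ordered_index"
    assume le: "\<And>b. b \<in> Basis \<Longrightarrow> l \<bullet> b \<le> u \<bullet> b"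
    \<comment> \<open>The preimage is an image under the inverse translation, the form required by
      the change of variables formula.\<close>
    have im: "F a -` box l u = F (- a) ` box l u"
      using inv by (auto simp: image_iff) metis
    have "F (- a) ` box l u \<in> lmeasurable \<and> measure lebesgue (F (- a) ` box l u) = measure lebesgue (box l u)"
    proof (subst has_measure_differentiable_image[OF _ dF])
      show "inj_on (F (- a)) (box l u)" by (rule inj_on_inverseI[of _ "F a"]) (simp add: inv)
      show "((\<lambda>x. \<bar>det (matrix (\<lambda>w. to_ord (fd (mul (- a)) (from_ord x) (from_ord w))))\<bar>) has_integral
          measure lebesgue (box l u)) (box l u)"
        using has_integral_measure_lborel[of "box l u"] emeasure_bounded_finite[OF bounded_box, of l u]
        by (simp add: det_left)
    qed auto
    then have eq: "emeasure lebesgue (F a -` box l u) = emeasure lebesgue (box l u)"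
      unfolding im using emeasure_eq_measure2[of _ lebesgue] lmeasurable_box[of l u] by metis
    have "F a -` box l u \<in> sets borel" using measurable_sets_borel[OF mF] by simp
    then have "emeasure (distr lborel borel (F a)) (box l u) = emeasure lebesgue (F a -` box l u)"
      using mF by (simp add: emeasure_distr)
    also have "\<dots> = emeasure lborel (box l u)" unfolding eq by simp
    finally have "emeasure (distr lborel borel (F a)) (box l u) = emeasure lborel (box l u)" .
    then show "emeasure (distr lborel borel (F a)) (box l u) = (\<Prod>b\<in>Basis. (u - l) \<bullet> b)"
      using le by (simp add: emeasure_lborel_box)
  qed simp
  then have "distr lborel borel from_ord = distr (distr (distr lborel borel to_ord) borel (F a)) borel (from_ord :: _ \<Rightarrow> real ^ 'n)"
    by (simp add: distr_to_ord)
  also have "\<dots> = distr lborel borel (from_ord \<circ> (F a \<circ> to_ord))"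
    using mF by (simp add: distr_distr)
  also have "from_ord \<circ> (F a \<circ> to_ord) = mul a" by (simp add: F_def fun_eq_iff)
  finally show ?thesis by (simp add: distr_from_ord)
qed

text \<open>Inversion is x -> -x in these coordinates, preserves Lebesgue measure, and exchanges
  left and right translations.\<close>

lemma distr_right: "distr lborel borel (\<lambda>x. mul x a) = lborel"
proof -
  have "distr (distr (distr lborel borel uminus) borel (mul (- a))) borel uminus = lborel"
    by (simp add: lborel_distr_uminus_euclidean distr_left)
  moreover have "distr (distr (distr lborel borel uminus) borel (mul (- a))) borel uminus =
      distr lborel borel (uminus \<circ> (mul (- a) \<circ> uminus))"
    by (simp add: distr_distr)
  moreover have "uminus \<circ> (mul (- a) \<circ> uminus) = (\<lambda>x. mul x a)"
    by (simp add: fun_eq_iff neg_mul)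
  ultimately show ?thesis by simp
qed

end

lemma homdim_eq:
  fixes deg :: "'n::finite \<Rightarrow> nat"
  assumes "\<And>k. deg k \<ge> 1"
  shows "homdim deg = (\<Sum>k\<in>UNIV. deg k)"
proof -
  have dim: "dim (layer deg i :: (real ^ 'n) set) = card {k. deg k = i}" for i
  proof -
    have "inj_on (\<lambda>k. axis k (1::real)) {k. deg k = i}" by (auto simp: inj_on_def axis_eq_axis)
    moreover have "independent ((\<lambda>k. axis k (1::real)) ` {k. deg k = i})"
      by (rule independent_mono[OF independent_Basis]) auto
    ultimately show ?thesis by (simp add: layer_def dim_eq_card_independent card_image)
  qed
  have "homdim deg = (\<Sum>i = 1..step deg. \<Sum>k\<in>{k\<in>UNIV. deg k = i}. deg k)"
    unfolding homdim_def dim by (simp add: mult.commute)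
  also have "\<dots> = (\<Sum>k\<in>UNIV. deg k)"
    by (rule sum.group) (use assms deg_le_step[of deg] in auto)
  finally show ?thesis .
qed

lemma lborel_dil:
  fixes deg :: "'n::finite \<Rightarrow> nat"
  assumes "\<And>k. deg k \<ge> 1" "r > 0"
  shows "lborel = density (distr lborel borel (dil deg r)) (\<lambda>_. ennreal (r ^ homdim deg))"
proof -
  define c where "c = (\<lambda>b :: real ^ 'n. \<Sum>k\<in>UNIV. r ^ deg k * b $ k)"
  have c: "c (axis k 1) = r ^ deg k" for k
    by (simp add: c_def axis_def if_distrib cong: if_cong)
  have "(\<Sum>j\<in>Basis. (c j * (x \<bullet> j)) *\<^sub>R j) = dil deg r x" for x
  proof -
    have "(\<Sum>j\<in>Basis. (c j * (x \<bullet> j)) *\<^sub>R j) = (\<Sum>k\<in>UNIV. (c (axis k 1) * (x \<bullet> axis k 1)) *\<^sub>R axis k 1)"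
      by (rule sum_Basis_vec)
    also have "\<dots> = dil deg r x"
      unfolding c inner_axis by (simp add: vec_eq_iff axis_def if_distrib cong: if_cong)
    finally show ?thesis .
  qed
  then have T: "dil deg r = (\<lambda>x. 0 + (\<Sum>j\<in>Basis. (c j * (x \<bullet> j)) *\<^sub>R j))" by auto
  have "(\<Prod>j\<in>Basis. \<bar>c j\<bar>) = r ^ homdim deg"
    using assms(2) by (simp add: prod_Basis_vec c homdim_eq[OF assms(1)] power_sum)
  moreover have "c j \<noteq> 0" if "j \<in> Basis" for j
    using that assms(2) by (auto simp: Basis_vec_def c)
  ultimately show ?thesis
    using lborel_affine_euclidean[of c "0 :: real ^ 'n"] unfolding T by simp
qed

section \<open>The homogeneous norm\<close>

text \<open>The homogeneous norm raised to the power 2 s!. Unlike the norm it is a polynomial in the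
  coordinates, hence smooth at the origin; the divisions are exact because each i divides
  s!.\<close>

definition hpow :: "('n::finite \<Rightarrow> nat) \<Rightarrow> real ^ 'n \<Rightarrow> real" where
  "hpow deg x = (\<Sum>i = 1..step deg. norm (component deg i x) ^ (2 * fact (step deg) div i))"

abbreviation hdeg :: "('n::finite \<Rightarrow> nat) \<Rightarrow> nat" where
  "hdeg deg \<equiv> 2 * fact (step deg)"

text \<open>The weight for all decay estimates: smooth, at least 1, submultiplicative up to a
  constant (\<open>wt_mul\<close>), and comparable with its own horizontal derivatives
  (\<open>lvf_wt_bound\<close>).\<close>

definition wt :: "('n::finite \<Rightarrow> nat) \<Rightarrow> real ^ 'n \<Rightarrow> real" where
  "wt deg x = 1 + hpow deg x"

lemma hnorm_eq: "hnorm deg x = root (hdeg deg) (hpow deg x)"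
  by (simp add: hnorm_def hpow_def)

lemma hpow_nonneg: "hpow deg x \<ge> 0"
  unfolding hpow_def by (intro sum_nonneg) auto

lemma wt_ge_1: "wt deg x \<ge> 1"
  using hpow_nonneg by (simp add: wt_def)

lemma wt_pos: "wt deg x > 0"
  using wt_ge_1[of deg x] by simp

lemma hnorm_power: "hnorm deg x ^ hdeg deg = hpow deg x"
  by (simp add: hnorm_eq real_root_pow_pos2 hpow_nonneg)

lemma hnorm_nonneg: "hnorm deg x \<ge> 0"
  by (simp add: hnorm_eq hpow_nonneg)

lemma component_dil: "component deg i (dil deg r x) = r ^ i *\<^sub>R component deg i x"
  by (simp add: component_def vec_eq_iff)

lemma linear_component: "linear (component deg i)"
  by (rule linearI) (simp_all add: component_def vec_eq_iff)

text \<open>The exponents are even, so the powers of Euclidean norms in \<open>hpow\<close> are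
  powers of inner products.\<close>

lemma hexp_eq: "1 \<le> i \<Longrightarrow> i \<le> s \<Longrightarrow> 2 * fact s div i = 2 * (fact s div i)" for i s :: nat
  by (metis div_mult_swap dvd_fact mult.commute)

lemma hexp_pos: "1 \<le> i \<Longrightarrow> i \<le> s \<Longrightarrow> 1 \<le> 2 * fact s div i" for i s :: nat
proof -
  assume "1 \<le> i" "i \<le> s"
  moreover have "s \<le> fact s" by (rule fact_ge_self)
  ultimately have "i \<le> 2 * fact s" "i > 0" by linarith+
  then show ?thesis using div_greater_zero_iff[of "2 * fact s" i] by linarith
qed

lemma hpow_dil:
  assumes "r > 0"
  shows "hpow deg (dil deg r x) = r ^ hdeg deg * hpow deg x"
proof -
  have "norm (component deg i (dil deg r x)) ^ (hdeg deg div i) =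
      r ^ hdeg deg * norm (component deg i x) ^ (hdeg deg div i)" if "i \<in> {1..step deg}" for i
  proof -
    have "i * (hdeg deg div i) = hdeg deg"
      using that by (intro dvd_mult_div_cancel dvd_mult dvd_fact) auto
    then show ?thesis using assms
      by (simp add: component_dil power_mult_distrib flip: power_mult)
  qed
  then show ?thesis by (simp add: hpow_def sum_distrib_left)
qed

lemma hnorm_dil: "r > 0 \<Longrightarrow> hnorm deg (dil deg r x) = r * hnorm deg x"
  by (simp add: hnorm_eq hpow_dil real_root_mult real_root_power_cancel)

lemma hpow_uminus [simp]: "hpow deg (- x) = hpow deg x"
  by (simp add: hpow_def linear_neg[OF linear_component])

lemma hnorm_uminus [simp]: "hnorm deg (- x) = hnorm deg x"
  by (simp add: hnorm_eq)

lemma wt_uminus [simp]: "wt deg (- x) = wt deg x"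
  by (simp add: wt_def)

lemma hpow_0 [simp]: "hpow deg 0 = 0" for deg :: "'n::finite \<Rightarrow> nat"
proof -
  have "(norm (component deg i 0 :: real ^ 'n) ^ (hdeg deg div i)) = 0" if "i \<in> {1..step deg}" for i
  proof -
    have "hdeg deg div i > 0" using that hexp_pos[of i "step deg"] by simp
    then show ?thesis by (simp add: linear_0[OF linear_component] zero_power)
  qed
  then show ?thesis unfolding hpow_def by (intro sum.neutral) blast
qed

lemma smooth_hpow: "smooth (hpow deg)"
proof -
  have "hpow deg = (\<lambda>x. \<Sum>i = 1..step deg. (component deg i x \<bullet> component deg i x) ^ (fact (step deg) div i))"
    unfolding hpow_def
    by (intro ext sum.cong) (auto simp: hexp_eq power_mult dot_square_norm)
  moreover have "smooth (component deg i)" for i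
    using linear_component linear_conv_bounded_linear smooth_linear by blast
  ultimately show ?thesis
    by (auto intro!: smooth_sum smooth_power smooth_bilinear[OF bounded_bilinear_inner])
qed

lemma smooth_wt: "smooth (wt deg)"
  unfolding wt_def by (intro smooth_add smooth_const smooth_hpow)

lemma continuous_hnorm: "continuous_on S (hnorm deg)"
  unfolding hnorm_eq by (intro continuous_on_real_root smooth_continuous_on smooth_hpow)

lemma wt_measurable [measurable]: "wt deg \<in> borel_measurable borel"
  and hpow_measurable [measurable]: "hpow deg \<in> borel_measurable borel"
  and hnorm_measurable [measurable]: "hnorm deg \<in> borel_measurable borel"
  by (intro borel_measurable_continuous_onI smooth_continuous_on smooth_wt smooth_hpow continuous_hnorm)+

context
  fixes deg :: "'n::finite \<Rightarrow> nat"
  assumes dp: "\<And>k. deg k \<ge> 1"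
begin

lemma abs_nth_le_wt: "\<bar>x $ k\<bar> \<le> wt deg x"
proof -
  let ?c = "norm (component deg (deg k) x)" and ?m = "hdeg deg div deg k"
  have k: "deg k \<in> {1..step deg}" using dp deg_le_step[of deg] by auto
  then have m: "?m \<ge> 1"
    using hexp_pos[of "deg k" "step deg"] by simp
  have le: "?c ^ ?m \<le> hpow deg x"
    unfolding hpow_def by (rule member_le_sum[OF k]) auto
  have "\<bar>x $ k\<bar> \<le> ?c" using component_le_norm_cart[of "component deg (deg k) x" k]
    by (simp add: component_def)
  also have "?c \<le> wt deg x"
  proof (cases "?c \<le> 1")
    case True
    then show ?thesis using wt_ge_1[of deg x] by linarith
  next
    case False
    then have "?c \<le> ?c ^ ?m" using m by (intro self_le_power) auto
    with le show ?thesis by (simp add: wt_def)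
  qed
  finally show ?thesis .
qed

lemma wt_le_subset_cbox: "{x. wt deg x \<le> R} \<subseteq> cbox (\<chi> k. - R) (\<chi> k. R)"
proof
  fix x assume "x \<in> {x. wt deg x \<le> R}"
  then have "\<bar>x $ k\<bar> \<le> R" for k using abs_nth_le_wt[of x k] by simp
  then show "x \<in> cbox (\<chi> k. - R) (\<chi> k. R)" by (simp add: mem_box_cart abs_le_iff minus_le_iff)
qed

lemma compact_wt_le: "compact {x. wt deg x \<le> R}"
proof -
  have "closed {x. wt deg x \<le> R}"
    by (intro closed_Collect_le smooth_continuous_on smooth_wt continuous_on_const)
  then show ?thesis
    using bounded_subset[OF bounded_cbox wt_le_subset_cbox] compact_eq_bounded_closed by blast
qed

lemma hpow_eq_0_iff [simp]: "hpow deg x = 0 \<longleftrightarrow> x = 0"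
proof
  assume 0: "hpow deg x = 0"
  show "x = 0"
  proof (rule ccontr)
    assume "x \<noteq> 0"
    then obtain k where k: "x $ k \<noteq> 0" by (auto simp: vec_eq_iff)
    \<comment> \<open>Chosen so that coordinate \<open>k\<close> of the dilate would reach 2,
      whereas a point with vanishing \<open>hpow\<close> keeps weight 1 under every
      dilation.\<close>
    define r where "r = 2 / \<bar>x $ k\<bar>"
    have r: "r > 0" using k by (simp add: r_def)
    define R where "R = max r 1"
    have "R * \<bar>x $ k\<bar> \<le> R ^ deg k * \<bar>x $ k\<bar>"
      using dp[of k] by (intro mult_right_mono self_le_power) (auto simp: R_def)
    also have "\<dots> = \<bar>dil deg R x $ k\<bar>" by (simp add: abs_mult R_def power_abs)
    also have "\<dots> \<le> wt deg (dil deg R x)" by (rule abs_nth_le_wt)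
    also have "\<dots> = 1" using 0 by (simp add: wt_def hpow_dil R_def)
    finally have "r * \<bar>x $ k\<bar> \<le> 1"
      using mult_right_mono[of r R "\<bar>x $ k\<bar>"] by (simp add: R_def)
    then show False using k by (simp add: r_def)
  qed
qed simp

lemma hpow_pos: "x \<noteq> 0 \<Longrightarrow> hpow deg x > 0"
  using hpow_nonneg[of deg x] hpow_eq_0_iff[of x] by linarith

lemma hnorm_pos: "x \<noteq> 0 \<Longrightarrow> hnorm deg x > 0"
  using hpow_pos[of x] by (simp add: hnorm_eq real_root_gt_zero)

lemma compact_hpow_le: "compact {x. hpow deg x \<le> R}"
  using compact_wt_le[of "1 + R"] by (simp add: wt_def)

lemma continuous_bounded_hpow_le:
  fixes f :: "real ^ 'n \<Rightarrow> 'b::real_normed_vector"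
  assumes "continuous_on UNIV f"
  obtains C where "C \<ge> 0" "\<And>x. hpow deg x \<le> 1 \<Longrightarrow> norm (f x) \<le> C"
proof -
  have "bounded (f ` {x. hpow deg x \<le> 1})"
    by (intro compact_imp_bounded compact_continuous_image compact_hpow_le continuous_on_subset[OF assms]) auto
  then obtain C where "\<forall>y\<in>f ` {x. hpow deg x \<le> 1}. norm y \<le> C" using bounded_iff by blast
  then show ?thesis using that[of "max C 0"] by (auto simp: le_max_iff_disj)
qed

lemma hnorm_dil_normalize:
  assumes "x \<noteq> 0"
  shows "hpow deg (dil deg (1 / hnorm deg x) x) = 1"
  using hnorm_pos[OF assms] hpow_pos[OF assms] assms
  by (simp add: hpow_dil power_divide hnorm_power)

text \<open>The hypothesis is homogeneity of degree \<open>hdeg deg\<close> minus \<open>d\<close>,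
  written without subtraction. Outside the unit ball the point is scaled to the unit sphere, where
  compactness bounds \<open>f\<close>; the factor r^d >= 1 may be dropped.\<close>

lemma homogeneous_bound:
  assumes f: "continuous_on UNIV f" and h: "\<And>r x. r > 0 \<Longrightarrow> r ^ d * f (dil deg r x) = r ^ hdeg deg * f x"
  shows "\<exists>C\<ge>0. \<forall>x. \<bar>f x :: real\<bar> \<le> C * wt deg x"
proof -
  obtain C where C: "C \<ge> 0" "\<And>x. hpow deg x \<le> 1 \<Longrightarrow> norm (f x) \<le> C"
    using continuous_bounded_hpow_le[OF f] by blast
  have "\<bar>f x\<bar> \<le> C * wt deg x" for x
  proof (cases "hpow deg x \<le> 1")
    case True
    then have "\<bar>f x\<bar> \<le> C * 1" using C by simp
    also have "\<dots> \<le> C * wt deg x" using C wt_ge_1 by (intro mult_left_mono) auto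
    finally show ?thesis .
  next
    case False
    then have x: "x \<noteq> 0" by auto
    define r where "r = hnorm deg x"
    have r: "r \<ge> 1" using False by (simp add: r_def hnorm_eq)
    define y where "y = dil deg (1 / r) x"
    have y: "hpow deg y = 1" unfolding y_def r_def by (rule hnorm_dil_normalize[OF x])
    have "\<bar>f x\<bar> \<le> r ^ d * \<bar>f x\<bar>" using mult_right_mono[of 1 "r ^ d" "\<bar>f x\<bar>"] r by simp
    also have "\<dots> = \<bar>r ^ d * f (dil deg r y)\<bar>" using r by (simp add: y_def abs_mult)
    also have "\<dots> = r ^ hdeg deg * \<bar>f y\<bar>" using r by (subst h) (auto simp: abs_mult)
    also have "\<dots> \<le> r ^ hdeg deg * C" using C(2)[of y] y r by (intro mult_left_mono) auto
    also have "\<dots> = C * hpow deg x" by (simp add: r_def hnorm_power)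
    also have "\<dots> \<le> C * wt deg x" using C by (intro mult_left_mono) (auto simp: wt_def)
    finally show ?thesis .
  qed
  with C show ?thesis by blast
qed

lemma emeasure_wt_le: "emeasure lborel {x. wt deg x \<le> R} \<le> ennreal ((2 * R) ^ CARD('n))" if "R \<ge> 0"
proof -
  have "emeasure lborel {x. wt deg x \<le> R} \<le> emeasure lborel (cbox (\<chi> k. - R) (\<chi> k. R) :: (real ^ 'n) set)"
    by (intro emeasure_mono wt_le_subset_cbox) simp
  also have "\<dots> = ennreal (\<Prod>b\<in>Basis. ((\<chi> k. R) - (\<chi> k. - R) :: real ^ 'n) \<bullet> b)"
    by (rule emeasure_lborel_cbox) (use that in \<open>auto simp: Basis_vec_def inner_axis\<close>)
  also have "\<dots> = ennreal ((2 * R) ^ CARD('n))"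
    by (simp add: prod_Basis_vec inner_axis)
  finally show ?thesis .
qed

text \<open>A sublevel set of \<open>wt\<close> at height R lies in a cube of volume (2R)^N. Cutting
  the space at integer heights, the exponent N + 2 leaves a series comparable with the sum of
  1/n^2.\<close>

lemma nn_integral_wt_finite: "(\<integral>\<^sup>+x. ennreal (1 / wt deg x ^ (CARD('n) + 2)) \<partial>lborel) < \<infinity>"
proof -
  let ?N = "CARD('n)"
  let ?t = "\<lambda>n x. ennreal (1 / real (Suc n) ^ (?N + 2)) * indicator {x. wt deg x \<le> real (Suc (Suc n))} x"
  have "ennreal (1 / wt deg x ^ (?N + 2)) \<le> (\<Sum>n. ?t n x)" for x
  proof -
    define n where "n = nat \<lfloor>wt deg x\<rfloor> - 1"
    have 1: "wt deg x \<ge> 1" by (rule wt_ge_1)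
    have n: "real (Suc n) \<le> wt deg x" "wt deg x \<le> real (Suc (Suc n))"
      using 1 unfolding n_def by linarith+
    have "1 / wt deg x ^ (?N + 2) \<le> 1 / real (Suc n) ^ (?N + 2)"
      using n(1) by (intro divide_left_mono power_mono mult_pos_pos zero_less_power wt_pos) auto
    then have "ennreal (1 / wt deg x ^ (?N + 2)) \<le> ?t n x" using n(2) by (simp add: ennreal_leI)
    also have "sum (\<lambda>n. ?t n x) {n} \<le> (\<Sum>n. ?t n x)" by (intro sum_le_suminf) auto
    then have "?t n x \<le> (\<Sum>n. ?t n x)"
      by (simp only: sum.insert sum.empty finite.emptyI empty_iff not_False_eq_True add_0_right)
    finally show ?thesis .
  qed
  then have "(\<integral>\<^sup>+x. ennreal (1 / wt deg x ^ (?N + 2)) \<partial>lborel) \<le> (\<integral>\<^sup>+x. (\<Sum>n. ?t n x) \<partial>lborel)"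
    by (intro nn_integral_mono) auto
  also have "\<dots> = (\<Sum>n. \<integral>\<^sup>+x. ?t n x \<partial>lborel)"
    by (intro nn_integral_suminf) measurable
  also have "\<dots> \<le> (\<Sum>n. ennreal (4 ^ ?N * (1 / real (Suc n) ^ 2)))"
  proof (rule suminf_le)
    fix n
    have "(\<integral>\<^sup>+x. ?t n x \<partial>lborel) = ennreal (1 / real (Suc n) ^ (?N + 2)) * emeasure lborel {x. wt deg x \<le> real (Suc (Suc n))}"
      by (subst nn_integral_cmult_indicator) auto
    also have "\<dots> \<le> ennreal (1 / real (Suc n) ^ (?N + 2)) * ennreal ((2 * real (Suc (Suc n))) ^ ?N)"
      by (intro mult_left_mono emeasure_wt_le) auto
    also have "\<dots> = ennreal (1 / real (Suc n) ^ (?N + 2) * (2 * real (Suc (Suc n))) ^ ?N)"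
      by (subst ennreal_mult) auto
    also have "\<dots> \<le> ennreal (1 / real (Suc n) ^ (?N + 2) * (4 * real (Suc n)) ^ ?N)"
      by (intro ennreal_leI mult_left_mono power_mono) auto
    also have "1 / real (Suc n) ^ (?N + 2) * (4 * real (Suc n)) ^ ?N = 4 ^ ?N * (1 / real (Suc n) ^ 2)"
      by (simp add: power_add power_mult_distrib power2_eq_square field_simps del: of_nat_Suc)
    finally show "(\<integral>\<^sup>+x. ?t n x \<partial>lborel) \<le> ennreal (4 ^ ?N * (1 / real (Suc n) ^ 2))" .
  qed auto
  also have "\<dots> < \<infinity>"
  proof -
    have "summable (\<lambda>n. 4 ^ ?N * (1 / real (Suc n) ^ 2))"
      using inverse_power_summable[of 2, where 'a = real]
      by (intro summable_mult) (subst summable_Suc_iff, simp add: inverse_eq_divide)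
    then have "(\<Sum>n. ennreal (4 ^ ?N * (1 / real (Suc n) ^ 2))) = ennreal (\<Sum>n. 4 ^ ?N * (1 / real (Suc n) ^ 2))"
      by (intro suminf_ennreal2) auto
    then show ?thesis by simp
  qed
  finally show ?thesis .
qed

end

context stratified_group
begin

text \<open>Both factors are dilated by one common \<open>r\<close> into the compact unit ball of
  \<open>hpow\<close>, where the product is bounded; dilations being automorphisms, the bound scales
  back.\<close>

lemma wt_mul: "\<exists>C\<ge>1. \<forall>a b. wt deg (mul a b) \<le> C * wt deg a * wt deg b"
proof -
  let ?K = "{x. hpow deg x \<le> 1}"
  have "compact ((\<lambda>z. hpow deg (mul (fst z) (snd z))) ` (?K \<times> ?K))"
    by (intro compact_continuous_image compact_Times compact_hpow_le deg_pos
        continuous_on_compose2[OF smooth_continuous_on[OF smooth_hpow, of UNIV]] continuous_mul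
        continuous_on_fst continuous_on_snd continuous_on_id) auto
  then have "bounded ((\<lambda>z. hpow deg (mul (fst z) (snd z))) ` (?K \<times> ?K))" by (rule compact_imp_bounded)
  then obtain C where C: "\<And>a b. a \<in> ?K \<Longrightarrow> b \<in> ?K \<Longrightarrow> norm (hpow deg (mul a b)) \<le> C"
    unfolding bounded_iff by fastforce
  have C0: "C \<ge> 0" using C[of 0 0] by auto
  have "wt deg (mul a b) \<le> (C + 1) * wt deg a * wt deg b" for a b
  proof (cases "a = 0 \<and> b = 0")
    case True
    then show ?thesis using C0 by (simp add: wt_def)
  next
    case False
    \<comment> \<open>With r^(2 s!) equal to the sum of the two powers, neither dilated factor
      leaves the unit ball.\<close>
    define r where "r = root (hdeg deg) (hpow deg a + hpow deg b)"
    have s: "hpow deg a + hpow deg b > 0"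
      using False hpow_pos[OF deg_pos, of a] hpow_pos[OF deg_pos, of b] hpow_nonneg[of deg a] hpow_nonneg[of deg b]
      by (cases "a = 0"; cases "b = 0") (auto intro: add_pos_nonneg add_nonneg_pos)
    then have r: "r > 0" by (simp add: r_def real_root_gt_zero)
    have rp: "r ^ hdeg deg = hpow deg a + hpow deg b"
      using s by (simp add: r_def real_root_pow_pos)
    have "dil deg (1 / r) a \<in> ?K" "dil deg (1 / r) b \<in> ?K"
      using r s hpow_nonneg[of deg a] hpow_nonneg[of deg b] by (auto simp: hpow_dil power_divide rp)
    from C[OF this] have "hpow deg (dil deg (1 / r) (mul a b)) \<le> C"
      using r by (simp add: dil_mul)
    then have "hpow deg (mul a b) \<le> C * (hpow deg a + hpow deg b)"
      using r s by (simp add: hpow_dil power_divide rp divide_le_eq)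
    also have "\<dots> \<le> C * (wt deg a * wt deg b)"
      using C0 hpow_nonneg[of deg a] hpow_nonneg[of deg b]
      by (intro mult_left_mono) (auto simp: wt_def algebra_simps)
    finally have "hpow deg (mul a b) \<le> C * (wt deg a * wt deg b)" .
    moreover have "1 \<le> wt deg a * wt deg b"
      using mult_mono[of 1 "wt deg a" 1 "wt deg b"] wt_ge_1[of deg a] wt_ge_1[of deg b] wt_pos[of deg a] by simp
    ultimately show ?thesis by (simp add: wt_def algebra_simps)
  qed
  with C0 show ?thesis by (intro exI[of _ "C + 1"]) auto
qed

lemma lvf_smooth:
  assumes f: "smooth f"
  shows "smooth (lvf mul v f)"
proof -
  have "lvf mul v f = (\<lambda>x. fd f x (M x v))" by (rule ext) (rule lvf_eq[OF f])
  then show ?thesis by (simp add: smooth_fd_compose[OF f smooth_id smooth_M[OF smooth_id smooth_const]])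
qed

lemma lvf_hvd: "smooth f \<Longrightarrow> ((\<lambda>t. f (mul g (t *\<^sub>R v))) has_vector_derivative lvf mul v f (mul g (t *\<^sub>R v))) (at t)"
  using hvd_compose[OF hvd_flow] by (simp add: lvf_eq)

lemma lvf_scale: "smooth f \<Longrightarrow> lvf mul (c *\<^sub>R v) f g = c *\<^sub>R lvf mul v f g"
  by (simp add: lvf_eq linear_scale[OF linear_M] linear_scale[OF smooth_fd_linear])

lemma lvf_dil:
  assumes "r > 0" "smooth f" "deg k = 1"
  shows "lvf mul (axis k 1) (\<lambda>x. f (dil deg r x)) g = r *\<^sub>R lvf mul (axis k 1) f (dil deg r g)"
proof -
  have "lvf mul (axis k 1) (\<lambda>x. f (dil deg r x)) g = lvf mul (dil deg r (axis k 1)) f (dil deg r g)"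
    by (simp add: lvf_def dil_mul[OF assms(1)] dil_scaleR)
  then show ?thesis using assms by (simp add: dil_axis lvf_scale)
qed

lemma smooth_dil: "smooth f \<Longrightarrow> smooth (\<lambda>x. f (dil deg r x))" for f :: "real ^ 'n \<Rightarrow> 'b::real_normed_vector"
  by (rule smooth_compose[OF _ smooth_linear[OF bounded_linear_dil]])

lemma lvf_cmult:
  assumes f: "smooth f"
  shows "lvf mul v (\<lambda>x. c *\<^sub>R f x) g = c *\<^sub>R lvf mul v f g"
proof -
  have "fd (\<lambda>x. c *\<^sub>R f x) g = (\<lambda>h. c *\<^sub>R fd f g h)"
    by (rule fd_eq[OF has_derivative_scaleR_right[OF smooth_has_derivative[OF f]]])
  then show ?thesis using f by (simp add: lvf_eq smooth_scaleR)
qed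

text \<open>A horizontal field lowers the degree of homogeneity by one, so its first and second
  applications to \<open>hpow\<close> are covered by \<open>homogeneous_bound\<close> with d = 1 and
  d = 2.\<close>

lemma lvf_hpow_bound:
  assumes k: "deg k = 1"
  shows "\<exists>C\<ge>0. \<forall>x. \<bar>lvf mul (axis k 1) (hpow deg) x\<bar> \<le> C * wt deg x"
    and "\<exists>C\<ge>0. \<forall>x. \<bar>lvf mul (axis k 1) (lvf mul (axis k 1) (hpow deg)) x\<bar> \<le> C * wt deg x"
proof -
  let ?X = "\<lambda>f. lvf mul (axis k 1) f"
  let ?N = "hpow deg"
  have s: "smooth ?N" "smooth (?X ?N)" "smooth (?X (?X ?N))" by (intro lvf_smooth smooth_hpow)+
  have 1: "r * ?X ?N (dil deg r x) = r ^ hdeg deg * ?X ?N x" if "r > 0" for r x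
    using lvf_dil[OF that s(1) k, of x] lvf_cmult[OF s(1), of "axis k 1" "r ^ hdeg deg" x]
    by (simp add: hpow_dil[OF that])
  have 2: "r ^ 2 * ?X (?X ?N) (dil deg r x) = r ^ hdeg deg * ?X (?X ?N) x" if "r > 0" for r x
  proof -
    have "r * (r * ?X (?X ?N) (dil deg r x)) = r * ?X (\<lambda>x. ?X ?N (dil deg r x)) x"
      using lvf_dil[OF that s(2) k, of x] by simp
    also have "\<dots> = ?X (\<lambda>x. r * ?X ?N (dil deg r x)) x"
      using lvf_cmult[OF smooth_dil[OF s(2)], of "axis k 1" r r x] by simp
    also have "\<dots> = r ^ hdeg deg * ?X (?X ?N) x"
      using lvf_cmult[OF s(2), of "axis k 1" "r ^ hdeg deg" x] by (simp add: 1[OF that])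
    finally show ?thesis by (simp add: power2_eq_square)
  qed
  show "\<exists>C\<ge>0. \<forall>x. \<bar>?X ?N x\<bar> \<le> C * wt deg x"
    by (rule homogeneous_bound[where d = 1]) (use 1 deg_pos s smooth_continuous_on in auto)
  show "\<exists>C\<ge>0. \<forall>x. \<bar>?X (?X ?N) x\<bar> \<le> C * wt deg x"
    by (rule homogeneous_bound[where d = 2]) (use 2 deg_pos s smooth_continuous_on in auto)
qed

lemma nn_integral_left: "f \<in> borel_measurable borel \<Longrightarrow> (\<integral>\<^sup>+x. f (mul a x) \<partial>lborel) = (\<integral>\<^sup>+x. f x \<partial>lborel)"
  using nn_integral_distr[of "mul a" lborel borel f] by (simp add: distr_left)

lemma integral_left: "f \<in> borel_measurable borel \<Longrightarrow> (LINT x|lborel. f (mul a x)) = (LINT x|lborel. f x)"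
  for f :: "_ \<Rightarrow> real"
  using integral_distr[of "mul a" lborel borel f] by (simp add: distr_left)

lemma integral_right: "f \<in> borel_measurable borel \<Longrightarrow> (LINT x|lborel. f (mul x a)) = (LINT x|lborel. f x)"
  for f :: "_ \<Rightarrow> real"
  using integral_distr[of "\<lambda>x. mul x a" lborel borel f] by (simp add: distr_right)

lemma integrable_right: "f \<in> borel_measurable borel \<Longrightarrow> integrable lborel (\<lambda>x. f (mul x a)) \<longleftrightarrow> integrable lborel f"
  for f :: "_ \<Rightarrow> real"
  using integrable_distr_eq[of "\<lambda>x. mul x a" lborel borel f] by (simp add: distr_right)

lemma nn_integral_dil:
  assumes "r > 0" and f: "f \<in> borel_measurable borel"
  shows "(\<integral>\<^sup>+x. f x \<partial>lborel) = ennreal (r ^ homdim deg) * (\<integral>\<^sup>+x. f (dil deg r x) \<partial>lborel)"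
proof -
  have m: "dil deg r \<in> borel_measurable borel"
    by (intro borel_measurable_continuous_onI linear_continuous_on bounded_linear_dil)
  have "(\<integral>\<^sup>+x. f x \<partial>lborel) = (\<integral>\<^sup>+x. f x \<partial>density (distr lborel borel (dil deg r)) (\<lambda>_. ennreal (r ^ homdim deg)))"
    by (rule arg_cong[OF lborel_dil[OF deg_pos assms(1)], of "\<lambda>M. nn_integral M f"])
  also have "\<dots> = (\<integral>\<^sup>+x. ennreal (r ^ homdim deg) * f (dil deg r x) \<partial>lborel)"
    using f m by (simp add: nn_integral_density nn_integral_distr)
  also have "\<dots> = ennreal (r ^ homdim deg) * (\<integral>\<^sup>+x. f (dil deg r x) \<partial>lborel)"
    using measurable_compose[OF m f] by (intro nn_integral_cmult) simp
  finally show ?thesis .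
qed

end

section \<open>Square integrable functions and contraction semigroups\<close>

definition ip :: "('a::euclidean_space \<Rightarrow> real) \<Rightarrow> ('a \<Rightarrow> real) \<Rightarrow> real" where
  "ip f g = (LINT x|lborel. f x * g x)"

lemma L2_measurable: "f \<in> L2 \<Longrightarrow> f \<in> borel_measurable borel"
  by (simp add: L2_def)

lemma L2_prod_integrable:
  assumes "f \<in> L2" "g \<in> L2"
  shows "integrable lborel (\<lambda>x. f x * g x)"
proof (rule Bochner_Integration.integrable_bound)
  show "integrable lborel (\<lambda>x. (f x)\<^sup>2 + (g x)\<^sup>2)" using assms by (simp add: L2_def)
  show "(\<lambda>x. f x * g x) \<in> borel_measurable lborel" using assms[THEN L2_measurable] by simp
  have "\<bar>f x * g x\<bar> \<le> (f x)\<^sup>2 + (g x)\<^sup>2" for x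
  proof -
    have "2 * \<bar>f x\<bar> * \<bar>g x\<bar> \<le> \<bar>f x\<bar>\<^sup>2 + \<bar>g x\<bar>\<^sup>2" by (rule sum_squares_bound)
    moreover have "0 \<le> \<bar>f x\<bar> * \<bar>g x\<bar>" by simp
    ultimately show ?thesis unfolding abs_mult power2_abs by linarith
  qed
  then show "AE x in lborel. norm (f x * g x) \<le> norm ((f x)\<^sup>2 + (g x)\<^sup>2)" by simp
qed

lemma L2_lincomb:
  assumes "f \<in> L2" "g \<in> L2"
  shows "(\<lambda>x. a * f x + b * g x) \<in> L2"
proof -
  have "integrable lborel (\<lambda>x. a\<^sup>2 * (f x)\<^sup>2 + 2 * a * b * (f x * g x) + b\<^sup>2 * (g x)\<^sup>2)"
    using assms L2_prod_integrable[OF assms] by (simp add: L2_def)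
  moreover have "(\<lambda>x. a\<^sup>2 * (f x)\<^sup>2 + 2 * a * b * (f x * g x) + b\<^sup>2 * (g x)\<^sup>2) = (\<lambda>x. (a * f x + b * g x)\<^sup>2)"
    by (simp add: power2_eq_square algebra_simps)
  ultimately show ?thesis using assms[THEN L2_measurable] by (simp add: L2_def)
qed

lemma L2_add: "f \<in> L2 \<Longrightarrow> g \<in> L2 \<Longrightarrow> (\<lambda>x. f x + g x) \<in> L2"
  and L2_diff: "f \<in> L2 \<Longrightarrow> g \<in> L2 \<Longrightarrow> (\<lambda>x. f x - g x) \<in> L2"
  and L2_cmult: "f \<in> L2 \<Longrightarrow> (\<lambda>x. a * f x) \<in> L2"
  and L2_minus: "f \<in> L2 \<Longrightarrow> (\<lambda>x. - f x) \<in> L2"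
  using L2_lincomb[of f g 1 1] L2_lincomb[of f g 1 "-1"] L2_lincomb[of f f a 0] L2_lincomb[of f f "-1" 0] by simp_all

lemma L2_divide: "f \<in> L2 \<Longrightarrow> (\<lambda>x. f x / a) \<in> L2"
  using L2_cmult[of f "1 / a"] by simp

lemma L2_dominated:
  assumes "g \<in> L2" "f \<in> borel_measurable borel" "\<And>x. \<bar>f x\<bar> \<le> \<bar>g x\<bar>"
  shows "f \<in> L2"
proof -
  have "integrable lborel (\<lambda>x. (f x)\<^sup>2)"
  proof (rule Bochner_Integration.integrable_bound)
    show "integrable lborel (\<lambda>x. (g x)\<^sup>2)" using assms by (simp add: L2_def)
    show "AE x in lborel. norm ((f x)\<^sup>2) \<le> norm ((g x)\<^sup>2)"
      using assms(3) by (auto simp: abs_le_square_iff)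
  qed (use assms(2) in simp)
  then show ?thesis using assms(2) by (simp add: L2_def)
qed

lemma L2_max_0: "f \<in> L2 \<Longrightarrow> (\<lambda>x. max 0 (f x)) \<in> L2"
  by (rule L2_dominated) (auto dest: L2_measurable)

lemma L2_zero: "(\<lambda>x. 0) \<in> L2"
  by (simp add: L2_def)

lemma ip_commute: "ip f g = ip g f"
  by (simp add: ip_def mult.commute)

lemma ip_lincomb_left:
  assumes "f \<in> L2" "g \<in> L2" "h \<in> L2"
  shows "ip (\<lambda>x. a * f x + b * g x) h = a * ip f h + b * ip g h"
proof -
  have "ip (\<lambda>x. a * f x + b * g x) h = (LINT x|lborel. a * (f x * h x) + b * (g x * h x))"
    unfolding ip_def by (rule Bochner_Integration.integral_cong) (auto simp: algebra_simps)
  also have "\<dots> = a * ip f h + b * ip g h"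
    using L2_prod_integrable[OF assms(1,3)] L2_prod_integrable[OF assms(2,3)] by (simp add: ip_def)
  finally show ?thesis .
qed

lemma ip_add_left: "f \<in> L2 \<Longrightarrow> g \<in> L2 \<Longrightarrow> h \<in> L2 \<Longrightarrow> ip (\<lambda>x. f x + g x) h = ip f h + ip g h"
  and ip_diff_left: "f \<in> L2 \<Longrightarrow> g \<in> L2 \<Longrightarrow> h \<in> L2 \<Longrightarrow> ip (\<lambda>x. f x - g x) h = ip f h - ip g h"
  using ip_lincomb_left[of f g h 1 1] ip_lincomb_left[of f g h 1 "-1"] by simp_all

lemma ip_cmult_left: "ip (\<lambda>x. a * f x) h = a * ip f h"
  and ip_minus_left: "ip (\<lambda>x. - f x) h = - ip f h"
  by (simp_all add: ip_def mult.assoc)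

lemma ip_add_right: "f \<in> L2 \<Longrightarrow> g \<in> L2 \<Longrightarrow> h \<in> L2 \<Longrightarrow> ip h (\<lambda>x. f x + g x) = ip h f + ip h g"
  and ip_diff_right: "f \<in> L2 \<Longrightarrow> g \<in> L2 \<Longrightarrow> h \<in> L2 \<Longrightarrow> ip h (\<lambda>x. f x - g x) = ip h f - ip h g"
  and ip_cmult_right: "ip h (\<lambda>x. a * f x) = a * ip h f"
  unfolding ip_commute[of h] by (simp_all add: ip_add_left ip_diff_left ip_cmult_left)

lemma ip_self_nonneg: "ip f f \<ge> 0"
  by (simp add: ip_def integral_nonneg_AE)

lemma L2_norm_eq: "L2_norm f = sqrt (ip f f)"
  by (simp add: L2_norm_def ip_def power2_eq_square)

lemma L2_norm_nonneg: "L2_norm f \<ge> 0"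
  by (simp add: L2_norm_eq ip_self_nonneg)

lemma L2_norm_sq: "(L2_norm f)\<^sup>2 = ip f f"
  by (simp add: L2_norm_eq ip_self_nonneg)

lemma L2_norm_cmult: "L2_norm (\<lambda>x. a * f x) = \<bar>a\<bar> * L2_norm f"
  by (simp add: L2_norm_def power_mult_distrib real_sqrt_mult)

lemma L2_norm_minus: "L2_norm (\<lambda>x. - f x) = L2_norm f"
  by (simp add: L2_norm_def)

lemma ip_Cauchy_Schwarz:
  assumes "f \<in> L2" "g \<in> L2"
  shows "\<bar>ip f g\<bar> \<le> L2_norm f * L2_norm g"
proof -
  have q: "ip f f * t\<^sup>2 + 2 * ip f g * t + ip g g \<ge> 0" for t
  proof -
    have "0 \<le> ip (\<lambda>x. t * f x + 1 * g x) (\<lambda>x. t * f x + 1 * g x)" by (rule ip_self_nonneg)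
    also have "\<dots> = t * ip f (\<lambda>x. t * f x + 1 * g x) + ip g (\<lambda>x. t * f x + 1 * g x)"
      by (subst ip_lincomb_left[OF assms L2_lincomb[OF assms]]) simp
    also have "\<dots> = t * (t * ip f f + ip f g) + (t * ip f g + ip g g)"
      using ip_lincomb_left[OF assms assms(1), of t 1] ip_lincomb_left[OF assms assms(2), of t 1]
      by (simp add: ip_commute)
    finally show ?thesis by (simp add: algebra_simps power2_eq_square)
  qed
  have "(ip f g)\<^sup>2 \<le> ip f f * ip g g"
  proof (cases "ip f f = 0")
    case True
    have "ip f g = 0"
    proof (rule ccontr)
      assume ne: "ip f g \<noteq> 0"
      have "2 * ip f g * (- (ip g g + 1) / (2 * ip f g)) + ip g g \<ge> 0"
        using q[of "- (ip g g + 1) / (2 * ip f g)"] True by simp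
      then show False using ne by simp
    qed
    then show ?thesis using True by simp
  next
    case False
    then have p: "ip f f > 0" using ip_self_nonneg[of f] by simp
    have "0 \<le> ip f f * (ip f f * (- ip f g / ip f f)\<^sup>2 + 2 * ip f g * (- ip f g / ip f f) + ip g g)"
      using q[of "- ip f g / ip f f"] p by (intro mult_nonneg_nonneg) auto
    also have "\<dots> = ip f f * ip g g - (ip f g)\<^sup>2"
      using p by (simp add: power2_eq_square field_simps)
    finally show ?thesis by simp
  qed
  then have "sqrt ((ip f g)\<^sup>2) \<le> sqrt (ip f f * ip g g)" by (rule real_sqrt_le_mono)
  then show ?thesis by (simp add: L2_norm_eq real_sqrt_mult)
qed

lemma L2_norm_add_sq:
  assumes "f \<in> L2" "g \<in> L2"
  shows "(L2_norm (\<lambda>x. f x + g x))\<^sup>2 = ip f f + 2 * ip f g + ip g g"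
  using assms by (simp add: L2_norm_sq ip_add_left ip_add_right L2_add ip_commute[of g f])

lemma L2_norm_triangle:
  assumes "f \<in> L2" "g \<in> L2"
  shows "L2_norm (\<lambda>x. f x + g x) \<le> L2_norm f + L2_norm g"
proof (rule power2_le_imp_le)
  have "(L2_norm (\<lambda>x. f x + g x))\<^sup>2 = ip f f + 2 * ip f g + ip g g"
    by (rule L2_norm_add_sq[OF assms])
  also have "\<dots> \<le> ip f f + 2 * (L2_norm f * L2_norm g) + ip g g"
    using ip_Cauchy_Schwarz[OF assms] by simp
  also have "\<dots> = (L2_norm f + L2_norm g)\<^sup>2"
    by (simp add: power2_sum L2_norm_sq)
  finally show "(L2_norm (\<lambda>x. f x + g x))\<^sup>2 \<le> (L2_norm f + L2_norm g)\<^sup>2" .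
qed (simp add: L2_norm_nonneg)

lemma L2_norm_triangle_diff:
  assumes "f \<in> L2" "g \<in> L2"
  shows "L2_norm (\<lambda>x. f x - g x) \<le> L2_norm f + L2_norm g"
  using L2_norm_triangle[OF assms(1) L2_minus[OF assms(2)]] by (simp add: L2_norm_minus)

lemma L2_norm_max_0:
  assumes "f \<in> L2"
  shows "L2_norm (\<lambda>x. max 0 (f x)) \<le> L2_norm f"
proof -
  have "ip (\<lambda>x. max 0 (f x)) (\<lambda>x. max 0 (f x)) \<le> ip f f"
    unfolding ip_def
    by (intro integral_mono L2_prod_integrable assms L2_max_0) (auto simp: max_def)
  then show ?thesis by (simp add: L2_norm_eq)
qed

lemma ip_cong_AE:
  assumes "f \<in> L2" "f' \<in> L2" "g \<in> L2" "g' \<in> L2" "AE x in lborel. f x = f' x" "AE x in lborel. g x = g' x"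
  shows "ip f g = ip f' g'"
  unfolding ip_def
proof (rule integral_cong_AE)
  note [measurable] = assms(1-4)[THEN L2_measurable]
  show "(\<lambda>x. f x * g x) \<in> borel_measurable lborel" "(\<lambda>x. f' x * g' x) \<in> borel_measurable lborel" by measurable
  show "AE x in lborel. f x * g x = f' x * g' x" using assms(5,6) by eventually_elim simp
qed

lemma L2_norm_cong_AE:
  assumes "f \<in> L2" "g \<in> L2" "AE x in lborel. f x = g x"
  shows "L2_norm f = L2_norm g"
  unfolding L2_norm_eq using ip_cong_AE assms by metis

lemma L2_norm_0_AE:
  assumes "f \<in> L2" "L2_norm f = 0"
  shows "AE x in lborel. f x = 0"
proof -
  have "(LINT x|lborel. (f x)\<^sup>2) = 0" using assms(2) by (simp add: L2_norm_def)
  moreover have "integrable lborel (\<lambda>x. (f x)\<^sup>2)" using assms(1) by (simp add: L2_def)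
  ultimately have "AE x in lborel. (f x)\<^sup>2 = 0"
    by (subst (asm) integral_nonneg_eq_0_iff_AE) auto
  then show ?thesis by simp
qed

lemma ip_tendsto:
  assumes "\<And>m. \<phi> m \<in> L2" "f \<in> L2" "(\<lambda>m. L2_norm (\<lambda>x. \<phi> m x - f x)) \<longlonglongrightarrow> 0"
    and "\<And>m. \<psi> m \<in> L2" "g \<in> L2" "(\<lambda>m. L2_norm (\<lambda>x. \<psi> m x - g x)) \<longlonglongrightarrow> 0"
  shows "(\<lambda>m. ip (\<phi> m) (\<psi> m)) \<longlonglongrightarrow> ip f g"
proof -
  let ?a = "\<lambda>m. L2_norm (\<lambda>x. \<phi> m x - f x)" and ?b = "\<lambda>m. L2_norm (\<lambda>x. \<psi> m x - g x)"
  have "\<bar>ip (\<phi> m) (\<psi> m) - ip f g\<bar> \<le> ?a m * ?b m + ?a m * L2_norm g + L2_norm f * ?b m" for m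
  proof -
    note i = assms(1)[of m] assms(2) assms(4)[of m] assms(5)
    have d: "(\<lambda>x. \<phi> m x - f x) \<in> L2" "(\<lambda>x. \<psi> m x - g x) \<in> L2"
      using L2_diff[OF i(1,2)] L2_diff[OF i(3,4)] .
    have eq: "ip (\<phi> m) (\<psi> m) - ip f g = ip (\<lambda>x. \<phi> m x - f x) (\<lambda>x. \<psi> m x - g x) + ip (\<lambda>x. \<phi> m x - f x) g + ip f (\<lambda>x. \<psi> m x - g x)"
      by (simp only: ip_diff_left[OF i(1,2) d(2)] ip_diff_left[OF i(1,2) i(4)] ip_diff_right[OF i(3,4) i(1)] ip_diff_right[OF i(3,4) i(2)])
    have abs3: "\<bar>p + q + r\<bar> \<le> a + b + c" if "\<bar>p\<bar> \<le> a" "\<bar>q\<bar> \<le> b" "\<bar>r\<bar> \<le> c" for p q r a b c :: real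
      using that by linarith
    show ?thesis
      unfolding eq by (rule abs3[OF ip_Cauchy_Schwarz[OF d] ip_Cauchy_Schwarz[OF d(1) i(4)] ip_Cauchy_Schwarz[OF i(2) d(2)]])
  qed
  then have "\<forall>m. norm (ip (\<phi> m) (\<psi> m) - ip f g) \<le> ?a m * ?b m + ?a m * L2_norm g + L2_norm f * ?b m"
    unfolding real_norm_def ..
  note ev = always_eventually[OF this, of sequentially]
  have "(\<lambda>m. ?a m * ?b m + ?a m * L2_norm g + L2_norm f * ?b m) \<longlonglongrightarrow> 0 * 0 + 0 * L2_norm g + L2_norm f * 0"
    by (intro tendsto_intros assms)
  then have "(\<lambda>m. ?a m * ?b m + ?a m * L2_norm g + L2_norm f * ?b m) \<longlonglongrightarrow> 0"
    by (simp only: mult_zero_left mult_zero_right add_0_right)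
  from Lim_null_comparison[OF ev this] have "(\<lambda>m. ip (\<phi> m) (\<psi> m) - ip f g) \<longlonglongrightarrow> 0" .
  then show ?thesis by (simp add: LIM_zero_iff)
qed

text \<open>A one-step inequality with error \<open>o(h)\<close> replaces a differential inequality: the orbits are
  only classes of functions, differentiable in the norm of \<open>L\<^sup>2\<close>.\<close>

lemma discrete_gronwall:
  fixes F e :: "real \<Rightarrow> real"
  assumes step: "\<And>a h. a \<ge> 0 \<Longrightarrow> h > 0 \<Longrightarrow> F (a + h) \<le> (1 + C * h) * F a + h * e h"
    and e: "(e \<longlongrightarrow> 0) (at_right 0)" and C: "C \<ge> 0" and t: "t \<ge> 0"
  shows "F t \<le> exp (C * t) * F 0"
proof (cases "t = 0")
  case False
  with t have t: "t > 0" by simp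
  have iter: "F (real k * h) \<le> (1 + C * h) ^ k * (F 0 + real k * (h * \<bar>e h\<bar>))" if h: "h > 0" for h k
  proof (induction k)
    case (Suc k)
    have c: "1 + C * h \<ge> 1" using C h by simp
    have "F (real (Suc k) * h) = F (real k * h + h)" by (simp add: algebra_simps)
    also have "\<dots> \<le> (1 + C * h) * F (real k * h) + h * e h" using h by (intro step) auto
    also have "\<dots> \<le> (1 + C * h) * ((1 + C * h) ^ k * (F 0 + real k * (h * \<bar>e h\<bar>))) + (1 + C * h) ^ Suc k * (h * \<bar>e h\<bar>)"
    proof (rule add_mono)
      have "h * e h \<le> 1 * (h * \<bar>e h\<bar>)" using h by (simp add: mult_left_mono)
      also have "\<dots> \<le> (1 + C * h) ^ Suc k * (h * \<bar>e h\<bar>)"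
        using h c by (intro mult_right_mono one_le_power) auto
      finally show "h * e h \<le> (1 + C * h) ^ Suc k * (h * \<bar>e h\<bar>)" .
    qed (use Suc c in \<open>auto intro: mult_left_mono\<close>)
    also have "\<dots> = (1 + C * h) ^ Suc k * (F 0 + real (Suc k) * (h * \<bar>e h\<bar>))"
      by (simp add: algebra_simps)
    finally show ?case .
  qed simp
  \<comment> \<open>\<open>n\<close> steps of length t/n: the growth factors tend to the exponential
    and the accumulated error is t times e(t/n), which vanishes.\<close>
  have "\<forall>\<^sub>F n in sequentially. F t \<le> (1 + C * t / real n) ^ n * (F 0 + t * \<bar>e (t / real n)\<bar>)"
    using eventually_gt_at_top[of 0]
  proof eventually_elim
    case (elim n)
    then show ?case using iter[of "t / real n" n] t by simp
  qed
  moreover have "(\<lambda>n. (1 + C * t / real n) ^ n * (F 0 + t * \<bar>e (t / real n)\<bar>)) \<longlonglongrightarrow> exp (C * t) * (F 0 + t * \<bar>0\<bar>)"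
  proof (intro tendsto_intros tendsto_exp_limit_sequentially)
    have "filterlim (\<lambda>n. t / real n) (at_right 0) sequentially"
      unfolding filterlim_at
      using t by (auto intro!: tendsto_divide_0[OF tendsto_const] filterlim_at_top_imp_at_infinity filterlim_real_sequentially
          eventually_mono[OF eventually_gt_at_top[of 0]])
    then show "(\<lambda>n. e (t / real n)) \<longlonglongrightarrow> 0" by (rule filterlim_compose[OF e])
  qed
  ultimately show ?thesis
    using tendsto_lowerbound[of _ _ sequentially] by fastforce
qed simp

lemma tendsto_0_at_right_bound:
  fixes A B :: "real \<Rightarrow> real"
  assumes "(B \<longlongrightarrow> 0) (at_right 0)" "\<And>h. h > 0 \<Longrightarrow> 0 \<le> A h" "\<And>h. h > 0 \<Longrightarrow> A h \<le> B h"
  shows "(A \<longlongrightarrow> 0) (at_right 0)"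
proof (rule tendsto_sandwich[OF _ _ tendsto_const assms(1)])
  show "\<forall>\<^sub>F h in at_right 0. 0 \<le> A h" "\<forall>\<^sub>F h in at_right 0. A h \<le> B h"
    using assms(2,3) eventually_at_right_less[of "0 :: real"] by (auto elim: eventually_mono)
qed

locale csg =
  fixes T :: "real \<Rightarrow> ('a::euclidean_space \<Rightarrow> real) \<Rightarrow> ('a \<Rightarrow> real)"
  assumes cs: "contraction_semigroup T"
begin

lemma T_L2: "h \<ge> 0 \<Longrightarrow> f \<in> L2 \<Longrightarrow> T h f \<in> L2"
  and T_norm: "h \<ge> 0 \<Longrightarrow> f \<in> L2 \<Longrightarrow> L2_norm (T h f) \<le> L2_norm f"
  and T_lin: "h \<ge> 0 \<Longrightarrow> f \<in> L2 \<Longrightarrow> u \<in> L2 \<Longrightarrow> AE x in lborel. T h (\<lambda>y. a * f y + b * u y) x = a * T h f x + b * T h u x"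
  and T_0: "f \<in> L2 \<Longrightarrow> AE x in lborel. T 0 f x = f x"
  and T_add: "h \<ge> 0 \<Longrightarrow> k \<ge> 0 \<Longrightarrow> f \<in> L2 \<Longrightarrow> AE x in lborel. T (h + k) f x = T h (T k f) x"
  using cs unfolding contraction_semigroup_def by blast+

lemma gen_L2: "(f, u) \<in> generator_graph T \<Longrightarrow> f \<in> L2 \<and> u \<in> L2"
  by (simp add: generator_graph_def)

lemma T_diff:
  assumes "h \<ge> 0" "f \<in> L2" "u \<in> L2"
  shows "AE x in lborel. T h (\<lambda>y. f y - u y) x = T h f x - T h u x"
  using T_lin[OF assms, of 1 "-1"] by simp

definition rem where
  "rem f u h = L2_norm (\<lambda>x. (T h f x - f x) / h - u x)"

lemma rem_tendsto: "(f, u) \<in> generator_graph T \<Longrightarrow> (rem f u \<longlongrightarrow> 0) (at_right 0)"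
  by (simp add: generator_graph_def rem_def[abs_def])

lemma rem_nonneg: "rem f u h \<ge> 0"
  by (simp add: rem_def L2_norm_nonneg)

text \<open>The semigroup law writes the increment after time \<open>a\<close> as \<open>T a\<close>
  applied to the increment after time 0. By contractivity the error \<open>rem\<close> at time 0
  therefore controls all times uniformly.\<close>

lemma gen_increment:
  assumes g: "(f, u) \<in> generator_graph T" and a: "a \<ge> 0" and h: "h > 0"
  shows "L2_norm (\<lambda>x. T (a + h) f x - T a f x - h * T a u x) \<le> h * rem f u h"
proof -
  have fu: "f \<in> L2" "u \<in> L2" using gen_L2[OF g] by auto
  let ?v = "\<lambda>x. T h f x - f x"
  let ?w = "\<lambda>x. 1 * ?v x + (- h) * u x"
  have v: "?v \<in> L2" using h fu by (intro L2_diff T_L2) auto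
  have w: "?w \<in> L2" using v fu by (intro L2_lincomb)
  have "AE x in lborel. T (a + h) f x - T a f x - h * T a u x = T a ?w x"
    using T_add[OF a less_imp_le[OF h] fu(1)] T_lin[OF a v fu(2), of 1 "-h"]
      T_diff[OF a T_L2[OF less_imp_le[OF h] fu(1)] fu(1)]
    by eventually_elim simp
  then have "L2_norm (\<lambda>x. T (a + h) f x - T a f x - h * T a u x) = L2_norm (T a ?w)"
    using a h fu by (intro L2_norm_cong_AE L2_diff L2_cmult T_L2 w) auto
  also have "\<dots> \<le> L2_norm ?w" by (rule T_norm[OF a w])
  also have "?w = (\<lambda>x. h * ((T h f x - f x) / h - u x))"
  proof
    have "h * (y / h - z) = y - h * z" for y z using h by (simp add: right_diff_distrib)
    then show "?w x = h * ((T h f x - f x) / h - u x)" for x by simp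
  qed
  also have "L2_norm \<dots> = h * rem f u h"
    using h by (simp add: L2_norm_cmult rem_def)
  finally show ?thesis .
qed

lemma gen_T:
  assumes g: "(f, u) \<in> generator_graph T" and a: "a \<ge> 0"
  shows "(T a f, T a u) \<in> generator_graph T"
proof -
  have fu: "f \<in> L2" "u \<in> L2" using gen_L2[OF g] by auto
  have "L2_norm (\<lambda>x. (T h (T a f) x - T a f x) / h - T a u x) \<le> rem f u h" if h: "h > 0" for h
  proof -
    let ?d = "\<lambda>x. T (a + h) f x - T a f x - h * T a u x"
    have "AE x in lborel. (T h (T a f) x - T a f x) / h - T a u x = 1 / h * ?d x"
      using T_add[OF less_imp_le[OF h] a fu(1)]
      by eventually_elim (use h in \<open>simp add: add.commute field_simps\<close>)
    then have "L2_norm (\<lambda>x. (T h (T a f) x - T a f x) / h - T a u x) = L2_norm (\<lambda>x. 1 / h * ?d x)"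
      using a h fu by (intro L2_norm_cong_AE L2_diff L2_cmult L2_divide T_L2) auto
    also have "\<dots> = 1 / h * L2_norm ?d" unfolding L2_norm_cmult using h by simp
    also have "\<dots> \<le> 1 / h * (h * rem f u h)"
      using h by (intro mult_left_mono gen_increment[OF g a h]) auto
    finally show ?thesis using h by simp
  qed
  then have "((\<lambda>h. L2_norm (\<lambda>x. (T h (T a f) x - T a f x) / h - T a u x)) \<longlongrightarrow> 0) (at_right 0)"
    using L2_norm_nonneg by (intro tendsto_0_at_right_bound[OF rem_tendsto[OF g]]) simp_all
  then show ?thesis using a fu by (simp add: generator_graph_def T_L2)
qed

lemma gen_diff:
  assumes g: "(f, u) \<in> generator_graph T" "(f', u') \<in> generator_graph T"
  shows "((\<lambda>x. f x - f' x), (\<lambda>x. u x - u' x)) \<in> generator_graph T"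
proof -
  have fu: "f \<in> L2" "u \<in> L2" "f' \<in> L2" "u' \<in> L2" using gen_L2[OF g(1)] gen_L2[OF g(2)] by auto
  have "L2_norm (\<lambda>x. (T h (\<lambda>x. f x - f' x) x - (f x - f' x)) / h - (u x - u' x)) \<le> rem f u h + rem f' u' h"
    if h: "h > 0" for h
  proof -
    let ?d = "\<lambda>x. ((T h f x - f x) / h - u x) - ((T h f' x - f' x) / h - u' x)"
    have "AE x in lborel. (T h (\<lambda>x. f x - f' x) x - (f x - f' x)) / h - (u x - u' x) = ?d x"
      using T_diff[OF less_imp_le[OF h] fu(1,3)]
      by eventually_elim (simp add: diff_divide_distrib)
    then have "L2_norm (\<lambda>x. (T h (\<lambda>x. f x - f' x) x - (f x - f' x)) / h - (u x - u' x)) = L2_norm ?d"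
      using h fu by (intro L2_norm_cong_AE L2_diff L2_divide T_L2) auto
    also have "\<dots> \<le> rem f u h + rem f' u' h"
      unfolding rem_def using h fu by (intro L2_norm_triangle_diff L2_diff L2_divide T_L2) auto
    finally show ?thesis .
  qed
  moreover have "((\<lambda>h. rem f u h + rem f' u' h) \<longlongrightarrow> 0 + 0) (at_right 0)"
    by (intro tendsto_add rem_tendsto g)
  ultimately have "((\<lambda>h. L2_norm (\<lambda>x. (T h (\<lambda>x. f x - f' x) x - (f x - f' x)) / h - (u x - u' x))) \<longlongrightarrow> 0) (at_right 0)"
    by - (rule tendsto_0_at_right_bound[where B = "\<lambda>h. rem f u h + rem f' u' h"], simp_all add: L2_norm_nonneg)
  then show ?thesis using fu by (simp add: generator_graph_def L2_diff)
qed

lemma gen_zero: "((\<lambda>x. 0), (\<lambda>x. 0)) \<in> generator_graph T" if "(f, u) \<in> generator_graph T" for f u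
  using gen_diff[OF that that] by simp

lemma gen_minus:
  assumes g: "(f, u) \<in> generator_graph T"
  shows "((\<lambda>x. - f x), (\<lambda>x. - u x)) \<in> generator_graph T"
  using gen_diff[OF gen_zero[OF g] g] by simp

text \<open>Contractivity and the Cauchy-Schwarz inequality give <f, T_h f> <= <f, f>, so the
  difference quotients pair nonpositively with \<open>f\<close>.\<close>

lemma gen_dissipative:
  assumes g: "(f, u) \<in> generator_graph T"
  shows "ip f u \<le> 0"
proof -
  have fu: "f \<in> L2" "u \<in> L2" using gen_L2[OF g] by auto
  have "ip f u \<le> L2_norm f * rem f u h" if h: "h > 0" for h
  proof -
    let ?d = "\<lambda>x. (T h f x - f x) / h - u x"
    have T: "T h f \<in> L2" using h fu by (intro T_L2) auto
    have "ip f (T h f) \<le> L2_norm f * L2_norm f"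
      using ip_Cauchy_Schwarz[OF fu(1) T] mult_left_mono[OF T_norm[OF less_imp_le[OF h] fu(1)] L2_norm_nonneg[of f]] by simp
    then have "ip f (\<lambda>x. T h f x - f x) \<le> 0"
      using fu T L2_norm_sq[of f] by (simp add: ip_diff_right power2_eq_square)
    then have "ip f (\<lambda>x. (T h f x - f x) / h) \<le> 0"
      using h ip_cmult_right[of f "1/h" "\<lambda>x. T h f x - f x"] by (simp add: divide_le_0_iff)
    moreover have "ip f (\<lambda>x. (T h f x - f x) / h) = ip f ?d + ip f u"
      using fu T by (simp add: ip_diff_right L2_diff L2_divide)
    moreover have "\<bar>ip f ?d\<bar> \<le> L2_norm f * rem f u h"
      unfolding rem_def using fu T by (intro ip_Cauchy_Schwarz L2_diff L2_divide)
    ultimately show ?thesis by linarith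
  qed
  then have "\<forall>\<^sub>F h in at_right 0. ip f u \<le> L2_norm f * rem f u h"
    by (auto intro: eventually_mono[OF eventually_at_right_less])
  moreover have "((\<lambda>h. L2_norm f * rem f u h) \<longlongrightarrow> L2_norm f * 0) (at_right 0)"
    by (intro tendsto_intros rem_tendsto g)
  ultimately show ?thesis using tendsto_lowerbound[of "\<lambda>h. L2_norm f * rem f u h" _ "at_right 0"] by simp
qed

end

text \<open>Two orbits with the same initial value solve the same equation. Their difference stays
  in the domain of the common generator, so by dissipativity its squared norm grows by at most o(h)
  in each step, and \<open>discrete_gronwall\<close> with rate 0 shows that it vanishes.\<close>

lemma generator_determines_semigroup:
  fixes T S :: "real \<Rightarrow> ('a::euclidean_space \<Rightarrow> real) \<Rightarrow> 'a \<Rightarrow> real"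
  assumes "contraction_semigroup T" "contraction_semigroup S" "generator_graph T = generator_graph S"
    and g: "(f, u) \<in> generator_graph T" and t: "t \<ge> 0"
  shows "AE x in lborel. T t f x = S t f x"
proof -
  interpret T: csg T by unfold_locales fact
  interpret S: csg S by unfold_locales fact
  have fu: "f \<in> L2" "u \<in> L2" using T.gen_L2[OF g] by auto
  have g': "(f, u) \<in> generator_graph S" using g assms(3) by simp
  define F where "F = (\<lambda>a. (L2_norm (\<lambda>x. T a f x - S a f x))\<^sup>2)"
  define e where "e = (\<lambda>h. T.rem f u h + S.rem f u h)"
  have e0: "e h \<ge> 0" for h by (simp add: e_def T.rem_nonneg S.rem_nonneg)
  have "(e \<longlongrightarrow> 0 + 0) (at_right 0)"
    unfolding e_def by (intro tendsto_add T.rem_tendsto S.rem_tendsto g g')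
  then have e: "(e \<longlongrightarrow> 0) (at_right 0)" by simp
  let ?f = "2 * L2_norm f" and ?u = "2 * L2_norm u"
  have "F t \<le> exp (0 * t) * F 0"
  proof (rule discrete_gronwall[where e = "\<lambda>h. 2 * ?f * e h + h * (?u + e h)\<^sup>2"])
    have "((\<lambda>h. 2 * ?f * e h + h * (?u + e h)\<^sup>2) \<longlongrightarrow> 2 * ?f * 0 + 0 * (?u + 0)\<^sup>2) (at_right 0)"
      by (intro tendsto_intros e)
    then show "((\<lambda>h. 2 * ?f * e h + h * (?u + e h)\<^sup>2) \<longlongrightarrow> 0) (at_right 0)" by simp
    fix a h :: real assume a: "a \<ge> 0" and h: "h > 0"
    let ?v = "\<lambda>x. T a f x - S a f x" and ?z = "\<lambda>x. T a u x - S a u x"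
    let ?R = "\<lambda>x. (T (a + h) f x - T a f x - h * T a u x) - (S (a + h) f x - S a f x - h * S a u x)"
    let ?d = "\<lambda>x. h * ?z x + ?R x"
    have L: "T b f \<in> L2" "S b f \<in> L2" "T b u \<in> L2" "S b u \<in> L2" if "b \<ge> 0" for b
      using that fu by (auto intro: T.T_L2 S.T_L2)
    have ah: "a + h \<ge> 0" using a h by simp
    have L2: "?v \<in> L2" "?z \<in> L2" "?R \<in> L2" "?d \<in> L2"
      using L[OF a] L[OF ah] by (auto intro!: L2_diff L2_add L2_cmult)
    have vz: "ip ?v ?z \<le> 0"
      by (rule T.gen_dissipative, rule T.gen_diff) (use T.gen_T[OF g a] S.gen_T[OF g' a] assms(3) in auto)
    have nR: "L2_norm ?R \<le> h * e h"
    proof -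
      have "L2_norm ?R \<le> L2_norm (\<lambda>x. T (a + h) f x - T a f x - h * T a u x) + L2_norm (\<lambda>x. S (a + h) f x - S a f x - h * S a u x)"
        using L[OF a] L[OF ah] by (intro L2_norm_triangle_diff L2_diff L2_cmult)
      also have "\<dots> \<le> h * T.rem f u h + h * S.rem f u h"
        by (intro add_mono T.gen_increment S.gen_increment g g' a h)
      finally show ?thesis by (simp add: e_def algebra_simps)
    qed
    have nv: "L2_norm ?v \<le> ?f"
      using L2_norm_triangle_diff[OF L(1,2)[OF a]] T.T_norm[OF a fu(1)] S.T_norm[OF a fu(1)] by linarith
    have nz: "L2_norm ?z \<le> ?u"
      using L2_norm_triangle_diff[OF L(3,4)[OF a]] T.T_norm[OF a fu(2)] S.T_norm[OF a fu(2)] by linarith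
    have nd: "L2_norm ?d \<le> h * (?u + e h)"
    proof -
      have "L2_norm ?d \<le> L2_norm (\<lambda>x. h * ?z x) + L2_norm ?R"
        by (intro L2_norm_triangle L2_cmult L2)
      also have "\<dots> \<le> h * ?u + h * e h"
        using add_mono[OF mult_left_mono[OF nz less_imp_le[OF h]] nR] h by (simp add: L2_norm_cmult)
      finally show ?thesis by (simp add: algebra_simps)
    qed
    have "F (a + h) = (L2_norm (\<lambda>x. ?v x + ?d x))\<^sup>2"
      unfolding F_def by (rule arg_cong[of _ _ "\<lambda>q. (L2_norm q)\<^sup>2"]) (auto simp: algebra_simps)
    then have E1: "F (a + h) = F a + 2 * ip ?v ?d + (L2_norm ?d)\<^sup>2"
      by (simp only: L2_norm_add_sq[OF L2(1,4)] F_def L2_norm_sq)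
    have "ip ?v ?R \<le> ?f * (h * e h)"
      by (rule order_trans[OF order_trans[OF abs_ge_self ip_Cauchy_Schwarz[OF L2(1,3)]] mult_mono[OF nv nR]])
        (simp_all add: L2_norm_nonneg)
    then have E2: "ip ?v ?d \<le> ?f * (h * e h)"
      using mult_nonneg_nonpos[OF less_imp_le[OF h] vz]
      by (simp only: ip_add_right[OF L2_cmult[OF L2(2)] L2(3) L2(1)] ip_cmult_right)
    have E3: "(L2_norm ?d)\<^sup>2 \<le> (h * (?u + e h))\<^sup>2" by (rule power_mono[OF nd L2_norm_nonneg])
    show "F (a + h) \<le> (1 + 0 * h) * F a + h * (2 * ?f * e h + h * (?u + e h)\<^sup>2)"
    proof -
      have "Fn \<le> (1 + 0 * h) * F0 + h * (2 * f * r + h * s\<^sup>2)"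
        if "Fn = F0 + 2 * p + q" "p \<le> f * (h * r)" "q \<le> (h * s)\<^sup>2" for Fn F0 p q f r s :: real
        using that by (simp add: power2_eq_square algebra_simps)
      from this[OF E1 E2 E3] show ?thesis .
    qed
  qed (use t in auto)
  also have "F 0 = 0"
  proof -
    have "AE x in lborel. T 0 f x - S 0 f x = 0"
      using T.T_0[OF fu(1)] S.T_0[OF fu(1)] by eventually_elim simp
    then have "L2_norm (\<lambda>x. T 0 f x - S 0 f x) = L2_norm (\<lambda>x::'a. 0)"
      by - (rule L2_norm_cong_AE[OF L2_diff[OF T.T_L2[OF order_refl fu(1)] S.T_L2[OF order_refl fu(1)]] L2_zero])
    then show ?thesis by (simp add: F_def L2_norm_def)
  qed
  finally have "L2_norm (\<lambda>x. T t f x - S t f x) = 0" by (simp add: F_def)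
  then have "AE x in lborel. T t f x - S t f x = 0"
    using t fu by (intro L2_norm_0_AE L2_diff T.T_L2 S.T_L2)
  then show ?thesis by eventually_elim simp
qed

section \<open>Positivity, symmetry and weighted growth along the orbits of a contraction
  semigroup\<close>

context csg
begin

text \<open>The squared norm of the negative part of the orbit does not increase: hypothesis
  \<open>pd\<close>, applied to minus the orbit, says that its formal derivative is
  nonpositive.\<close>

lemma T_positive:
  assumes pd: "\<And>f u. (f, u) \<in> generator_graph T \<Longrightarrow> ip u (\<lambda>x. max 0 (f x)) \<le> 0"
    and g: "(f, u) \<in> generator_graph T" and t: "t \<ge> 0" and f: "\<And>x. f x \<ge> 0"
  shows "AE x in lborel. T t f x \<ge> 0"
proof -
  have fu: "f \<in> L2" "u \<in> L2" using gen_L2[OF g] by auto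
  define n where "n = (\<lambda>(v :: 'a \<Rightarrow> real) x. max 0 (- v x))"
  have nL2: "n v \<in> L2" if "v \<in> L2" for v unfolding n_def using that by (intro L2_max_0 L2_minus)
  define F where "F = (\<lambda>a. ip (n (T a f)) (n (T a f)))"
  let ?e = "rem f u"
  have "F t \<le> exp (0 * t) * F 0"
  proof (rule discrete_gronwall[where e = "\<lambda>h. 2 * L2_norm f * ?e h + h * (L2_norm u + ?e h)\<^sup>2"])
    have "((\<lambda>h. 2 * L2_norm f * ?e h + h * (L2_norm u + ?e h)\<^sup>2) \<longlongrightarrow> 2 * L2_norm f * 0 + 0 * (L2_norm u + 0)\<^sup>2) (at_right 0)"
      by (intro tendsto_intros rem_tendsto[OF g])
    then show "((\<lambda>h. 2 * L2_norm f * ?e h + h * (L2_norm u + ?e h)\<^sup>2) \<longlongrightarrow> 0) (at_right 0)" by simp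
    fix a h :: real assume a: "a \<ge> 0" and h: "h > 0"
    let ?v = "T a f" and ?z = "T a u"
    let ?R = "\<lambda>x. T (a + h) f x - T a f x - h * T a u x"
    let ?d = "\<lambda>x. h * ?z x + ?R x"
    have L: "T b f \<in> L2" "T b u \<in> L2" if "b \<ge> 0" for b
      using that fu by (auto intro: T_L2)
    have ah: "a + h \<ge> 0" using a h by simp
    have L2: "?v \<in> L2" "?z \<in> L2" "?R \<in> L2" "?d \<in> L2" "n ?v \<in> L2"
      using L[OF a] L[OF ah] by (auto intro!: L2_diff L2_add L2_cmult nL2)
    have vz: "ip (n ?v) ?z \<ge> 0"
      using pd[OF gen_minus[OF gen_T[OF g a]]] by (simp add: ip_minus_left n_def ip_commute)
    have nR: "L2_norm ?R \<le> h * ?e h" by (rule gen_increment[OF g a h])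
    have nv: "L2_norm (n ?v) \<le> L2_norm f"
      using L2_norm_max_0[OF L2_minus[OF L2(1)]] T_norm[OF a fu(1)] by (simp add: n_def L2_norm_minus)
    have nd: "L2_norm ?d \<le> h * (L2_norm u + ?e h)"
    proof -
      have "L2_norm ?d \<le> L2_norm (\<lambda>x. h * ?z x) + L2_norm ?R"
        by (intro L2_norm_triangle L2_cmult L2)
      also have "\<dots> \<le> h * L2_norm u + h * ?e h"
        using add_mono[OF mult_left_mono[OF T_norm[OF a fu(2)] less_imp_le[OF h]] nR] h by (simp add: L2_norm_cmult)
      finally show ?thesis by (simp add: algebra_simps)
    qed
    have Tah: "T (a + h) f = (\<lambda>x. ?v x + ?d x)" by (auto simp: algebra_simps)
    have "F (a + h) \<le> (LINT x|lborel. n ?v x * n ?v x - 2 * (n ?v x * ?d x) + ?d x * ?d x)"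
      unfolding F_def ip_def
    proof (rule integral_mono)
      show "integrable lborel (\<lambda>x. n (T (a + h) f) x * n (T (a + h) f) x)"
        using L[OF ah] by (intro L2_prod_integrable nL2)
      show "integrable lborel (\<lambda>x. n ?v x * n ?v x - 2 * (n ?v x * ?d x) + ?d x * ?d x)"
        by (intro Bochner_Integration.integrable_add Bochner_Integration.integrable_diff integrable_mult_right L2_prod_integrable L2)
      \<comment> \<open>The square of the negative part is differentiable with Lipschitz derivative;
        this is its first order expansion with a quadratic remainder, which replaces the
        derivative.\<close>
      have q: "max 0 (- (v + d)) * max 0 (- (v + d)) \<le> max 0 (- v) * max 0 (- v) - 2 * (max 0 (- v) * d) + d * d" for v d :: real
      proof (cases "v + d \<ge> 0")
        case True
        have "0 \<le> (max 0 (- v) - d)\<^sup>2" by simp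
        then show ?thesis using True by (simp add: power2_eq_square algebra_simps)
      next
        case False
        show ?thesis
        proof (cases "v \<ge> 0")
          case True
          then have "(v + d) * (v + d) \<le> d * d"
            using False mult_mono[of "- (v + d)" "- d" "- (v + d)" "- d"] by (simp add: algebra_simps)
          then show ?thesis using True False by (simp add: algebra_simps)
        qed (use False in \<open>simp add: algebra_simps\<close>)
      qed
      show "n (T (a + h) f) x * n (T (a + h) f) x \<le> n ?v x * n ?v x - 2 * (n ?v x * ?d x) + ?d x * ?d x" for x
        using q[of "?v x" "?d x"] by (subst (1 2) Tah) (simp only: n_def)
    qed
    also have "\<dots> = F a - 2 * ip (n ?v) ?d + ip ?d ?d"
    proof -
      have "integrable lborel (\<lambda>x. n ?v x * n ?v x)" "integrable lborel (\<lambda>x. 2 * (n ?v x * ?d x))"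
        "integrable lborel (\<lambda>x. ?d x * ?d x)"
        by (intro integrable_mult_right L2_prod_integrable L2)+
      then show ?thesis
        unfolding F_def ip_def
        by (simp only: Bochner_Integration.integral_add Bochner_Integration.integral_diff
            Bochner_Integration.integrable_diff integral_mult_right_zero)
    qed
    finally have E1: "F (a + h) \<le> F a - 2 * ip (n ?v) ?d + ip ?d ?d" .
    have "- ip (n ?v) ?R \<le> L2_norm f * (h * ?e h)"
      by (rule order_trans[OF order_trans[OF abs_ge_minus_self ip_Cauchy_Schwarz[OF L2(5,3)]] mult_mono[OF nv nR]])
        (simp_all add: L2_norm_nonneg)
    moreover have "h * ip (n ?v) ?z \<ge> 0" using vz h by simp
    moreover have "ip (n ?v) ?d = h * ip (n ?v) ?z + ip (n ?v) ?R"
      by (simp only: ip_add_right[OF L2_cmult[OF L2(2)] L2(3) L2(5)] ip_cmult_right)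
    ultimately have E2: "- ip (n ?v) ?d \<le> L2_norm f * (h * ?e h)" by (simp only:)
    have E3: "ip ?d ?d \<le> (h * (L2_norm u + ?e h))\<^sup>2"
      using power_mono[OF nd L2_norm_nonneg, of 2] by (simp only: L2_norm_sq)
    show "F (a + h) \<le> (1 + 0 * h) * F a + h * (2 * L2_norm f * ?e h + h * (L2_norm u + ?e h)\<^sup>2)"
    proof -
      have "Fn \<le> (1 + 0 * h) * F0 + h * (2 * f * r + h * s\<^sup>2)"
        if "Fn \<le> F0 - 2 * p + q" "- p \<le> f * (h * r)" "q \<le> (h * s)\<^sup>2" for Fn F0 p q f r s :: real
        using that by (simp add: power2_eq_square algebra_simps)
      from this[OF E1 E2 E3] show ?thesis .
    qed
  qed (use t in auto)
  also have "F 0 = 0"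
  proof -
    have "AE x in lborel. n (T 0 f) x = 0" using T_0[OF fu(1)] by eventually_elim (use f in \<open>simp add: n_def\<close>)
    then have "ip (n (T 0 f)) (n (T 0 f)) = ip (\<lambda>x::'a. 0) (\<lambda>x. 0)"
      using nL2[OF T_L2[OF order_refl fu(1)]] L2_zero by - (rule ip_cong_AE)
    then show ?thesis by (simp add: F_def ip_def)
  qed
  finally have "L2_norm (n (T t f)) = 0" using ip_self_nonneg[of "n (T t f)"] by (simp add: F_def L2_norm_eq)
  then have "AE x in lborel. n (T t f) x = 0"
    using t fu by (intro L2_norm_0_AE nL2 T_L2)
  then show ?thesis by eventually_elim (simp add: n_def max_def split: if_splits)
qed

text \<open>The time \<open>t\<close> is shifted from one factor of the inner product to the other
  in small steps. By symmetry of the generator the first order terms of a shift by h cancel, and the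
  errors o(h) add up to something that vanishes with the step.\<close>

lemma T_symmetric:
  assumes sym: "\<And>f u g w. (f, u) \<in> generator_graph T \<Longrightarrow> (g, w) \<in> generator_graph T \<Longrightarrow> ip u g = ip f w"
    and f: "(f, u) \<in> generator_graph T" and g: "(g, w) \<in> generator_graph T" and t: "t \<ge> 0"
  shows "ip (T t f) g = ip f (T t g)"
proof (cases "t = 0")
  case True
  have L: "f \<in> L2" "g \<in> L2" using gen_L2[OF f] gen_L2[OF g] by blast+
  have "ip (T 0 f) g = ip f g"
    by (rule ip_cong_AE[OF T_L2[OF order_refl L(1)] L(1) L(2) L(2) T_0[OF L(1)]]) simp
  moreover have "ip f (T 0 g) = ip f g"
    by (rule ip_cong_AE[OF L(1) L(1) T_L2[OF order_refl L(2)] L(2) _ T_0[OF L(2)]]) simp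
  ultimately have "ip (T 0 f) g = ip f g" "ip f (T 0 g) = ip f g" .
  then show ?thesis using True by simp
next
  case False
  then have t: "t > 0" using t by simp
  have L: "f \<in> L2" "u \<in> L2" "g \<in> L2" "w \<in> L2" using gen_L2[OF f] gen_L2[OF g] by blast+
  define E where "E = (\<lambda>h. rem f u h * L2_norm g + L2_norm f * rem g w h)"
  have step: "\<bar>ip (T (a + h) f) (T b g) - ip (T a f) (T (b + h) g)\<bar> \<le> h * E h"
    if a: "a \<ge> 0" and b: "b \<ge> 0" and h: "h > 0" for a b h
  proof -
    let ?R = "\<lambda>x. T (a + h) f x - T a f x - h * T a u x"
    let ?S = "\<lambda>x. T (b + h) g x - T b g x - h * T b w x"
    have M: "T (a + h) f \<in> L2" "T a f \<in> L2" "T a u \<in> L2" "T (b + h) g \<in> L2" "T b g \<in> L2" "T b w \<in> L2"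
      using L a b h by (auto intro: T_L2)
    have N: "?R \<in> L2" "?S \<in> L2" using M by (auto intro!: L2_diff L2_cmult)
    have "ip ?R (T b g) = ip (T (a + h) f) (T b g) - ip (T a f) (T b g) - h * ip (T a u) (T b g)"
      using M by (simp add: ip_diff_left ip_cmult_left L2_diff L2_cmult)
    moreover have "ip (T a f) ?S = ip (T a f) (T (b + h) g) - ip (T a f) (T b g) - h * ip (T a f) (T b w)"
      using M by (simp add: ip_diff_right ip_cmult_right L2_diff L2_cmult)
    moreover have "ip (T a u) (T b g) = ip (T a f) (T b w)"
      by (rule sym[OF gen_T[OF f a] gen_T[OF g b]])
    ultimately have "ip (T (a + h) f) (T b g) - ip (T a f) (T (b + h) g) = ip ?R (T b g) - ip (T a f) ?S"
      by simp
    moreover have "\<bar>ip ?R (T b g)\<bar> \<le> (h * rem f u h) * L2_norm g"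
      by (rule order_trans[OF ip_Cauchy_Schwarz[OF N(1) M(5)] mult_mono[OF gen_increment[OF f a h] T_norm[OF b L(3)]]])
        (use h in \<open>simp_all add: L2_norm_nonneg rem_nonneg\<close>)
    moreover have "\<bar>ip (T a f) ?S\<bar> \<le> L2_norm f * (h * rem g w h)"
      by (rule order_trans[OF ip_Cauchy_Schwarz[OF M(2) N(2)] mult_mono[OF T_norm[OF a L(1)] gen_increment[OF g b h]]])
        (use h in \<open>simp_all add: L2_norm_nonneg rem_nonneg\<close>)
    ultimately show ?thesis by (simp add: E_def algebra_simps)
  qed
  have bound: "\<bar>ip (T t f) (T 0 g) - ip (T 0 f) (T t g)\<bar> \<le> t * E (t / real n)" if n: "n > 0" for n
  proof -
    define h where "h = t / real n"
    have h: "h > 0" "real n * h = t" using t n by (auto simp: h_def)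
    \<comment> \<open>Interpolates between the whole time on \<open>g\<close> (k = 0) and the whole
      time on \<open>f\<close> (k = n).\<close>
    define H where "H = (\<lambda>k. ip (T (real k * h) f) (T (real (n - k) * h) g))"
    have "\<bar>H k - H 0\<bar> \<le> real k * (h * E h)" if "k \<le> n" for k
      using that
    proof (induction k)
      case (Suc k)
      have st: "\<bar>ip (T (real k * h + h) f) (T (real (n - Suc k) * h) g) -
          ip (T (real k * h) f) (T (real (n - Suc k) * h + h) g)\<bar> \<le> h * E h"
        by (rule step) (use h in auto)
      have "n - k = Suc (n - Suc k)" using Suc.prems by simp
      then have "real (n - k) * h = real (n - Suc k) * h + h" by (simp add: algebra_simps)
      moreover have "real (Suc k) * h = real k * h + h" by (simp add: algebra_simps)
      ultimately have "\<bar>H (Suc k) - H k\<bar> \<le> h * E h" using st by (simp only: H_def)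
      moreover have "\<bar>H k - H 0\<bar> \<le> real k * (h * E h)" using Suc by simp
      ultimately show ?case by (simp add: algebra_simps)
    qed simp
    from this[of n] have "\<bar>H n - H 0\<bar> \<le> (real n * h) * E h" by simp
    then show ?thesis using h(2) by (simp add: H_def h_def)
  qed
  have "(\<lambda>n. t * E (t / real n)) \<longlonglongrightarrow> t * 0"
  proof (intro tendsto_intros)
    have "(E \<longlongrightarrow> 0 * L2_norm g + L2_norm f * 0) (at_right 0)"
      unfolding E_def by (intro tendsto_intros rem_tendsto f g)
    then have E: "(E \<longlongrightarrow> 0) (at_right 0)" by simp
    have "filterlim (\<lambda>n. t / real n) (at_right 0) sequentially"
      unfolding filterlim_at
      using t by (auto intro!: tendsto_divide_0[OF tendsto_const] filterlim_at_top_imp_at_infinity filterlim_real_sequentially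
          eventually_mono[OF eventually_gt_at_top[of 0]])
    then show "(\<lambda>n. E (t / real n)) \<longlonglongrightarrow> 0" by (rule filterlim_compose[OF E])
  qed
  moreover have "\<forall>\<^sub>F n in sequentially. \<bar>ip (T t f) (T 0 g) - ip (T 0 f) (T t g)\<bar> \<le> t * E (t / real n)"
    using bound by (auto intro: eventually_mono[OF eventually_gt_at_top[of 0]])
  ultimately have "\<bar>ip (T t f) (T 0 g) - ip (T 0 f) (T t g)\<bar> \<le> t * 0"
    by (rule tendsto_lowerbound) simp
  then have "ip (T t f) (T 0 g) = ip (T 0 f) (T t g)" by simp
  moreover have "ip (T t f) (T 0 g) = ip (T t f) g"
    using t by (intro ip_cong_AE[OF _ _ T_L2[OF order_refl L(3)] L(3) _ T_0[OF L(3)]] T_L2 L) simp_all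
  moreover have "ip (T 0 f) (T t g) = ip f (T t g)"
    using t by (intro ip_cong_AE[OF T_L2[OF order_refl L(1)] L(1) _ _ T_0[OF L(1)]] T_L2 L) simp_all
  ultimately show ?thesis by simp
qed

text \<open>Here \<open>v\<close> is the adjoint of the generator applied to the weight
  \<open>w\<close>. Since the orbit is nonnegative, v <= C w bounds the derivative of its weighted
  integral by C times the integral itself.\<close>

lemma T_weight_bound:
  assumes adj: "\<And>f u. (f, u) \<in> generator_graph T \<Longrightarrow> ip w u = ip v f"
    and w: "w \<in> L2" and v: "v \<in> L2" "\<And>x. v x \<le> C * w x" and C: "C \<ge> 0"
    and g: "(f, u) \<in> generator_graph T" and pos: "\<And>a. a \<ge> 0 \<Longrightarrow> AE x in lborel. T a f x \<ge> 0" and t: "t \<ge> 0"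
  shows "ip w (T t f) \<le> exp (C * t) * ip w f"
proof -
  have fu: "f \<in> L2" "u \<in> L2" using gen_L2[OF g] by auto
  have "ip w (T t f) \<le> exp (C * t) * ip w (T 0 f)"
  proof (rule discrete_gronwall[where e = "\<lambda>h. L2_norm w * rem f u h" and F = "\<lambda>a. ip w (T a f)"])
    have "((\<lambda>h. L2_norm w * rem f u h) \<longlongrightarrow> L2_norm w * 0) (at_right 0)"
      by (intro tendsto_intros rem_tendsto g)
    then show "((\<lambda>h. L2_norm w * rem f u h) \<longlongrightarrow> 0) (at_right 0)" by simp
    fix a h :: real assume a: "a \<ge> 0" and h: "h > 0"
    let ?R = "\<lambda>x. T (a + h) f x - T a f x - h * T a u x"
    have L: "T a f \<in> L2" "T a u \<in> L2" "T (a + h) f \<in> L2" using a h fu by (auto intro: T_L2)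
    have R: "?R \<in> L2" using L by (intro L2_diff L2_cmult)
    have "ip w ?R = ip w (T (a + h) f) - ip w (T a f) - h * ip w (T a u)"
      using w L by (simp add: ip_diff_right ip_cmult_right L2_diff L2_cmult)
    moreover have "ip w ?R \<le> L2_norm w * (h * rem f u h)"
      by (rule order_trans[OF order_trans[OF abs_ge_self ip_Cauchy_Schwarz[OF w R]]
          mult_left_mono[OF gen_increment[OF g a h] L2_norm_nonneg]])
    moreover have "ip w (T a u) \<le> C * ip w (T a f)"
    proof -
      have "ip w (T a u) = ip v (T a f)" by (rule adj[OF gen_T[OF g a]])
      also have "\<dots> \<le> ip (\<lambda>x. C * w x) (T a f)"
        unfolding ip_def
      proof (rule integral_mono_AE)
        show "integrable lborel (\<lambda>x. v x * T a f x)" by (rule L2_prod_integrable[OF v(1) L(1)])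
        show "integrable lborel (\<lambda>x. C * w x * T a f x)" by (rule L2_prod_integrable[OF L2_cmult[OF w] L(1)])
        show "AE x in lborel. v x * T a f x \<le> C * w x * T a f x"
          using pos[OF a] by eventually_elim (rule mult_right_mono[OF v(2)])
      qed
      finally show ?thesis by (simp add: ip_cmult_left)
    qed
    moreover have "Fn \<le> (1 + C * h) * F0 + h * (W * r)"
      if "R = Fn - F0 - h * z" "R \<le> W * (h * r)" "z \<le> C * F0" for Fn F0 W r R z :: real
      using that mult_left_mono[OF that(3) less_imp_le[OF h]] by (simp add: algebra_simps)
    ultimately show "ip w (T (a + h) f) \<le> (1 + C * h) * ip w (T a f) + h * (L2_norm w * rem f u h)"
      by blast
  qed (use C t in auto)
  also have "ip w (T 0 f) = ip w f"
    by (rule ip_cong_AE[OF w w T_L2[OF order_refl fu(1)] fu(1) _ T_0[OF fu(1)]]) simp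
  finally show ?thesis .
qed

end

section \<open>Test functions\<close>

text \<open>The family is closed under differentiation (\<open>flat_derivative\<close>), so
  smoothness of all members follows by one induction on the order. \<open>flat 0\<close> is the
  usual function exp(-1/x), continued by 0.\<close>

definition flat :: "nat \<Rightarrow> real \<Rightarrow> real" where
  "flat k x = (if x > 0 then (1 / x) ^ k * exp (- (1 / x)) else 0)"

lemma flat_tendsto: "(flat k \<longlongrightarrow> 0) (at 0)"
proof -
  have "((\<lambda>y. y ^ k / exp y) \<longlongrightarrow> (0::real)) at_top" by (rule tendsto_power_div_exp_0)
  from filterlim_compose[OF this filterlim_inverse_at_top_right]
  have "((\<lambda>x. inverse x ^ k / exp (inverse x)) \<longlongrightarrow> (0::real)) (at_right 0)" .
  then have "(flat k \<longlongrightarrow> 0) (at_right 0)"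
    by (rule Lim_transform_eventually)
      (auto simp: flat_def exp_minus inverse_eq_divide intro: eventually_mono[OF eventually_at_right_less])
  moreover have "(flat k \<longlongrightarrow> 0) (at_left 0)"
    by (rule Lim_transform_eventually[OF tendsto_const])
      (auto simp: flat_def eventually_at_left_field intro: exI[of _ "- 1"])
  ultimately show ?thesis by (simp add: filterlim_split_at)
qed

lemma flat_derivative: "(flat k has_real_derivative flat (k + 2) x - real k * flat (k + 1) x) (at x)"
proof -
  consider "x > 0" | "x < 0" | "x = 0" by linarith
  then show ?thesis
  proof cases
    case 1
    have d: "((\<lambda>x. (1 / x) ^ k * exp (- (1 / x))) has_real_derivative flat (k + 2) x - real k * flat (k + 1) x) (at x)"
    proof -
      define y where "y = 1 / x"
      have D1: "((\<lambda>x. 1 / x) has_real_derivative - y\<^sup>2) (at x)"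
        using 1 by (auto intro!: derivative_eq_intros simp: y_def power2_eq_square)
      have D2: "((\<lambda>x. exp (- (1 / x))) has_real_derivative exp (- y) * y\<^sup>2) (at x)"
        using DERIV_chain2[OF DERIV_exp DERIV_minus[OF D1]] by (simp add: y_def)
      have fl: "flat k x = y ^ k * exp (- y)" for k using 1 by (simp add: flat_def y_def)
      have D3: "((\<lambda>x. (1 / x) ^ k * exp (- (1 / x))) has_real_derivative
          real k * (y ^ (k - Suc 0) * - y\<^sup>2) * exp (- y) + exp (- y) * y\<^sup>2 * y ^ k) (at x)"
        using DERIV_mult[OF DERIV_power[OF D1, of k] D2] by (simp add: y_def mult.commute)
      show ?thesis
        by (rule DERIV_cong[OF D3]) (cases k; simp add: fl power2_eq_square algebra_simps)
    qed
    show ?thesis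
      by (rule has_field_derivative_transform_within_open[OF d, of "{0<..}"]) (use 1 in \<open>auto simp: flat_def\<close>)
  next
    case 2
    have d: "((\<lambda>x. 0) has_real_derivative flat (k + 2) x - real k * flat (k + 1) x) (at x)"
      using 2 by (simp add: flat_def)
    show ?thesis
      by (rule has_field_derivative_transform_within_open[OF d, of "{..<0}"]) (use 2 in \<open>auto simp: flat_def\<close>)
  next
    case 3
    have "((\<lambda>h. (flat k (0 + h) - flat k 0) / h) \<longlongrightarrow> 0) (at 0)"
      by (rule Lim_transform_eventually[OF flat_tendsto[of "k + 1"]])
        (auto simp: flat_def eventually_at_filter)
    then show ?thesis using 3 by (simp add: DERIV_def flat_def)
  qed
qed

lemma smooth_flat: "smooth (flat k)"
proof -
  have "\<forall>k. Ck m (flat k)" for m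
  proof (induction m)
    case 0
    then show ?case
      using flat_derivative DERIV_isCont continuous_at_imp_continuous_on by (metis Ck.simps(1))
  next
    case (Suc m)
    show ?case
    proof
      fix k
      show "Ck (Suc m) (flat k)"
      proof (rule Ck_SucI)
        show "(flat k has_derivative (\<lambda>v. v * (flat (k + 2) x + (- real k) * flat (k + 1) x))) (at x)" for x
          using flat_derivative[of k x] by (simp add: has_field_derivative_def mult_commute_abs)
        show "Ck m (\<lambda>x. v * (flat (k + 2) x + (- real k) * flat (k + 1) x))" for v
          using Suc by (intro Ck_bilinear[OF bounded_bilinear_mult] Ck_add Ck_const) auto
      qed
    qed
  qed
  then show ?thesis by (simp add: smooth_def)
qed

lemma flat_0_eq: "flat 0 x = (if x > 0 then exp (- (1 / x)) else 0)"
  by (simp add: flat_def)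

definition bump :: "'a::euclidean_space \<Rightarrow> real \<Rightarrow> 'a \<Rightarrow> real" where
  "bump a e x = flat 0 (e\<^sup>2 - (x - a) \<bullet> (x - a))"

lemma bump_nonneg: "bump a e x \<ge> 0"
  by (simp add: bump_def flat_0_eq)

lemma bump_pos_iff: "e > 0 \<Longrightarrow> bump a e x > 0 \<longleftrightarrow> dist x a < e"
proof -
  assume "e > 0"
  then have "(x - a) \<bullet> (x - a) < e\<^sup>2 \<longleftrightarrow> dist x a < e"
    using power2_less_imp_less[of "dist x a" e] power_strict_mono[of "dist x a" e 2]
    by (auto simp: dot_square_norm dist_norm)
  then show ?thesis by (simp add: bump_def flat_0_eq)
qed

lemma smooth_bump: "smooth (bump a e)"
  unfolding bump_def
  by (intro smooth_compose[OF smooth_flat] smooth_diff smooth_const smooth_bilinear[OF bounded_bilinear_inner] smooth_id)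

lemma test_funI:
  assumes "smooth f" "compact K" "\<And>x. x \<notin> K \<Longrightarrow> f x = 0"
  shows "test_fun f"
proof -
  have "closure {x. f x \<noteq> 0} \<subseteq> K"
    using assms(2,3) by (intro closure_minimal compact_imp_closed) auto
  then show ?thesis
    using assms(1,2) by (metis compact_Int_closed closed_closure inf.absorb_iff2 test_fun_def)
qed

lemma test_funE:
  assumes "test_fun f"
  obtains K where "compact K" "\<And>x. x \<notin> K \<Longrightarrow> f x = 0" "smooth f"
proof (rule that)
  show "compact (closure {x. f x \<noteq> 0})" "smooth f" using assms by (simp_all add: test_fun_def)
  show "\<And>x. x \<notin> closure {x. f x \<noteq> 0} \<Longrightarrow> f x = 0" using closure_subset[of "{x. f x \<noteq> 0}"] by auto
qed

lemma test_fun_smooth: "test_fun f \<Longrightarrow> smooth f"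
  by (simp add: test_fun_def)

lemma test_fun_bump: "e > 0 \<Longrightarrow> test_fun (bump a e)"
proof (rule test_funI[OF smooth_bump compact_cball[of a e]])
  fix x assume "e > 0" "x \<notin> cball a e"
  then show "bump a e x = 0"
    using bump_pos_iff[of e a x] bump_nonneg[of a e x] by (auto simp: dist_commute)
qed

lemma compact_support_integrable:
  fixes f :: "'a::euclidean_space \<Rightarrow> real"
  assumes "continuous_on UNIV f" "compact K" "\<And>x. x \<notin> K \<Longrightarrow> f x = 0"
  shows "integrable lborel f"
proof -
  have "integrable lborel (\<lambda>x. indicator K x *\<^sub>R f x)"
    by (rule borel_integrable_compact[OF assms(2) continuous_on_subset[OF assms(1)]]) simp
  moreover have "(\<lambda>x. indicator K x *\<^sub>R f x) = f"
  proof
    show "indicator K x *\<^sub>R f x = f x" for x using assms(3)[of x] by (cases "x \<in> K") auto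
  qed
  ultimately show ?thesis by simp
qed

lemma compact_support_bounded:
  fixes f :: "'a::euclidean_space \<Rightarrow> real"
  assumes "continuous_on UNIV f" "compact K" "\<And>x. x \<notin> K \<Longrightarrow> f x = 0"
  shows "\<exists>B\<ge>0. \<forall>x. \<bar>f x\<bar> \<le> B"
proof -
  have "bounded (f ` K)"
    by (intro compact_imp_bounded compact_continuous_image continuous_on_subset[OF assms(1)] assms(2)) simp
  then obtain B where "\<forall>y\<in>f ` K. norm y \<le> B" using bounded_iff by blast
  then have "\<bar>f x\<bar> \<le> max B 0" for x using assms(3)[of x] by (cases "x \<in> K") (auto simp: le_max_iff_disj)
  then show ?thesis by (intro exI[of _ "max B 0"]) auto
qed

lemma compact_support_L2:
  fixes f :: "'a::euclidean_space \<Rightarrow> real"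
  assumes "continuous_on UNIV f" "compact K" "\<And>x. x \<notin> K \<Longrightarrow> f x = 0"
  shows "f \<in> L2"
proof -
  have "integrable lborel (\<lambda>x. (f x)\<^sup>2)"
    by (rule compact_support_integrable[OF _ assms(2)]) (auto intro!: continuous_intros assms)
  then show ?thesis using assms(1) by (simp add: L2_def borel_measurable_continuous_onI)
qed

lemma test_fun_L2: "test_fun f \<Longrightarrow> f \<in> L2"
  by (erule test_funE) (rule compact_support_L2[OF smooth_continuous_on])

lemma test_fun_mult:
  assumes "test_fun f" "smooth g"
  shows "test_fun (\<lambda>x. f x * g x)" "test_fun (\<lambda>x. g x * f x)"
proof -
  obtain K where K: "compact K" "\<And>x. x \<notin> K \<Longrightarrow> f x = 0" "smooth f" by (rule test_funE[OF assms(1)]) blast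
  show "test_fun (\<lambda>x. f x * g x)" "test_fun (\<lambda>x. g x * f x)"
    by (auto intro!: test_funI[OF _ K(1)] smooth_mult K assms)
qed

lemma fd_zero_outside:
  assumes "closed K" "\<And>x. x \<notin> K \<Longrightarrow> f x = 0" "x \<notin> K"
  shows "fd f x v = 0"
proof -
  have "(f has_derivative (\<lambda>_. 0)) (at x)"
  proof (rule has_derivative_transform_within_open[OF has_derivative_const[where c = 0]])
    show "open (- K)" "x \<in> - K" "\<And>y. y \<in> - K \<Longrightarrow> 0 = f y" using assms by auto
  qed
  then show ?thesis by (simp add: fd_eq)
qed

section \<open>Integration by parts along left-invariant fields\<close>

context stratified_group
begin

lemma lvf_test_fun:
  assumes "test_fun f"
  shows "test_fun (lvf mul v f)"
proof -
  obtain K where K: "compact K" "\<And>x. x \<notin> K \<Longrightarrow> f x = 0" "smooth f" by (rule test_funE[OF assms]) blast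
  show ?thesis
    by (rule test_funI[OF lvf_smooth[OF K(3)] K(1)])
      (simp add: lvf_eq[OF K(3)] fd_zero_outside[OF compact_imp_closed[OF K(1)] K(2)])
qed

text \<open>Flowing along a left-invariant field is a right translation, so it preserves the
  integral of \<open>F\<close>; dominated convergence differentiates this. Only differentiability
  along the flow is asked for, which makes the lemma applicable to compositions such as those in
  \<open>L_positive_part\<close>.\<close>

lemma flow_integral_zero:
  assumes d: "\<And>g t. ((\<lambda>t. F (mul g (t *\<^sub>R v))) has_real_derivative F' (mul g (t *\<^sub>R v))) (at t)"
    and c: "continuous_on UNIV F" "continuous_on UNIV F'" and K: "compact K"
    and z: "\<And>x. x \<notin> K \<Longrightarrow> F x = 0" "\<And>x. x \<notin> K \<Longrightarrow> F' x = 0"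
  shows "(LINT x|lborel. F' x) = 0"
proof -
  define q where "q = (\<lambda>n x. real (Suc n) * (F (mul x ((1 / real (Suc n)) *\<^sub>R v)) - F x))"
  \<comment> \<open>The points that the flow can carry into \<open>K\<close> within time 1. This
    compact set supports all the difference quotients with step at most 1.\<close>
  define K' where "K' = (\<lambda>(k, t). mul k (t *\<^sub>R (- v))) ` (K \<times> {0..1})"
  have K': "compact K'"
    unfolding K'_def case_prod_unfold
    by (intro compact_continuous_image compact_Times K compact_Icc continuous_mul continuous_on_fst
        continuous_on_scaleR continuous_on_snd continuous_on_id continuous_on_const)
  obtain B where B: "B \<ge> 0" "\<And>x. \<bar>F' x\<bar> \<le> B"
    using compact_support_bounded[OF c(2) K z(2)] by blast
  have inK': "x \<in> K'" if "mul x (t *\<^sub>R v) \<in> K" "0 \<le> t" "t \<le> 1" for x t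
  proof -
    have "mul (mul x (t *\<^sub>R v)) (t *\<^sub>R (- v)) = x"
      using mul_inv_cancel'(1)[of x "t *\<^sub>R v"] by simp
    then show ?thesis unfolding K'_def using that by (force intro!: image_eqI[of _ _ "(mul x (t *\<^sub>R v), t)"])
  qed
  have qb: "\<bar>q n x\<bar> \<le> B * indicator K' x" for n x
  proof -
    define s where "s = 1 / real (Suc n)"
    have s: "s > 0" "s \<le> 1" by (auto simp: s_def)
    have "\<exists>t. 0 < t \<and> t < s \<and> F (mul x (s *\<^sub>R v)) - F (mul x (0 *\<^sub>R v)) = (s - 0) * F' (mul x (t *\<^sub>R v))"
      by (rule MVT2[OF s(1) d])
    then obtain t where t: "0 < t" "t < s" "F (mul x (s *\<^sub>R v)) - F x = s * F' (mul x (t *\<^sub>R v))" by auto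
    have q: "q n x = F' (mul x (t *\<^sub>R v))"
      using t(3) s by (simp add: q_def s_def field_simps)
    show ?thesis
    proof (cases "x \<in> K'")
      case False
      then have "mul x (t *\<^sub>R v) \<notin> K" using inK' t s by force
      then show ?thesis using z(2) False by (simp add: q)
    qed (use B q in simp)
  qed
  have lim: "(\<lambda>n. q n x) \<longlonglongrightarrow> F' x" for x
  proof -
    have "(\<lambda>h. (F (mul x ((0 + h) *\<^sub>R v)) - F (mul x (0 *\<^sub>R v))) / h) \<midarrow>0\<rightarrow> F' (mul x (0 *\<^sub>R v))"
      using d[of x 0] by (simp add: DERIV_def)
    then have *: "((\<lambda>h. (F (mul x (h *\<^sub>R v)) - F x) / h) \<longlongrightarrow> F' x) (at 0)" by simp
    have "filterlim (\<lambda>n. 1 / real (Suc n)) (at 0) sequentially"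
      using LIMSEQ_inverse_real_of_nat by (auto simp: filterlim_at inverse_eq_divide)
    from filterlim_compose[OF * this] show ?thesis
      by (simp add: q_def mult.commute del: of_nat_Suc)
  qed
  have mF: "F \<in> borel_measurable borel" "F' \<in> borel_measurable borel"
    using c by (auto intro: borel_measurable_continuous_onI)
  have mq: "q n \<in> borel_measurable lborel" for n unfolding q_def
    using measurable_compose[OF measurable_mul[of "\<lambda>x. x" borel "\<lambda>_. (1 / real (Suc n)) *\<^sub>R v"] mF(1)] mF(1)
    by simp
  have "(\<lambda>n. LINT x|lborel. q n x) \<longlonglongrightarrow> (LINT x|lborel. F' x)"
  proof (rule integral_dominated_convergence[where w = "\<lambda>x. B * indicator K' x"])
    show "integrable lborel (\<lambda>x. B * indicator K' x)"
      using K' emeasure_bounded_finite[OF compact_imp_bounded[OF K']]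
      by (intro integrable_mult_right integrable_real_indicator) (auto simp: borel_compact)
  qed (use mF mq lim qb in auto)
  moreover have "(LINT x|lborel. q n x) = 0" for n
  proof -
    have iF: "integrable lborel F" by (rule compact_support_integrable[OF c(1) K z(1)])
    show ?thesis unfolding q_def
      using iF integrable_right[OF mF(1), of "(1 / real (Suc n)) *\<^sub>R v"] integral_right[OF mF(1), of "(1 / real (Suc n)) *\<^sub>R v"]
      by simp
  qed
  ultimately show ?thesis by (simp add: LIMSEQ_const_iff)
qed

lemma lvf_has_real_derivative: "smooth f \<Longrightarrow>
    ((\<lambda>t. f (mul g (t *\<^sub>R v))) has_real_derivative lvf mul v f (mul g (t *\<^sub>R v))) (at t)"
  using lvf_hvd by (simp add: has_real_derivative_iff_has_vector_derivative)

lemma lvf_mult: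
  assumes "smooth f" "smooth g"
  shows "lvf mul v (\<lambda>x. f x * g x) x = lvf mul v f x * g x + f x * (lvf mul v g x :: real)"
proof -
  have "((\<lambda>t. f (mul x (t *\<^sub>R v)) * g (mul x (t *\<^sub>R v))) has_real_derivative
      lvf mul v f (mul x (0 *\<^sub>R v)) * g (mul x (0 *\<^sub>R v)) + lvf mul v g (mul x (0 *\<^sub>R v)) * f (mul x (0 *\<^sub>R v))) (at 0)"
    by (intro DERIV_mult lvf_has_real_derivative assms)
  from DERIV_unique[OF this lvf_has_real_derivative[OF smooth_mult[OF assms], of x v 0]]
  show ?thesis by (simp add: mult.commute)
qed

lemma integration_by_parts:
  assumes "test_fun f" "smooth g"
  shows "(LINT x|lborel. lvf mul v f x * g x) = - (LINT x|lborel. f x * lvf mul v g x)"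
proof -
  obtain K where K: "compact K" "\<And>x. x \<notin> K \<Longrightarrow> f x = 0" "smooth f" by (rule test_funE[OF assms(1)]) blast
  have zf: "lvf mul v f x = 0" if "x \<notin> K" for x
    using that by (simp add: lvf_eq[OF K(3)] fd_zero_outside[OF compact_imp_closed[OF K(1)] K(2)])
  have sm: "smooth (\<lambda>x. f x * g x)" "smooth (\<lambda>x. lvf mul v f x * g x)" "smooth (\<lambda>x. f x * lvf mul v g x)"
    using K assms by (auto intro!: smooth_mult lvf_smooth)
  have "(LINT x|lborel. lvf mul v (\<lambda>x. f x * g x) x) = 0"
  proof (rule flow_integral_zero[OF lvf_has_real_derivative[OF sm(1)] _ _ K(1)])
    show "continuous_on UNIV (\<lambda>x. f x * g x)" "continuous_on UNIV (lvf mul v (\<lambda>x. f x * g x))"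
      by (intro smooth_continuous_on lvf_smooth sm)+
    show "f x * g x = 0" "lvf mul v (\<lambda>x. f x * g x) x = 0" if "x \<notin> K" for x
      using that K(2) zf by (simp_all add: lvf_mult[OF K(3) assms(2)])
  qed
  moreover have "integrable lborel (\<lambda>x. lvf mul v f x * g x)" "integrable lborel (\<lambda>x. f x * lvf mul v g x)"
    by (rule compact_support_integrable[OF smooth_continuous_on[OF sm(2)] K(1)], use zf in simp)
      (rule compact_support_integrable[OF smooth_continuous_on[OF sm(3)] K(1)], use K in simp)
  ultimately show ?thesis by (simp add: lvf_mult[OF K(3) assms(2)])
qed

section \<open>The sub-Laplacian on test functions\<close>

abbreviation X :: "'n \<Rightarrow> (real ^ 'n \<Rightarrow> real) \<Rightarrow> real ^ 'n \<Rightarrow> real" where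
  "X k \<equiv> lvf mul (axis k 1)"

abbreviation L :: "(real ^ 'n \<Rightarrow> real) \<Rightarrow> real ^ 'n \<Rightarrow> real" where
  "L \<equiv> sublaplacian mul deg"

lemma L_eq: "L f = (\<lambda>x. \<Sum>k | deg k = 1. X k (X k f) x)"
  by (simp add: sublaplacian_def fun_eq_iff)

lemma smooth_L: "smooth f \<Longrightarrow> smooth (L f)"
  unfolding L_eq by (intro smooth_sum lvf_smooth)

lemma test_fun_sum: "finite I \<Longrightarrow> (\<And>i. i \<in> I \<Longrightarrow> test_fun (f i)) \<Longrightarrow> test_fun (\<lambda>x. \<Sum>i\<in>I. f i x)"
  for f :: "'i \<Rightarrow> 'a::euclidean_space \<Rightarrow> real"
proof (induction I rule: finite_induct)
  case empty
  show ?case by (rule test_funI[of _ "{}"]) auto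
next
  case (insert i I)
  obtain K where K: "compact K" "\<And>x. x \<notin> K \<Longrightarrow> f i x = 0" "smooth (f i)"
    using test_funE[of "f i"] insert.prems by blast
  obtain K' where K': "compact K'" "\<And>x. x \<notin> K' \<Longrightarrow> (\<Sum>i\<in>I. f i x) = 0" "smooth (\<lambda>x. \<Sum>i\<in>I. f i x)"
    using test_funE[of "\<lambda>x. \<Sum>i\<in>I. f i x"] insert.IH insert.prems by blast
  show ?case
  proof (rule test_funI[of _ "K \<union> K'"])
    have "smooth (\<lambda>x. f i x + (\<Sum>i\<in>I. f i x))" by (intro smooth_add K K')
    then show "smooth (\<lambda>x. \<Sum>i\<in>insert i I. f i x)" using insert.hyps by simp
    show "(\<Sum>i\<in>insert i I. f i x) = 0" if "x \<notin> K \<union> K'" for x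
      using that K(2)[of x] K'(2)[of x] insert.hyps by (simp del: sum.insert add: sum.insert[OF insert.hyps])
  qed (use K K' in auto)
qed

lemma test_fun_L: "test_fun f \<Longrightarrow> test_fun (L f)"
  using test_fun_sum[of "{k. deg k = 1}" "\<lambda>k. X k (X k f)"] by (simp add: L_eq lvf_test_fun)

lemma ip_sum_left:
  assumes "\<And>k. k \<in> I \<Longrightarrow> integrable lborel (\<lambda>x. f k x * g x)"
  shows "ip (\<lambda>x. \<Sum>k\<in>I. f k x) g = (\<Sum>k\<in>I. ip (f k) g)"
  unfolding ip_def sum_distrib_right by (rule Bochner_Integration.integral_sum) (rule assms)

lemma test_fun_integrable: "test_fun f \<Longrightarrow> integrable lborel f"
  by (erule test_funE) (rule compact_support_integrable[OF smooth_continuous_on])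

text \<open>Only \<open>f\<close> has to be compactly supported: the second argument will be a
  cut-off weight or the heat kernel itself.\<close>

lemma L_symmetric:
  assumes f: "test_fun f" and w: "smooth w"
  shows "ip (L f) w = ip f (L w)"
proof -
  have "ip (L f) w = (\<Sum>k | deg k = 1. ip (X k (X k f)) w)"
    unfolding L_eq by (intro ip_sum_left test_fun_integrable test_fun_mult lvf_test_fun f w)
  also have "\<dots> = (\<Sum>k | deg k = 1. ip (X k (X k w)) f)"
  proof (rule sum.cong[OF refl])
    fix k
    have "ip (X k (X k f)) w = - (LINT x|lborel. X k f x * X k w x)"
      unfolding ip_def by (rule integration_by_parts[OF lvf_test_fun[OF f] w])
    also have "(LINT x|lborel. X k f x * X k w x) = - (LINT x|lborel. f x * X k (X k w) x)"
      by (rule integration_by_parts[OF f lvf_smooth[OF w]])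
    finally show "ip (X k (X k f)) w = ip (X k (X k w)) f" by (simp add: ip_def mult.commute)
  qed
  also have "\<dots> = ip (L w) f"
    unfolding L_eq
    by (intro ip_sum_left[symmetric] test_fun_integrable test_fun_mult lvf_smooth f w)
  finally show ?thesis by (simp add: ip_commute)
qed

text \<open>For an increasing function b, integration by parts turns the integral of X_k X_k f times
  b(f) into minus the integral of b'(f) |X_k f|^2. The positive part is a uniform limit of such
  functions.\<close>

lemma L_positive_part:
  assumes f: "test_fun f"
  shows "ip (L f) (\<lambda>x. max 0 (f x)) \<le> 0"
proof -
  obtain K where K: "compact K" "\<And>x. x \<notin> K \<Longrightarrow> f x = 0" "smooth f" by (rule test_funE[OF f]) blast
  have "ip (X k (X k f)) (\<lambda>x. max 0 (f x)) \<le> 0" for k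
  proof -
    let ?h = "X k (X k f)"
    have th: "test_fun ?h" by (intro lvf_test_fun f)
    have sm: "smooth (X k f)" "smooth ?h" by (intro lvf_smooth K)+
    have zX1: "X k f x = 0" if "x \<notin> K" for x
      using that by (simp add: lvf_eq[OF K(3)] fd_zero_outside[OF compact_imp_closed[OF K(1)] K(2)])
    have "?h x = 0" if "x \<notin> K" for x
      using that by (simp add: lvf_eq[OF sm(1)] fd_zero_outside[OF compact_imp_closed[OF K(1)] zX1])
    note zX = zX1 this
    \<comment> \<open>A regularised positive part: increasing, differentiable for e > 0, and within
      sqrt e of max 0 s.\<close>
    define b where "b = (\<lambda>e s :: real. (s + sqrt (s\<^sup>2 + e)) / 2)"
    define b' where "b' = (\<lambda>e s :: real. (1 + s / sqrt (s\<^sup>2 + e)) / 2)"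
    have pos: "s\<^sup>2 + e > 0" if "e > 0" for e s :: real using that by (simp add: add_nonneg_pos)
    have db: "(b e has_real_derivative b' e s) (at s)" if "e > 0" for e s
      unfolding b_def b'_def using pos[OF that, of s]
      by (auto intro!: derivative_eq_intros simp: field_simps)
    have b'0: "b' e s \<ge> 0" if "e > 0" for e s
    proof -
      have "\<bar>s\<bar> \<le> sqrt (s\<^sup>2 + e)" using that by (intro real_le_rsqrt) simp
      then have "- 1 \<le> s / sqrt (s\<^sup>2 + e)"
        using pos[OF that, of s] by (simp add: le_divide_eq)
      then show ?thesis by (simp add: b'_def)
    qed
    have cb: "continuous_on UNIV (b e)" "continuous_on UNIV (b' e)" if "e > 0" for e
    proof -
      show "continuous_on UNIV (b e)" unfolding b_def by (intro continuous_intros) auto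
      show "continuous_on UNIV (b' e)" unfolding b'_def
        using pos[OF that] by (intro continuous_intros) (auto simp: less_imp_neq[symmetric])
    qed
    have neg: "(LINT x|lborel. ?h x * b e (f x)) \<le> 0" if e: "e > 0" for e
    proof -
      let ?F = "\<lambda>x. X k f x * b e (f x)" and ?F' = "\<lambda>x. ?h x * b e (f x) + b' e (f x) * X k f x * X k f x"
      have c: "continuous_on UNIV (\<lambda>x. b e (f x))" "continuous_on UNIV (\<lambda>x. b' e (f x))"
        using continuous_on_compose2[OF cb(1)[OF e] smooth_continuous_on[OF K(3)]]
          continuous_on_compose2[OF cb(2)[OF e] smooth_continuous_on[OF K(3)]] by auto
      have c2: "continuous_on UNIV (\<lambda>x. ?h x * b e (f x))" "continuous_on UNIV (\<lambda>x. b' e (f x) * X k f x * X k f x)"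
        by (intro continuous_on_mult c smooth_continuous_on sm)+
      have "(LINT x|lborel. ?F' x) = 0"
      proof (rule flow_integral_zero[where F = ?F and v = "axis k 1", OF _ _ _ K(1)])
        show "((\<lambda>t. ?F (mul g (t *\<^sub>R axis k 1))) has_real_derivative ?F' (mul g (t *\<^sub>R axis k 1))) (at t)" for g t
        proof -
          have "((\<lambda>t. b e (f (mul g (t *\<^sub>R axis k 1)))) has_real_derivative
              b' e (f (mul g (t *\<^sub>R axis k 1))) * X k f (mul g (t *\<^sub>R axis k 1))) (at t)"
            by (rule DERIV_chain2[OF db[OF e] lvf_has_real_derivative[OF K(3)]])
          from DERIV_mult[OF lvf_has_real_derivative[OF sm(1)] this]
          show ?thesis by (simp add: algebra_simps)
        qed
        show "continuous_on UNIV ?F" by (intro continuous_on_mult c smooth_continuous_on sm)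
        show "continuous_on UNIV ?F'" by (intro continuous_on_add c2)
      qed (use zX in auto)
      moreover have "integrable lborel (\<lambda>x. ?h x * b e (f x))" "integrable lborel (\<lambda>x. b' e (f x) * X k f x * X k f x)"
        by (rule compact_support_integrable[OF c2(1) K(1)], use zX in simp)
          (rule compact_support_integrable[OF c2(2) K(1)], use zX in simp)
      moreover have "(LINT x|lborel. b' e (f x) * X k f x * X k f x) \<ge> 0"
        using b'0[OF e] by (intro integral_nonneg_AE) (auto simp: mult.assoc)
      ultimately show ?thesis by simp
    qed
    have close: "\<bar>b e s - max 0 s\<bar> \<le> sqrt e" if "e > 0" for e s
    proof -
      have "sqrt (s\<^sup>2 + e) \<le> \<bar>s\<bar> + sqrt e" using sqrt_add_le_add_sqrt[of "s\<^sup>2" e] that by simp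
      moreover have "\<bar>s\<bar> \<le> sqrt (s\<^sup>2 + e)" using that by (intro real_le_rsqrt) simp
      moreover have "sqrt e \<ge> 0" using that by simp
      ultimately show ?thesis by (auto simp: b_def max_def abs_if split: if_splits)
    qed
    \<comment> \<open>Squares, so that the approximation error sqrt e is 1/(n+1).\<close>
    define e where "e = (\<lambda>n. (1 / real (Suc n))\<^sup>2)"
    have e: "e n > 0" for n by (simp add: e_def)
    have "(\<lambda>n. LINT x|lborel. ?h x * b (e n) (f x)) \<longlonglongrightarrow> (LINT x|lborel. ?h x * max 0 (f x))"
    proof (rule integral_dominated_convergence[where w = "\<lambda>x. \<bar>?h x * (\<bar>f x\<bar> + 1)\<bar>"])
      have "continuous_on UNIV (\<lambda>x. ?h x * (\<bar>f x\<bar> + 1))"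
        by (intro continuous_intros smooth_continuous_on sm K)
      then have "integrable lborel (\<lambda>x. ?h x * (\<bar>f x\<bar> + 1))"
        by (rule compact_support_integrable[OF _ K(1)]) (use zX in simp)
      then show "integrable lborel (\<lambda>x. \<bar>?h x * (\<bar>f x\<bar> + 1)\<bar>)" by (rule integrable_abs)
      have "\<bar>b (e n) (f x)\<bar> \<le> \<bar>f x\<bar> + 1" for n x
      proof -
        have "sqrt (e n) \<le> 1" unfolding e_def real_sqrt_abs by simp
        from order_trans[OF close[OF e] this] have "\<bar>b (e n) (f x) - max 0 (f x)\<bar> \<le> 1" .
        then show ?thesis by (auto simp: max_def split: if_splits)
      qed
      then show "AE x in lborel. norm (?h x * b (e n) (f x)) \<le> \<bar>?h x * (\<bar>f x\<bar> + 1)\<bar>" for n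
        by (auto simp: abs_mult intro!: mult_left_mono)
      have "(\<lambda>n. b (e n) s) \<longlonglongrightarrow> max 0 s" for s
      proof (rule LIM_zero_cancel, rule Lim_null_comparison)
        show "\<forall>\<^sub>F n in sequentially. norm (b (e n) s - max 0 s) \<le> 1 / real (Suc n)"
          using close[OF e, of _ s] unfolding e_def real_sqrt_abs by simp
        show "(\<lambda>n. 1 / real (Suc n)) \<longlonglongrightarrow> 0" using LIMSEQ_inverse_real_of_nat by (simp add: inverse_eq_divide)
      qed
      then show "AE x in lborel. (\<lambda>n. ?h x * b (e n) (f x)) \<longlonglongrightarrow> ?h x * max 0 (f x)"
        by (intro AE_I2 tendsto_mult_left)
      show "(\<lambda>x. ?h x * b (e n) (f x)) \<in> borel_measurable lborel" for n
      proof -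
        have "continuous_on UNIV (\<lambda>x. b (e n) (f x))"
          using continuous_on_compose2[OF cb(1)[OF e] smooth_continuous_on[OF K(3)], of UNIV n] by simp
        from borel_measurable_continuous_onI[OF continuous_on_mult[OF smooth_continuous_on[OF sm(2)] this]]
        show ?thesis by simp
      qed
      show "(\<lambda>x. ?h x * max 0 (f x)) \<in> borel_measurable lborel"
      proof -
        have "continuous_on UNIV (\<lambda>x. ?h x * max 0 (f x))"
          by (intro continuous_on_mult continuous_on_max continuous_on_const smooth_continuous_on[OF sm(2)] smooth_continuous_on[OF K(3)])
        then show ?thesis by (simp add: borel_measurable_continuous_onI)
      qed
    qed
    then show ?thesis unfolding ip_def
      by (rule LIMSEQ_le_const2) (use neg[OF e] in auto)
  qed
  note neg = this
  have "ip (L f) (\<lambda>x. max 0 (f x)) = (\<Sum>k | deg k = 1. ip (X k (X k f)) (\<lambda>x. max 0 (f x)))"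
    unfolding L_eq
    by (intro ip_sum_left L2_prod_integrable L2_max_0 test_fun_L2 lvf_test_fun f)
  also have "\<dots> \<le> 0" by (intro sum_nonpos neg)
  finally show ?thesis .
qed

section \<open>The closure of the sub-Laplacian in L2\<close>

lemma closure_graphE:
  assumes "(f, u) \<in> closure_graph L"
  obtains \<phi> where "f \<in> L2" "u \<in> L2" "\<And>m. test_fun (\<phi> m)" "\<And>m. \<phi> m \<in> L2" "\<And>m. L (\<phi> m) \<in> L2"
    "(\<lambda>m. L2_norm (\<lambda>x. \<phi> m x - f x)) \<longlonglongrightarrow> 0" "(\<lambda>m. L2_norm (\<lambda>x. L (\<phi> m) x - u x)) \<longlonglongrightarrow> 0"
  using assms test_fun_L2 test_fun_L unfolding closure_graph_def by blast

lemma test_fun_closure_graph: "test_fun f \<Longrightarrow> (f, L f) \<in> closure_graph L"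
  by (auto simp: closure_graph_def test_fun_L2 test_fun_L L2_norm_def intro!: exI[of _ "\<lambda>_. f"])

lemma tendsto_L2_const: "(\<lambda>m. L2_norm (\<lambda>x. g x - g x)) \<longlonglongrightarrow> 0"
  by (simp add: L2_norm_def)

text \<open>Only the pair (f, u) is approximated by test functions, so \<open>w\<close> may have
  unbounded support, as the cut-off weights in \<open>p_moment\<close> do.\<close>

lemma closure_graph_adjoint:
  assumes "(f, u) \<in> closure_graph L" "smooth w" "w \<in> L2" "L w \<in> L2"
  shows "ip w u = ip (L w) f"
proof -
  obtain \<phi> where \<phi>: "f \<in> L2" "u \<in> L2" "\<And>m. test_fun (\<phi> m)" "\<And>m. \<phi> m \<in> L2" "\<And>m. L (\<phi> m) \<in> L2"
    "(\<lambda>m. L2_norm (\<lambda>x. \<phi> m x - f x)) \<longlonglongrightarrow> 0" "(\<lambda>m. L2_norm (\<lambda>x. L (\<phi> m) x - u x)) \<longlonglongrightarrow> 0"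
    using closure_graphE[OF assms(1)] by blast
  have "(\<lambda>m. ip (L (\<phi> m)) w) \<longlonglongrightarrow> ip u w"
    by (rule ip_tendsto[OF \<phi>(5,2,7) assms(3,3) tendsto_L2_const])
  moreover have "(\<lambda>m. ip (\<phi> m) (L w)) \<longlonglongrightarrow> ip f (L w)"
    by (rule ip_tendsto[OF \<phi>(4,1,6) assms(4,4) tendsto_L2_const])
  ultimately have "ip u w = ip f (L w)"
    using LIMSEQ_unique by (simp add: L_symmetric[OF \<phi>(3) assms(2)])
  then show ?thesis by (simp add: ip_commute[of w u] ip_commute[of "L w" f])
qed

lemma closure_graph_symmetric:
  assumes "(f, u) \<in> closure_graph L" "(g, w) \<in> closure_graph L"
  shows "ip u g = ip f w"
proof -
  obtain \<phi> where \<phi>: "g \<in> L2" "w \<in> L2" "\<And>m. test_fun (\<phi> m)" "\<And>m. \<phi> m \<in> L2" "\<And>m. L (\<phi> m) \<in> L2"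
    "(\<lambda>m. L2_norm (\<lambda>x. \<phi> m x - g x)) \<longlonglongrightarrow> 0" "(\<lambda>m. L2_norm (\<lambda>x. L (\<phi> m) x - w x)) \<longlonglongrightarrow> 0"
    using closure_graphE[OF assms(2)] by blast
  have fu: "f \<in> L2" "u \<in> L2" using assms(1) by (auto simp: closure_graph_def)
  have "(\<lambda>m. ip (\<phi> m) u) \<longlonglongrightarrow> ip g u"
    by (rule ip_tendsto[OF \<phi>(4,1,6) fu(2,2) tendsto_L2_const])
  moreover have "(\<lambda>m. ip (L (\<phi> m)) f) \<longlonglongrightarrow> ip w f"
    by (rule ip_tendsto[OF \<phi>(5,2,7) fu(1,1) tendsto_L2_const])
  moreover have "ip (\<phi> m) u = ip (L (\<phi> m)) f" for m
    by (rule closure_graph_adjoint[OF assms(1) test_fun_smooth[OF \<phi>(3)] \<phi>(4,5)])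
  ultimately have "ip g u = ip w f" using LIMSEQ_unique by simp
  then show ?thesis by (simp add: ip_commute[of u g] ip_commute[of f w])
qed

text \<open>Taking positive parts is 1-Lipschitz and hence continuous in L2, so the inequality for
  test functions passes to the closure.\<close>

lemma closure_graph_positive_part:
  assumes "(f, u) \<in> closure_graph L"
  shows "ip u (\<lambda>x. max 0 (f x)) \<le> 0"
proof -
  obtain \<phi> where \<phi>: "f \<in> L2" "u \<in> L2" "\<And>m. test_fun (\<phi> m)" "\<And>m. \<phi> m \<in> L2" "\<And>m. L (\<phi> m) \<in> L2"
    "(\<lambda>m. L2_norm (\<lambda>x. \<phi> m x - f x)) \<longlonglongrightarrow> 0" "(\<lambda>m. L2_norm (\<lambda>x. L (\<phi> m) x - u x)) \<longlonglongrightarrow> 0"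
    using closure_graphE[OF assms(1)] by blast
  have le: "L2_norm (\<lambda>x. max 0 (\<phi> m x) - max 0 (f x)) \<le> L2_norm (\<lambda>x. \<phi> m x - f x)" for m
  proof -
    have "(max 0 a - max 0 b) * (max 0 a - max 0 b) \<le> (a - b) * (a - b)" for a b :: real
    proof -
      have "\<bar>max 0 a - max 0 b\<bar> \<le> \<bar>a - b\<bar>" by (auto simp: max_def)
      then show ?thesis using abs_le_square_iff[of "max 0 a - max 0 b" "a - b"] by (simp add: power2_eq_square)
    qed
    then have "ip (\<lambda>x. max 0 (\<phi> m x) - max 0 (f x)) (\<lambda>x. max 0 (\<phi> m x) - max 0 (f x)) \<le> ip (\<lambda>x. \<phi> m x - f x) (\<lambda>x. \<phi> m x - f x)"
      unfolding ip_def by (intro integral_mono L2_prod_integrable L2_diff L2_max_0 \<phi>)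
    then show ?thesis by (simp add: L2_norm_eq)
  qed
  have l: "(\<lambda>m. L2_norm (\<lambda>x. max 0 (\<phi> m x) - max 0 (f x))) \<longlonglongrightarrow> 0"
    by (rule tendsto_sandwich[OF _ _ tendsto_const \<phi>(6)]) (auto simp: L2_norm_nonneg le)
  have "(\<lambda>m. ip (L (\<phi> m)) (\<lambda>x. max 0 (\<phi> m x))) \<longlonglongrightarrow> ip u (\<lambda>x. max 0 (f x))"
    by (rule ip_tendsto[OF \<phi>(5,2,7) L2_max_0[OF \<phi>(4)] L2_max_0[OF \<phi>(1)] l])
  then show ?thesis
    by (rule LIMSEQ_le_const2) (use L_positive_part[OF \<phi>(3)] in auto)
qed

section \<open>Homogeneity of the sub-Laplacian and of its closure under dilations\<close>

lemma L_dil: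
  assumes "r > 0" "smooth f"
  shows "L (\<lambda>x. f (dil deg r x)) x = r\<^sup>2 * L f (dil deg r x)"
proof -
  have "X k (X k (\<lambda>x. f (dil deg r x))) x = r\<^sup>2 * X k (X k f) (dil deg r x)" if k: "deg k = 1" for k
  proof -
    have "X k (\<lambda>x. f (dil deg r x)) = (\<lambda>x. r *\<^sub>R X k f (dil deg r x))"
      by (rule ext) (rule lvf_dil[OF assms k])
    then have "X k (X k (\<lambda>x. f (dil deg r x))) x = r *\<^sub>R X k (\<lambda>x. X k f (dil deg r x)) x"
      using lvf_cmult[OF smooth_dil[OF lvf_smooth[OF assms(2)]]] by metis
    also have "\<dots> = r *\<^sub>R (r *\<^sub>R X k (X k f) (dil deg r x))"
      by (subst lvf_dil[OF assms(1) lvf_smooth[OF assms(2)] k]) simp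
    finally show ?thesis by (simp add: power2_eq_square)
  qed
  then show ?thesis by (simp add: L_eq sum_distrib_left)
qed

lemma test_fun_dil:
  assumes "test_fun f" "r > 0"
  shows "test_fun (\<lambda>x. f (dil deg r x))"
proof -
  obtain K where K: "compact K" "\<And>x. x \<notin> K \<Longrightarrow> f x = 0" "smooth f" by (rule test_funE[OF assms(1)]) blast
  have "compact (dil deg (1 / r) ` K)"
    by (intro compact_continuous_image linear_continuous_on bounded_linear_dil K)
  then show ?thesis
  proof (rule test_funI[OF smooth_dil[OF K(3)]])
    fix x assume "x \<notin> dil deg (1 / r) ` K"
    then have "dil deg r x \<notin> K" using assms(2) by (metis dil_inverse(1) image_eqI less_irrefl)
    then show "f (dil deg r x) = 0" by (rule K(2))
  qed
qed

lemma measurable_dil [measurable]: "dil deg r \<in> borel_measurable borel"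
  by (intro borel_measurable_continuous_onI linear_continuous_on bounded_linear_dil)

lemma integral_dil:
  fixes f :: "real ^ 'n \<Rightarrow> real"
  assumes "r > 0" and f: "f \<in> borel_measurable borel"
  shows "(LINT x|lborel. f x) = r ^ homdim deg * (LINT x|lborel. f (dil deg r x))"
    and "integrable lborel f \<longleftrightarrow> integrable lborel (\<lambda>x. f (dil deg r x))"
proof -
  let ?M = "density (distr lborel borel (dil deg r)) (\<lambda>_. ennreal (r ^ homdim deg))"
  have M: "lborel = ?M" by (rule lborel_dil[OF deg_pos assms(1)])
  have mc: "(\<lambda>x. f (dil deg r x)) \<in> borel_measurable borel" using f by measurable
  have "(LINT x|lborel. f x) = (LINT x|?M. f x)" by (rule arg_cong[OF M, of "\<lambda>M. LINT x|M. f x"])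
  also have "\<dots> = (LINT x|lborel. r ^ homdim deg * f (dil deg r x))"
    using f assms(1) by (simp add: integral_density integral_distr)
  finally show "(LINT x|lborel. f x) = r ^ homdim deg * (LINT x|lborel. f (dil deg r x))" by simp
  have "integrable lborel f \<longleftrightarrow> integrable ?M f" by (rule arg_cong[OF M, of "\<lambda>M. integrable M f"])
  also have "\<dots> \<longleftrightarrow> integrable lborel (\<lambda>x. f (dil deg r x))"
    using f assms(1) by (simp add: integrable_density integrable_distr_eq)
  finally show "integrable lborel f \<longleftrightarrow> integrable lborel (\<lambda>x. f (dil deg r x))" .
qed

lemma L2_dil: "r > 0 \<Longrightarrow> f \<in> L2 \<Longrightarrow> (\<lambda>x. f (dil deg r x)) \<in> L2"
  using integral_dil(2)[of r "\<lambda>x. (f x)\<^sup>2"] measurable_compose[OF measurable_dil, of f borel r]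
    borel_measurable_power[of f borel 2]
  by (simp add: L2_def)

lemma L2_norm_dil:
  assumes "r > 0" "f \<in> borel_measurable borel"
  shows "L2_norm (\<lambda>x. f (dil deg r x)) = sqrt (1 / r ^ homdim deg) * L2_norm f"
proof -
  have "(LINT x|lborel. (f (dil deg r x))\<^sup>2) = 1 / r ^ homdim deg * (LINT x|lborel. (f x)\<^sup>2)"
    using integral_dil(1)[of r "\<lambda>x. (f x)\<^sup>2"] assms by simp
  then show ?thesis by (simp only: L2_norm_def real_sqrt_mult)
qed

lemma closure_graph_dil:
  assumes r: "r > 0" and "(f, u) \<in> closure_graph L"
  shows "((\<lambda>x. f (dil deg r x)), (\<lambda>x. r\<^sup>2 * u (dil deg r x))) \<in> closure_graph L"
proof -
  obtain \<phi> where \<phi>: "f \<in> L2" "u \<in> L2" "\<And>m. test_fun (\<phi> m)" "\<And>m. \<phi> m \<in> L2" "\<And>m. L (\<phi> m) \<in> L2"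
    "(\<lambda>m. L2_norm (\<lambda>x. \<phi> m x - f x)) \<longlonglongrightarrow> 0" "(\<lambda>m. L2_norm (\<lambda>x. L (\<phi> m) x - u x)) \<longlonglongrightarrow> 0"
    using closure_graphE[OF assms(2)] by blast
  let ?c = "sqrt (1 / r ^ homdim deg)"
  have m: "(\<lambda>x. \<phi> m x - f x) \<in> borel_measurable borel" "(\<lambda>x. L (\<phi> m) x - u x) \<in> borel_measurable borel" for m
    using L2_measurable[OF L2_diff[OF \<phi>(4)[of m] \<phi>(1)]] L2_measurable[OF L2_diff[OF \<phi>(5)[of m] \<phi>(2)]] .
  have "(\<lambda>m. ?c * L2_norm (\<lambda>x. \<phi> m x - f x)) \<longlonglongrightarrow> ?c * 0"
    by (intro tendsto_mult_left \<phi>)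
  then have 1: "(\<lambda>m. L2_norm (\<lambda>x. \<phi> m (dil deg r x) - f (dil deg r x))) \<longlonglongrightarrow> 0"
    using L2_norm_dil[OF r m(1)] by simp
  have "L2_norm (\<lambda>x. L (\<lambda>x. \<phi> m (dil deg r x)) x - r\<^sup>2 * u (dil deg r x)) = r\<^sup>2 * (?c * L2_norm (\<lambda>x. L (\<phi> m) x - u x))" for m
  proof -
    have "(\<lambda>x. L (\<lambda>x. \<phi> m (dil deg r x)) x - r\<^sup>2 * u (dil deg r x)) = (\<lambda>x. r\<^sup>2 * (L (\<phi> m) (dil deg r x) - u (dil deg r x)))"
      by (simp add: L_dil[OF r test_fun_smooth[OF \<phi>(3)]] right_diff_distrib)
    then show ?thesis
      by (simp only: L2_norm_cmult L2_norm_dil[OF r m(2)]) simp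
  qed
  moreover have "(\<lambda>m. r\<^sup>2 * (?c * L2_norm (\<lambda>x. L (\<phi> m) x - u x))) \<longlonglongrightarrow> r\<^sup>2 * (?c * 0)"
    by (intro tendsto_mult_left \<phi>)
  ultimately have 2: "(\<lambda>m. L2_norm (\<lambda>x. L (\<lambda>x. \<phi> m (dil deg r x)) x - r\<^sup>2 * u (dil deg r x))) \<longlonglongrightarrow> 0"
    by simp
  have "test_fun (\<lambda>x. \<phi> m (dil deg r x))" for m by (rule test_fun_dil[OF \<phi>(3) r])
  with 1 2 have "\<exists>\<psi> :: nat \<Rightarrow> real ^ 'n \<Rightarrow> real. (\<forall>m. test_fun (\<psi> m)) \<and>
      (\<lambda>m. L2_norm (\<lambda>x. \<psi> m x - f (dil deg r x))) \<longlonglongrightarrow> 0 \<and>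
      (\<lambda>m. L2_norm (\<lambda>x. L (\<psi> m) x - r\<^sup>2 * u (dil deg r x))) \<longlonglongrightarrow> 0"
    by (intro exI[of _ "\<lambda>m x. \<phi> m (dil deg r x)"]) blast
  then show ?thesis
    unfolding closure_graph_def using L2_dil[OF r \<phi>(1)] L2_cmult[OF L2_dil[OF r \<phi>(2)], of "r\<^sup>2"] by blast
qed

end

section \<open>Positivity, symmetry and scaling of the heat kernel\<close>

lemma compact_support_integrable_pair:
  fixes F :: "'a::euclidean_space \<times> 'b::euclidean_space \<Rightarrow> real"
  assumes "continuous_on UNIV F" "compact K" "compact K'" "\<And>x y. x \<notin> K \<or> y \<notin> K' \<Longrightarrow> F (x, y) = 0"
  shows "integrable (lborel \<Otimes>\<^sub>M lborel) F"
  unfolding lborel_prod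
  by (rule compact_support_integrable[OF assms(1) compact_Times[OF assms(2,3)]]) (use assms(4) in auto)

lemma AE_open_point:
  fixes S :: "'a::euclidean_space set"
  assumes "AE x in lborel. P x" "open S" "S \<noteq> {}"
  shows "\<exists>x\<in>S. P x"
proof (rule ccontr)
  assume no: "\<not> (\<exists>x\<in>S. P x)"
  obtain N where N: "{x \<in> space lborel. \<not> P x} \<subseteq> N" "N \<in> null_sets lborel"
    using assms(1) by (auto simp: eventually_ae_filter)
  have "N \<in> null_sets lebesgue" using N(2) by (rule null_sets_completionI)
  then have "negligible N" by (simp add: negligible_iff_null_sets)
  moreover have "S \<subseteq> N" using N(1) no by auto
  ultimately have "negligible S" using negligible_subset by blast
  then show False using open_not_negligible[OF assms(2,3)] by blast
qed

lemma test_fun_integral_pos: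
  assumes "test_fun f" "\<And>x. f x \<ge> 0" "f a > 0"
  shows "(LINT x|lborel. f x) > 0"
proof -
  have i: "integrable lborel f"
    using assms(1) by (elim test_funE) (rule compact_support_integrable[OF smooth_continuous_on])
  have "(LINT x|lborel. f x) \<noteq> 0"
  proof
    assume "(LINT x|lborel. f x) = 0"
    then have "AE x in lborel. f x = 0"
      using integral_nonneg_eq_0_iff_AE[OF i] assms(2) by simp
    moreover have "open {x. f x > 0}"
      by (intro open_Collect_less smooth_continuous_on test_fun_smooth[OF assms(1)] continuous_on_const)
    ultimately have "\<exists>x\<in>{x. f x > 0}. f x = 0" by (rule AE_open_point) (use assms(3) in auto)
    then show False by auto
  qed
  moreover have "(LINT x|lborel. f x) \<ge> 0" using assms(2) by (intro integral_nonneg_AE) simp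
  ultimately show ?thesis by simp
qed

context stratified_group
begin

lemma gconv_integrable_pair:
  assumes f: "test_fun f" and k: "test_fun k" and q: "continuous_on UNIV q"
  shows "integrable (lborel \<Otimes>\<^sub>M lborel) (\<lambda>(g, a). k g * (f a * q (mul (- a) g)))"
proof -
  obtain K where K: "compact K" "\<And>x. x \<notin> K \<Longrightarrow> f x = 0" "smooth f" by (rule test_funE[OF f]) blast
  obtain K' where K': "compact K'" "\<And>x. x \<notin> K' \<Longrightarrow> k x = 0" "smooth k" by (rule test_funE[OF k]) blast
  have c: "continuous_on UNIV (\<lambda>z :: (real ^ 'n) \<times> (real ^ 'n). k (fst z) * (f (snd z) * q (mul (- snd z) (fst z))))"
    by (intro continuous_on_mult continuous_on_compose2[OF smooth_continuous_on[OF K(3), of UNIV]]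
        continuous_on_compose2[OF smooth_continuous_on[OF K'(3), of UNIV]] continuous_on_compose2[OF q]
        continuous_mul continuous_on_minus continuous_on_fst continuous_on_snd continuous_on_id) auto
  show ?thesis unfolding case_prod_unfold
    by (rule compact_support_integrable_pair[OF c K'(1) K(1)]) (use K(2) K'(2) in auto)
qed

lemma gconv_test_integrable:
  assumes f: "test_fun f" and q: "continuous_on UNIV q"
  shows "integrable lborel (\<lambda>a. f a * q (mul (- a) g))"
proof -
  obtain K where K: "compact K" "\<And>x. x \<notin> K \<Longrightarrow> f x = 0" "smooth f" by (rule test_funE[OF f]) blast
  have "continuous_on UNIV (\<lambda>a. f a * q (mul (- a) g))"
    by (intro continuous_on_mult smooth_continuous_on K continuous_on_compose2[OF q]
        continuous_mul continuous_on_minus continuous_on_id continuous_on_const) auto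
  then show ?thesis by (rule compact_support_integrable[OF _ K(1)]) (use K(2) in simp)
qed

lemma gconv_pairing_integrable:
  assumes f: "test_fun f" and k: "test_fun k" and q: "continuous_on UNIV q"
  shows "integrable lborel (\<lambda>g. k g * gconv mul f q g)"
  using lborel_pair.integrable_fst'[OF gconv_integrable_pair[OF f k q]] by (simp add: gconv_def)

text \<open>The adjoint of convolution with \<open>q\<close> is convolution with the inverted
  kernel.\<close>

lemma gconv_pairing_swap:
  assumes f: "test_fun f" and k: "test_fun k" and q: "continuous_on UNIV q"
  shows "(LINT g|lborel. k g * gconv mul f (\<lambda>x. q (- x)) g) = (LINT a|lborel. f a * gconv mul k q a)"
proof -
  have c: "continuous_on UNIV (\<lambda>x. q (- x))"
    by (intro continuous_on_compose2[OF q] continuous_on_minus continuous_on_id) auto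
  have "(LINT g|lborel. k g * gconv mul f (\<lambda>x. q (- x)) g) =
      (LINT g|lborel. LINT a|lborel. k g * (f a * q (- mul (- a) g)))"
    by (simp add: gconv_def)
  also have "\<dots> = (LINT a|lborel. LINT g|lborel. k g * (f a * q (- mul (- a) g)))"
    using lborel_pair.Fubini_integral[OF gconv_integrable_pair[OF f k c]] by simp
  also have "\<dots> = (LINT a|lborel. LINT g|lborel. f a * (k g * q (mul (- g) a)))"
    by (intro Bochner_Integration.integral_cong) (auto simp: neg_mul mult.left_commute)
  also have "\<dots> = (LINT a|lborel. f a * gconv mul k q a)"
    by (simp add: gconv_def)
  finally show ?thesis .
qed

text \<open>If \<open>q\<close> were negative at x_0, then q(a^-1 g) would be negative for (a, g)
  near (0, x_0), and two bumps concentrated there would give a negative pairing. This passes from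
  information on the operator to the values of a continuous kernel.\<close>

lemma kernel_nonneg:
  assumes q: "continuous_on UNIV q"
    and pair: "\<And>f k. test_fun f \<Longrightarrow> (\<And>x. f x \<ge> 0) \<Longrightarrow> test_fun k \<Longrightarrow> (\<And>x. k x \<ge> 0) \<Longrightarrow>
      (LINT g|lborel. k g * gconv mul f q g) \<ge> 0"
  shows "q x0 \<ge> 0"
proof (rule ccontr)
  assume "\<not> q x0 \<ge> 0"
  define c where "c = - q x0 / 2"
  have c: "c > 0" "q x0 < - c" using \<open>\<not> q x0 \<ge> 0\<close> by (auto simp: c_def)
  have cont: "continuous_on UNIV (\<lambda>z :: (real ^ 'n) \<times> (real ^ 'n). q (mul (- fst z) (snd z)))"
    by (intro continuous_on_compose2[OF q] continuous_mul continuous_on_minus continuous_on_fst continuous_on_snd continuous_on_id) auto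
  have "open {z :: (real ^ 'n) \<times> (real ^ 'n). q (mul (- fst z) (snd z)) < - c}"
    by (intro open_Collect_less cont continuous_on_const)
  then obtain A B where AB: "open A" "open B" "(0, x0) \<in> A \<times> B"
      "A \<times> B \<subseteq> {z. q (mul (- fst z) (snd z)) < - c}"
    by (rule open_prod_elim[where x = "(0, x0)"]) (use c in auto)
  obtain d1 where d1: "d1 > 0" "ball 0 d1 \<subseteq> A" using AB by (meson mem_Sigma_iff open_contains_ball)
  obtain d2 where d2: "d2 > 0" "ball x0 d2 \<subseteq> B" using AB by (meson mem_Sigma_iff open_contains_ball)
  let ?f = "bump 0 d1 :: real ^ 'n \<Rightarrow> real" and ?k = "bump x0 d2"
  have t: "test_fun ?f" "test_fun ?k" using d1 d2 by (auto intro: test_fun_bump)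
  have If: "(LINT x|lborel. ?f x) > 0" and Ik: "(LINT x|lborel. ?k x) > 0"
    using d1 d2 by (simp_all add: test_fun_integral_pos[OF t(1) bump_nonneg, of 0] test_fun_integral_pos[OF t(2) bump_nonneg, of x0] bump_pos_iff)
  have le: "?k g * gconv mul ?f q g \<le> ?k g * (- c * (LINT x|lborel. ?f x))" for g
  proof (cases "?k g > 0")
    case True
    then have g: "g \<in> B" using d2 by (auto simp: bump_pos_iff dist_commute)
    have "gconv mul ?f q g \<le> (LINT a|lborel. - c * ?f a)"
      unfolding gconv_def
    proof (rule integral_mono)
      show "integrable lborel (\<lambda>a. ?f a * q (mul (- a) g))" by (rule gconv_test_integrable[OF t(1) q])
      show "integrable lborel (\<lambda>a. - c * ?f a)" using test_fun_integrable[OF t(1)] by simp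
      show "?f a * q (mul (- a) g) \<le> - c * ?f a" for a
      proof (cases "?f a > 0")
        case True
        then have "a \<in> A" using d1 by (auto simp: bump_pos_iff dist_commute)
        then have "q (mul (- a) g) < - c" using AB(4) g by auto
        then show ?thesis using True mult_left_mono[of "q (mul (- a) g)" "- c" "?f a"] by (simp add: mult.commute)
      next
        case False
        then have "?f a = 0" using bump_nonneg[of 0 d1 a] by simp
        then show ?thesis by simp
      qed
    qed
    then show ?thesis using True by (intro mult_left_mono) auto
  next
    case False
    then have "?k g = 0" using bump_nonneg[of x0 d2 g] by simp
    then show ?thesis by simp
  qed
  have "(LINT g|lborel. ?k g * gconv mul ?f q g) \<le> (LINT g|lborel. ?k g * (- c * (LINT x|lborel. ?f x)))"
    by (rule integral_mono[OF gconv_pairing_integrable[OF t q] _ le]) (simp add: test_fun_integrable[OF t(2)])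
  also have "\<dots> = - (c * (LINT x|lborel. ?f x) * (LINT x|lborel. ?k x))" by simp
  also have "\<dots> < 0" using c If Ik by simp
  finally show False using pair[OF t(1) bump_nonneg t(2) bump_nonneg] by simp
qed

lemma gconv_diff_kernel:
  assumes "test_fun f" "continuous_on UNIV q" "continuous_on UNIV r"
  shows "gconv mul f (\<lambda>x. q x - r x) g = gconv mul f q g - gconv mul f r g"
  using gconv_test_integrable[OF assms(1,2), of g] gconv_test_integrable[OF assms(1,3), of g]
  by (simp add: gconv_def right_diff_distrib)

text \<open>Nonnegativity of the difference of the kernels in both orders. Every pointwise identity
  for the heat kernel is reduced to an identity of pairings through this lemma.\<close>

lemma kernel_unique:
  assumes q: "continuous_on UNIV q" and r: "continuous_on UNIV r"
    and pair: "\<And>f k. test_fun f \<Longrightarrow> (\<And>x. f x \<ge> 0) \<Longrightarrow> test_fun k \<Longrightarrow> (\<And>x. k x \<ge> 0) \<Longrightarrow>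
      (LINT g|lborel. k g * gconv mul f q g) = (LINT g|lborel. k g * gconv mul f r g)"
  shows "q x = r x"
proof -
  have *: "q x - r x \<ge> 0" if q: "continuous_on UNIV q" and r: "continuous_on UNIV r"
    and pair: "\<And>f k. test_fun f \<Longrightarrow> (\<And>x. f x \<ge> 0) \<Longrightarrow> test_fun k \<Longrightarrow> (\<And>x. k x \<ge> 0) \<Longrightarrow>
      (LINT g|lborel. k g * gconv mul f q g) = (LINT g|lborel. k g * gconv mul f r g)" for q r
  proof (rule kernel_nonneg)
    show "continuous_on UNIV (\<lambda>x. q x - r x)" by (rule continuous_on_diff[OF q r])
    fix f k :: "real ^ 'n \<Rightarrow> real"
    assume fk: "test_fun f" "\<And>x. f x \<ge> 0" "test_fun k" "\<And>x. k x \<ge> 0"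
    have "(LINT g|lborel. k g * gconv mul f (\<lambda>x. q x - r x) g) =
        (LINT g|lborel. k g * gconv mul f q g) - (LINT g|lborel. k g * gconv mul f r g)"
      using gconv_pairing_integrable[OF fk(1,3) q] gconv_pairing_integrable[OF fk(1,3) r]
      by (simp add: gconv_diff_kernel[OF fk(1) q r] right_diff_distrib)
    then show "(LINT g|lborel. k g * gconv mul f (\<lambda>x. q x - r x) g) \<ge> 0" using pair[OF fk] by simp
  qed
  have "q x - r x \<ge> 0" by (rule *[OF q r pair])
  moreover have "r x - q x \<ge> 0" by (rule *[OF r q]) (rule pair[symmetric])
  ultimately show ?thesis by simp
qed

lemma AE_dil:
  assumes "AE x in lborel. Q x" and r: "r > 0"
  shows "AE x in lborel. Q (dil deg r x)"
proof -
  obtain N where N: "{x \<in> space lborel. \<not> Q x} \<subseteq> N" "N \<in> null_sets (lborel :: (real ^ 'n) measure)"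
    using assms(1) by (auto simp: eventually_ae_filter)
  have Nm: "N \<in> sets borel" using N(2) by auto
  have m: "dil deg r -` N \<in> sets borel" using measurable_sets_borel[OF measurable_dil Nm] by simp
  have "(\<integral>\<^sup>+x. indicator N x \<partial>lborel) = ennreal (r ^ homdim deg) * (\<integral>\<^sup>+x. indicator N (dil deg r x) \<partial>lborel)"
    by (rule nn_integral_dil[OF r]) (use Nm in simp)
  moreover have "(\<integral>\<^sup>+x. indicator N (dil deg r x) \<partial>lborel) = emeasure lborel (dil deg r -` N)"
  proof -
    have "(\<lambda>x. indicator N (dil deg r x) :: ennreal) = indicator (dil deg r -` N)"
      by (auto simp: indicator_def)
    then show ?thesis using m by simp
  qed
  ultimately have "ennreal (r ^ homdim deg) * emeasure lborel (dil deg r -` N) = 0"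
    using N(2) Nm by (simp add: null_sets_def)
  then have "emeasure lborel (dil deg r -` N) = 0" using r by auto
  then have "dil deg r -` N \<in> null_sets lborel" using m by (simp add: null_sets_def)
  then show ?thesis by (rule AE_I') (use N(1) in auto)
qed

end

locale heat = stratified_group mul deg + csg T
  for mul :: "real ^ 'n \<Rightarrow> real ^ 'n \<Rightarrow> real ^ 'n" and deg :: "'n::finite \<Rightarrow> nat"
    and T :: "real \<Rightarrow> (real ^ 'n \<Rightarrow> real) \<Rightarrow> real ^ 'n \<Rightarrow> real" +
  fixes p :: "real \<Rightarrow> real ^ 'n \<Rightarrow> real"
  assumes smooth_p: "h > 0 \<Longrightarrow> smooth (p h)"
    and gen_eq: "generator_graph T = closure_graph (sublaplacian mul deg)"
    and T_conv: "h > 0 \<Longrightarrow> f \<in> L2 \<Longrightarrow> AE g in lborel. T h f g = gconv mul f (p h) g"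
begin

lemma cont_p: "h > 0 \<Longrightarrow> continuous_on S (p h)"
  by (rule smooth_continuous_on[OF smooth_p])

lemma measurable_p: "h > 0 \<Longrightarrow> p h \<in> borel_measurable borel"
  by (rule borel_measurable_continuous_onI[OF cont_p])

lemma test_gen: "test_fun f \<Longrightarrow> (f, L f) \<in> generator_graph T"
  using test_fun_closure_graph gen_eq by simp

lemma ip_T_conv:
  assumes "h > 0" "test_fun f" "test_fun k"
  shows "ip k (T h f) = (LINT g|lborel. k g * gconv mul f (p h) g)"
  unfolding ip_def
proof (rule integral_cong_AE)
  show "(\<lambda>x. k x * T h f x) \<in> borel_measurable lborel"
    using L2_measurable[OF T_L2[OF less_imp_le[OF assms(1)] test_fun_L2[OF assms(2)]]] L2_measurable[OF test_fun_L2[OF assms(3)]] by simp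
  show "(\<lambda>g. k g * gconv mul f (p h) g) \<in> borel_measurable lborel"
    using gconv_pairing_integrable[OF assms(2,3) cont_p[OF assms(1)]] by simp
  show "AE x in lborel. k x * T h f x = k x * gconv mul f (p h) x"
    using T_conv[OF assms(1) test_fun_L2[OF assms(2)]] by eventually_elim simp
qed

lemma T_test_nonneg:
  assumes "t \<ge> 0" "test_fun f" "\<And>x. f x \<ge> 0"
  shows "AE x in lborel. T t f x \<ge> 0"
  by (rule T_positive[OF closure_graph_positive_part test_gen[OF assms(2)] assms(1,3)]) (simp add: gen_eq)

lemma p_nonneg:
  assumes h: "h > 0"
  shows "p h x \<ge> 0"
proof (rule kernel_nonneg[OF cont_p[OF h]])
  fix f k :: "real ^ 'n \<Rightarrow> real"
  assume fk: "test_fun f" "\<And>x. f x \<ge> 0" "test_fun k" "\<And>x. k x \<ge> 0"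
  have "ip k (T h f) \<ge> 0"
    unfolding ip_def
  proof (rule integral_nonneg_AE)
    show "AE x in lborel. 0 \<le> k x * T h f x"
      using T_test_nonneg[OF less_imp_le[OF h] fk(1,2)] by eventually_elim (use fk(4) in simp)
  qed
  then show "(LINT g|lborel. k g * gconv mul f (p h) g) \<ge> 0" by (simp add: ip_T_conv[OF h fk(1,3)])
qed

text \<open>The inverted kernel represents the adjoint operator, and \<open>T h\<close> is symmetric
  because its generator is.\<close>

lemma p_symmetric:
  assumes h: "h > 0"
  shows "p h (- x) = p h x"
proof (rule kernel_unique)
  show "continuous_on UNIV (\<lambda>x. p h (- x))"
    by (intro continuous_on_compose2[OF cont_p[OF h, of UNIV]] continuous_on_minus continuous_on_id) auto
  show "continuous_on UNIV (p h)" by (rule cont_p[OF h])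
  fix f k :: "real ^ 'n \<Rightarrow> real"
  assume fk: "test_fun f" "\<And>x. f x \<ge> 0" "test_fun k" "\<And>x. k x \<ge> 0"
  have "(LINT g|lborel. k g * gconv mul f (\<lambda>x. p h (- x)) g) = ip f (T h k)"
    by (simp add: gconv_pairing_swap[OF fk(1,3) cont_p[OF h]] ip_T_conv[OF h fk(3,1)])
  also have "\<dots> = ip (T h f) k"
    by (rule T_symmetric[symmetric, OF closure_graph_symmetric test_gen[OF fk(1)] test_gen[OF fk(3)]])
      (use h gen_eq in simp_all)
  also have "\<dots> = (LINT g|lborel. k g * gconv mul f (p h) g)"
    by (simp add: ip_commute[of "T h f"] ip_T_conv[OF h fk(1,3)])
  finally show "(LINT g|lborel. k g * gconv mul f (\<lambda>x. p h (- x)) g) = (LINT g|lborel. k g * gconv mul f (p h) g)" .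
qed

text \<open>The semigroup conjugated by a dilation, run at the parabolic time r^2 t. It will turn
  out to be the same semigroup.\<close>

definition S where "S r t f = (\<lambda>x. T (r\<^sup>2 * t) (\<lambda>y. f (dil deg (1 / r) y)) (dil deg r x))"

lemma S_contraction:
  assumes r: "r > 0"
  shows "contraction_semigroup (S r)"
proof -
  let ?c = "\<lambda>f y. f (dil deg (1 / r) y)"
  have r': "1 / r > 0" using r by simp
  have c: "?c f \<in> L2" if "f \<in> L2" for f by (rule L2_dil[OF r' that])
  have rt: "r\<^sup>2 * t \<ge> 0" if "t \<ge> 0" for t using that by simp
  have nn: "sqrt (1 / r ^ homdim deg) * (sqrt (1 / (1 / r) ^ homdim deg) * z) = z" for z
  proof -
    have "sqrt (1 / r ^ homdim deg) * sqrt (1 / (1 / r) ^ homdim deg) = 1"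
      using r by (simp add: power_divide flip: real_sqrt_mult)
    then show ?thesis by (simp flip: mult.assoc)
  qed
  have norm: "L2_norm (\<lambda>x. u (dil deg r x)) \<le> L2_norm f"
    if "u \<in> L2" "f \<in> L2" "L2_norm u \<le> L2_norm (?c f)" for u f
  proof -
    have "L2_norm (\<lambda>x. u (dil deg r x)) = sqrt (1 / r ^ homdim deg) * L2_norm u"
      by (rule L2_norm_dil[OF r L2_measurable[OF that(1)]])
    also have "\<dots> \<le> sqrt (1 / r ^ homdim deg) * L2_norm (?c f)"
      using that(3) r by (intro mult_left_mono) auto
    also have "\<dots> = L2_norm f"
      by (simp only: L2_norm_dil[OF r' L2_measurable[OF that(2)]] nn)
    finally show ?thesis .
  qed
  show ?thesis
    unfolding contraction_semigroup_def
  proof (intro conjI allI impI ballI)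
    fix h :: real and f :: "real ^ 'n \<Rightarrow> real" assume h: "h \<ge> 0" and f: "f \<in> L2"
    show "S r h f \<in> L2" unfolding S_def by (intro L2_dil[OF r] T_L2 rt h c f)
    show "L2_norm (S r h f) \<le> L2_norm f"
      unfolding S_def by (intro norm T_L2 T_norm rt h c f)
  next
    fix h :: real and f u :: "real ^ 'n \<Rightarrow> real" and a b :: real
    assume h: "h \<ge> 0" and f: "f \<in> L2" and u: "u \<in> L2"
    show "AE x in lborel. S r h (\<lambda>y. a * f y + b * u y) x = a * S r h f x + b * S r h u x"
      unfolding S_def by (rule AE_dil[OF T_lin[OF rt[OF h] c[OF f] c[OF u]] r])
  next
    fix f :: "real ^ 'n \<Rightarrow> real" assume f: "f \<in> L2"
    show "AE x in lborel. S r 0 f x = f x"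
      using AE_dil[OF T_0[OF c[OF f]] r] r by (simp add: S_def)
    have "L2_norm (\<lambda>x. S r h f x - f x) = sqrt (1 / r ^ homdim deg) * L2_norm (\<lambda>x. T (r\<^sup>2 * h) (?c f) x - ?c f x)"
      if "h > 0" for h
    proof -
      have "(\<lambda>x. T (r\<^sup>2 * h) (?c f) x - ?c f x) \<in> borel_measurable borel"
        by (intro L2_measurable L2_diff T_L2 rt c f) (use that in simp)
      from L2_norm_dil[OF r this] r show ?thesis by (simp add: S_def)
    qed
    moreover have "((\<lambda>h. sqrt (1 / r ^ homdim deg) * L2_norm (\<lambda>x. T (r\<^sup>2 * h) (?c f) x - ?c f x)) \<longlongrightarrow> sqrt (1 / r ^ homdim deg) * 0) (at_right 0)"
    proof (rule tendsto_mult_left)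
      have "((\<lambda>h. L2_norm (\<lambda>x. T h (?c f) x - ?c f x)) \<longlongrightarrow> 0) (at_right 0)"
        using cs c[OF f] unfolding contraction_semigroup_def by blast
      moreover have "filterlim (\<lambda>h. r\<^sup>2 * h) (at_right 0) (at_right 0)"
        using r by (intro filterlim_times_pos[where l = 0 and c = "r\<^sup>2"]) (auto simp: filterlim_ident)
      ultimately show "((\<lambda>h. L2_norm (\<lambda>x. T (r\<^sup>2 * h) (?c f) x - ?c f x)) \<longlongrightarrow> 0) (at_right 0)"
        by (rule filterlim_compose)
    qed
    ultimately show "((\<lambda>h. L2_norm (\<lambda>x. S r h f x - f x)) \<longlongrightarrow> 0) (at_right 0)"
      by - (rule Lim_transform_eventually[where f = "\<lambda>h. sqrt (1 / r ^ homdim deg) * L2_norm (\<lambda>x. T (r\<^sup>2 * h) (?c f) x - ?c f x)"],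
        simp, rule eventually_mono[OF eventually_at_right_less], simp)
  next
    fix h k :: real and f :: "real ^ 'n \<Rightarrow> real" assume h: "h \<ge> 0" and k: "k \<ge> 0" and f: "f \<in> L2"
    have "AE x in lborel. T (r\<^sup>2 * h + r\<^sup>2 * k) (?c f) (dil deg r x) = T (r\<^sup>2 * h) (T (r\<^sup>2 * k) (?c f)) (dil deg r x)"
      by (rule AE_dil[OF T_add[OF rt[OF h] rt[OF k] c[OF f]] r])
    then show "AE x in lborel. S r (h + k) f x = S r h (S r k f) x"
      using r by (simp add: S_def distrib_left)
  qed
qed

text \<open>Conjugation by the dilation multiplies the sub-Laplacian by a power r^2 that the change
  of time compensates; the closure inherits this from \<open>closure_graph_dil\<close>.\<close>

lemma S_generator:
  assumes r: "r > 0"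
  shows "generator_graph (S r) = generator_graph T"
proof -
  have r': "1 / r > 0" using r by simp
  let ?c = "\<lambda>f y. f (dil deg (1 / r) y)"
  have key: "(f, u) \<in> generator_graph (S r) \<longleftrightarrow> (?c f, \<lambda>y. (1 / r)\<^sup>2 * ?c u y) \<in> generator_graph T"
    if f: "f \<in> L2" and u: "u \<in> L2" for f u
  proof -
    let ?g = "\<lambda>h. L2_norm (\<lambda>x. (T h (?c f) x - ?c f x) / h - (1 / r)\<^sup>2 * ?c u x)"
    have cf: "?c f \<in> L2" "?c u \<in> L2" by (rule L2_dil[OF r' f], rule L2_dil[OF r' u])
    have eq: "L2_norm (\<lambda>x. (S r h f x - f x) / h - u x) = r\<^sup>2 * (sqrt (1 / r ^ homdim deg) * ?g (r\<^sup>2 * h))"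
      if h: "h > 0" for h
    proof -
      let ?w = "\<lambda>x. (T (r\<^sup>2 * h) (?c f) x - ?c f x) / (r\<^sup>2 * h) - (1 / r)\<^sup>2 * ?c u x"
      have m: "?w \<in> borel_measurable borel"
        using h cf by (intro L2_measurable L2_diff L2_divide L2_cmult T_L2) auto
      have "(\<lambda>x. (S r h f x - f x) / h - u x) = (\<lambda>x. r\<^sup>2 * ?w (dil deg r x))"
      proof
        fix x
        have "(a / h - b) = r\<^sup>2 * (a / (r\<^sup>2 * h) - (1 / r)\<^sup>2 * b)" for a b
          using r h by (simp add: field_simps)
        from this[of "S r h f x - f x" "u x"]
        show "(S r h f x - f x) / h - u x = r\<^sup>2 * ?w (dil deg r x)" using r by (simp add: S_def)
      qed
      then have "L2_norm (\<lambda>x. (S r h f x - f x) / h - u x) = \<bar>r\<^sup>2\<bar> * L2_norm (\<lambda>x. ?w (dil deg r x))"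
        by (simp only: L2_norm_cmult)
      also have "L2_norm (\<lambda>x. ?w (dil deg r x)) = sqrt (1 / r ^ homdim deg) * L2_norm ?w"
        by (rule L2_norm_dil[OF r m])
      finally show ?thesis by simp
    qed
    define C where "C = r\<^sup>2 * sqrt (1 / r ^ homdim deg)"
    have C: "C > 0" using r by (simp add: C_def)
    have f1: "filterlim (\<lambda>h. r\<^sup>2 * h) (at_right 0) (at_right 0)"
      using r by (intro filterlim_times_pos[where l = 0 and c = "r\<^sup>2"]) (auto simp: filterlim_ident)
    have f2: "filterlim (\<lambda>h. (1 / r\<^sup>2) * h) (at_right 0) (at_right 0)"
      using r by (intro filterlim_times_pos[where l = 0 and c = "1 / r\<^sup>2"]) (auto simp: filterlim_ident)
    have "((\<lambda>h. L2_norm (\<lambda>x. (S r h f x - f x) / h - u x)) \<longlongrightarrow> 0) (at_right 0) \<longleftrightarrow> ((\<lambda>h. C * ?g (r\<^sup>2 * h)) \<longlongrightarrow> 0) (at_right 0)"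
      by (rule tendsto_cong, rule eventually_mono[OF eventually_at_right_less]) (simp add: eq C_def)
    also have "\<dots> \<longleftrightarrow> ((\<lambda>h. ?g (r\<^sup>2 * h)) \<longlongrightarrow> 0) (at_right 0)"
      using C by (simp add: tendsto_mult_left_iff[of C _ 0, simplified])
    also have "\<dots> \<longleftrightarrow> (?g \<longlongrightarrow> 0) (at_right 0)"
    proof
      assume "((\<lambda>h. ?g (r\<^sup>2 * h)) \<longlongrightarrow> 0) (at_right 0)"
      from filterlim_compose[OF this f2] show "(?g \<longlongrightarrow> 0) (at_right 0)" using r by simp
    next
      assume "(?g \<longlongrightarrow> 0) (at_right 0)"
      from filterlim_compose[OF this f1] show "((\<lambda>h. ?g (r\<^sup>2 * h)) \<longlongrightarrow> 0) (at_right 0)" .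
    qed
    finally show ?thesis
      using f u cf L2_cmult[OF cf(2), of "(1 / r)\<^sup>2"] by (simp add: generator_graph_def)
  qed
  have bk: "(f, u) \<in> closure_graph L" if "(?c f, \<lambda>y. (1 / r)\<^sup>2 * ?c u y) \<in> closure_graph L" for f u
    using closure_graph_dil[OF r that] r by (simp add: power_divide)
  show ?thesis
  proof (intro set_eqI iffI)
    fix z :: "(real ^ 'n \<Rightarrow> real) \<times> (real ^ 'n \<Rightarrow> real)" assume z: "z \<in> generator_graph (S r)"
    obtain f u where fu: "z = (f, u)" by (cases z)
    have "f \<in> L2" "u \<in> L2" using z fu by (simp_all add: generator_graph_def)
    then show "z \<in> generator_graph T" using key[of f u] z fu bk[of f u] gen_eq by simp
  next
    fix z :: "(real ^ 'n \<Rightarrow> real) \<times> (real ^ 'n \<Rightarrow> real)" assume z: "z \<in> generator_graph T"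
    obtain f u where fu: "z = (f, u)" by (cases z)
    have "f \<in> L2" "u \<in> L2" using z fu by (simp_all add: generator_graph_def)
    then show "z \<in> generator_graph (S r)" using key[of f u] z fu closure_graph_dil[OF r', of f u] gen_eq by simp
  qed
qed

text \<open>\<open>S r\<close> and \<open>T\<close> have the same generator, hence agree on test
  functions. A change of variables, with Jacobian r^Q, reads off the kernel of
  \<open>S r\<close>.\<close>

theorem p_scaling:
  assumes r: "r > 0" and t: "t > 0"
  shows "p t x = r ^ homdim deg * p (r\<^sup>2 * t) (dil deg r x)"
proof -
  have r': "1 / r > 0" and rt: "r\<^sup>2 * t > 0" using r t by auto
  have cq: "continuous_on UNIV (\<lambda>x. r ^ homdim deg * p (r\<^sup>2 * t) (dil deg r x))"
    by (intro continuous_on_mult continuous_on_const continuous_on_compose2[OF cont_p[OF rt, of UNIV]]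
        linear_continuous_on bounded_linear_dil) auto
  show ?thesis
  proof (rule kernel_unique[OF cont_p[OF t] cq])
    fix f k :: "real ^ 'n \<Rightarrow> real"
    assume fk: "test_fun f" "\<And>x. f x \<ge> 0" "test_fun k" "\<And>x. k x \<ge> 0"
    let ?f = "\<lambda>y. f (dil deg (1 / r) y)"
    have f': "?f \<in> L2" by (rule L2_dil[OF r' test_fun_L2[OF fk(1)]])
    have a1: "AE g in lborel. T t f g = S r t f g"
      by (rule generator_determines_semigroup[OF cs S_contraction[OF r] S_generator[OF r, symmetric] test_gen[OF fk(1)]])
        (use t in simp)
    have a2: "AE g in lborel. S r t f g = gconv mul ?f (p (r\<^sup>2 * t)) (dil deg r g)"
      unfolding S_def by (rule AE_dil[OF T_conv[OF rt f'] r])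
    have a3: "gconv mul ?f (p (r\<^sup>2 * t)) (dil deg r g) = gconv mul f (\<lambda>x. r ^ homdim deg * p (r\<^sup>2 * t) (dil deg r x)) g" for g
    proof -
      have c: "continuous_on UNIV (\<lambda>a. ?f a * p (r\<^sup>2 * t) (mul (- a) (dil deg r g)))"
        by (intro continuous_on_mult continuous_on_compose2[OF cont_p[OF rt, of UNIV]]
            continuous_on_compose2[OF smooth_continuous_on[OF test_fun_smooth[OF fk(1)], of UNIV]]
            continuous_mul continuous_on_minus continuous_on_id continuous_on_const linear_continuous_on bounded_linear_dil) auto
      have "gconv mul ?f (p (r\<^sup>2 * t)) (dil deg r g) =
          r ^ homdim deg * (LINT a|lborel. ?f (dil deg r a) * p (r\<^sup>2 * t) (mul (- dil deg r a) (dil deg r g)))"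
        unfolding gconv_def by (rule integral_dil(1)[OF r borel_measurable_continuous_onI[OF c]])
      also have "\<dots> = (LINT a|lborel. f a * (r ^ homdim deg * p (r\<^sup>2 * t) (dil deg r (mul (- a) g))))"
        unfolding integral_mult_right_zero[symmetric] using r by (simp add: dil_mul[OF r] mult.left_commute)
      finally show ?thesis by (simp add: gconv_def)
    qed
    have a4: "AE g in lborel. T t f g = gconv mul f (p t) g" by (rule T_conv[OF t test_fun_L2[OF fk(1)]])
    from a1 a2 a4 have "AE g in lborel. gconv mul f (p t) g = gconv mul f (\<lambda>x. r ^ homdim deg * p (r\<^sup>2 * t) (dil deg r x)) g"
      by eventually_elim (simp add: a3)
    then show "(LINT g|lborel. k g * gconv mul f (p t) g) =
        (LINT g|lborel. k g * gconv mul f (\<lambda>x. r ^ homdim deg * p (r\<^sup>2 * t) (dil deg r x)) g)"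
      using gconv_pairing_integrable[OF fk(1,3) cont_p[OF t]] gconv_pairing_integrable[OF fk(1,3) cq]
      by (intro integral_cong_AE) (auto elim: eventually_mono)
  qed
qed

end

section \<open>The semigroup law for the heat kernel\<close>

lemma L2_cong_AE:
  assumes "f \<in> L2" "g \<in> borel_measurable borel" "AE x in lborel. f x = g x"
  shows "g \<in> L2"
proof -
  have "integrable lborel (\<lambda>x. (f x)\<^sup>2) \<longleftrightarrow> integrable lborel (\<lambda>x. (g x)\<^sup>2)"
    by (rule integrable_cong_AE)
      (use assms L2_measurable[OF assms(1)] in \<open>auto elim: eventually_mono\<close>)
  then show ?thesis using assms by (simp add: L2_def)
qed

context stratified_group
begin

lemma L2_norm_left:
  assumes f: "f \<in> borel_measurable borel"
  shows "L2_norm (\<lambda>x. f (mul a x)) = L2_norm f"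
proof -
  have "(\<lambda>x. (f x)\<^sup>2) \<in> borel_measurable borel" using f by (rule borel_measurable_power)
  from integral_left[OF this, of a] show ?thesis unfolding L2_norm_def by (rule arg_cong)
qed

lemma L2_left:
  assumes f: "f \<in> L2"
  shows "(\<lambda>x. f (mul a x)) \<in> L2"
proof -
  have m: "mul a \<in> borel_measurable borel"
    by (rule borel_measurable_continuous_onI[OF smooth_continuous_on[OF smooth_left]])
  have f2: "(\<lambda>x. (f x)\<^sup>2) \<in> borel_measurable borel" by (rule borel_measurable_power[OF L2_measurable[OF f]])
  have "integrable (distr lborel borel (mul a)) (\<lambda>x. (f x)\<^sup>2)" unfolding distr_left using f by (simp add: L2_def)
  moreover have "integrable (distr lborel borel (mul a)) (\<lambda>x. (f x)\<^sup>2) \<longleftrightarrow> integrable lborel (\<lambda>x. (f (mul a x))\<^sup>2)"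
    by (rule integrable_distr_eq) (simp_all only: m f2 measurable_lborel1 measurable_lborel2)
  ultimately have "integrable lborel (\<lambda>x. (f (mul a x))\<^sup>2)" by simp
  then show ?thesis
    using measurable_compose[OF m L2_measurable[OF f]] by (simp add: L2_def)
qed

end

context heat
begin

lemma p_kernel_measurable [measurable]:
  assumes "s > 0" "f \<in> borel_measurable N" "g \<in> borel_measurable N"
  shows "(\<lambda>z. p s (mul (f z) (g z))) \<in> borel_measurable N"
  using measurable_compose[OF measurable_mul[OF assms(2,3)] measurable_p[OF assms(1)]] .

lemma cont_p_mul:
  assumes "s > 0" "continuous_on A f" "continuous_on A g"
  shows "continuous_on A (\<lambda>z. p s (mul (f z) (g z)))"
  by (rule continuous_on_compose2[OF cont_p[OF assms(1), of UNIV] continuous_mul[OF assms(2,3)]]) simp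

text \<open>The convolution of two heat kernels. It takes extended values because its finiteness is
  part of what has to be shown.\<close>

definition E :: "real \<Rightarrow> real \<Rightarrow> real ^ 'n \<Rightarrow> ennreal" where
  "E t s x = (\<integral>\<^sup>+a. ennreal (p t a * p s (mul (- a) x)) \<partial>lborel)"

text \<open>Associativity of convolution for nonnegative functions, by Tonelli's theorem and left
  invariance.\<close>

lemma nn_E:
  assumes t: "t > 0" and s: "s > 0" and f: "test_fun f" "\<And>x. f x \<ge> 0"
  shows "(\<integral>\<^sup>+b. ennreal (gconv mul f (p t) b * p s (mul (- b) g)) \<partial>lborel) =
    (\<integral>\<^sup>+a. ennreal (f a) * E t s (mul (- a) g) \<partial>lborel)"
proof -
  have mf [measurable]: "f \<in> borel_measurable borel"
    by (intro borel_measurable_continuous_onI smooth_continuous_on test_fun_smooth f)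
  note [measurable] = measurable_p[OF t] measurable_p[OF s]
  note mk [measurable] = p_kernel_measurable[OF t] p_kernel_measurable[OF s]
  have pos: "f a \<ge> 0" "p t b \<ge> 0" "p s b \<ge> 0" for a b using f p_nonneg t s by auto
  have c: "ennreal (gconv mul f (p t) b) = (\<integral>\<^sup>+a. ennreal (f a * p t (mul (- a) b)) \<partial>lborel)" for b
    unfolding gconv_def
    by (rule nn_integral_eq_integral[symmetric, OF gconv_test_integrable[OF f(1) cont_p[OF t]]]) (simp add: pos)
  have "(\<integral>\<^sup>+b. ennreal (gconv mul f (p t) b * p s (mul (- b) g)) \<partial>lborel) =
      (\<integral>\<^sup>+b. (\<integral>\<^sup>+a. ennreal (f a * p t (mul (- a) b)) * ennreal (p s (mul (- b) g)) \<partial>lborel) \<partial>lborel)"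
  proof (rule nn_integral_cong)
    fix b
    have "gconv mul f (p t) b \<ge> 0" unfolding gconv_def by (rule integral_nonneg_AE) (simp add: pos)
    then have "ennreal (gconv mul f (p t) b * p s (mul (- b) g)) = ennreal (gconv mul f (p t) b) * ennreal (p s (mul (- b) g))"
      by (simp add: ennreal_mult pos)
    also have "\<dots> = (\<integral>\<^sup>+a. ennreal (f a * p t (mul (- a) b)) * ennreal (p s (mul (- b) g)) \<partial>lborel)"
      unfolding c by (rule nn_integral_multc[symmetric]) measurable
    finally show "ennreal (gconv mul f (p t) b * p s (mul (- b) g)) =
      (\<integral>\<^sup>+a. ennreal (f a * p t (mul (- a) b)) * ennreal (p s (mul (- b) g)) \<partial>lborel)" .
  qed
  also have "\<dots> = (\<integral>\<^sup>+a. (\<integral>\<^sup>+b. ennreal (f a * p t (mul (- a) b)) * ennreal (p s (mul (- b) g)) \<partial>lborel) \<partial>lborel)"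
    by (rule lborel_pair.Fubini') measurable
  also have "\<dots> = (\<integral>\<^sup>+a. ennreal (f a) * E t s (mul (- a) g) \<partial>lborel)"
  proof (rule nn_integral_cong)
    fix a
    have "(\<integral>\<^sup>+b. ennreal (f a * p t (mul (- a) b)) * ennreal (p s (mul (- b) g)) \<partial>lborel) =
        (\<integral>\<^sup>+b. ennreal (f a * p t (mul (- a) (mul a b))) * ennreal (p s (mul (- mul a b) g)) \<partial>lborel)"
      by (rule nn_integral_left[symmetric]) measurable
    also have "\<dots> = (\<integral>\<^sup>+b. ennreal (f a) * ennreal (p t b * p s (mul (- b) (mul (- a) g))) \<partial>lborel)"
      by (rule nn_integral_cong) (simp add: neg_mul assoc pos ennreal_mult mult.assoc)
    also have "\<dots> = ennreal (f a) * E t s (mul (- a) g)"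
      unfolding E_def by (rule nn_integral_cmult) measurable
    finally show "(\<integral>\<^sup>+b. ennreal (f a * p t (mul (- a) b)) * ennreal (p s (mul (- b) g)) \<partial>lborel) =
        ennreal (f a) * E t s (mul (- a) g)" .
  qed
  finally show ?thesis .
qed

text \<open>In essence T_s T_t f = T_{t+s} f. The difficulty is that \<open>gconv\<close> is a
  Bochner integral, equal to 0 when it diverges, so the formula for \<open>T s\<close> does not by
  itself control the nonnegative integral. Truncations, for which convergence is automatic, and
  monotone convergence supply integrability.\<close>

lemma conv_E_AE:
  assumes t: "t > 0" and s: "s > 0" and f: "test_fun f" "\<And>x. f x \<ge> 0"
  shows "AE g in lborel. (\<integral>\<^sup>+a. ennreal (f a) * E t s (mul (- a) g) \<partial>lborel) = ennreal (gconv mul f (p (t + s)) g)"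
proof -
  define c where "c = gconv mul f (p t)"
  have pos: "f a \<ge> 0" "p t b \<ge> 0" "p s b \<ge> 0" for a b using f p_nonneg t s by auto
  have fL: "f \<in> L2" by (rule test_fun_L2[OF f(1)])
  have c0: "c b \<ge> 0" for b unfolding c_def gconv_def by (rule integral_nonneg_AE) (simp add: pos)
  have mf [measurable]: "f \<in> borel_measurable borel" by (rule L2_measurable[OF fL])
  note mk [measurable] = p_kernel_measurable[OF t] p_kernel_measurable[OF s]
  have mc [measurable]: "c \<in> borel_measurable borel"
    unfolding c_def gconv_def by (rule lborel.borel_measurable_lebesgue_integral) measurable
  have cT: "AE x in lborel. T t f x = c x" unfolding c_def by (rule T_conv[OF t fL])
  have TL: "T t f \<in> L2" by (rule T_L2[OF less_imp_le[OF t] fL])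
  have cL: "c \<in> L2" by (rule L2_cong_AE[OF TL mc cT])
  \<comment> \<open>Truncation of \<open>c\<close> to balls: increasing to \<open>c\<close>, and
    integrable against every translate of \<open>p s\<close>.\<close>
  define k where "k = (\<lambda>n x. indicator (cball 0 (real n)) x * c x)"
  have kL: "k n \<in> L2" for n
    by (rule L2_dominated[OF cL]) (auto simp: k_def indicator_def)
  have ckL: "(\<lambda>x. c x - k n x) \<in> L2" for n by (rule L2_diff[OF cL kL])
  have s0: "s \<ge> 0" using s by simp
  have A1: "AE g in lborel. T s c g = gconv mul c (p s) g" by (rule T_conv[OF s cL])
  have A2: "AE g in lborel. \<forall>n. T s (k n) g = gconv mul (k n) (p s) g"
    unfolding AE_all_countable using T_conv[OF s kL] by blast
  have A3: "AE g in lborel. \<forall>n. T s (\<lambda>x. c x - k n x) g = gconv mul (\<lambda>x. c x - k n x) (p s) g"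
    unfolding AE_all_countable using T_conv[OF s ckL] by blast
  have A4: "AE g in lborel. \<forall>n. T s (\<lambda>x. c x - k n x) g = T s c g - T s (k n) g"
    unfolding AE_all_countable using T_diff[OF s0 cL kL] by blast
  have A5: "AE g in lborel. T s c g = gconv mul f (p (t + s)) g"
  proof -
    have d: "(\<lambda>x. T t f x - c x) \<in> L2" by (rule L2_diff[OF TL cL])
    have "AE x in lborel. T t f x - c x = 0" using cT by eventually_elim simp
    then have "L2_norm (\<lambda>x. T t f x - c x) = L2_norm (\<lambda>x :: real ^ 'n. 0)"
      by - (rule L2_norm_cong_AE[OF d L2_zero])
    moreover have "L2_norm (\<lambda>x :: real ^ 'n. 0) = 0" by (simp add: L2_norm_def)
    ultimately have "L2_norm (T s (\<lambda>x. T t f x - c x)) = 0"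
      using T_norm[OF s0 d] L2_norm_nonneg[of "T s (\<lambda>x. T t f x - c x)"] by simp
    then have "AE x in lborel. T s (\<lambda>x. T t f x - c x) x = 0" by (rule L2_norm_0_AE[OF T_L2[OF s0 d]])
    moreover have "AE x in lborel. T s (\<lambda>x. T t f x - c x) x = T s (T t f) x - T s c x"
      by (rule T_diff[OF s0 TL cL])
    moreover have "AE x in lborel. T (s + t) f x = T s (T t f) x" using T_add[OF s0 _ fL, of t] t by simp
    moreover have "AE x in lborel. T (s + t) f x = gconv mul f (p (s + t)) x" using T_conv[OF _ fL] s t by simp
    ultimately show ?thesis by eventually_elim (simp add: add.commute)
  qed
  have "AE g in lborel. (\<integral>\<^sup>+b. ennreal (c b * p s (mul (- b) g)) \<partial>lborel) = ennreal (gconv mul f (p (t + s)) g)"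
    using A1 A2 A3 A4 A5
  proof eventually_elim
    case (elim g)
    let ?r = "\<lambda>b. p s (mul (- b) g)"
    \<comment> \<open>The convolution of the remainder is nonnegative whether or not it converges,
      as a divergent integral has value 0. Linearity of \<open>T s\<close> then bounds the truncated
      convolutions.\<close>
    have kn: "gconv mul (k n) (p s) g \<le> gconv mul f (p (t + s)) g" for n
    proof -
      have "gconv mul (\<lambda>x. c x - k n x) (p s) g \<ge> 0"
        unfolding gconv_def by (rule integral_nonneg_AE) (auto simp: pos k_def c0 indicator_def)
      then show ?thesis using elim by (metis diff_ge_0_iff_ge)
    qed
    have r: "continuous_on UNIV ?r"
      by (intro cont_p_mul[OF s] continuous_on_minus continuous_on_id continuous_on_const)
    note mr = borel_measurable_continuous_onI[OF r]
    have ik: "integrable lborel (\<lambda>b. k n b * ?r b)" for n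
    proof -
      have "integrable lborel (\<lambda>b. indicator (cball 0 (real n)) b *\<^sub>R (?r b)\<^sup>2)"
        by (rule borel_integrable_compact[OF compact_cball]) (intro continuous_on_power continuous_on_subset[OF r], simp)
      moreover have "(\<lambda>b. indicator (cball 0 (real n)) b *\<^sub>R (?r b)\<^sup>2) = (\<lambda>b. (indicator (cball 0 (real n)) b * ?r b)\<^sup>2)"
        by (auto simp: indicator_def)
      moreover have "(\<lambda>b. indicator (cball 0 (real n)) b * ?r b) \<in> borel_measurable borel"
        by (intro borel_measurable_times borel_measurable_indicator borel_measurable_continuous_onI[OF r]) simp
      ultimately have "(\<lambda>b. indicator (cball 0 (real n)) b * ?r b) \<in> L2" by (simp add: L2_def)
      from L2_prod_integrable[OF cL this] show ?thesis by (simp add: k_def mult.assoc mult.left_commute)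
    qed
    have n: "(\<integral>\<^sup>+b. ennreal (k n b * ?r b) \<partial>lborel) = ennreal (gconv mul (k n) (p s) g)" for n
      unfolding gconv_def by (rule nn_integral_eq_integral[OF ik]) (auto simp: pos c0 k_def)
    have sup: "(SUP n. ennreal (k n b * ?r b)) = ennreal (c b * ?r b)" for b
    proof (rule antisym)
      show "(SUP n. ennreal (k n b * ?r b)) \<le> ennreal (c b * ?r b)"
        by (rule SUP_least) (auto simp: k_def indicator_def c0 pos intro!: ennreal_leI)
      obtain n where "norm b \<le> real n" using real_arch_simple by blast
      then have "k n b = c b" by (simp add: k_def)
      then show "ennreal (c b * ?r b) \<le> (SUP n. ennreal (k n b * ?r b))" by (metis SUP_upper UNIV_I)
    qed
    have "(\<integral>\<^sup>+b. ennreal (c b * ?r b) \<partial>lborel) = (\<integral>\<^sup>+b. (SUP n. ennreal (k n b * ?r b)) \<partial>lborel)"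
      by (simp add: sup)
    also have "\<dots> = (SUP n. \<integral>\<^sup>+b. ennreal (k n b * ?r b) \<partial>lborel)"
    proof (rule nn_integral_monotone_convergence_SUP)
      show "incseq (\<lambda>n b. ennreal (k n b * ?r b))"
        by (auto simp: incseq_def le_fun_def k_def indicator_def c0 pos intro!: ennreal_leI)
      show "(\<lambda>b. ennreal (k n b * ?r b)) \<in> borel_measurable lborel" for n
        unfolding k_def using mc mr
        by (intro measurable_compose[OF _ measurable_ennreal] borel_measurable_times borel_measurable_indicator) simp_all
    qed
    also have "\<dots> \<le> ennreal (gconv mul f (p (t + s)) g)"
      unfolding n by (rule SUP_least) (rule ennreal_leI[OF kn])
    finally have fin: "(\<integral>\<^sup>+b. ennreal (c b * ?r b) \<partial>lborel) \<le> ennreal (gconv mul f (p (t + s)) g)" .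
    have "integrable lborel (\<lambda>b. c b * ?r b)"
    proof (rule integrableI_bounded)
      show "(\<integral>\<^sup>+b. ennreal (norm (c b * ?r b)) \<partial>lborel) < \<infinity>"
        using le_less_trans[OF fin ennreal_less_top] by (simp add: c0 pos)
    qed measurable
    then have "(\<integral>\<^sup>+b. ennreal (c b * ?r b) \<partial>lborel) = ennreal (gconv mul c (p s) g)"
      unfolding gconv_def by (rule nn_integral_eq_integral) (auto simp: pos c0)
    then show ?case using elim by simp
  qed
  then show ?thesis unfolding c_def by (simp add: nn_E[OF t s f])
qed

lemma E_Fatou:
  assumes t: "t > 0" and s: "s > 0" and x: "x \<longlonglongrightarrow> x0"
  shows "E t s x0 \<le> liminf (\<lambda>n. E t s (x n))"
proof -
  have "(\<lambda>n. ennreal (p t a * p s (mul (- a) (x n)))) \<longlonglongrightarrow> ennreal (p t a * p s (mul (- a) x0))" for a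
  proof -
    have "continuous_on UNIV (\<lambda>y. p s (mul (- a) y))"
      by (intro cont_p_mul[OF s] continuous_on_const continuous_on_id)
    from continuous_on_tendsto_compose[OF this x] show ?thesis
      by (intro tendsto_ennrealI tendsto_mult_left) auto
  qed
  then have l: "liminf (\<lambda>n. ennreal (p t a * p s (mul (- a) (x n)))) = ennreal (p t a * p s (mul (- a) x0))" for a
    by (intro lim_imp_Liminf) auto
  note [measurable] = measurable_p[OF t] p_kernel_measurable[OF s]
  have "E t s x0 = (\<integral>\<^sup>+a. liminf (\<lambda>n. ennreal (p t a * p s (mul (- a) (x n)))) \<partial>lborel)"
    by (simp add: E_def l)
  also have "\<dots> \<le> liminf (\<lambda>n. E t s (x n))"
    unfolding E_def by (rule nn_integral_liminf) measurable
  finally show ?thesis .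
qed

text \<open>If E exceeded the kernel at a point, lower semicontinuity of E (by Fatou's lemma) and
  continuity of the kernel would keep them apart on a neighbourhood. Averaging against a small bump
  contradicts the almost everywhere identity \<open>conv_E_AE\<close>.\<close>

lemma E_le:
  assumes t: "t > 0" and s: "s > 0"
  shows "E t s x0 \<le> ennreal (p (t + s) x0)"
proof (rule ccontr)
  assume "\<not> ?thesis"
  then obtain M where M: "ennreal (p (t + s) x0) < ennreal M" "ennreal M < E t s x0" "M \<ge> 0"
    using dense[of "ennreal (p (t + s) x0)" "E t s x0"]
    by (metis ennreal_cases less_top_ennreal not_le order.strict_trans top.not_eq_extremum top.extremum_strict)
  have ts: "t + s > 0" using t s by simp
  have pM: "p (t + s) x0 < M" using M p_nonneg[OF ts] by (simp add: ennreal_less_iff)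
  \<comment> \<open>A level strictly between, so that near x_0 the kernel stays below
    \<open>M'\<close> while E stays above \<open>M\<close>.\<close>
  define M' where "M' = (p (t + s) x0 + M) / 2"
  have M': "p (t + s) x0 < M'" "M' < M" using pM by (auto simp: M'_def)
  have "\<exists>d>0. \<forall>x. dist x x0 < d \<longrightarrow> ennreal M < E t s x"
  proof (rule ccontr)
    assume "\<not> ?thesis"
    then have "\<forall>n. \<exists>x. dist x x0 < 1 / real (Suc n) \<and> E t s x \<le> ennreal M"
      by (metis not_less of_nat_0_less_iff zero_less_Suc zero_less_divide_1_iff)
    then obtain x where x: "\<And>n. dist (x n) x0 < 1 / real (Suc n)" "\<And>n. E t s (x n) \<le> ennreal M"
      by metis
    have "(\<lambda>n. dist (x n) x0) \<longlonglongrightarrow> 0"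
    proof (rule tendsto_sandwich[OF _ _ tendsto_const])
      show "(\<lambda>n. 1 / real (Suc n)) \<longlonglongrightarrow> 0" using LIMSEQ_inverse_real_of_nat by (simp add: inverse_eq_divide)
      show "\<forall>\<^sub>F n in sequentially. dist (x n) x0 \<le> 1 / real (Suc n)"
        using x(1) by (intro always_eventually allI less_imp_le)
    qed simp
    then have "x \<longlonglongrightarrow> x0" by (simp add: tendsto_dist_iff[symmetric])
    then have "E t s x0 \<le> liminf (\<lambda>n. E t s (x n))" by (rule E_Fatou[OF t s])
    also have "\<dots> \<le> ennreal M" by (rule Liminf_le) (use x(2) in auto)
    finally show False using M by simp
  qed
  then obtain d where d: "d > 0" "\<And>x. dist x x0 < d \<Longrightarrow> ennreal M < E t s x" by blast
  have "open (ball x0 d \<inter> {x. p (t + s) x < M'})"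
    by (intro open_Int open_ball open_Collect_less cont_p[OF ts] continuous_on_const)
  moreover have "continuous_on UNIV (\<lambda>z :: (real ^ 'n) \<times> (real ^ 'n). mul (- fst z) (snd z))"
    by (intro continuous_mul continuous_on_minus continuous_on_fst continuous_on_snd continuous_on_id)
  ultimately have "open ((\<lambda>z. mul (- fst z) (snd z)) -` (ball x0 d \<inter> {x. p (t + s) x < M'}))"
    by (rule open_vimage)
  then obtain A B where AB: "open A" "open B" "(0, x0) \<in> A \<times> B"
      "A \<times> B \<subseteq> (\<lambda>z. mul (- fst z) (snd z)) -` (ball x0 d \<inter> {x. p (t + s) x < M'})"
    by (rule open_prod_elim[where x = "(0, x0)"]) (use d M' in auto)
  obtain d1 where d1: "d1 > 0" "ball 0 d1 \<subseteq> A" using AB by (meson mem_Sigma_iff open_contains_ball)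
  let ?f = "bump 0 d1 :: real ^ 'n \<Rightarrow> real"
  have tf: "test_fun ?f" by (rule test_fun_bump[OF d1(1)])
  have If: "(LINT x|lborel. ?f x) > 0"
    using d1 by (simp add: test_fun_integral_pos[OF tf bump_nonneg, of 0] bump_pos_iff)
  have "\<exists>g\<in>B. (\<integral>\<^sup>+a. ennreal (?f a) * E t s (mul (- a) g) \<partial>lborel) = ennreal (gconv mul ?f (p (t + s)) g)"
    by (rule AE_open_point[OF conv_E_AE[OF t s tf bump_nonneg] AB(2)]) (use AB(3) in auto)
  then obtain g where g: "g \<in> B" "(\<integral>\<^sup>+a. ennreal (?f a) * E t s (mul (- a) g) \<partial>lborel) = ennreal (gconv mul ?f (p (t + s)) g)"
    by blast
  have near: "ennreal M < E t s (mul (- a) g)" "p (t + s) (mul (- a) g) < M'" if "?f a > 0" for a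
  proof -
    have "a \<in> A" using that d1 by (auto simp: bump_pos_iff dist_commute)
    then have "(a, g) \<in> (\<lambda>z. mul (- fst z) (snd z)) -` (ball x0 d \<inter> {x. p (t + s) x < M'})" using AB(4) g(1) by blast
    then show "ennreal M < E t s (mul (- a) g)" "p (t + s) (mul (- a) g) < M'"
      using d(2) by (auto simp: dist_commute)
  qed
  have "ennreal (M * (LINT x|lborel. ?f x)) = (\<integral>\<^sup>+a. ennreal (M * ?f a) \<partial>lborel)"
    using test_fun_integrable[OF tf] M(3)
    by (subst nn_integral_eq_integral) (simp_all add: bump_nonneg)
  also have "\<dots> \<le> (\<integral>\<^sup>+a. ennreal (?f a) * E t s (mul (- a) g) \<partial>lborel)"
  proof (rule nn_integral_mono)
    fix a
    show "ennreal (M * ?f a) \<le> ennreal (?f a) * E t s (mul (- a) g)"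
    proof (cases "?f a > 0")
      case True
      then have "ennreal (?f a) * ennreal M \<le> ennreal (?f a) * E t s (mul (- a) g)"
        using near(1) by (intro mult_left_mono) (auto intro: less_imp_le)
      then show ?thesis using True M(3) by (simp add: ennreal_mult mult.commute)
    next
      case False
      then have "?f a = 0" using bump_nonneg[of 0 d1 a] by simp
      then show ?thesis by simp
    qed
  qed
  also have "\<dots> = ennreal (gconv mul ?f (p (t + s)) g)" by (rule g(2))
  also have "gconv mul ?f (p (t + s)) g \<le> (LINT a|lborel. M' * ?f a)"
    unfolding gconv_def
  proof (rule integral_mono)
    show "integrable lborel (\<lambda>a. ?f a * p (t + s) (mul (- a) g))" by (rule gconv_test_integrable[OF tf cont_p[OF ts]])
    show "integrable lborel (\<lambda>a. M' * ?f a)" using test_fun_integrable[OF tf] by simp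
    show "?f a * p (t + s) (mul (- a) g) \<le> M' * ?f a" for a
    proof (cases "?f a > 0")
      case True
      then show ?thesis using near(2)[OF True] by (simp add: mult.commute)
    next
      case False
      then have "?f a = 0" using bump_nonneg[of 0 d1 a] by simp
      then show ?thesis by simp
    qed
  qed
  then have "ennreal (gconv mul ?f (p (t + s)) g) \<le> ennreal (M' * (LINT a|lborel. ?f a))"
    by (intro ennreal_leI) simp
  finally have "M * (LINT x|lborel. ?f x) \<le> M' * (LINT a|lborel. ?f a)"
    using M' p_nonneg[OF ts, of x0] If by (simp add: ennreal_le_iff)
  then show False using If M' by simp
qed

text \<open>As \<open>p t\<close> is even, its squared norm is the convolution E t t at the
  identity, which is at most p_{2t}(0).\<close>

lemma p_L2:
  assumes t: "t > 0"
  shows "p t \<in> L2"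
proof -
  have "(\<integral>\<^sup>+a. ennreal ((p t a)\<^sup>2) \<partial>lborel) = E t t 0"
    unfolding E_def by (rule nn_integral_cong) (simp add: p_symmetric[OF t] power2_eq_square)
  also have "\<dots> < \<infinity>" using le_less_trans[OF E_le[OF t t] ennreal_less_top] by simp
  finally have "integrable lborel (\<lambda>a. (p t a)\<^sup>2)"
    using measurable_p[OF t] by (intro integrableI_bounded) auto
  then show ?thesis using measurable_p[OF t] by (simp add: L2_def)
qed

lemma p_right_left: "s > 0 \<Longrightarrow> p s (mul (- a) x) = p s (mul (- x) a)"
  using p_symmetric[of s "mul (- x) a"] by (simp add: neg_mul)

lemma p_translate_L2: "s > 0 \<Longrightarrow> (\<lambda>a. p s (mul (- a) x)) \<in> L2"
  and p_translate_norm: "s > 0 \<Longrightarrow> L2_norm (\<lambda>a. p s (mul (- a) x)) = L2_norm (p s)"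
  using L2_left[OF p_L2] L2_norm_left[OF measurable_p] by (simp_all add: p_right_left[of s _ x])

text \<open>Translation is continuous in \<open>L\<^sup>2\<close> at the positive function \<open>p\<^sub>s\<close>: by Fatou's lemma the inner
  product of two translates is lower semicontinuous, and it is at most the square of the norm.\<close>

lemma p_translate_continuous:
  assumes s: "s > 0" and x: "x \<longlonglongrightarrow> x0"
  shows "(\<lambda>n. L2_norm (\<lambda>a. p s (mul (- a) (x n)) - p s (mul (- a) x0))) \<longlonglongrightarrow> 0"
proof -
  define r where "r = (\<lambda>y a. p s (mul (- a) y))"
  define N where "N = (L2_norm (p s))\<^sup>2"
  have rL: "r y \<in> L2" for y unfolding r_def by (rule p_translate_L2[OF s])
  have rN: "ip (r y) (r y) = N" for y
    unfolding L2_norm_sq[symmetric] N_def by (simp add: r_def p_translate_norm[OF s])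
  have rpos: "r y a \<ge> 0" for y a by (simp add: r_def p_nonneg[OF s])
  define i where "i = (\<lambda>n. ip (r (x n)) (r x0))"
  have ile: "i n \<le> N" for n
  proof -
    have "L2_norm (r y) = L2_norm (p s)" for y by (simp add: r_def p_translate_norm[OF s])
    then show ?thesis
      using order_trans[OF abs_ge_self ip_Cauchy_Schwarz[OF rL[of "x n"] rL[of x0]]]
      by (simp add: i_def N_def power2_eq_square)
  qed
  have nn: "ennreal (ip (r y) (r x0)) = (\<integral>\<^sup>+a. ennreal (r y a * r x0 a) \<partial>lborel)" for y
    unfolding ip_def by (rule nn_integral_eq_integral[symmetric, OF L2_prod_integrable[OF rL rL]]) (simp add: rpos)
  have lim: "(\<lambda>n. ennreal (r (x n) a * r x0 a)) \<longlonglongrightarrow> ennreal (r x0 a * r x0 a)" for a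
  proof -
    have "continuous_on UNIV (\<lambda>y. p s (mul (- a) y))"
      by (intro cont_p_mul[OF s] continuous_on_const continuous_on_id)
    from continuous_on_tendsto_compose[OF this x] show ?thesis unfolding r_def
      by (intro tendsto_ennrealI tendsto_mult_right) auto
  qed
  have "ennreal N = (\<integral>\<^sup>+a. liminf (\<lambda>n. ennreal (r (x n) a * r x0 a)) \<partial>lborel)"
    using nn[of x0] lim_imp_Liminf[OF _ lim] by (simp add: rN)
  also have "\<dots> \<le> liminf (\<lambda>n. \<integral>\<^sup>+a. ennreal (r (x n) a * r x0 a) \<partial>lborel)"
    using L2_measurable[OF rL] by (intro nn_integral_liminf) simp
  finally have li: "ennreal N \<le> liminf (\<lambda>n. ennreal (i n))" by (simp add: nn[symmetric] i_def)
  have "i \<longlonglongrightarrow> N"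
  proof (rule order_tendstoI)
    fix y assume y: "y < N"
    show "\<forall>\<^sub>F n in sequentially. y < i n"
    proof (cases "y < 0")
      case True
      have "i n \<ge> 0" for n unfolding i_def ip_def by (intro integral_nonneg_AE) (simp add: rpos)
      then show ?thesis using True by (intro always_eventually) (auto intro: less_le_trans)
    next
      case False
      then have "ennreal y < ennreal N" using y by (simp add: ennreal_less_iff)
      then have "\<forall>\<^sub>F n in sequentially. ennreal y < ennreal (i n)" using li unfolding le_Liminf_iff by blast
      then show ?thesis by eventually_elim (use False in \<open>simp add: ennreal_less_iff\<close>)
    qed
  next
    fix y assume "N < y"
    then show "\<forall>\<^sub>F n in sequentially. i n < y" using ile by (intro always_eventually) (auto intro: le_less_trans)
  qed
  then have "(\<lambda>n. sqrt (2 * N - 2 * i n)) \<longlonglongrightarrow> sqrt (2 * N - 2 * N)" by (intro tendsto_intros)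
  moreover have "L2_norm (\<lambda>a. r (x n) a - r x0 a) = sqrt (2 * N - 2 * i n)" for n
  proof -
    have "ip (\<lambda>a. r (x n) a - r x0 a) (\<lambda>a. r (x n) a - r x0 a) = 2 * N - 2 * i n"
      using rL by (simp add: ip_diff_left ip_diff_right L2_diff rN i_def ip_commute[of "r x0" "r (x n)"])
    then show ?thesis by (simp add: L2_norm_eq)
  qed
  ultimately show ?thesis by (simp add: r_def)
qed

text \<open>Square integrability and continuity of translation make the convolution a finite
  continuous function, so the almost everywhere identity for averages is an identity at every
  point.\<close>

theorem p_semigroup:
  assumes t: "t > 0" and s: "s > 0"
  shows "p (t + s) x = ip (p t) (\<lambda>a. p s (mul (- a) x))"
proof -
  define e where "e = (\<lambda>x. ip (p t) (\<lambda>a. p s (mul (- a) x)))"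
  have ts: "t + s > 0" using t s by simp
  have ce: "continuous_on UNIV e"
  proof (rule continuous_on_sequentiallyI)
    fix x x0 assume "x \<longlonglongrightarrow> (x0 :: real ^ 'n)"
    then show "(\<lambda>n. e (x n)) \<longlonglongrightarrow> e x0" unfolding e_def
      by (rule ip_tendsto[OF p_L2[OF t] p_L2[OF t] tendsto_L2_const p_translate_L2[OF s] p_translate_L2[OF s] p_translate_continuous[OF s]])
  qed
  have Ee: "E t s x = ennreal (e x)" for x
    unfolding E_def e_def ip_def
    by (rule nn_integral_eq_integral[OF L2_prod_integrable[OF p_L2[OF t] p_translate_L2[OF s]]])
      (simp add: p_nonneg t s)
  have e0: "e x \<ge> 0" for x unfolding e_def ip_def by (rule integral_nonneg_AE) (simp add: p_nonneg t s)
  have "p (t + s) x = e x"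
  proof (rule kernel_unique[OF cont_p[OF ts] ce])
    fix f k :: "real ^ 'n \<Rightarrow> real"
    assume fk: "test_fun f" "\<And>x. f x \<ge> 0" "test_fun k" "\<And>x. k x \<ge> 0"
    have i1: "(\<integral>\<^sup>+a. ennreal (f a) * E t s (mul (- a) g) \<partial>lborel) = ennreal (gconv mul f e g)" for g
    proof -
      have "(\<integral>\<^sup>+a. ennreal (f a) * E t s (mul (- a) g) \<partial>lborel) = (\<integral>\<^sup>+a. ennreal (f a * e (mul (- a) g)) \<partial>lborel)"
        by (simp add: Ee ennreal_mult fk(2) e0)
      also have "\<dots> = ennreal (gconv mul f e g)" unfolding gconv_def
        by (rule nn_integral_eq_integral[OF gconv_test_integrable[OF fk(1) ce]]) (simp add: fk(2) e0)
      finally show ?thesis .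
    qed
    have i2: "gconv mul f e g \<ge> 0" "gconv mul f (p (t + s)) g \<ge> 0" for g
      unfolding gconv_def by (rule integral_nonneg_AE, simp add: fk(2) e0 p_nonneg[OF ts])+
    from conv_E_AE[OF t s fk(1,2)] have "AE g in lborel. gconv mul f (p (t + s)) g = gconv mul f e g"
      by eventually_elim (simp add: i1 i2)
    then show "(LINT g|lborel. k g * gconv mul f (p (t + s)) g) = (LINT g|lborel. k g * gconv mul f e g)"
      using gconv_pairing_integrable[OF fk(1,3) cont_p[OF ts]] gconv_pairing_integrable[OF fk(1,3) ce]
      by (intro integral_cong_AE) (auto elim: eventually_mono)
  qed
  then show ?thesis by (simp add: e_def)
qed

lemma ip_p: "t > 0 \<Longrightarrow> s > 0 \<Longrightarrow> ip (p t) (p s) = p (t + s) 0"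
  using p_semigroup[of t s 0] by (simp add: p_symmetric)

text \<open>Cauchy-Schwarz for the semigroup law with two equal halves of the time; translates of
  the kernel have equal norms.\<close>

lemma p_le_p0:
  assumes t: "t > 0"
  shows "p t x \<le> p t 0"
proof -
  have h: "t / 2 > 0" using t by simp
  have "p (t / 2 + t / 2) x = ip (p (t / 2)) (\<lambda>a. p (t / 2) (mul (- a) x))" by (rule p_semigroup[OF h h])
  also have "\<dots> \<le> L2_norm (p (t / 2)) * L2_norm (\<lambda>a. p (t / 2) (mul (- a) x))"
    using ip_Cauchy_Schwarz[OF p_L2[OF h] p_translate_L2[OF h, of x]] by (rule order_trans[OF abs_ge_self])
  also have "\<dots> = ip (p (t / 2)) (p (t / 2))"
    using L2_norm_sq[of "p (t / 2)"] by (simp add: p_translate_norm[OF h] power2_eq_square)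
  also have "\<dots> = p (t / 2 + t / 2) 0" by (rule ip_p[OF h h])
  finally show ?thesis by simp
qed

text \<open>If p_t(0) = 0 then \<open>p t\<close> vanishes identically, by scaling so does every
  \<open>p h\<close>, and T_h f = 0 for all h > 0 contradicts strong continuity at time 0.\<close>

lemma p_0_pos:
  assumes t: "t > 0"
  shows "p t 0 > 0"
proof (rule ccontr)
  assume "\<not> p t 0 > 0"
  then have z: "p t x = 0" for x
    using p_nonneg[OF t, of x] p_le_p0[OF t, of x] by linarith
  have z': "p h x = 0" if h: "h > 0" for h x
  proof -
    have "(sqrt (t / h))\<^sup>2 * h = t" using t h by simp
    then show ?thesis using p_scaling[of "sqrt (t / h)" h x] t h by (simp add: z)
  qed
  let ?f = "bump 0 1 :: real ^ 'n \<Rightarrow> real"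
  have tf: "test_fun ?f" by (rule test_fun_bump) simp
  have fL: "?f \<in> L2" by (rule test_fun_L2[OF tf])
  have "L2_norm (\<lambda>x. T h ?f x - ?f x) = L2_norm ?f" if h: "h > 0" for h
  proof -
    have "AE x in lborel. T h ?f x - ?f x = - ?f x"
      using T_conv[OF h fL] by eventually_elim (simp add: gconv_def z'[OF h])
    then have "L2_norm (\<lambda>x. T h ?f x - ?f x) = L2_norm (\<lambda>x. - ?f x)"
      using h by (intro L2_norm_cong_AE L2_diff T_L2 L2_minus fL) auto
    then show ?thesis by (simp add: L2_norm_minus)
  qed
  then have "((\<lambda>h. L2_norm (\<lambda>x. T h ?f x - ?f x)) \<longlongrightarrow> L2_norm ?f) (at_right 0)"
    by - (rule Lim_transform_eventually[OF tendsto_const], rule eventually_mono[OF eventually_at_right_less], simp)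
  moreover have "((\<lambda>h. L2_norm (\<lambda>x. T h ?f x - ?f x)) \<longlongrightarrow> 0) (at_right 0)"
    using cs fL unfolding contraction_semigroup_def by blast
  ultimately have "L2_norm ?f = 0" by (rule tendsto_unique[OF trivial_limit_at_right_real])
  then have "AE x in lborel. ?f x = 0" by (rule L2_norm_0_AE[OF fL])
  then have "\<exists>x\<in>ball 0 1. ?f x = 0" by (rule AE_open_point) auto
  then show False using bump_pos_iff[of 1 "0 :: real ^ 'n"] by (force simp: dist_commute)
qed

end

section \<open>Decay of the heat kernel\<close>

lemma Ck_inverse:
  fixes f :: "'a::real_normed_vector \<Rightarrow> real"
  assumes "Ck k f" "\<And>x. f x \<noteq> 0"
  shows "Ck k (\<lambda>x. inverse (f x))"
  using assms(1)
proof (induction k)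
  case 0
  then show ?case using assms(2) by (auto intro: continuous_on_inverse)
next
  case (Suc k)
  from Suc.prems obtain f' where f': "\<And>x. (f has_derivative f' x) (at x)" "\<And>v. Ck k (\<lambda>x. f' x v)"
    by auto
  have i: "Ck k (\<lambda>x. inverse (f x))" by (rule Suc.IH[OF Ck_Suc_D[OF Suc.prems]])
  show ?case
  proof (rule Ck_SucI)
    show "((\<lambda>x. inverse (f x)) has_derivative (\<lambda>v. (- 1) * (inverse (f x) * f' x v * inverse (f x)))) (at x)" for x
      using Deriv.has_derivative_inverse[OF assms(2) f'(1)[of x]] by simp
    show "Ck k (\<lambda>x. (- 1) * (inverse (f x) * f' x v * inverse (f x)))" for v
      by (intro Ck_bilinear[OF bounded_bilinear_mult] Ck_const i f')
  qed
qed

lemma smooth_inverse: "smooth f \<Longrightarrow> (\<And>x. f x \<noteq> 0) \<Longrightarrow> smooth (\<lambda>x. inverse (f x))"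
  for f :: "'a::real_normed_vector \<Rightarrow> real"
  unfolding smooth_def using Ck_inverse by blast

context stratified_group
begin

lemma lvf_chain:
  assumes "smooth f" "smooth (\<lambda>x. \<theta> (f x))" "(\<theta> has_real_derivative d) (at (f x))"
  shows "lvf mul v (\<lambda>x. \<theta> (f x)) x = d * lvf mul v f x"
proof -
  have *: "(\<theta> has_real_derivative d) (at (f (mul x (0 *\<^sub>R v))))" using assms(3) by simp
  show ?thesis
    using DERIV_unique[OF lvf_has_real_derivative[OF assms(2), of x v 0] DERIV_chain2[OF * lvf_has_real_derivative[OF assms(1), of x v 0]]]
    by simp
qed

lemma lvf_wt: "lvf mul v (wt deg) = lvf mul v (hpow deg)"
proof
  fix x
  have "lvf mul v (\<lambda>x. (\<lambda>s. 1 + s) (hpow deg x)) x = 1 * lvf mul v (hpow deg) x"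
    by (rule lvf_chain[OF smooth_hpow]) (auto intro!: smooth_add smooth_hpow derivative_eq_intros)
  then show "lvf mul v (wt deg) x = lvf mul v (hpow deg) x" by (simp add: wt_def[abs_def])
qed

lemma lvf_wt_bound:
  "\<exists>C\<ge>0. \<forall>k x. deg k = 1 \<longrightarrow> \<bar>X k (wt deg) x\<bar> \<le> C * wt deg x \<and> \<bar>X k (X k (wt deg)) x\<bar> \<le> C * wt deg x"
proof -
  have "\<exists>C\<ge>0. \<forall>x. \<bar>X k (wt deg) x\<bar> \<le> C * wt deg x \<and> \<bar>X k (X k (wt deg)) x\<bar> \<le> C * wt deg x" if k: "deg k = 1" for k
  proof -
    obtain A where A: "A \<ge> 0" "\<And>x. \<bar>X k (wt deg) x\<bar> \<le> A * wt deg x"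
      using lvf_hpow_bound(1)[OF k] unfolding lvf_wt by blast
    obtain B where B: "B \<ge> 0" "\<And>x. \<bar>X k (X k (wt deg)) x\<bar> \<le> B * wt deg x"
      using lvf_hpow_bound(2)[OF k] unfolding lvf_wt by blast
    have "\<bar>X k (wt deg) x\<bar> \<le> max A B * wt deg x" "\<bar>X k (X k (wt deg)) x\<bar> \<le> max A B * wt deg x" for x
      using order_trans[OF A(2)[of x] mult_right_mono[of A "max A B" "wt deg x"]]
        order_trans[OF B(2)[of x] mult_right_mono[of B "max A B" "wt deg x"]] wt_pos[of deg x]
      by (simp_all add: less_imp_le)
    then show ?thesis using A(1) by (intro exI[of _ "max A B"]) auto
  qed
  then obtain c where c: "\<And>k. deg k = 1 \<Longrightarrow> c k \<ge> 0"
    "\<And>k x. deg k = 1 \<Longrightarrow> \<bar>X k (wt deg) x\<bar> \<le> c k * wt deg x \<and> \<bar>X k (X k (wt deg)) x\<bar> \<le> c k * wt deg x"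
    by metis
  define C where "C = (\<Sum>k | deg k = 1. c k)"
  have cC: "c k \<le> C" if "deg k = 1" for k
    unfolding C_def using that c(1) by (intro member_le_sum) auto
  have "C \<ge> 0" unfolding C_def using c(1) by (intro sum_nonneg) auto
  moreover have "\<bar>X k (wt deg) x\<bar> \<le> C * wt deg x \<and> \<bar>X k (X k (wt deg)) x\<bar> \<le> C * wt deg x" if "deg k = 1" for k x
    using c(2)[OF that, of x] mult_right_mono[OF cC[OF that] less_imp_le[OF wt_pos[of deg x]]] by linarith
  ultimately show ?thesis by blast
qed

text \<open>A power of \<open>s\<close> regularised so as to be square integrable along \<open>wt deg\<close>, with derivatives
  controlled uniformly in \<open>e\<close>.\<close>

definition wcut :: "nat \<Rightarrow> nat \<Rightarrow> real \<Rightarrow> real \<Rightarrow> real" where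
  "wcut m n e s = s ^ m * inverse (1 + e * s) ^ n"

lemma smooth_wcut: "e \<ge> 0 \<Longrightarrow> smooth (\<lambda>x. wcut m n e (wt deg x))"
  unfolding wcut_def
proof (intro smooth_mult smooth_power smooth_wt smooth_inverse smooth_add smooth_const)
  fix x assume "e \<ge> 0"
  then have "e * wt deg x \<ge> 0" using wt_pos[of deg x] by simp
  then show "1 + e * wt deg x \<noteq> 0" by linarith
qed

lemma wcut_nonneg: "e \<ge> 0 \<Longrightarrow> s \<ge> 0 \<Longrightarrow> wcut m n e s \<ge> 0"
  by (simp add: wcut_def)

text \<open>The logarithmic derivative of \<open>wcut\<close> at s is at most (m + n)/s, uniformly
  in \<open>e\<close>, while horizontal derivatives of \<open>wt\<close> are at most a multiple of
  \<open>wt\<close>. The factors s cancel, so the weight dominates its own sub-Laplacian with a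
  constant independent of the regularisation.\<close>

lemma L_wcut_bound: "\<exists>C\<ge>0. \<forall>e>0. \<forall>x. \<bar>L (\<lambda>x. wcut m n e (wt deg x)) x\<bar> \<le> C * wcut m n e (wt deg x)"
proof -
  obtain C where C: "C \<ge> 0" "\<And>k x. deg k = 1 \<Longrightarrow> \<bar>X k (wt deg) x\<bar> \<le> C * wt deg x"
    "\<And>k x. deg k = 1 \<Longrightarrow> \<bar>X k (X k (wt deg)) x\<bar> \<le> C * wt deg x"
    using lvf_wt_bound by blast
  define A where "A = real m + real n"
  \<comment> \<open>The three summands bound the square of the logarithmic derivative of the weight,
    the term with two first derivatives of \<open>wt\<close>, and the term with its second
    derivative.\<close>
  define B where "B = (A * C)\<^sup>2 + A * C\<^sup>2 + A * C"
  have A0: "A \<ge> 0" by (simp add: A_def)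
  have B0: "B \<ge> 0" using A0 C(1) by (simp add: B_def)
  have main: "\<bar>X k (X k (\<lambda>x. wcut m n e (wt deg x))) x\<bar> \<le> B * wcut m n e (wt deg x)"
    if e: "e > 0" and k: "deg k = 1" for e k x
  proof -
    \<comment> \<open>The logarithmic derivative of \<open>wcut m n e\<close>, followed by its
      derivative.\<close>
    define \<phi> where "\<phi> = (\<lambda>s. real m * inverse s - real n * e * inverse (1 + e * s))"
    define \<phi>' where "\<phi>' = (\<lambda>s. - real m * inverse s ^ 2 + real n * e ^ 2 * inverse (1 + e * s) ^ 2)"
    have pos: "1 + e * s > 0" if "s > 0" for s using e that by (simp add: add_pos_pos)
    have d\<theta>: "(wcut m n e has_real_derivative wcut m n e s * \<phi> s) (at s)" if s: "s > 0" for s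
    proof -
      have p1: "((\<lambda>s. s ^ m) has_real_derivative s ^ m * (real m * inverse s)) (at s)"
      proof -
        have "real m * s ^ (m - Suc 0) = s ^ m * (real m * inverse s)" using s by (cases m) (auto simp: field_simps)
        from DERIV_cong[OF DERIV_pow this] show ?thesis .
      qed
      have p2: "((\<lambda>s. inverse (1 + e * s)) has_real_derivative - (e * inverse (1 + e * s) ^ 2)) (at s)"
        using pos[OF s] by (auto intro!: derivative_eq_intros simp: power2_eq_square)
      have p3: "((\<lambda>s. inverse (1 + e * s) ^ n) has_real_derivative inverse (1 + e * s) ^ n * (- (real n * e * inverse (1 + e * s)))) (at s)"
        using DERIV_power[OF p2, of n] by (cases n) (auto simp: power2_eq_square algebra_simps)
      show ?thesis unfolding wcut_def[abs_def] \<phi>_def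
        using DERIV_mult[OF p1 p3] by (simp add: algebra_simps)
    qed
    have d\<phi>: "(\<phi> has_real_derivative \<phi>' s) (at s)" if s: "s > 0" for s
      unfolding \<phi>_def \<phi>'_def using s pos[OF s]
      by (auto intro!: derivative_eq_intros simp: power2_eq_square algebra_simps)
    have eb: "e * inverse (1 + e * s) \<le> inverse s" "0 \<le> e * inverse (1 + e * s)" if s: "s > 0" for s
      using e s pos[OF s] by (auto simp: field_simps)
    have b\<phi>: "\<bar>\<phi> s\<bar> \<le> A * inverse s" if s: "s > 0" for s
    proof -
      have "\<bar>\<phi> s\<bar> \<le> real m * inverse s + real n * (e * inverse (1 + e * s))"
      proof -
        have "\<bar>a - b\<bar> \<le> a + b" if "a \<ge> 0" "b \<ge> 0" for a b :: real using that by linarith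
        from this[of "real m * inverse s" "real n * (e * inverse (1 + e * s))"]
        show ?thesis using s eb(2)[OF s] by (simp add: \<phi>_def mult.assoc)
      qed
      also have "\<dots> \<le> real m * inverse s + real n * inverse s"
        using eb(1)[OF s] by (intro add_left_mono mult_left_mono) auto
      finally show ?thesis by (simp add: A_def algebra_simps)
    qed
    have b\<phi>': "\<bar>\<phi>' s\<bar> \<le> A * inverse s ^ 2" if s: "s > 0" for s
    proof -
      have "\<bar>\<phi>' s\<bar> \<le> real m * inverse s ^ 2 + real n * (e * inverse (1 + e * s)) ^ 2"
      proof -
        have "\<bar>- a + b\<bar> \<le> a + b" if "a \<ge> 0" "b \<ge> 0" for a b :: real using that by linarith
        from this[of "real m * inverse s ^ 2" "real n * (e * inverse (1 + e * s)) ^ 2"]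
        show ?thesis by (simp add: \<phi>'_def mult.assoc power_mult_distrib)
      qed
      also have "\<dots> \<le> real m * inverse s ^ 2 + real n * inverse s ^ 2"
        using eb[OF s] by (intro add_left_mono mult_left_mono power_mono) auto
      finally show ?thesis by (simp add: A_def algebra_simps)
    qed
    let ?W = "wt deg" and ?w = "\<lambda>x. wcut m n e (wt deg x)"
    let ?q = "\<lambda>x. \<phi> (?W x) * X k ?W x"
    have W0: "?W x > 0" for x by (rule wt_pos)
    have ew: "1 + e * ?W x \<noteq> 0" for x using pos[OF W0[of x]] by simp
    have s\<phi>: "smooth (\<lambda>x. \<phi> (?W x))"
      unfolding \<phi>_def using W0 ew
      by (intro smooth_diff smooth_mult smooth_const smooth_inverse smooth_wt smooth_add) (auto simp: less_imp_neq[symmetric])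
    have sw: "smooth ?w" by (rule smooth_wcut) (use e in simp)
    have sX: "smooth (X k ?W)" by (rule lvf_smooth[OF smooth_wt])
    have sq: "smooth ?q" by (intro smooth_mult s\<phi> sX)
    have Xw: "X k ?w = (\<lambda>x. ?w x * ?q x)"
      by (rule ext) (simp add: lvf_chain[OF smooth_wt sw d\<theta>[OF W0]])
    have Xq: "X k ?q x = \<phi>' (?W x) * X k ?W x * X k ?W x + \<phi> (?W x) * X k (X k ?W) x"
      by (simp add: lvf_mult[OF s\<phi> sX] lvf_chain[OF smooth_wt s\<phi> d\<phi>[OF W0]])
    have XXw: "X k (X k ?w) x = ?w x * (?q x * ?q x + X k ?q x)"
      unfolding Xw by (subst lvf_mult[OF sw sq]) (simp add: Xw algebra_simps)
    have "\<bar>?q x\<bar> \<le> A * C"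
    proof -
      have "\<bar>?q x\<bar> \<le> (A * inverse (?W x)) * (C * ?W x)"
        unfolding abs_mult using b\<phi>[OF W0] C(2)[OF k] A0 W0[of x] by (intro mult_mono) auto
      also have "\<dots> = A * C" using W0[of x] by (simp add: field_simps)
      finally show ?thesis .
    qed
    moreover have "\<bar>q * q\<bar> \<le> c\<^sup>2" if "\<bar>q\<bar> \<le> c" for q c :: real
      unfolding abs_mult power2_eq_square using that by (intro mult_mono) auto
    ultimately have "\<bar>?q x * ?q x\<bar> \<le> (A * C)\<^sup>2" by blast
    moreover have "\<bar>X k ?q x\<bar> \<le> A * C\<^sup>2 + A * C"
    proof -
      have 1: "\<bar>\<phi>' (?W x) * X k ?W x * X k ?W x\<bar> \<le> A * inverse (?W x) ^ 2 * (C * ?W x) * (C * ?W x)"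
        unfolding abs_mult using b\<phi>'[OF W0] C(1) C(2)[OF k] A0 W0[of x] by (intro mult_mono mult_nonneg_nonneg) auto
      have 2: "\<bar>\<phi> (?W x) * X k (X k ?W) x\<bar> \<le> A * inverse (?W x) * (C * ?W x)"
        unfolding abs_mult using b\<phi>[OF W0] C(3)[OF k] A0 W0[of x] by (intro mult_mono) auto
      have "A * inverse (?W x) ^ 2 * (C * ?W x) * (C * ?W x) = A * C\<^sup>2" "A * inverse (?W x) * (C * ?W x) = A * C"
        using W0[of x] by (simp_all add: power2_eq_square field_simps)
      with 1 2 show ?thesis unfolding Xq by (intro order_trans[OF abs_triangle_ineq]) linarith
    qed
    ultimately have "\<bar>?q x * ?q x + X k ?q x\<bar> \<le> B"
      unfolding B_def by linarith
    then have "\<bar>X k (X k ?w) x\<bar> \<le> \<bar>?w x\<bar> * B"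
      unfolding XXw abs_mult by (rule mult_left_mono) simp
    then show ?thesis using wcut_nonneg[of e "?W x" m n] e W0[of x] by (simp add: mult.commute)
  qed
  have "\<bar>L (\<lambda>x. wcut m n e (wt deg x)) x\<bar> \<le> (real CARD('n) * B) * wcut m n e (wt deg x)" if e: "e > 0" for e x
  proof -
    have w0: "wcut m n e (wt deg x) \<ge> 0" using wcut_nonneg[of e "wt deg x" m n] e wt_pos[of deg x] by simp
    have "\<bar>L (\<lambda>x. wcut m n e (wt deg x)) x\<bar> \<le> (\<Sum>k | deg k = 1. \<bar>X k (X k (\<lambda>x. wcut m n e (wt deg x))) x\<bar>)"
      unfolding L_eq by (rule sum_abs)
    also have "\<dots> \<le> real (card {k. deg k = 1}) * (B * wcut m n e (wt deg x))"
      by (rule sum_bounded_above) (use main[OF e] in auto)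
    also have "\<dots> \<le> real CARD('n) * (B * wcut m n e (wt deg x))"
      using B0 w0 by (intro mult_right_mono) (auto intro: card_mono)
    finally show ?thesis by (simp add: mult.assoc)
  qed
  then show ?thesis using B0 by (intro exI[of _ "real CARD('n) * B"]) auto
qed

lemma wt_integrable: "integrable lborel (\<lambda>x :: real ^ 'n. 1 / wt deg x ^ (CARD('n) + 2))"
proof (rule integrableI_bounded)
  show "(\<integral>\<^sup>+x. ennreal (norm (1 / wt deg x ^ (CARD('n) + 2))) \<partial>lborel) < \<infinity>"
    using nn_integral_wt_finite[OF deg_pos] by (simp add: wt_pos[THEN less_imp_le])
qed simp

text \<open>With this choice of the second exponent the weight decays like wt^-(N+2), which
  \<open>wt_integrable\<close> covers.\<close>

lemma wcut_L2:
  assumes e: "e > 0"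
  shows "(\<lambda>x. wcut m (m + CARD('n) + 2) e (wt deg x)) \<in> L2"
proof -
  let ?N = "CARD('n) + 2"
  have mw: "(\<lambda>x. wcut m (m + CARD('n) + 2) e (wt deg x)) \<in> borel_measurable borel"
    using smooth_wcut[of e] e by (intro borel_measurable_continuous_onI smooth_continuous_on) auto
  have b: "wcut m (m + CARD('n) + 2) e (wt deg x) \<le> inverse e ^ (m + ?N) * (1 / wt deg x ^ ?N)" for x
  proof -
    let ?W = "wt deg x"
    have W: "?W > 0" by (rule wt_pos)
    have "inverse (1 + e * ?W) \<le> inverse (e * ?W)" using e W by (intro le_imp_inverse_le) auto
    then have "?W ^ m * inverse (1 + e * ?W) ^ (m + ?N) \<le> ?W ^ m * inverse (e * ?W) ^ (m + ?N)"
      using e W by (intro mult_left_mono power_mono) auto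
    also have "\<dots> = inverse e ^ (m + ?N) * (1 / ?W ^ ?N)"
      using W by (simp add: power_add power_mult_distrib field_simps)
    finally show ?thesis by (simp add: wcut_def add.assoc)
  qed
  have g: "(\<lambda>x :: real ^ 'n. inverse e ^ (m + ?N) * (1 / wt deg x ^ ?N)) \<in> L2"
  proof -
    have "integrable lborel (\<lambda>x :: real ^ 'n. (1 / wt deg x ^ ?N)\<^sup>2)"
    proof (rule Bochner_Integration.integrable_bound[OF wt_integrable])
      have "(1 / wt deg x ^ ?N)\<^sup>2 \<le> 1 / wt deg x ^ ?N" for x :: "real ^ 'n"
      proof -
        have "1 / wt deg x ^ ?N \<le> 1" using one_le_power[OF wt_ge_1[of deg x], of ?N] wt_pos[of deg x] by (simp add: divide_le_eq)
        then show ?thesis using wt_pos[of deg x] mult_right_mono[of "1 / wt deg x ^ ?N" 1 "1 / wt deg x ^ ?N"]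
          by (simp add: power2_eq_square)
      qed
      then show "AE x in lborel. norm ((1 / wt deg x ^ ?N)\<^sup>2) \<le> norm (1 / wt deg x ^ ?N)"
        using wt_pos[of deg] by (auto simp: less_imp_le)
    qed simp
    then have "(\<lambda>x :: real ^ 'n. 1 / wt deg x ^ ?N) \<in> L2" by (simp add: L2_def)
    then show ?thesis by (rule L2_cmult)
  qed
  show ?thesis
  proof (rule L2_dominated[OF g mw])
    show "\<bar>wcut m (m + CARD('n) + 2) e (wt deg x)\<bar> \<le> \<bar>inverse e ^ (m + ?N) * (1 / wt deg x ^ ?N)\<bar>" for x
      using b[of x] wcut_nonneg[of e "wt deg x" m "m + CARD('n) + 2"] e wt_pos[of deg x] by simp
  qed
qed

end

context heat
begin

text \<open>The weight is submultiplicative, so a moment of \<open>e\<^bsup>t\<Delta>\<^esup> f\<close> for a single bump \<open>f\<close> bounds that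
  of \<open>p\<^sub>t\<close>.\<close>

lemma p_moment:
  assumes t: "t > 0"
  shows "(\<integral>\<^sup>+x. ennreal (wt deg x ^ m * p t x) \<partial>lborel) < \<infinity>"
proof -
  let ?n = "m + CARD('n) + 2" and ?W = "wt deg"
  let ?f = "bump 0 1 :: real ^ 'n \<Rightarrow> real"
  let ?w = "\<lambda>e x. wcut m ?n e (?W x)"
  have tf: "test_fun ?f" by (rule test_fun_bump) simp
  have fL: "?f \<in> L2" by (rule test_fun_L2[OF tf])
  have f0: "?f x \<ge> 0" for x by (rule bump_nonneg)
  have W0: "?W x > 0" for x by (rule wt_pos)
  obtain C where C: "C \<ge> 0" "\<And>e x. e > 0 \<Longrightarrow> \<bar>L (?w e) x\<bar> \<le> C * ?w e x"
    using L_wcut_bound[of m ?n] by blast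
  define c where "c = gconv mul ?f (p t)"
  have pos: "p t b \<ge> 0" for b by (rule p_nonneg[OF t])
  have c0: "c b \<ge> 0" for b unfolding c_def gconv_def by (rule integral_nonneg_AE) (simp add: pos f0)
  have mf [measurable]: "?f \<in> borel_measurable borel" by (rule L2_measurable[OF fL])
  note mk [measurable] = p_kernel_measurable[OF t]
  have mc [measurable]: "c \<in> borel_measurable borel"
    unfolding c_def gconv_def by (rule lborel.borel_measurable_lebesgue_integral) measurable
  have cT: "AE x in lborel. T t ?f x = c x" unfolding c_def by (rule T_conv[OF t fL])
  have TL: "T t ?f \<in> L2" by (rule T_L2[OF less_imp_le[OF t] fL])
  have cL: "c \<in> L2" by (rule L2_cong_AE[OF TL mc cT])
  define R where "R = exp (C * t) * (LINT x|lborel. ?W x ^ m * ?f x)"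
  have wle: "?w e x \<le> ?W x ^ m" if "e > 0" for e x
  proof -
    have "inverse (1 + e * ?W x) \<le> 1" using that W0[of x] by (intro inverse_le_1_iff[THEN iffD2]) auto
    then have "inverse (1 + e * ?W x) ^ ?n \<le> 1" using that W0[of x] by (intro power_le_one) auto
    then show ?thesis unfolding wcut_def using W0[of x] by (intro mult_left_le) auto
  qed
  have step: "ip (?w e) c \<le> R" if e: "e > 0" for e
  proof -
    have wL: "?w e \<in> L2" by (rule wcut_L2[OF e])
    have sw: "smooth (?w e)" by (rule smooth_wcut) (use e in simp)
    have LL: "L (?w e) \<in> L2"
    proof (rule L2_dominated[OF L2_cmult[OF wL, of C]])
      show "L (?w e) \<in> borel_measurable borel"
        by (intro borel_measurable_continuous_onI smooth_continuous_on smooth_L sw)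
      show "\<bar>L (?w e) x\<bar> \<le> \<bar>C * ?w e x\<bar>" for x using C(2)[OF e, of x] by simp
    qed
    have "ip (?w e) (T t ?f) \<le> exp (C * t) * ip (?w e) ?f"
    proof (rule T_weight_bound[OF _ wL LL _ C(1) test_gen[OF tf]])
      show "ip (?w e) u = ip (L (?w e)) f" if "(f, u) \<in> generator_graph T" for f u
        by (rule closure_graph_adjoint[OF _ sw wL LL]) (use that gen_eq in simp)
      show "L (?w e) x \<le> C * ?w e x" for x using C(2)[OF e, of x] by simp
      show "AE x in lborel. 0 \<le> T a ?f x" if "a \<ge> 0" for a by (rule T_test_nonneg[OF that tf f0])
    qed (use t in simp)
    also have "\<dots> \<le> R"
      unfolding R_def ip_def
    proof (intro mult_left_mono integral_mono)
      show "integrable lborel (\<lambda>x. ?w e x * ?f x)" by (rule test_fun_integrable[OF test_fun_mult(2)[OF tf sw]])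
      show "integrable lborel (\<lambda>x. ?W x ^ m * ?f x)"
        by (rule test_fun_integrable[OF test_fun_mult(2)[OF tf smooth_power[OF smooth_wt]]])
      show "?w e x * ?f x \<le> ?W x ^ m * ?f x" for x by (intro mult_right_mono wle e f0)
    qed simp
    also have "ip (?w e) (T t ?f) = ip (?w e) c"
      by (rule ip_cong_AE[OF wL wL TL cL _ cT]) simp
    finally show ?thesis .
  qed
  define \<epsilon> where "\<epsilon> = (\<lambda>j. 1 / real (Suc j))"
  have \<epsilon>: "\<epsilon> j > 0" for j by (simp add: \<epsilon>_def)
  have w0: "?w (\<epsilon> j) x \<ge> 0" for j x using wcut_nonneg[of "\<epsilon> j" "?W x" m ?n] \<epsilon>[of j] W0[of x] by simp
  have nnw: "(\<integral>\<^sup>+x. ennreal (?w (\<epsilon> j) x * c x) \<partial>lborel) \<le> ennreal R" for j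
  proof -
    have "(\<integral>\<^sup>+x. ennreal (?w (\<epsilon> j) x * c x) \<partial>lborel) = ennreal (ip (?w (\<epsilon> j)) c)"
      unfolding ip_def
      by (rule nn_integral_eq_integral[OF L2_prod_integrable[OF wcut_L2[OF \<epsilon>] cL]])
        (rule AE_I2, rule mult_nonneg_nonneg[OF w0 c0])
    then show ?thesis using step[OF \<epsilon>] by (simp add: ennreal_leI)
  qed
  \<comment> \<open>As the regularisation disappears the weights return to the full power of
    \<open>wt\<close>; Fatou's lemma transfers the uniform bound to the limit.\<close>
  have lim: "(\<lambda>j. ennreal (?w (\<epsilon> j) x * c x)) \<longlonglongrightarrow> ennreal (?W x ^ m * c x)" for x
  proof -
    have "(\<lambda>j. ?W x ^ m * inverse (1 + \<epsilon> j * ?W x) ^ ?n * c x) \<longlonglongrightarrow> ?W x ^ m * inverse (1 + 0 * ?W x) ^ ?n * c x"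
      unfolding \<epsilon>_def using LIMSEQ_inverse_real_of_nat
      by (intro tendsto_intros) (auto simp: inverse_eq_divide)
    then show ?thesis by (intro tendsto_ennrealI) (simp add: wcut_def)
  qed
  have "(\<integral>\<^sup>+x. ennreal (?W x ^ m * c x) \<partial>lborel) = (\<integral>\<^sup>+x. liminf (\<lambda>j. ennreal (?w (\<epsilon> j) x * c x)) \<partial>lborel)"
    using lim_imp_Liminf[OF _ lim] by simp
  also have "\<dots> \<le> liminf (\<lambda>j. \<integral>\<^sup>+x. ennreal (?w (\<epsilon> j) x * c x) \<partial>lborel)"
  proof (rule nn_integral_liminf)
    show "(\<lambda>x. ennreal (?w (\<epsilon> j) x * c x)) \<in> borel_measurable lborel" for j
      using L2_measurable[OF wcut_L2[OF \<epsilon>[of j], of m]] mc by simp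
  qed
  also have "\<dots> \<le> ennreal R" by (rule Liminf_le) (use nnw in auto)
  finally have fin: "(\<integral>\<^sup>+x. ennreal (?W x ^ m * c x) \<partial>lborel) \<le> ennreal R" .
  obtain D where D: "D \<ge> 1" "\<And>a b. ?W (mul a b) \<le> D * ?W a * ?W b" using wt_mul by blast
  define J where "J = (\<integral>\<^sup>+x. ennreal (?W x ^ m * p t x) \<partial>lborel)"
  \<comment> \<open>Submultiplicativity gives h(a) wt(b)^m <= f(a) wt(ab)^m. Thus the unknown moment
    \<open>J\<close> times the positive integral of \<open>h\<close> is bounded by the moment of f *
    p_t.\<close>
  define h where "h = (\<lambda>a. ?f a * inverse (D * ?W a) ^ m)"
  have h0: "h a \<ge> 0" for a unfolding h_def using f0 D(1) W0[of a] by simp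
  have th: "test_fun h" unfolding h_def
    by (intro test_fun_mult(1)[OF tf] smooth_power smooth_inverse smooth_mult smooth_const smooth_wt)
      (use D(1) W0 in \<open>auto simp: less_imp_neq[symmetric]\<close>)
  have hp: "(LINT a|lborel. h a) > 0"
  proof (rule test_fun_integral_pos[OF th h0])
    have "?f 0 > 0" by (simp add: bump_pos_iff)
    then show "h 0 > 0" unfolding h_def using D(1) W0[of 0] by simp
  qed
  have "ennreal (LINT a|lborel. h a) * J = (\<integral>\<^sup>+a. ennreal (h a) * J \<partial>lborel)"
    using th h0 by (subst nn_integral_multc)
      (auto simp: nn_integral_eq_integral[OF test_fun_integrable[OF th]] intro: L2_measurable test_fun_L2)
  also have "\<dots> \<le> (\<integral>\<^sup>+a. (\<integral>\<^sup>+g. ennreal (?f a * p t (mul (- a) g)) * ennreal (?W g ^ m) \<partial>lborel) \<partial>lborel)"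
  proof (rule nn_integral_mono)
    fix a
    have "ennreal (h a) * J = (\<integral>\<^sup>+b. ennreal (h a) * ennreal (?W b ^ m * p t b) \<partial>lborel)"
      unfolding J_def using measurable_p[OF t] by (intro nn_integral_cmult[symmetric]) simp
    also have "\<dots> \<le> (\<integral>\<^sup>+b. ennreal (?f a * p t (mul (- a) (mul a b))) * ennreal (?W (mul a b) ^ m) \<partial>lborel)"
    proof (rule nn_integral_mono)
      fix b
      have "?W b \<le> D * ?W a * ?W (mul a b)" using D(2)[of "- a" "mul a b"] by simp
      then have "inverse (D * ?W a) * ?W b \<le> ?W (mul a b)"
        using D(1) W0[of a] by (simp add: field_simps)
      then have "(inverse (D * ?W a) * ?W b) ^ m \<le> ?W (mul a b) ^ m"
        using D(1) W0[of a] W0[of b] by (intro power_mono) auto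
      then have "(?f a * p t b) * (inverse (D * ?W a) * ?W b) ^ m \<le> (?f a * p t b) * ?W (mul a b) ^ m"
        using f0 pos by (intro mult_left_mono) auto
      then have "ennreal (h a * (?W b ^ m * p t b)) \<le> ennreal (?f a * p t b * ?W (mul a b) ^ m)"
        by (intro ennreal_leI) (simp add: h_def power_mult_distrib mult.assoc mult.left_commute mult.commute)
      then show "ennreal (h a) * ennreal (?W b ^ m * p t b) \<le> ennreal (?f a * p t (mul (- a) (mul a b))) * ennreal (?W (mul a b) ^ m)"
        using h0[of a] f0[of a] pos[of b] W0[of b] W0[of "mul a b"] by (simp add: ennreal_mult)
    qed
    also have "\<dots> = (\<integral>\<^sup>+g. ennreal (?f a * p t (mul (- a) g)) * ennreal (?W g ^ m) \<partial>lborel)"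
      by (rule nn_integral_left) measurable
    finally show "ennreal (h a) * J \<le> (\<integral>\<^sup>+g. ennreal (?f a * p t (mul (- a) g)) * ennreal (?W g ^ m) \<partial>lborel)" .
  qed
  also have "\<dots> = (\<integral>\<^sup>+g. (\<integral>\<^sup>+a. ennreal (?f a * p t (mul (- a) g)) * ennreal (?W g ^ m) \<partial>lborel) \<partial>lborel)"
    by (rule lborel_pair.Fubini') measurable
  also have "\<dots> = (\<integral>\<^sup>+g. ennreal (?W g ^ m * c g) \<partial>lborel)"
  proof (rule nn_integral_cong)
    fix g
    have "(\<integral>\<^sup>+a. ennreal (?f a * p t (mul (- a) g)) * ennreal (?W g ^ m) \<partial>lborel) =
        (\<integral>\<^sup>+a. ennreal (?f a * p t (mul (- a) g)) \<partial>lborel) * ennreal (?W g ^ m)"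
      by (rule nn_integral_multc) measurable
    also have "(\<integral>\<^sup>+a. ennreal (?f a * p t (mul (- a) g)) \<partial>lborel) = ennreal (c g)"
      unfolding c_def gconv_def
      by (rule nn_integral_eq_integral[OF gconv_test_integrable[OF tf cont_p[OF t]]]) (simp add: pos f0)
    finally show "(\<integral>\<^sup>+a. ennreal (?f a * p t (mul (- a) g)) * ennreal (?W g ^ m) \<partial>lborel) = ennreal (?W g ^ m * c g)"
      using c0[of g] W0[of g] by (simp add: ennreal_mult mult.commute)
  qed
  also have "\<dots> \<le> ennreal R" by (rule fin)
  finally have "ennreal (LINT a|lborel. h a) * J < \<infinity>" by (rule le_less_trans) simp
  then have "J < \<infinity>" using hp by (auto simp: ennreal_mult_less_top)
  then show ?thesis by (simp add: J_def)
qed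

text \<open>One factor of the square is bounded by p_t(0), the other is integrated as a moment of
  order 2m.\<close>

lemma wt_p_L2:
  assumes t: "t > 0"
  shows "(\<lambda>x. wt deg x ^ m * p t x) \<in> L2"
proof -
  have m: "(\<lambda>x. wt deg x ^ m * p t x) \<in> borel_measurable borel" using measurable_p[OF t] by simp
  have "(\<integral>\<^sup>+x. ennreal (norm ((wt deg x ^ m * p t x)\<^sup>2)) \<partial>lborel) \<le> (\<integral>\<^sup>+x. ennreal (p t 0) * ennreal (wt deg x ^ (2 * m) * p t x) \<partial>lborel)"
  proof (rule nn_integral_mono)
    fix x
    have "p t x * p t x \<le> p t 0 * p t x" by (intro mult_right_mono p_le_p0 p_nonneg t)
    then have "wt deg x ^ (2 * m) * (p t x * p t x) \<le> wt deg x ^ (2 * m) * (p t 0 * p t x)"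
      using wt_pos[of deg x] by (intro mult_left_mono) auto
    then show "ennreal (norm ((wt deg x ^ m * p t x)\<^sup>2)) \<le> ennreal (p t 0) * ennreal (wt deg x ^ (2 * m) * p t x)"
      using p_nonneg[OF t, of 0] p_nonneg[OF t, of x] wt_pos[of deg x]
      by (simp add: ennreal_mult[symmetric] ennreal_leI power_mult_distrib power2_eq_square mult.left_commute mult.assoc
          power_add mult_2)
  qed
  also have "\<dots> = ennreal (p t 0) * (\<integral>\<^sup>+x. ennreal (wt deg x ^ (2 * m) * p t x) \<partial>lborel)"
    using measurable_p[OF t] by (intro nn_integral_cmult) simp
  also have "\<dots> < \<infinity>" using p_moment[OF t, of "2 * m"] by (simp add: ennreal_mult_less_top)
  finally have "integrable lborel (\<lambda>x. (wt deg x ^ m * p t x)\<^sup>2)"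
    using m by (intro integrableI_bounded) auto
  then show ?thesis using m by (simp add: L2_def)
qed

text \<open>In the semigroup law with halved time, submultiplicativity distributes the weight over
  the two kernels, and Cauchy-Schwarz applies.\<close>

lemma p_decay:
  assumes t: "t > 0"
  shows "\<exists>D. \<forall>x. wt deg x ^ m * p t x \<le> D"
proof -
  define h where "h = t / 2"
  have h: "h > 0" "t = h + h" using t by (auto simp: h_def)
  obtain C where C: "C \<ge> 1" "\<And>a b. wt deg (mul a b) \<le> C * wt deg a * wt deg b" using wt_mul by blast
  let ?F = "\<lambda>x. wt deg x ^ m * p h x"
  have W0: "wt deg x > 0" for x by (rule wt_pos)
  have FL: "?F \<in> L2" by (rule wt_p_L2[OF h(1)])
  have "wt deg x ^ m * p t x \<le> C ^ m * (L2_norm ?F * L2_norm ?F)" for x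
  proof -
    have tr: "(\<lambda>a. ?F (mul (- a) x)) = (\<lambda>a. ?F (mul (- x) a))"
    proof
      fix a
      have "mul (- a) x = - mul (- x) a" by (simp add: neg_mul)
      then show "?F (mul (- a) x) = ?F (mul (- x) a)" using p_symmetric[OF h(1), of "mul (- x) a"] by simp
    qed
    have GL: "(\<lambda>a. ?F (mul (- a) x)) \<in> L2" "L2_norm (\<lambda>a. ?F (mul (- a) x)) = L2_norm ?F"
      unfolding tr using L2_left[OF FL] L2_norm_left[OF L2_measurable[OF FL]] by auto
    have "wt deg x ^ m * p t x = (LINT a|lborel. wt deg x ^ m * (p h a * p h (mul (- a) x)))"
      using p_semigroup[OF h(1) h(1), of x] h(2) by (simp add: ip_def)
    also have "\<dots> \<le> (LINT a|lborel. C ^ m * (?F a * ?F (mul (- a) x)))"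
    proof (rule integral_mono)
      show "integrable lborel (\<lambda>a. wt deg x ^ m * (p h a * p h (mul (- a) x)))"
        by (intro integrable_mult_right L2_prod_integrable p_L2 p_translate_L2 h)
      show "integrable lborel (\<lambda>a. C ^ m * (?F a * ?F (mul (- a) x)))"
        by (intro integrable_mult_right L2_prod_integrable FL GL)
      fix a
      have "wt deg x \<le> C * wt deg a * wt deg (mul (- a) x)" using C(2)[of a "mul (- a) x"] by simp
      then have "wt deg x ^ m \<le> (C * wt deg a * wt deg (mul (- a) x)) ^ m"
        using W0[of x] by (intro power_mono) auto
      then have "wt deg x ^ m * (p h a * p h (mul (- a) x)) \<le> (C * wt deg a * wt deg (mul (- a) x)) ^ m * (p h a * p h (mul (- a) x))"
        by (intro mult_right_mono mult_nonneg_nonneg p_nonneg h)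
      then show "wt deg x ^ m * (p h a * p h (mul (- a) x)) \<le> C ^ m * (?F a * ?F (mul (- a) x))"
        by (simp add: power_mult_distrib mult.assoc mult.left_commute)
    qed
    also have "\<dots> = C ^ m * ip ?F (\<lambda>a. ?F (mul (- a) x))" by (simp add: ip_def)
    also have "\<dots> \<le> C ^ m * (L2_norm ?F * L2_norm ?F)"
      using order_trans[OF abs_ge_self ip_Cauchy_Schwarz[OF FL GL(1)]] C(1) by (intro mult_left_mono) (auto simp: GL(2))
    finally show ?thesis .
  qed
  then show ?thesis by blast
qed

end

section \<open>Decay of the horizontal gradient of the heat kernel\<close>

text \<open>The mean value theorem twice; all intermediate points exceed 2, where a power with
  negative exponent is at most 1. It will be used with a = -Q/2, the exponent of t in
  p_t(0).\<close>

lemma powr_second_difference: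
  fixes a h :: real
  assumes a: "a \<le> 0" and h: "0 < h"
  shows "\<bar>(2 + 2 * h) powr a - 2 * (2 + h) powr a + 2 powr a\<bar> \<le> \<bar>a * (a - 1)\<bar> * h\<^sup>2"
proof -
  let ?f = "\<lambda>s :: real. s powr a" and ?f' = "\<lambda>s :: real. a * s powr (a - 1)" and ?f'' = "\<lambda>s :: real. a * ((a - 1) * s powr (a - 2))"
  have d1: "(?f has_real_derivative ?f' s) (at s)" if "s > 0" for s
    using that by (auto intro!: derivative_eq_intros)
  have d2: "(?f' has_real_derivative ?f'' s) (at s)" if "s > 0" for s
    using that by (auto intro!: derivative_eq_intros simp: algebra_simps)
  have "\<exists>z. 2 < z \<and> z < 2 + h \<and> (?f (2 + h + h) - ?f (2 + h)) - (?f (2 + h) - ?f 2) = (2 + h - 2) * (?f' (z + h) - ?f' z)"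
  proof (rule MVT2)
    fix x assume "2 \<le> x" "x \<le> 2 + h"
    then have "((\<lambda>s. ?f (s + h)) has_real_derivative ?f' (x + h) * 1) (at x)"
      using h by (intro DERIV_chain2[OF d1]) (auto intro!: derivative_eq_intros)
    then show "((\<lambda>s. ?f (s + h) - ?f s) has_real_derivative ?f' (x + h) - ?f' x) (at x)"
      using d1[of x] \<open>2 \<le> x\<close> by (intro DERIV_diff) auto
  qed (use h in simp)
  then obtain z where z: "2 < z" "(?f (2 + h + h) - ?f (2 + h)) - (?f (2 + h) - ?f 2) = h * (?f' (z + h) - ?f' z)"
    by auto
  have "\<exists>w. z < w \<and> w < z + h \<and> ?f' (z + h) - ?f' z = (z + h - z) * ?f'' w"
    by (rule MVT2) (use h z d2 in auto)
  then obtain w where w: "z < w" "?f' (z + h) - ?f' z = h * ?f'' w" by auto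
  have eq: "(2 + 2 * h) powr a - 2 * (2 + h) powr a + 2 powr a = h\<^sup>2 * ?f'' w"
  proof -
    have "2 + h + h = 2 + 2 * h" by simp
    with z(2) w(2) show ?thesis by (simp only: power2_eq_square)
  qed
  have "x powr b \<le> 1" if "1 \<le> x" "b \<le> 0" for x b :: real
    using powr_mono[OF that(2,1)] that(1) by simp
  then have w1: "w powr (a - 2) \<le> 1" using a z(1) w(1) by simp
  have "\<bar>h\<^sup>2 * ?f'' w\<bar> = \<bar>a * (a - 1)\<bar> * h\<^sup>2 * w powr (a - 2)"
    by (simp add: abs_mult mult.assoc mult.commute mult.left_commute)
  also have "\<dots> \<le> \<bar>a * (a - 1)\<bar> * h\<^sup>2 * 1"
    using w1 by (intro mult_left_mono) auto
  finally show ?thesis using eq by simp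
qed

text \<open>The factor \<open>exp 1\<close> normalises the value at 0 to 1. There is no plateau; the
  limit of cutoff(s/R) for growing R is all that is used.\<close>

definition cutoff :: "real \<Rightarrow> real" where
  "cutoff s = exp 1 * flat 0 (1 - s)"

lemma cutoff_derivative: "(cutoff has_real_derivative - exp 1 * flat 2 (1 - s)) (at s)"
proof -
  have "((\<lambda>s. flat 0 (1 - s)) has_real_derivative (flat 2 (1 - s)) * (- 1)) (at s)"
    by (rule DERIV_chain2[where f = "flat 0"]) (use flat_derivative[of 0 "1 - s"] in \<open>auto intro!: derivative_eq_intros simp: numeral_2_eq_2\<close>)
  from DERIV_cmult[OF this, of "exp 1"] show ?thesis by (simp add: cutoff_def[abs_def])
qed

lemma smooth_cutoff: "smooth cutoff"
  unfolding cutoff_def[abs_def]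
  by (intro smooth_mult smooth_const smooth_compose[OF smooth_flat] smooth_diff smooth_id)

lemma cutoff_bounds: "cutoff s \<ge> 0" "s \<ge> 0 \<Longrightarrow> cutoff s \<le> 1" "s \<ge> 1 \<Longrightarrow> cutoff s = 0" "cutoff 0 = 1"
proof -
  show "cutoff s \<ge> 0" "s \<ge> 1 \<Longrightarrow> cutoff s = 0" "cutoff 0 = 1"
    by (auto simp: cutoff_def flat_0_eq simp flip: exp_add)
  assume s: "s \<ge> 0"
  show "cutoff s \<le> 1"
  proof (cases "s < 1")
    case True
    then have "1 \<le> 1 / (1 - s)" using s by (simp add: le_divide_eq)
    then have "exp (1 + - (1 / (1 - s))) \<le> exp 0" by (intro exp_mono) simp
    then have "exp 1 * exp (- (1 / (1 - s))) \<le> 1" by (simp only: exp_add exp_zero)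
    then show ?thesis using True by (simp add: cutoff_def flat_0_eq)
  qed (simp add: cutoff_def flat_0_eq)
qed

text \<open>The scale invariant form of the derivative bound: it makes the estimates for
  cutoff(wt/R) independent of R.\<close>

lemma cutoff_derivative_bound: "\<exists>B\<ge>0. \<forall>s\<ge>0. \<bar>exp 1 * flat 2 (1 - s)\<bar> * s \<le> B"
proof -
  have "continuous_on {0..1} (\<lambda>s. exp 1 * flat 2 (1 - s))"
    by (intro continuous_on_mult continuous_on_const continuous_on_compose2[OF smooth_continuous_on[OF smooth_flat, of UNIV]]
        continuous_on_diff continuous_on_id) auto
  then have "bounded ((\<lambda>s. exp 1 * flat 2 (1 - s)) ` {0..1})"
    by (intro compact_imp_bounded compact_continuous_image) auto
  then obtain B where B: "\<And>s. s \<in> {0..1} \<Longrightarrow> \<bar>exp 1 * flat 2 (1 - s)\<bar> \<le> B"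
    unfolding bounded_iff image_iff real_norm_def by blast
  have B0: "B \<ge> 0" using B[of 0] by simp
  have "\<bar>exp 1 * flat 2 (1 - s)\<bar> * s \<le> B" if "s \<ge> 0" for s
  proof (cases "s \<le> 1")
    case True
    then have "\<bar>exp 1 * flat 2 (1 - s)\<bar> * s \<le> \<bar>exp 1 * flat 2 (1 - s)\<bar> * 1" by (intro mult_left_mono) auto
    also have "\<dots> \<le> B" using B[of s] that True by simp
    finally show ?thesis .
  next
    case False
    then show ?thesis using B0 by (simp add: flat_def)
  qed
  then show ?thesis using B0 by blast
qed

lemma L2_norm_mono:
  assumes "f \<in> L2" "g \<in> L2" "\<And>x. \<bar>f x\<bar> \<le> \<bar>g x\<bar>"
  shows "L2_norm f \<le> L2_norm g"
  unfolding L2_norm_def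
proof (intro real_sqrt_le_mono integral_mono)
  show "(f x)\<^sup>2 \<le> (g x)\<^sup>2" for x using assms(3)[of x] by (simp add: abs_le_square_iff)
qed (use assms(1,2) in \<open>simp_all add: L2_def\<close>)

lemma L2_uminus: "f \<in> L2 \<Longrightarrow> (\<lambda>x. f (- x)) \<in> L2"
  and L2_norm_uminus: "f \<in> borel_measurable borel \<Longrightarrow> L2_norm (\<lambda>x. f (- x)) = L2_norm f"
  for f :: "'a::euclidean_space \<Rightarrow> real"
proof -
  have m: "uminus \<in> lborel \<rightarrow>\<^sub>M (borel :: 'a measure)" by simp
  show "L2_norm (\<lambda>x. f (- x)) = L2_norm f" if f: "f \<in> borel_measurable borel"
  proof -
    have "(LINT x|distr lborel borel uminus. (f x)\<^sup>2) = (LINT x|lborel. (f (- x))\<^sup>2)"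
      by (rule integral_distr[OF m]) (use f in simp)
    then show ?thesis by (simp add: lborel_distr_uminus_euclidean L2_norm_def)
  qed
  assume f: "f \<in> L2"
  have "integrable (distr lborel borel uminus) (\<lambda>x. (f x)\<^sup>2) \<longleftrightarrow> integrable lborel (\<lambda>x. (f (- x))\<^sup>2)"
    by (rule integrable_distr_eq[OF m]) (use L2_measurable[OF f] in simp)
  then show "(\<lambda>x. f (- x)) \<in> L2"
    using f L2_measurable[OF f] by (simp add: lborel_distr_uminus_euclidean L2_def)
qed

context stratified_group
begin

lemma L2_flip: "f \<in> L2 \<Longrightarrow> (\<lambda>a. f (mul (- a) y)) \<in> L2"
  and L2_norm_flip: "f \<in> borel_measurable borel \<Longrightarrow> L2_norm (\<lambda>a. f (mul (- a) y)) = L2_norm f"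
proof -
  show "(\<lambda>a. f (mul (- a) y)) \<in> L2" if "f \<in> L2"
    using L2_left[OF L2_uminus[OF that], of "- y"] by (simp add: neg_mul)
  assume f: "f \<in> borel_measurable borel"
  then have "L2_norm (\<lambda>a. f (- mul (- y) a)) = L2_norm (\<lambda>x. f (- x))"
    by (intro L2_norm_left) simp
  then show "L2_norm (\<lambda>a. f (mul (- a) y)) = L2_norm f"
    by (simp add: neg_mul L2_norm_uminus[OF f])
qed

end

context heat
begin

lemma p_at_0: "t > 0 \<Longrightarrow> p t 0 = t powr (- real (homdim deg) / 2) * p 1 0"
proof -
  assume t: "t > 0"
  have "p t 0 = (1 / sqrt t) ^ homdim deg * p 1 0"
    using p_scaling[of "1 / sqrt t" t 0] t by (simp add: power_divide)
  also have "(1 / sqrt t) ^ homdim deg = t powr (- real (homdim deg) / 2)"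
  proof -
    have "1 / sqrt t = t powr (- (1 / 2))" using t by (simp add: powr_minus powr_half_sqrt inverse_eq_divide)
    then have "(1 / sqrt t) ^ homdim deg = (t powr (- (1 / 2))) ^ homdim deg" by (rule arg_cong)
    also have "\<dots> = t powr (real (homdim deg) * (- (1 / 2)))"
      using t by (subst powr_power) auto
    finally show ?thesis by simp
  qed
  finally show ?thesis .
qed

text \<open>By the semigroup law the squared norm is a second difference of \<open>t \<mapsto> p\<^sub>t(0)\<close>, which is
  a power of \<open>t\<close> by scaling.\<close>

lemma p_difference:
  "\<exists>C\<ge>0. \<forall>h>0. L2_norm (\<lambda>x. p (1 + h) x - p 1 x) \<le> C * h"
proof -
  define a where "a = - real (homdim deg) / 2"
  have a0: "a \<le> 0" by (simp add: a_def)
  define K where "K = \<bar>a * (a - 1)\<bar> * p 1 0"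
  have K: "K \<ge> 0" by (simp add: K_def p_nonneg)
  have "L2_norm (\<lambda>x. p (1 + h) x - p 1 x) \<le> sqrt K * h" if h: "h > 0" for h
  proof -
    have L: "p (1 + h) \<in> L2" "p 1 \<in> L2" using h by (auto intro: p_L2)
    have "ip (\<lambda>x. p (1 + h) x - p 1 x) (\<lambda>x. p (1 + h) x - p 1 x) =
        p (2 + 2 * h) 0 - 2 * p (2 + h) 0 + p 2 0"
      using L h by (simp add: ip_diff_left ip_diff_right L2_diff ip_p algebra_simps)
    also have "\<dots> = ((2 + 2 * h) powr a - 2 * (2 + h) powr a + 2 powr a) * p 1 0"
    proof -
      have "p (2 + 2 * h) 0 = (2 + 2 * h) powr a * p 1 0" "p (2 + h) 0 = (2 + h) powr a * p 1 0" "p 2 0 = 2 powr a * p 1 0"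
        unfolding a_def by (rule p_at_0, use h in simp)+
      then show ?thesis by (simp only: ring_distribs)
    qed
    also have "\<dots> \<le> (\<bar>a * (a - 1)\<bar> * h\<^sup>2) * p 1 0"
      using order_trans[OF abs_ge_self powr_second_difference[of a h]] h by (intro mult_right_mono) (auto simp: a_def[symmetric] a0 p_nonneg)
    finally have "(L2_norm (\<lambda>x. p (1 + h) x - p 1 x))\<^sup>2 \<le> K * h\<^sup>2" by (simp add: L2_norm_sq K_def mult.commute mult.left_commute)
    then have "sqrt ((L2_norm (\<lambda>x. p (1 + h) x - p 1 x))\<^sup>2) \<le> sqrt (K * h\<^sup>2)" by (rule real_sqrt_le_mono)
    then show ?thesis using h L2_norm_nonneg by (simp add: real_sqrt_mult)
  qed
  then show ?thesis using K by (intro exI[of _ "sqrt K"]) auto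
qed

text \<open>\<open>p 1\<close> is not known to lie in the domain of the generator, so symmetry of
  the semigroup cannot be quoted. Fubini's theorem and the semigroup law for the kernels take its
  place.\<close>

lemma ip_p_T:
  assumes h: "h > 0" and \<psi>: "test_fun \<psi>"
  shows "ip (p 1) (T h \<psi>) = ip (p (1 + h)) \<psi>"
proof -
  let ?F = "\<lambda>(a, g). \<psi> a * (p 1 g * p h (mul (- a) g))"
  have one: "(1 :: real) > 0" by simp
  have oh: "1 + h > 0" using h by simp
  have mp [measurable]: "\<psi> \<in> borel_measurable borel" by (rule L2_measurable[OF test_fun_L2[OF \<psi>]])
  note [measurable] = measurable_p[OF one]
  note [measurable] = p_kernel_measurable[OF h]
  have tr: "p h (mul (- a) g) = p h (mul (- g) a)" for a g by (rule p_right_left[OF h])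
  have i: "integrable lborel (\<lambda>g. p 1 g * p h (mul (- a) g))" for a
    unfolding tr[of a] by (rule L2_prod_integrable[OF p_L2[OF one] p_translate_L2[OF h]])
  have v: "(LINT g|lborel. p 1 g * p h (mul (- a) g)) = p (1 + h) a" for a
    unfolding tr[of a] using p_semigroup[OF one h, of a] by (simp add: ip_def)
  have iF: "integrable (lborel \<Otimes>\<^sub>M lborel) ?F"
  proof (rule lborel_pair.Fubini_integrable)
    show "?F \<in> borel_measurable (lborel \<Otimes>\<^sub>M lborel)" by measurable
    show "AE a in lborel. integrable lborel (\<lambda>g. ?F (a, g))" using i by simp
    have e1: "(LINT g|lborel. norm (?F (a, g))) = \<bar>\<psi> a\<bar> * p (1 + h) a" for a
    proof -
      have "norm (?F (a, g)) = \<bar>\<psi> a\<bar> * (p 1 g * p h (mul (- a) g))" for g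
        by (simp add: abs_mult p_nonneg h)
      then show ?thesis using v[of a] by simp
    qed
    have e: "(\<lambda>a. LINT g|lborel. norm (?F (a, g))) = (\<lambda>a. \<bar>\<psi> a * p (1 + h) a\<bar>)"
      by (simp only: e1 abs_mult abs_of_nonneg[OF p_nonneg[OF oh]])
    show "integrable lborel (\<lambda>a. LINT g|lborel. norm (?F (a, g)))"
      unfolding e by (intro integrable_abs L2_prod_integrable test_fun_L2 \<psi> p_L2 oh)
  qed
  have "ip (p 1) (T h \<psi>) = (LINT g|lborel. p 1 g * gconv mul \<psi> (p h) g)"
    unfolding ip_def
  proof (rule integral_cong_AE)
    have "gconv mul \<psi> (p h) \<in> borel_measurable borel"
      unfolding gconv_def by (rule lborel.borel_measurable_lebesgue_integral) measurable
    then show "(\<lambda>g. p 1 g * gconv mul \<psi> (p h) g) \<in> borel_measurable lborel" by simp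
    show "(\<lambda>g. p 1 g * T h \<psi> g) \<in> borel_measurable lborel"
      using L2_measurable[OF T_L2[OF less_imp_le[OF h] test_fun_L2[OF \<psi>]]] by simp
    show "AE g in lborel. p 1 g * T h \<psi> g = p 1 g * gconv mul \<psi> (p h) g"
      using T_conv[OF h test_fun_L2[OF \<psi>]] by eventually_elim simp
  qed
  also have "\<dots> = (LINT g|lborel. LINT a|lborel. ?F (a, g))"
    by (simp only: gconv_def integral_mult_right_zero[symmetric] prod.case mult.left_commute)
  also have "\<dots> = (LINT a|lborel. LINT g|lborel. ?F (a, g))"
    using lborel_pair.Fubini_integral[OF iF] by simp
  also have "\<dots> = ip (p (1 + h)) \<psi>"
    by (simp add: v ip_def mult.commute)
  finally show ?thesis .
qed

text \<open>The weak form of the statement that the sub-Laplacian of \<open>p 1\<close> is in L2.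
  The difference quotient of the orbit of the test function is moved onto the kernel by
  \<open>ip_p_T\<close> and bounded there by \<open>p_difference\<close>.\<close>

lemma L_p_bound: "\<exists>C\<ge>0. \<forall>\<psi>. test_fun \<psi> \<longrightarrow> \<bar>ip \<psi> (L (p 1))\<bar> \<le> C * L2_norm \<psi>"
proof -
  obtain C where C: "C \<ge> 0" "\<And>h. h > 0 \<Longrightarrow> L2_norm (\<lambda>x. p (1 + h) x - p 1 x) \<le> C * h" using p_difference by blast
  have "\<bar>ip \<psi> (L (p 1))\<bar> \<le> C * L2_norm \<psi>" if \<psi>: "test_fun \<psi>" for \<psi>
  proof -
    have one: "(1 :: real) > 0" by simp
    have L: "\<psi> \<in> L2" "L \<psi> \<in> L2" "p 1 \<in> L2" using \<psi> by (auto intro: test_fun_L2 test_fun_L p_L2)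
    have eq: "ip \<psi> (L (p 1)) = ip (p 1) (L \<psi>)"
      using L_symmetric[OF \<psi> smooth_p[OF one]] by (simp add: ip_commute)
    have "\<bar>ip (p 1) (L \<psi>)\<bar> \<le> C * L2_norm \<psi> + L2_norm (p 1) * rem \<psi> (L \<psi>) h" if h: "h > 0" for h
    proof -
      let ?d = "\<lambda>x. (T h \<psi> x - \<psi> x) / h - L \<psi> x"
      have Th: "T h \<psi> \<in> L2" using h L by (intro T_L2) auto
      have ph: "p (1 + h) \<in> L2" using h by (intro p_L2) auto
      have "ip (p 1) (\<lambda>x. (T h \<psi> x - \<psi> x) / h) = 1 / h * ip (p 1) (\<lambda>x. T h \<psi> x - \<psi> x)"
        using ip_cmult_right[of "p 1" "1 / h" "\<lambda>x. T h \<psi> x - \<psi> x"] by simp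
      also have "ip (p 1) (\<lambda>x. T h \<psi> x - \<psi> x) = ip (\<lambda>x. p (1 + h) x - p 1 x) \<psi>"
        using L Th ph by (simp add: ip_diff_right ip_diff_left ip_p_T[OF h \<psi>])
      finally have e: "ip (p 1) (\<lambda>x. (T h \<psi> x - \<psi> x) / h) = 1 / h * ip (\<lambda>x. p (1 + h) x - p 1 x) \<psi>" .
      have "\<bar>ip (\<lambda>x. p (1 + h) x - p 1 x) \<psi>\<bar> \<le> (C * h) * L2_norm \<psi>"
        by (rule order_trans[OF ip_Cauchy_Schwarz[OF L2_diff[OF ph L(3)] L(1)] mult_right_mono[OF C(2)[OF h] L2_norm_nonneg]])
      then have b1: "\<bar>ip (p 1) (\<lambda>x. (T h \<psi> x - \<psi> x) / h)\<bar> \<le> C * L2_norm \<psi>"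
        unfolding e using h by (simp add: abs_mult field_simps)
      have b2: "\<bar>ip (p 1) ?d\<bar> \<le> L2_norm (p 1) * rem \<psi> (L \<psi>) h"
        unfolding rem_def by (rule ip_Cauchy_Schwarz[OF L(3) L2_diff[OF L2_divide[OF L2_diff[OF Th L(1)]] L(2)]])
      have "ip (p 1) ?d = ip (p 1) (\<lambda>x. (T h \<psi> x - \<psi> x) / h) - ip (p 1) (L \<psi>)"
        by (rule ip_diff_right[OF L2_divide[OF L2_diff[OF Th L(1)]] L(2,3)])
      moreover have "\<bar>z\<bar> \<le> A + B" if "d = y - z" "\<bar>y\<bar> \<le> A" "\<bar>d\<bar> \<le> B" for d y z A B :: real
        using that by linarith
      ultimately show ?thesis using b1 b2 by blast
    qed
    then have "\<forall>\<^sub>F h in at_right 0. \<bar>ip (p 1) (L \<psi>)\<bar> \<le> C * L2_norm \<psi> + L2_norm (p 1) * rem \<psi> (L \<psi>) h"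
      by (auto intro: eventually_mono[OF eventually_at_right_less])
    moreover have "((\<lambda>h. C * L2_norm \<psi> + L2_norm (p 1) * rem \<psi> (L \<psi>) h) \<longlongrightarrow> C * L2_norm \<psi> + L2_norm (p 1) * 0) (at_right 0)"
      by (intro tendsto_intros rem_tendsto test_gen \<psi>)
    ultimately have "\<bar>ip (p 1) (L \<psi>)\<bar> \<le> C * L2_norm \<psi> + L2_norm (p 1) * 0"
      by - (rule tendsto_lowerbound, auto)
    then show ?thesis by (simp add: eq)
  qed
  then show ?thesis using C(1) by blast
qed

text \<open>Caccioppoli's argument: test \<open>\<Delta> p\<^sub>1 \<in> L\<^sup>2\<close> against \<open>w\<^sup>2 p\<^sub>1\<close> with a cut-off weight \<open>w\<close>.\<close>

lemma wt_gradient_L2: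
  assumes j: "deg j = 1"
  shows "(\<lambda>x. wt deg x ^ m * X j (p 1) x) \<in> L2"
proof -
  let ?W = "wt deg" and ?P = "p 1"
  have W0: "?W x > 0" for x by (rule wt_pos)
  have sP: "smooth ?P" by (rule smooth_p) simp
  have sX: "smooth (X k ?P)" for k by (rule lvf_smooth[OF sP])
  obtain C where C: "C \<ge> 0" "\<And>\<psi>. test_fun \<psi> \<Longrightarrow> \<bar>ip \<psi> (L ?P)\<bar> \<le> C * L2_norm \<psi>" using L_p_bound by blast
  obtain D where D: "D \<ge> 0" "\<And>k x. deg k = 1 \<Longrightarrow> \<bar>X k ?W x\<bar> \<le> D * ?W x" using lvf_wt_bound by blast
  obtain B where B: "B \<ge> 0" "\<And>s. s \<ge> 0 \<Longrightarrow> \<bar>exp 1 * flat 2 (1 - s)\<bar> * s \<le> B" using cutoff_derivative_bound by blast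
  \<comment> \<open>The derivative falls on the power of \<open>wt\<close>, contributing
    \<open>m\<close>, or on the cut-off, contributing \<open>B\<close>; \<open>D\<close> bounds the
    derivative of \<open>wt\<close> itself.\<close>
  define G where "G = (real m + B) * D"
  have G0: "G \<ge> 0" using B D by (simp add: G_def)
  define w where "w = (\<lambda>R x. ?W x ^ m * cutoff (?W x / R))"
  have sw: "smooth (w R)" for R
    unfolding w_def using smooth_compose[OF smooth_cutoff smooth_mult[OF smooth_wt smooth_const[of "1 / R"]]]
    by (intro smooth_mult smooth_power smooth_wt) simp
  have w0: "w R x \<ge> 0" and wle: "R > 0 \<Longrightarrow> w R x \<le> ?W x ^ m" for R x
  proof -
    show "w R x \<ge> 0" unfolding w_def using W0[of x] cutoff_bounds(1) by simp
    assume "R > 0"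
    then show "w R x \<le> ?W x ^ m" unfolding w_def
      using W0[of x] cutoff_bounds(2)[of "?W x / R"] by (intro mult_left_le) auto
  qed
  have wsupp: "w R x = 0" if "R > 0" "x \<notin> {x. ?W x \<le> R}" for R x
    using that cutoff_bounds(3)[of "?W x / R"] by (simp add: w_def le_divide_eq)
  have Xw: "\<bar>X k (w R) x\<bar> \<le> G * ?W x ^ m" if R: "R > 0" and k: "deg k = 1" for R k x
  proof -
    let ?s = "?W x"
    let ?d = "real m * ?s ^ (m - Suc 0) * cutoff (?s / R) + ?s ^ m * (- exp 1 * flat 2 (1 - ?s / R) * (1 / R))"
    have "((\<lambda>s. cutoff (s / R)) has_real_derivative - exp 1 * flat 2 (1 - ?s / R) * (1 / R)) (at ?s)"
      by (rule DERIV_chain2[OF cutoff_derivative]) (use R in \<open>auto intro!: derivative_eq_intros\<close>)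
    from DERIV_mult'[OF DERIV_pow[of m ?s] this]
    have "((\<lambda>s. s ^ m * cutoff (s / R)) has_real_derivative ?d) (at ?s)"
      by (simp add: algebra_simps)
    from lvf_chain[OF smooth_wt _ this, of "axis k 1"] sw[of R]
    have eq: "X k (w R) x = ?d * X k ?W x" by (simp add: w_def)
    have "\<bar>?d\<bar> * ?s \<le> (real m + B) * ?s ^ m"
    proof -
      have "\<bar>?d\<bar> \<le> real m * ?s ^ (m - Suc 0) * cutoff (?s / R) + ?s ^ m * (\<bar>exp 1 * flat 2 (1 - ?s / R)\<bar> * (1 / R))"
        using R W0[of x] cutoff_bounds(1)[of "?s / R"] by (intro order_trans[OF abs_triangle_ineq]) (simp add: abs_mult)
      also have "\<dots> \<le> real m * ?s ^ (m - Suc 0) * 1 + ?s ^ m * (\<bar>exp 1 * flat 2 (1 - ?s / R)\<bar> * (1 / R))"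
        using R W0[of x] cutoff_bounds(2)[of "?s / R"] by (intro add_right_mono mult_left_mono) auto
      finally have "\<bar>?d\<bar> * ?s \<le> (real m * ?s ^ (m - Suc 0) * 1 + ?s ^ m * (\<bar>exp 1 * flat 2 (1 - ?s / R)\<bar> * (1 / R))) * ?s"
        using W0[of x] by (intro mult_right_mono) auto
      also have "\<dots> = real m * ?s ^ m + ?s ^ m * (\<bar>exp 1 * flat 2 (1 - ?s / R)\<bar> * (?s / R))"
        by (cases m) (simp_all add: algebra_simps)
      also have "\<dots> \<le> real m * ?s ^ m + ?s ^ m * B"
        using B(2)[of "?s / R"] R W0[of x] by (intro add_left_mono mult_left_mono) auto
      finally show ?thesis by (simp add: algebra_simps)
    qed
    then have "\<bar>?d\<bar> * ?s * D \<le> (real m + B) * ?s ^ m * D" using D(1) by (intro mult_right_mono)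
    moreover have "\<bar>X k (w R) x\<bar> \<le> \<bar>?d\<bar> * (D * ?s)"
      unfolding eq abs_mult using D(2)[OF k, of x] by (intro mult_left_mono) auto
    moreover have "z \<le> G * q" if "d * s * D \<le> (real m + B) * q * D" "z \<le> d * (D * s)" for z d s q :: real
      using that by (simp add: G_def ac_simps)
    ultimately show ?thesis by blast
  qed
  have WL: "(\<lambda>x. ?W x ^ k * ?P x) \<in> L2" for k by (rule wt_p_L2) simp
  \<comment> \<open>The sum S of the energies satisfies S <= (pairing) + S/2 + 2 (cut-off terms).
    Absorbing S/2 doubles the constants, hence 2 and 4.\<close>
  define A where "A = 2 * C * L2_norm (\<lambda>x. ?W x ^ (2 * m) * ?P x) + 4 * (real CARD('n) * (G\<^sup>2 * ip (\<lambda>x. ?W x ^ m * ?P x) (\<lambda>x. ?W x ^ m * ?P x)))"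
  have energy: "(LINT x|lborel. (w R x * X j ?P x)\<^sup>2) \<le> A" if R: "R > 0" for R
  proof -
    have tw: "test_fun (w R)" by (rule test_funI[OF sw compact_wt_le[OF deg_pos, where R = R] wsupp[OF R]])
    have tww: "test_fun (\<lambda>x. w R x * w R x)" by (rule test_fun_mult(1)[OF tw sw])
    define \<phi> where "\<phi> = (\<lambda>x. w R x * w R x * ?P x)"
    have t\<phi>: "test_fun \<phi>" unfolding \<phi>_def by (rule test_fun_mult(1)[OF tww sP])
    define I where "I = (\<lambda>k. LINT x|lborel. (w R x * X k ?P x)\<^sup>2)"
    define H where "H = (\<lambda>k. LINT x|lborel. (X k (w R) x * ?P x)\<^sup>2)"
    have L2i: "integrable lborel (\<lambda>x. (f x)\<^sup>2)" if "test_fun f" for f :: "real ^ 'n \<Rightarrow> real"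
      using test_fun_L2[OF that] by (simp add: L2_def)
    have iI: "integrable lborel (\<lambda>x. (w R x * X k ?P x)\<^sup>2)" for k
      by (rule L2i, rule test_fun_mult(1)[OF tw sX])
    have iH: "integrable lborel (\<lambda>x. (X k (w R) x * ?P x)\<^sup>2)" for k
      by (rule L2i, rule test_fun_mult(1)[OF lvf_test_fun[OF tw] sP])
    have I0: "I k \<ge> 0" and H0: "H k \<ge> 0" for k
      unfolding I_def H_def by (rule integral_nonneg_AE, simp)+
    have Hle: "H k \<le> G\<^sup>2 * ip (\<lambda>x. ?W x ^ m * ?P x) (\<lambda>x. ?W x ^ m * ?P x)" if k: "deg k = 1" for k
    proof -
      have "H k \<le> (LINT x|lborel. G\<^sup>2 * ((?W x ^ m * ?P x) * (?W x ^ m * ?P x)))"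
        unfolding H_def
      proof (rule integral_mono[OF iH])
        show "integrable lborel (\<lambda>x. G\<^sup>2 * ((?W x ^ m * ?P x) * (?W x ^ m * ?P x)))"
          by (intro integrable_mult_right L2_prod_integrable WL)
        fix x
        have "\<bar>X k (w R) x * ?P x\<bar> \<le> G * ?W x ^ m * \<bar>?P x\<bar>"
          unfolding abs_mult by (intro mult_right_mono Xw R k) auto
        then have "\<bar>X k (w R) x * ?P x\<bar>\<^sup>2 \<le> (G * ?W x ^ m * \<bar>?P x\<bar>)\<^sup>2" by (intro power_mono) auto
        then show "(X k (w R) x * ?P x)\<^sup>2 \<le> G\<^sup>2 * ((?W x ^ m * ?P x) * (?W x ^ m * ?P x))"
          by (simp add: power_mult_distrib power2_eq_square[of "?W x ^ m"] power2_eq_square[of "?P x"] mult.assoc mult.left_commute)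
      qed
      then show ?thesis by (simp add: ip_def)
    qed
    \<comment> \<open>Expanding the derivative of w^2 p_1 leaves a cross term 2ab, with a = (X_k w)
      p_1 and b = w X_k p_1. It is at least - b^2/2 - 2a^2, by (b + 2a)^2 >= 0.\<close>
    have parts: "I k \<le> (LINT x|lborel. X k \<phi> x * X k ?P x) + (I k / 2 + 2 * H k)" if k: "deg k = 1" for k
    proof -
      have X\<phi>: "X k \<phi> x = 2 * (w R x * X k (w R) x * ?P x) + w R x * w R x * X k ?P x" for x
        unfolding \<phi>_def lvf_mult[OF smooth_mult[OF sw sw] sP] lvf_mult[OF sw sw] by (simp add: algebra_simps)
      have "(w R x * X k ?P x)\<^sup>2 \<le> X k \<phi> x * X k ?P x + ((w R x * X k ?P x)\<^sup>2 / 2 + 2 * (X k (w R) x * ?P x)\<^sup>2)" for x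
      proof -
        have "b\<^sup>2 \<le> (2 * (a * b) + b * b) + (b\<^sup>2 / 2 + 2 * a\<^sup>2)" for a b :: real
        proof -
          have "0 \<le> (b + 2 * a)\<^sup>2 / 2" by simp
          then show ?thesis by (simp add: power2_eq_square algebra_simps)
        qed
        from this[of "w R x * X k ?P x" "X k (w R) x * ?P x"]
        show ?thesis by (simp add: X\<phi> power2_eq_square algebra_simps)
      qed
      note pt = this
      have i\<phi>: "integrable lborel (\<lambda>x. X k \<phi> x * X k ?P x)"
        by (rule test_fun_integrable[OF test_fun_mult(1)[OF lvf_test_fun[OF t\<phi>] sX]])
      have "I k \<le> (LINT x|lborel. X k \<phi> x * X k ?P x + ((w R x * X k ?P x)\<^sup>2 / 2 + 2 * (X k (w R) x * ?P x)\<^sup>2))"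
        unfolding I_def by (rule integral_mono) (use iI iH i\<phi> pt in auto)
      also have "\<dots> = (LINT x|lborel. X k \<phi> x * X k ?P x) + (I k / 2 + 2 * H k)"
        using iI iH i\<phi> by (simp add: I_def H_def)
      finally show ?thesis .
    qed
    \<comment> \<open>Only the sum over all horizontal directions is controlled by the
      sub-Laplacian. The single energy for \<open>j\<close> is recovered at the end, all of them
      being nonnegative.\<close>
    have Jsum: "(\<Sum>k | deg k = 1. LINT x|lborel. X k \<phi> x * X k ?P x) = - ip \<phi> (L ?P)"
    proof -
      have "(LINT x|lborel. X k \<phi> x * X k ?P x) = - ip (X k (X k ?P)) \<phi>" for k
        using integration_by_parts[OF t\<phi> sX[of k], of "axis k 1"] by (simp add: ip_def mult.commute)
      then have "(\<Sum>k | deg k = 1. LINT x|lborel. X k \<phi> x * X k ?P x) = - (\<Sum>k | deg k = 1. ip (X k (X k ?P)) \<phi>)"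
        by (simp add: sum_negf)
      also have "(\<Sum>k | deg k = 1. ip (X k (X k ?P)) \<phi>) = ip (L ?P) \<phi>"
        unfolding L_eq
      proof (rule ip_sum_left[symmetric])
        fix k
        show "integrable lborel (\<lambda>x. X k (X k ?P) x * \<phi> x)"
          using test_fun_integrable[OF test_fun_mult(2)[OF t\<phi> lvf_smooth[OF sX[of k]]]] .
      qed
      finally show ?thesis by (simp add: ip_commute)
    qed
    have Sp: "(\<Sum>k | deg k = 1. I k) \<le> - ip \<phi> (L ?P) + ((\<Sum>k | deg k = 1. I k) / 2 + 2 * (\<Sum>k | deg k = 1. H k))"
    proof -
      have "(\<Sum>k | deg k = 1. I k) \<le> (\<Sum>k | deg k = 1. (LINT x|lborel. X k \<phi> x * X k ?P x) + (I k / 2 + 2 * H k))"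
        by (rule sum_mono) (use parts in simp)
      then show ?thesis by (simp only: sum.distrib Jsum sum_divide_distrib sum_distrib_left)
    qed
    have ipb: "- ip \<phi> (L ?P) \<le> C * L2_norm (\<lambda>x. ?W x ^ (2 * m) * ?P x)"
    proof -
      have "L2_norm \<phi> \<le> L2_norm (\<lambda>x. ?W x ^ (2 * m) * ?P x)"
      proof (rule L2_norm_mono[OF test_fun_L2[OF t\<phi>] WL])
        fix x
        have "w R x * w R x \<le> ?W x ^ m * ?W x ^ m"
          using wle[OF R, of x] w0[of R x] by (intro mult_mono) (auto intro: order_trans)
        then have "\<bar>w R x * w R x\<bar> \<le> \<bar>?W x ^ (2 * m)\<bar>"
          using W0[of x] w0[of R x] by (simp add: power_add mult_2)
        then show "\<bar>\<phi> x\<bar> \<le> \<bar>?W x ^ (2 * m) * ?P x\<bar>"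
          unfolding \<phi>_def abs_mult[of _ "?P x"] by (rule mult_right_mono) simp
      qed
      then have "C * L2_norm \<phi> \<le> C * L2_norm (\<lambda>x. ?W x ^ (2 * m) * ?P x)" using C(1) by (rule mult_left_mono)
      then show ?thesis using C(2)[OF t\<phi>] by linarith
    qed
    have Hs: "(\<Sum>k | deg k = 1. H k) \<le> real CARD('n) * (G\<^sup>2 * ip (\<lambda>x. ?W x ^ m * ?P x) (\<lambda>x. ?W x ^ m * ?P x))"
    proof -
      let ?h = "G\<^sup>2 * ip (\<lambda>x. ?W x ^ m * ?P x) (\<lambda>x. ?W x ^ m * ?P x)"
      have "(\<Sum>k | deg k = 1. H k) \<le> real (card {k. deg k = 1}) * ?h"
        by (rule sum_bounded_above) (use Hle in auto)
      also have "\<dots> \<le> real CARD('n) * ?h"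
        by (intro mult_right_mono) (auto intro: card_mono order_trans[OF H0 Hle[OF j]])
      finally show ?thesis .
    qed
    have "I j \<le> (\<Sum>k | deg k = 1. I k)"
      using j I0 by (intro member_le_sum) auto
    then have "I j \<le> A" unfolding A_def using Sp ipb Hs by linarith
    then show ?thesis by (simp add: I_def)
  qed
  have mX: "X j ?P \<in> borel_measurable borel"
    by (intro borel_measurable_continuous_onI smooth_continuous_on sX)
  have mw: "w R \<in> borel_measurable borel" for R
    by (intro borel_measurable_continuous_onI smooth_continuous_on sw)
  have mW: "wt deg \<in> borel_measurable (borel :: (real ^ 'n) measure)"
    by (intro borel_measurable_continuous_onI smooth_continuous_on smooth_wt)
  let ?R = "\<lambda>i. real (Suc i)"
  \<comment> \<open>Here the normalisation cutoff(0) = 1 enters: the cut-off weights tend to the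
    full weight, and Fatou's lemma keeps the bound.\<close>
  have lim: "(\<lambda>i. ennreal ((w (?R i) x * X j ?P x)\<^sup>2)) \<longlonglongrightarrow> ennreal ((?W x ^ m * X j ?P x)\<^sup>2)" for x
  proof -
    have "(\<lambda>i. ?W x / ?R i) \<longlonglongrightarrow> 0"
      using tendsto_mult_right_zero[OF LIMSEQ_inverse_real_of_nat, of "?W x"] by (simp add: inverse_eq_divide)
    moreover have "isCont cutoff 0" using smooth_continuous_on[OF smooth_cutoff, of UNIV] by (simp add: continuous_on_eq_continuous_at)
    ultimately have "(\<lambda>i. cutoff (?W x / ?R i)) \<longlonglongrightarrow> cutoff 0" by (rule isCont_tendsto_compose[rotated])
    then have "(\<lambda>i. (?W x ^ m * cutoff (?W x / ?R i) * X j ?P x)\<^sup>2) \<longlonglongrightarrow> (?W x ^ m * cutoff 0 * X j ?P x)\<^sup>2"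
      by (intro tendsto_intros)
    then show ?thesis by (intro tendsto_ennrealI) (simp add: w_def cutoff_bounds(4))
  qed
  have "(\<integral>\<^sup>+x. ennreal ((?W x ^ m * X j ?P x)\<^sup>2) \<partial>lborel) = (\<integral>\<^sup>+x. liminf (\<lambda>i. ennreal ((w (?R i) x * X j ?P x)\<^sup>2)) \<partial>lborel)"
    using lim_imp_Liminf[OF _ lim] by simp
  also have "\<dots> \<le> liminf (\<lambda>i. \<integral>\<^sup>+x. ennreal ((w (?R i) x * X j ?P x)\<^sup>2) \<partial>lborel)"
    by (rule nn_integral_liminf) (use mw mX in simp)
  also have "\<dots> \<le> ennreal A"
  proof (rule Liminf_le)
    show "\<forall>\<^sub>F i in sequentially. (\<integral>\<^sup>+x. ennreal ((w (?R i) x * X j ?P x)\<^sup>2) \<partial>lborel) \<le> ennreal A"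
    proof (rule always_eventually, rule allI)
      fix i
      have R: "?R i > 0" by simp
      have tw: "test_fun (w (?R i))" by (rule test_funI[OF sw compact_wt_le[OF deg_pos, where R = "?R i"] wsupp[OF R]])
      have iI: "integrable lborel (\<lambda>x. (w (?R i) x * X j ?P x)\<^sup>2)"
        using test_fun_L2[OF test_fun_mult(1)[OF tw sX[of j]]] by (simp add: L2_def)
      have "(\<integral>\<^sup>+x. ennreal ((w (?R i) x * X j ?P x)\<^sup>2) \<partial>lborel) = ennreal (LINT x|lborel. (w (?R i) x * X j ?P x)\<^sup>2)"
        by (rule nn_integral_eq_integral[OF iI]) simp
      then show "(\<integral>\<^sup>+x. ennreal ((w (?R i) x * X j ?P x)\<^sup>2) \<partial>lborel) \<le> ennreal A"
        using energy[OF R] by (simp add: ennreal_leI)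
    qed
  qed simp
  finally have fin: "(\<integral>\<^sup>+x. ennreal ((?W x ^ m * X j ?P x)\<^sup>2) \<partial>lborel) \<le> ennreal A" .
  have "integrable lborel (\<lambda>x. (?W x ^ m * X j ?P x)\<^sup>2)"
  proof (rule integrableI_bounded)
    show "(\<lambda>x. (?W x ^ m * X j ?P x)\<^sup>2) \<in> borel_measurable lborel" using mW mX by simp
    show "(\<integral>\<^sup>+x. ennreal (norm ((?W x ^ m * X j ?P x)\<^sup>2)) \<partial>lborel) < \<infinity>"
      using le_less_trans[OF fin ennreal_less_top] by simp
  qed
  then show ?thesis using mW mX by (simp add: L2_def)
qed

text \<open>The weight at y is split by submultiplicativity between a and a^-1 y; the two factors
  are then weighted L2 functions and Cauchy-Schwarz bounds the integral uniformly.\<close>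

lemma gradient_translate_bound:
  assumes j: "deg j = 1"
  shows "\<exists>K\<ge>0. \<forall>y. (\<integral>\<^sup>+a. ennreal (p 1 a) * ennreal \<bar>X j (p 1) (mul (- a) y)\<bar> \<partial>lborel) \<le> ennreal (K / wt deg y ^ m)"
proof -
  let ?W = "wt deg" and ?P = "p 1" and ?V = "X j (p 1)"
  have one: "(1 :: real) > 0" by simp
  have W0: "?W x > 0" for x by (rule wt_pos)
  have sV: "smooth ?V" by (rule lvf_smooth[OF smooth_p[OF one]])
  have cV: "continuous_on S ?V" for S by (rule smooth_continuous_on[OF sV])
  obtain D where D: "D \<ge> 1" "\<And>a b. ?W (mul a b) \<le> D * ?W a * ?W b" using wt_mul by blast
  let ?f = "\<lambda>a. ?W a ^ m * ?P a" and ?g = "\<lambda>y a. \<bar>?W (mul (- a) y) ^ m * ?V (mul (- a) y)\<bar>"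
  have fL: "?f \<in> L2" by (rule wt_p_L2[OF one])
  have VL: "(\<lambda>a. ?W a ^ m * ?V a) \<in> L2" by (rule wt_gradient_L2[OF j])
  have VLa: "(\<lambda>a. \<bar>?W a ^ m * ?V a\<bar>) \<in> L2"
    by (rule L2_dominated[OF VL]) (use L2_measurable[OF VL] in simp_all)
  have gL: "?g y \<in> L2" for y by (rule L2_flip[OF VLa])
  define A where "A = L2_norm ?f * L2_norm (\<lambda>a. \<bar>?W a ^ m * ?V a\<bar>)"
  have gN: "L2_norm (?g y) = L2_norm (\<lambda>a. \<bar>?W a ^ m * ?V a\<bar>)" for y
    by (rule L2_norm_flip[OF L2_measurable[OF VLa]])
  have A0: "A \<ge> 0" by (simp add: A_def L2_norm_nonneg)
  have "(\<integral>\<^sup>+a. ennreal (?P a) * ennreal \<bar>?V (mul (- a) y)\<bar> \<partial>lborel) \<le> ennreal (D ^ m * A / ?W y ^ m)" for y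
  proof -
    have "(\<integral>\<^sup>+a. ennreal (?P a) * ennreal \<bar>?V (mul (- a) y)\<bar> \<partial>lborel) \<le> (\<integral>\<^sup>+a. ennreal (D ^ m / ?W y ^ m * (?f a * ?g y a)) \<partial>lborel)"
    proof (rule nn_integral_mono)
      fix a
      have "?W y \<le> D * ?W a * ?W (mul (- a) y)" using D(2)[of a "mul (- a) y"] by simp
      then have "?W y ^ m \<le> (D * ?W a * ?W (mul (- a) y)) ^ m" using W0[of y] by (intro power_mono) auto
      then have "1 \<le> D ^ m / ?W y ^ m * (?W a ^ m * ?W (mul (- a) y) ^ m)"
        using W0[of y] by (simp add: power_mult_distrib field_simps)
      from mult_right_mono[OF this, of "?P a * \<bar>?V (mul (- a) y)\<bar>"]
      have "?P a * \<bar>?V (mul (- a) y)\<bar> \<le> D ^ m / ?W y ^ m * (?f a * ?g y a)"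
        using p_nonneg[OF one, of a] W0[of "mul (- a) y"] by (simp add: abs_mult mult.assoc mult.left_commute)
      then show "ennreal (?P a) * ennreal \<bar>?V (mul (- a) y)\<bar> \<le> ennreal (D ^ m / ?W y ^ m * (?f a * ?g y a))"
        using p_nonneg[OF one, of a] by (simp add: ennreal_mult[symmetric] ennreal_leI)
    qed
    also have "\<dots> = ennreal (LINT a|lborel. D ^ m / ?W y ^ m * (?f a * ?g y a))"
    proof (rule nn_integral_eq_integral)
      show "integrable lborel (\<lambda>a. D ^ m / ?W y ^ m * (?f a * ?g y a))"
        by (intro integrable_mult_right L2_prod_integrable fL gL)
      show "AE a in lborel. 0 \<le> D ^ m / ?W y ^ m * (?f a * ?g y a)"
        using W0 D(1) p_nonneg[OF one] by (simp add: less_imp_le)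
    qed
    also have "(LINT a|lborel. D ^ m / ?W y ^ m * (?f a * ?g y a)) = D ^ m / ?W y ^ m * ip ?f (?g y)"
      unfolding ip_def by (rule integral_mult_right_zero)
    also have "ennreal \<dots> \<le> ennreal (D ^ m / ?W y ^ m * A)"
    proof (rule ennreal_leI, rule mult_left_mono)
      show "ip ?f (?g y) \<le> A"
        using ip_Cauchy_Schwarz[OF fL gL[of y]] unfolding gN A_def by (rule order_trans[OF abs_ge_self])
      show "0 \<le> D ^ m / ?W y ^ m" using D(1) W0[of y] by simp
    qed
    finally show ?thesis by simp
  qed
  then show ?thesis using A0 D(1) by (intro exI[of _ "D ^ m * A"]) simp
qed

text \<open>The fundamental theorem of calculus along the flow, in extended values so that Tonelli's
  theorem applies without an integrability check.\<close>

lemma increment_bound: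
  assumes "smooth f" "0 \<le> \<tau>"
  shows "ennreal \<bar>f (mul z (\<tau> *\<^sub>R v)) - f z\<bar> \<le> (\<integral>\<^sup>+s. indicator {0..\<tau>} s * ennreal \<bar>lvf mul v f (mul z (s *\<^sub>R v))\<bar> \<partial>lborel)"
proof -
  let ?d = "\<lambda>s. lvf mul v f (mul z (s *\<^sub>R v))"
  have c: "continuous_on UNIV ?d"
    by (intro continuous_on_compose2[OF smooth_continuous_on[OF lvf_smooth[OF assms(1)], of UNIV]] continuous_mul continuous_intros) auto
  have "has_bochner_integral lborel (\<lambda>s. ?d s * indicator {0..\<tau>} s) (f (mul z (\<tau> *\<^sub>R v)) - f (mul z (0 *\<^sub>R v)))"
    using assms(2) by (rule has_bochner_integral_FTC_Icc_real[OF _ lvf_has_real_derivative[OF assms(1)] ])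
      (use c in \<open>auto simp: continuous_on_eq_continuous_at\<close>)
  then have i: "integrable lborel (\<lambda>s. ?d s * indicator {0..\<tau>} s)"
    and v: "(LINT s|lborel. ?d s * indicator {0..\<tau>} s) = f (mul z (\<tau> *\<^sub>R v)) - f z"
    by (auto simp: has_bochner_integral_iff)
  have "ennreal \<bar>f (mul z (\<tau> *\<^sub>R v)) - f z\<bar> \<le> (\<integral>\<^sup>+s. ennreal (norm (?d s * indicator {0..\<tau>} s)) \<partial>lborel)"
    using integral_norm_bound_ennreal[OF i] by (simp add: v)
  also have "\<dots> = (\<integral>\<^sup>+s. indicator {0..\<tau>} s * ennreal \<bar>?d s\<bar> \<partial>lborel)"
    by (rule nn_integral_cong) (simp split: split_indicator)
  finally show ?thesis .
qed

text \<open>p_2 = p_1 * p_1, and left-invariant fields see only the second factor p_1(a^-1 y).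
  Instead of differentiating under the integral, increments along the flow are bounded and divided
  by their length.\<close>

lemma gradient_decay:
  assumes j: "deg j = 1"
  shows "\<exists>D\<ge>0. \<forall>y. wt deg y ^ m * \<bar>X j (p 2) y\<bar> \<le> D"
proof -
  let ?W = "wt deg" and ?P = "p 1" and ?V = "X j (p 1)" and ?e = "axis j 1 :: real ^ 'n"
  have one: "(1 :: real) > 0" by simp
  have W0: "?W x > 0" for x by (rule wt_pos)
  have sP: "smooth ?P" by (rule smooth_p[OF one])
  have sP2: "smooth (p 2)" by (rule smooth_p) simp
  have sV: "smooth ?V" by (rule lvf_smooth[OF sP])
  have mV [measurable]: "?V \<in> borel_measurable borel"
    by (intro borel_measurable_continuous_onI smooth_continuous_on[OF sV])
  note mP [measurable] = measurable_p[OF one]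
  obtain K where K: "K \<ge> 0" "\<And>y. (\<integral>\<^sup>+a. ennreal (?P a) * ennreal \<bar>?V (mul (- a) y)\<bar> \<partial>lborel) \<le> ennreal (K / ?W y ^ m)"
    using gradient_translate_bound[OF j, of m] by blast
  have diff: "ennreal \<bar>p 2 (mul y (\<tau> *\<^sub>R ?e)) - p 2 y\<bar> \<le>
      (\<integral>\<^sup>+s. indicator {0..\<tau>} s * ennreal (K / ?W (mul y (s *\<^sub>R ?e)) ^ m) \<partial>lborel)" if \<tau>: "0 \<le> \<tau>" for y \<tau>
  proof -
    have v: "p 2 x = (LINT a|lborel. ?P a * ?P (mul (- a) x))" for x
      using p_semigroup[OF one one, of x] by (simp add: ip_def)
    have i: "integrable lborel (\<lambda>a. ?P a * ?P (mul (- a) x))" for x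
      by (rule L2_prod_integrable[OF p_L2[OF one] p_translate_L2[OF one]])
    let ?d = "\<lambda>a. ?P a * ?P (mul (- a) (mul y (\<tau> *\<^sub>R ?e))) - ?P a * ?P (mul (- a) y)"
    have "ennreal \<bar>p 2 (mul y (\<tau> *\<^sub>R ?e)) - p 2 y\<bar> = ennreal (norm (LINT a|lborel. ?d a))"
      unfolding v by (subst Bochner_Integration.integral_diff[OF i i]) simp
    also have "\<dots> \<le> (\<integral>\<^sup>+a. ennreal (norm (?d a)) \<partial>lborel)"
      by (rule integral_norm_bound_ennreal[OF Bochner_Integration.integrable_diff[OF i i]])
    also have "\<dots> \<le> (\<integral>\<^sup>+a. (\<integral>\<^sup>+s. ennreal (?P a) * (indicator {0..\<tau>} s * ennreal \<bar>?V (mul (- a) (mul y (s *\<^sub>R ?e)))\<bar>) \<partial>lborel) \<partial>lborel)"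
    proof (rule nn_integral_mono)
      fix a
      have "ennreal (norm (?d a)) = ennreal (?P a) * ennreal \<bar>?P (mul (mul (- a) y) (\<tau> *\<^sub>R ?e)) - ?P (mul (- a) y)\<bar>"
        using p_nonneg[OF one, of a] by (simp add: assoc ennreal_mult[symmetric] abs_mult flip: right_diff_distrib)
      also have "\<dots> \<le> ennreal (?P a) * (\<integral>\<^sup>+s. indicator {0..\<tau>} s * ennreal \<bar>?V (mul (mul (- a) y) (s *\<^sub>R ?e))\<bar> \<partial>lborel)"
        by (rule mult_left_mono[OF increment_bound[OF sP \<tau>]]) simp
      also have "\<dots> = (\<integral>\<^sup>+s. ennreal (?P a) * (indicator {0..\<tau>} s * ennreal \<bar>?V (mul (mul (- a) y) (s *\<^sub>R ?e))\<bar>) \<partial>lborel)"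
        by (rule nn_integral_cmult[symmetric]) measurable
      finally show "ennreal (norm (?d a)) \<le> (\<integral>\<^sup>+s. ennreal (?P a) * (indicator {0..\<tau>} s * ennreal \<bar>?V (mul (- a) (mul y (s *\<^sub>R ?e)))\<bar>) \<partial>lborel)"
        by (simp only: assoc)
    qed
    also have "\<dots> = (\<integral>\<^sup>+s. (\<integral>\<^sup>+a. ennreal (?P a) * (indicator {0..\<tau>} s * ennreal \<bar>?V (mul (- a) (mul y (s *\<^sub>R ?e)))\<bar>) \<partial>lborel) \<partial>lborel)"
      by (rule lborel_pair.Fubini') measurable
    also have "\<dots> \<le> (\<integral>\<^sup>+s. indicator {0..\<tau>} s * ennreal (K / ?W (mul y (s *\<^sub>R ?e)) ^ m) \<partial>lborel)"
    proof (rule nn_integral_mono)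
      fix s
      have "(\<integral>\<^sup>+a. ennreal (?P a) * (indicator {0..\<tau>} s * ennreal \<bar>?V (mul (- a) (mul y (s *\<^sub>R ?e)))\<bar>) \<partial>lborel) =
          indicator {0..\<tau>} s * (\<integral>\<^sup>+a. ennreal (?P a) * ennreal \<bar>?V (mul (- a) (mul y (s *\<^sub>R ?e)))\<bar> \<partial>lborel)"
        by (subst nn_integral_cmult[symmetric]) (measurable, simp add: mult.left_commute)
      also have "\<dots> \<le> indicator {0..\<tau>} s * ennreal (K / ?W (mul y (s *\<^sub>R ?e)) ^ m)"
        by (rule mult_left_mono[OF K(2)]) simp
      finally show "(\<integral>\<^sup>+a. ennreal (?P a) * (indicator {0..\<tau>} s * ennreal \<bar>?V (mul (- a) (mul y (s *\<^sub>R ?e)))\<bar>) \<partial>lborel) \<le> indicator {0..\<tau>} s * ennreal (K / ?W (mul y (s *\<^sub>R ?e)) ^ m)" .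
    qed
    finally show ?thesis .
  qed
  have "?W y ^ m * \<bar>X j (p 2) y\<bar> \<le> 2 ^ m * K" for y
  proof -
    \<comment> \<open>The factor 2^m pays for replacing the weight at nearby points of the flow by
      half the weight at \<open>y\<close>.\<close>
    let ?B = "2 ^ m * K / ?W y ^ m"
    have B0: "?B \<ge> 0" using K(1) W0[of y] by simp
    have "continuous_on UNIV (\<lambda>s. ?W (mul y (s *\<^sub>R ?e)))"
      by (intro continuous_on_compose2[OF smooth_continuous_on[OF smooth_wt, of UNIV]] continuous_mul continuous_intros) auto
    then have "isCont (\<lambda>s. ?W (mul y (s *\<^sub>R ?e))) 0" by (simp add: continuous_on_eq_continuous_at)
    then have "((\<lambda>s. ?W (mul y (s *\<^sub>R ?e))) \<longlongrightarrow> ?W y) (at 0)" by (simp add: isCont_def)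
    then have "\<forall>\<^sub>F s in at 0. ?W y / 2 < ?W (mul y (s *\<^sub>R ?e))"
      by (rule order_tendstoD(1)) (use W0[of y] in simp)
    then obtain d where d: "d > 0" "\<And>s. s \<noteq> 0 \<Longrightarrow> dist s 0 < d \<Longrightarrow> ?W y / 2 < ?W (mul y (s *\<^sub>R ?e))"
      unfolding eventually_at by auto
    have near: "?W y / 2 \<le> ?W (mul y (s *\<^sub>R ?e))" if "0 \<le> s" "s < d" for s
      using d(2)[of s] that W0[of y] by (cases "s = 0") auto
    have bd: "\<bar>p 2 (mul y (\<tau> *\<^sub>R ?e)) - p 2 y\<bar> \<le> ?B * \<tau>" if \<tau>: "0 < \<tau>" "\<tau> < d" for \<tau>
    proof -
      have "ennreal \<bar>p 2 (mul y (\<tau> *\<^sub>R ?e)) - p 2 y\<bar> \<le> (\<integral>\<^sup>+s. indicator {0..\<tau>} s * ennreal (K / ?W (mul y (s *\<^sub>R ?e)) ^ m) \<partial>lborel)"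
        by (rule diff) (use \<tau> in simp)
      also have "\<dots> \<le> (\<integral>\<^sup>+s. ennreal ?B * indicator {0..\<tau>} s \<partial>lborel)"
      proof (rule nn_integral_mono)
        fix s :: real
        have "K / ?W (mul y (s *\<^sub>R ?e)) ^ m \<le> ?B" if "s \<in> {0..\<tau>}"
        proof -
          have "(?W y / 2) ^ m \<le> ?W (mul y (s *\<^sub>R ?e)) ^ m"
            using near[of s] that \<tau> W0[of y] by (intro power_mono) auto
          then have "K / ?W (mul y (s *\<^sub>R ?e)) ^ m \<le> K / (?W y / 2) ^ m"
            using K(1) W0[of y] by (intro divide_left_mono) (auto simp: W0)
          then show ?thesis by (simp add: power_divide mult.commute)
        qed
        then show "indicator {0..\<tau>} s * ennreal (K / ?W (mul y (s *\<^sub>R ?e)) ^ m) \<le> ennreal ?B * indicator {0..\<tau>} s"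
          by (auto split: split_indicator intro: ennreal_leI)
      qed
      also have "\<dots> = ennreal (?B * \<tau>)"
        using \<tau> B0 by (subst nn_integral_cmult_indicator) (simp_all add: ennreal_mult[symmetric])
      finally show ?thesis using mult_nonneg_nonneg[OF B0 less_imp_le[OF \<tau>(1)]] by (simp only: ennreal_le_iff)
    qed
    have "((\<lambda>t. p 2 (mul y (t *\<^sub>R ?e))) has_real_derivative X j (p 2) y) (at 0)"
      using lvf_has_real_derivative[OF sP2, of y ?e 0] by simp
    then have "((\<lambda>t. (p 2 (mul y (t *\<^sub>R ?e)) - p 2 y) / t) \<longlongrightarrow> X j (p 2) y) (at 0)"
      by (simp add: has_field_derivative_iff)
    then have "((\<lambda>t. \<bar>(p 2 (mul y (t *\<^sub>R ?e)) - p 2 y) / t\<bar>) \<longlongrightarrow> \<bar>X j (p 2) y\<bar>) (at_right 0)"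
      by (intro tendsto_rabs) (rule filterlim_mono[OF _ order_refl at_le], auto)
    moreover have "\<forall>\<^sub>F t in at_right 0. \<bar>(p 2 (mul y (t *\<^sub>R ?e)) - p 2 y) / t\<bar> \<le> ?B"
      unfolding eventually_at_right_field
    proof (intro exI[of _ d] conjI allI impI)
      fix t :: real assume "0 < t" "t < d"
      with bd[OF this] show "\<bar>(p 2 (mul y (t *\<^sub>R ?e)) - p 2 y) / t\<bar> \<le> ?B" by (simp add: abs_divide pos_divide_le_eq)
    qed (rule d(1))
    ultimately have "\<bar>X j (p 2) y\<bar> \<le> ?B"
      by (rule tendsto_upperbound) simp
    then show ?thesis using W0[of y] by (simp add: pos_le_divide_eq mult.commute)
  qed
  then show ?thesis using K(1) by (intro exI[of _ "2 ^ m * K"]) simp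
qed

end

section \<open>The kernel of the Riesz transform\<close>

text \<open>The dilation by \<open>scl h\<close> carries \<open>p\<^sub>h\<close> to \<open>p\<^sub>2\<close>.\<close>

definition scl :: "real \<Rightarrow> real" where
  "scl h = sqrt (2 / h)"

lemma scl_pos: "h > 0 \<Longrightarrow> scl h > 0"
  by (simp add: scl_def)

lemma scl_le_1: "h \<ge> 2 \<Longrightarrow> scl h \<le> 1"
  by (simp add: scl_def)

lemma scl_ge_1: "0 < h \<Longrightarrow> h \<le> 2 \<Longrightarrow> scl h \<ge> 1"
  by (simp add: scl_def)

lemma scl_measurable [measurable]: "scl \<in> borel_measurable borel"
  unfolding scl_def by measurable

lemma scl_square: "h > 0 \<Longrightarrow> (scl h)\<^sup>2 * h = 2"
  by (simp add: scl_def)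

lemma scl_scale: "r > 0 \<Longrightarrow> scl (r\<^sup>2 * h) = scl h / r"
  by (simp add: scl_def real_sqrt_divide real_sqrt_mult)

lemma scl_derivative:
  assumes h: "h > 0"
  shows "(scl has_real_derivative - (scl h ^ 3) / 4) (at h)"
proof -
  have "((\<lambda>h. 2 / h) has_real_derivative - (2 / h\<^sup>2)) (at h)"
    using h by (auto intro!: derivative_eq_intros simp: power2_eq_square)
  from DERIV_chain2[OF DERIV_real_sqrt this] h
  have d: "(scl has_real_derivative inverse (scl h) / 2 * - (2 / h\<^sup>2)) (at h)"
    unfolding scl_def[abs_def] by simp
  have "h = 2 / (scl h)\<^sup>2" using scl_square[OF h] scl_pos[OF h] by (simp add: field_simps)
  then have "inverse (scl h) / 2 * - (2 / h\<^sup>2) = inverse (scl h) / 2 * - (2 / (2 / (scl h)\<^sup>2)\<^sup>2)" by simp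
  also have "\<dots> = - (scl h ^ 3) / 4"
    using scl_pos[OF h] by (simp add: field_simps power2_eq_square power3_eq_cube)
  finally show ?thesis using d by (simp only:)
qed

lemma scl_tendsto_0: "(scl \<longlongrightarrow> 0) at_top"
proof -
  have "((\<lambda>h :: real. 2 / h) \<longlongrightarrow> 0) at_top"
    by (rule tendsto_divide_0[OF tendsto_const]) (simp add: filterlim_at_top_imp_at_infinity filterlim_ident)
  then have "((\<lambda>h :: real. sqrt (2 / h)) \<longlongrightarrow> sqrt 0) at_top" by (rule tendsto_real_sqrt)
  then show ?thesis by (simp add: scl_def[abs_def])
qed

text \<open>The majorant is 1 for h <= 2 and a multiple of h^(-3/2) beyond, where
  \<open>scl_derivative\<close> provides the primitive.\<close>

lemma riesz_majorant_integrable: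
  "integrable lborel (\<lambda>h. indicator {0<..} h * min 1 (scl h ^ 3))"
proof (rule integrableI_bounded)
  have "(\<integral>\<^sup>+h. ennreal (norm (indicator {0<..} h * min 1 (scl h ^ 3))) \<partial>lborel) \<le>
      (\<integral>\<^sup>+h. indicator {0..2} h + ennreal (scl h ^ 3) * indicator {2..} h \<partial>lborel)"
  proof (rule nn_integral_mono)
    fix h :: real
    show "ennreal (norm (indicator {0<..} h * min 1 (scl h ^ 3))) \<le> indicator {0..2} h + ennreal (scl h ^ 3) * indicator {2..} h"
    proof (cases "h > 0")
      case True
      then have "scl h ^ 3 \<ge> 0" using scl_pos[of h] by simp
      then show ?thesis using True
        by (cases "h \<le> 2") (auto simp: indicator_def ennreal_leI intro: order_trans[OF ennreal_leI[of _ 1]] add_increasing2)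
    qed simp
  qed
  also have "\<dots> = (\<integral>\<^sup>+h. indicator {0..2 :: real} h \<partial>lborel) + (\<integral>\<^sup>+h. ennreal (scl h ^ 3) * indicator {2..} h \<partial>lborel)"
    by (rule nn_integral_add) measurable
  also have "(\<integral>\<^sup>+h. ennreal (scl h ^ 3) * indicator {2..} h \<partial>lborel) = ennreal (0 - (- 4 * scl 2))"
  proof (rule nn_integral_FTC_atLeast)
    show "((\<lambda>h. - 4 * scl h) has_real_derivative scl h ^ 3) (at h)" if "2 \<le> h" for h
      using DERIV_cmult[OF scl_derivative, of h "- 4"] that by simp
    show "0 \<le> scl h ^ 3" if "2 \<le> h" for h using scl_pos[of h] that by simp
    show "((\<lambda>h. - 4 * scl h) \<longlongrightarrow> 0) at_top"
      using tendsto_mult_right_zero[OF scl_tendsto_0, of "- 4"] by simp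
  qed measurable
  also have "(\<integral>\<^sup>+h. indicator {0..2 :: real} h \<partial>lborel) + ennreal (0 - (- 4 * scl 2)) < \<infinity>"
    by (simp add: ennreal_add_eq_top less_top[symmetric])
  finally show "(\<integral>\<^sup>+h. ennreal (norm (indicator {0<..} h * min 1 (scl h ^ 3))) \<partial>lborel) < \<infinity>" .
qed measurable

context stratified_group
begin

lemma homdim_ge_deg: "homdim deg \<ge> deg k"
  unfolding homdim_eq[OF deg_pos] by (rule member_le_sum) auto

end

lemma hpow_axis:
  fixes deg :: "'n::finite \<Rightarrow> nat"
  assumes "\<And>k. deg k \<ge> 1"
  shows "hpow deg (axis k 1) = 1"
proof -
  have "norm (component deg i (axis k 1)) ^ (hdeg deg div i) = (if i = deg k then 1 else 0)" if i: "i \<in> {1..step deg}" for i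
  proof -
    have "i dvd fact (step deg)" using i by (intro dvd_fact) auto
    then have "i \<le> hdeg deg" by (intro dvd_imp_le dvd_mult) auto
    then have "hdeg deg div i > 0" using i by (simp add: div_greater_zero_iff)
    moreover have "component deg i (axis k 1) = (if i = deg k then axis k 1 else 0)"
      by (auto simp: component_def vec_eq_iff axis_def)
    ultimately show ?thesis by simp
  qed
  then have "hpow deg (axis k 1) = (\<Sum>i = 1..step deg. if i = deg k then 1 else 0)"
    unfolding hpow_def by (intro sum.cong) auto
  also have "\<dots> = 1" using assms[of k] by (simp add: step_def)
  finally show ?thesis .
qed

context heat
begin

text \<open>The integrand of the Riesz kernel carried to time 2 (\<open>gradient_scaling\<close>).
  Of the exponent Q + 2, scaling of the kernel gives Q, the derivative gives 1 and the factor
  h^(-1/2) = scl h / sqrt 2 gives 1.\<close>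

definition riesz_density :: "'n \<Rightarrow> real ^ 'n \<Rightarrow> real \<Rightarrow> real" where
  "riesz_density j g h = indicator {0<..} h * (scl h ^ (homdim deg + 2) * X j (p 2) (dil deg (scl h) g) / sqrt 2)"

abbreviation "RK \<equiv> riesz_conv_kernel mul p"

lemma gradient_scaling:
  assumes h: "h > 0" and j: "deg j = 1"
  shows "h powr (- (1 / 2)) * X j (p h) g = scl h ^ (homdim deg + 2) * X j (p 2) (dil deg (scl h) g) / sqrt 2"
proof -
  have s: "scl h > 0" by (rule scl_pos[OF h])
  have s2: "smooth (p 2)" by (rule smooth_p) simp
  have eq: "p h = (\<lambda>x. scl h ^ homdim deg *\<^sub>R p 2 (dil deg (scl h) x))"
    using p_scaling[OF s h] scl_square[OF h] by auto
  have "X j (p h) g = scl h ^ homdim deg * (scl h * X j (p 2) (dil deg (scl h) g))"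
    unfolding eq lvf_cmult[OF smooth_dil[OF s2]] lvf_dil[OF s s2 j] by simp
  moreover have "h powr (- (1 / 2)) = scl h / sqrt 2"
    using h by (simp add: scl_def powr_minus powr_half_sqrt real_sqrt_divide inverse_eq_divide)
  ultimately show ?thesis by (simp add: power_add power2_eq_square)
qed

lemma riesz_conv_kernel_eq:
  assumes "deg j = 1"
  shows "RK j g = 1 / sqrt pi * (LINT h|lborel. riesz_density j g h)"
proof -
  have "indicator {0<..} h *\<^sub>R (h powr (- (1 / 2)) * X j (p h) g) = riesz_density j g h" for h
    using gradient_scaling[OF _ assms, of h g] by (simp add: riesz_density_def indicator_def)
  then show ?thesis by (simp add: riesz_conv_kernel_def set_lebesgue_integral_def)
qed

lemma continuous_dil: "continuous_on U (\<lambda>r. dil deg r g)"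
  unfolding dil_def by (intro continuous_intros)

lemma continuous_X_p2: "continuous_on U (X j (p 2))"
  by (rule smooth_continuous_on[OF lvf_smooth[OF smooth_p]]) simp

lemma riesz_density_measurable [measurable]: "riesz_density j g \<in> borel_measurable borel"
proof -
  have "(\<lambda>r. X j (p 2) (dil deg r g)) \<in> borel_measurable borel"
    by (intro borel_measurable_continuous_onI continuous_on_compose2[OF continuous_X_p2[of UNIV] continuous_dil]) auto
  from measurable_compose[OF scl_measurable this] show ?thesis
    unfolding riesz_density_def[abs_def] by measurable
qed

text \<open>For small h the dilation factor is large and the decay of the gradient beats its power Q
  + 2, as the weight of the dilated point is at least c times that factor. For large h the factor is
  at most 1, and Q >= 1 leaves its cube.\<close>

lemma riesz_density_bound:
  assumes j: "deg j = 1" and c: "c > 0"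
  shows "\<exists>A\<ge>0. \<forall>g h. hpow deg g \<ge> c \<longrightarrow> \<bar>riesz_density j g h\<bar> \<le> A * (indicator {0<..} h * min 1 (scl h ^ 3))"
proof -
  let ?Q = "homdim deg"
  have Q: "?Q \<ge> 1" using homdim_ge_deg[of j] j by simp
  obtain D where D: "D \<ge> 0" "\<And>y. wt deg y ^ (?Q + 2) * \<bar>X j (p 2) y\<bar> \<le> D" using gradient_decay[OF j] by blast
  \<comment> \<open>Sum of the constants of the two regimes: \<open>D\<close> for large h, and
    \<open>D\<close> times c^-(Q+2) for small h.\<close>
  define A where "A = D * (1 + inverse c ^ (?Q + 2))"
  have A0: "A \<ge> 0" using D(1) c by (simp add: A_def)
  have "\<bar>riesz_density j g h\<bar> \<le> A * (indicator {0<..} h * min 1 (scl h ^ 3))" if g: "hpow deg g \<ge> c" for g h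
  proof (cases "h > 0")
    case True
    let ?s = "scl h" and ?V = "\<bar>X j (p 2) (dil deg (scl h) g)\<bar>" and ?w = "wt deg (dil deg (scl h) g)"
    have s: "?s > 0" by (rule scl_pos[OF True])
    have w: "?w = 1 + ?s ^ hdeg deg * hpow deg g" by (simp add: wt_def hpow_dil[OF s])
    have w1: "?w \<ge> 1" by (rule wt_ge_1)
    have V: "?V \<le> D / ?w ^ (?Q + 2)" using D(2)[of "dil deg ?s g"] w1 by (simp add: pos_le_divide_eq mult.commute)
    have r: "\<bar>riesz_density j g h\<bar> \<le> ?s ^ (?Q + 2) * ?V"
    proof -
      have "\<bar>riesz_density j g h\<bar> = ?s ^ (?Q + 2) * ?V / sqrt 2"
        using True s by (simp add: riesz_density_def abs_mult)
      also have "\<dots> \<le> ?s ^ (?Q + 2) * ?V / 1"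
        by (rule divide_left_mono) (use s in auto)
      finally show ?thesis by simp
    qed
    have "?s ^ (?Q + 2) * ?V \<le> A * min 1 (?s ^ 3)"
    proof (cases "h \<le> 2")
      case h: True
      then have s1: "?s \<ge> 1" using scl_ge_1 True by simp
      have "?s \<le> ?s ^ hdeg deg" using s1 by (intro self_le_power) auto
      then have "?s * c \<le> ?s ^ hdeg deg * hpow deg g" using g c s by (intro mult_mono) auto
      then have "(?s * c) ^ (?Q + 2) \<le> ?w ^ (?Q + 2)" using s c unfolding w by (intro power_mono) auto
      then have "D / ?w ^ (?Q + 2) \<le> D / (?s * c) ^ (?Q + 2)"
        using D(1) s c w1 by (intro divide_left_mono mult_pos_pos zero_less_power) auto
      with V have "?V \<le> D / (?s * c) ^ (?Q + 2)" by linarith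
      then have "?s ^ (?Q + 2) * ?V \<le> ?s ^ (?Q + 2) * (D / (?s * c) ^ (?Q + 2))"
        using s by (intro mult_left_mono) auto
      also have "\<dots> = D * inverse c ^ (?Q + 2)"
        using s c by (simp only: power_mult_distrib power_inverse) (simp add: field_simps)
      also have "\<dots> \<le> A" using D(1) c by (simp add: A_def distrib_left)
      also have "A = A * min 1 (?s ^ 3)" using s1 by (simp add: one_le_power)
      finally show ?thesis .
    next
      case h: False
      then have s1: "?s \<le> 1" using scl_le_1 by simp
      have "?s ^ (?Q + 2) \<le> ?s ^ 3" using s s1 Q by (intro power_decreasing) auto
      moreover have "?V \<le> D"
      proof -
        have "D / ?w ^ (?Q + 2) \<le> D / 1"
          using D(1) w1 by (intro divide_left_mono one_le_power) auto
        with V show ?thesis by linarith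
      qed
      ultimately have "?s ^ (?Q + 2) * ?V \<le> ?s ^ 3 * D" using s by (intro mult_mono) auto
      also have "\<dots> \<le> ?s ^ 3 * A" using D(1) c s by (intro mult_left_mono) (auto simp: A_def distrib_left)
      also have "\<dots> = A * min 1 (?s ^ 3)" using s s1 by (simp add: power_le_one)
      finally show ?thesis .
    qed
    with r show ?thesis using True by simp
  qed (simp add: riesz_density_def)
  then show ?thesis using A0 by blast
qed

lemma riesz_density_integrable:
  assumes "deg j = 1" "g \<noteq> 0"
  shows "integrable lborel (riesz_density j g)"
proof -
  obtain A where "\<And>h. \<bar>riesz_density j g h\<bar> \<le> A * (indicator {0<..} h * min 1 (scl h ^ 3))"
    using riesz_density_bound[OF assms(1) hpow_pos[where deg = deg, OF deg_pos assms(2)]] by blast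
  then have "AE h in lborel. norm (riesz_density j g h) \<le> norm (A * (indicator {0<..} h * min 1 (scl h ^ 3)))"
    by (auto intro: order_trans[OF _ abs_ge_self])
  then show ?thesis
    by (rule Bochner_Integration.integrable_bound[OF integrable_mult_right[OF riesz_majorant_integrable], rotated]) simp
qed

lemma riesz_kernel_continuous:
  assumes j: "deg j = 1" and c: "c > 0"
  shows "continuous_on {g. hpow deg g \<ge> c} (RK j)"
  unfolding continuous_on_sequentially comp_def
proof (intro allI ballI impI, elim conjE)
  fix x :: "nat \<Rightarrow> real ^ 'n" and a
  assume a: "a \<in> {g. hpow deg g \<ge> c}" and x: "\<forall>n. x n \<in> {g. hpow deg g \<ge> c}" and lim: "x \<longlonglongrightarrow> a"
  obtain A where A: "\<And>g h. hpow deg g \<ge> c \<Longrightarrow> \<bar>riesz_density j g h\<bar> \<le> A * (indicator {0<..} h * min 1 (scl h ^ 3))"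
    using riesz_density_bound[OF j c] by blast
  have "(\<lambda>n. LINT h|lborel. riesz_density j (x n) h) \<longlonglongrightarrow> (LINT h|lborel. riesz_density j a h)"
  proof (rule integral_dominated_convergence)
    show "integrable lborel (\<lambda>h. A * (indicator {0<..} h * min 1 (scl h ^ 3)))"
      by (rule integrable_mult_right[OF riesz_majorant_integrable])
    show "AE h in lborel. norm (riesz_density j (x n) h) \<le> A * (indicator {0<..} h * min 1 (scl h ^ 3))" for n
      using A[of "x n"] x by simp
    show "AE h in lborel. (\<lambda>n. riesz_density j (x n) h) \<longlonglongrightarrow> riesz_density j a h"
    proof (rule AE_I2)
      fix h
      have "(\<lambda>n. dil deg (scl h) (x n)) \<longlonglongrightarrow> dil deg (scl h) a"
        by (rule bounded_linear.tendsto[OF bounded_linear_dil lim])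
      moreover have "isCont (X j (p 2)) (dil deg (scl h) a)"
        using continuous_X_p2[of UNIV j] by (simp add: continuous_on_eq_continuous_at)
      ultimately have "(\<lambda>n. X j (p 2) (dil deg (scl h) (x n))) \<longlonglongrightarrow> X j (p 2) (dil deg (scl h) a)"
        by (rule isCont_tendsto_compose[rotated])
      then show "(\<lambda>n. riesz_density j (x n) h) \<longlonglongrightarrow> riesz_density j a h"
        unfolding riesz_density_def by (intro tendsto_mult tendsto_divide tendsto_const) auto
    qed
  qed simp_all
  then show "(\<lambda>n. RK j (x n)) \<longlonglongrightarrow> RK j a"
    unfolding riesz_conv_kernel_eq[OF j] by (intro tendsto_mult tendsto_const)
qed

text \<open>The substitution of r^2 h for h gives r^2 from the measure and r^-(Q+2) from the
  density.\<close>

lemma riesz_kernel_dil: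
  assumes j: "deg j = 1" and r: "r > 0"
  shows "RK j (dil deg r g) = RK j g / r ^ homdim deg"
proof -
  have r2: "r\<^sup>2 \<noteq> 0" using r by simp
  have "riesz_density j (dil deg r g) (r\<^sup>2 * h) = riesz_density j g h / r ^ (homdim deg + 2)" for h
  proof -
    have "indicator {0<..} (r\<^sup>2 * h) = (indicator {0<..} h :: real)" using r by (simp add: indicator_def zero_less_mult_iff)
    then show ?thesis using r by (simp add: riesz_density_def scl_scale[OF r] power_divide)
  qed
  then have "(LINT h|lborel. riesz_density j (dil deg r g) h) = r\<^sup>2 * (LINT h|lborel. riesz_density j g h / r ^ (homdim deg + 2))"
    using lborel_integral_real_affine[OF r2, of "riesz_density j (dil deg r g)" 0] r by simp
  also have "\<dots> = (LINT h|lborel. riesz_density j g h) / r ^ homdim deg"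
    using r by (simp add: power_add power2_eq_square)
  finally show ?thesis by (simp add: riesz_conv_kernel_eq[OF j])
qed

lemma p2_axis_derivative:
  "((\<lambda>u. p 2 (u *\<^sub>R axis j 1)) has_real_derivative X j (p 2) (u *\<^sub>R axis j 1)) (at u)"
proof -
  have "smooth (p 2)" by (rule smooth_p) simp
  from lvf_has_real_derivative[OF this, of 0 "axis j 1" u] show ?thesis by simp
qed

text \<open>Inversion turns left-invariant fields into right-invariant ones, so evenness of
  \<open>p 2\<close> does not directly give oddness of its derivative along \<open>X j\<close>. On
  the axis, however, \<open>X j\<close> is the derivative along a line through the identity.\<close>

lemma riesz_kernel_uminus_axis:
  assumes j: "deg j = 1"
  shows "RK j (- axis j 1) = - RK j (axis j 1)"
proof -
  have V: "X j (p 2) (- (u *\<^sub>R axis j 1)) = - X j (p 2) (u *\<^sub>R axis j 1)" for u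
  proof -
    have "((\<lambda>u. p 2 ((- u) *\<^sub>R axis j 1)) has_real_derivative X j (p 2) ((- u) *\<^sub>R axis j 1) * (- 1)) (at u)"
      by (rule DERIV_chain2[OF p2_axis_derivative]) (auto intro!: derivative_eq_intros)
    moreover have "p 2 ((- u) *\<^sub>R axis j 1) = p 2 (u *\<^sub>R axis j 1)" for u by (simp add: p_symmetric)
    ultimately have "((\<lambda>u. p 2 (u *\<^sub>R axis j 1)) has_real_derivative - X j (p 2) (- (u *\<^sub>R axis j 1))) (at u)" by simp
    from DERIV_unique[OF this p2_axis_derivative] show ?thesis by simp
  qed
  have "riesz_density j (- axis j 1) h = - riesz_density j (axis j 1) h" for h
    using V[of "scl h"] by (simp add: riesz_density_def dil_axis j)
  then show ?thesis by (simp add: riesz_conv_kernel_eq[OF j])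
qed

text \<open>With \<open>s = scl h\<close>, the density on the axis and the derivative of
  \<open>- 2 \<surd>2 s\<^bsup>Q-1\<^esup> (p\<^sub>2(s e\<^sub>j) - c)\<close> differ by a multiple of \<open>p\<^sub>2(s e\<^sub>j) - c\<close>. The constant \<open>c\<close> is \<open>0\<close>
  for small \<open>h\<close> and positive for large \<open>h\<close>, where \<open>p\<^sub>2(s e\<^sub>j)\<close> is close to \<open>p\<^sub>2(0)\<close>; this makes the
  sign strict also for \<open>Q = 1\<close>.\<close>

lemma riesz_density_primitive:
  assumes j: "deg j = 1" and ab: "0 < a" "a \<le> b"
    and c: "\<And>h. a \<le> h \<Longrightarrow> h \<le> b \<Longrightarrow> c \<le> p 2 (scl h *\<^sub>R axis j 1)"
  defines "Z \<equiv> \<lambda>h. scl h ^ (homdim deg - 1) * (p 2 (scl h *\<^sub>R axis j 1) - c)"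
  shows "(LINT h:{a..b}|lborel. riesz_density j (axis j 1) h) \<le> 2 * sqrt 2 * (Z a - Z b)"
proof -
  let ?\<phi> = "\<lambda>u. p 2 (u *\<^sub>R axis j 1)" and ?\<phi>' = "\<lambda>u. X j (p 2) (u *\<^sub>R axis j 1)"
  let ?q = "riesz_density j (axis j 1)"
  obtain k where k: "homdim deg = Suc k" using homdim_ge_deg[of j] j by (cases "homdim deg") auto
  \<comment> \<open>Here k = Q - 1. For k = 0 the truncated exponent is harmless because of the
    factor \<open>real k\<close>.\<close>
  let ?G' = "\<lambda>h. sqrt 2 / 2 * scl h ^ 3 * (real k * scl h ^ (k - 1) * (?\<phi> (scl h) - c) + scl h ^ k * ?\<phi>' (scl h))"
  have d: "((\<lambda>h. - 2 * sqrt 2 * Z h) has_real_derivative ?G' h) (at h)" if h: "h > 0" for h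
  proof -
    have "((\<lambda>s. s ^ k * (?\<phi> s - c)) has_real_derivative
        real k * scl h ^ (k - 1) * (?\<phi> (scl h) - c) + scl h ^ k * ?\<phi>' (scl h)) (at (scl h))"
      using DERIV_mult[OF DERIV_pow[of k "scl h"] DERIV_diff[OF p2_axis_derivative DERIV_const[of c]]]
      by (simp add: mult.commute)
    note deriv = this
    from DERIV_cmult[OF DERIV_chain2[OF deriv scl_derivative[OF h]], of "- 2 * sqrt 2"]
    have d': "((\<lambda>h. - 2 * sqrt 2 * (scl h ^ k * (?\<phi> (scl h) - c))) has_real_derivative - 2 * sqrt 2 *
        ((real k * scl h ^ (k - 1) * (?\<phi> (scl h) - c) + scl h ^ k * ?\<phi>' (scl h)) * (- (scl h ^ 3) / 4))) (at h)" .
    have "- 2 * r * (A * (- q / 4)) = r / 2 * q * A" for r A q :: real by simp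
    from DERIV_cong[OF d' this] show ?thesis unfolding Z_def k diff_Suc_1 .
  qed
  have I: "(?G' has_integral (- 2 * sqrt 2 * Z b - (- 2 * sqrt 2 * Z a))) {a..b}"
  proof (rule fundamental_theorem_of_calculus[where f = "\<lambda>h. - 2 * sqrt 2 * Z h", OF ab(2)])
    fix h assume "h \<in> {a..b}"
    then have "h > 0" using ab(1) by simp
    from has_field_derivative_at_within[OF d[OF this]]
    show "((\<lambda>h. - 2 * sqrt 2 * Z h) has_vector_derivative ?G' h) (at h within {a..b})"
      by (simp only: has_real_derivative_iff_has_vector_derivative)
  qed
  have si: "set_integrable lborel {a..b} ?q"
    using riesz_density_integrable[OF j, of "axis j 1"]
    unfolding set_integrable_def by (intro integrable_mult_indicator) auto
  have q: "(?q has_integral (LINT h:{a..b}|lborel. ?q h)) {a..b}"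
    using set_borel_integral_eq_integral[OF si] by (simp add: has_integral_integral)
  have "(LINT h:{a..b}|lborel. ?q h) \<le> - 2 * sqrt 2 * Z b - (- 2 * sqrt 2 * Z a)"
  proof (rule has_integral_le[OF q I])
    fix h assume "h \<in> {a..b}"
    then have h: "h > 0" and ch: "c \<le> ?\<phi> (scl h)" using ab c by auto
    have s: "scl h > 0" by (rule scl_pos[OF h])
    have "?q h = sqrt 2 / 2 * scl h ^ 3 * (scl h ^ k * ?\<phi>' (scl h))"
      using h by (simp add: riesz_density_def dil_axis j k power3_eq_cube power_add field_simps)
    \<comment> \<open>The discarded term is k s^(k-1) (p_2(s e_j) - c), nonnegative by the choice of
      \<open>c\<close>.\<close>
    also have "\<dots> \<le> ?G' h"
      using s ch by (intro mult_left_mono) auto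
    finally show "?q h \<le> ?G' h" .
  qed
  then show ?thesis by (simp add: algebra_simps)
qed

text \<open>The primitive is used with constant 0 up to a time b and with constant c > 0 after it.
  The jump of the boundary terms at b leaves a strictly negative contribution; the boundary term at
  h -> 0 vanishes by decay, and the one at large h has a favourable sign.\<close>

lemma riesz_kernel_axis_neg:
  assumes j: "deg j = 1"
  shows "RK j (axis j 1) < 0"
proof -
  let ?\<phi> = "\<lambda>u. p 2 (u *\<^sub>R axis j 1)" and ?q = "riesz_density j (axis j 1)"
  obtain k where k: "homdim deg = Suc k" using homdim_ge_deg[of j] j by (cases "homdim deg") auto
  define c where "c = p 2 0 / 2"
  have c: "c > 0" using p_0_pos[of 2] by (simp add: c_def)
  have "isCont ?\<phi> 0" by (rule DERIV_isCont[OF p2_axis_derivative])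
  then have "(?\<phi> \<longlongrightarrow> p 2 0) (at 0)" by (simp add: isCont_def)
  then have "\<forall>\<^sub>F u in at 0. c < ?\<phi> u" by (rule order_tendstoD(1)) (use c in \<open>simp add: c_def\<close>)
  then obtain \<delta> where \<delta>: "\<delta> > 0" "\<And>u. u \<noteq> 0 \<Longrightarrow> dist u 0 < \<delta> \<Longrightarrow> c < ?\<phi> u"
    unfolding eventually_at by auto
  have "\<forall>\<^sub>F h in at_top. scl h < \<delta>" by (rule order_tendstoD(2)[OF scl_tendsto_0 \<delta>(1)])
  then obtain b1 where b1: "\<And>h. b1 \<le> h \<Longrightarrow> scl h < \<delta>" by (auto simp: eventually_at_top_linorder)
  define b where "b = max b1 1"
  have b: "b > 0" and b1': "b \<ge> 1" by (simp_all add: b_def)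
  have cb: "c \<le> ?\<phi> (scl h)" if "b \<le> h" for h
    using \<delta>(2)[of "scl h"] b1[of h] scl_pos[of h] b that by (simp add: b_def)
  \<comment> \<open>The surplus at b: the difference of the boundary terms formed with 0 and with
    \<open>c\<close>.\<close>
  define \<kappa> where "\<kappa> = 2 * sqrt 2 * (scl b ^ k * c)"
  have \<kappa>: "\<kappa> > 0" using c scl_pos[OF b] by (simp add: \<kappa>_def)
  obtain D where D: "\<And>x. wt deg x ^ homdim deg * p 2 x \<le> D" using p_decay[of 2 "homdim deg"] by auto
  \<comment> \<open>Along the axis the weight is at least the dilation factor s, so wt^Q p_2 <= D
    yields s^(Q-1) p_2 <= D/s, which vanishes as the time tends to 0.\<close>
  have small: "scl a ^ k * ?\<phi> (scl a) \<le> D / scl a" if a: "0 < a" "a \<le> 2" for a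
  proof -
    have s: "scl a \<ge> 1" using scl_ge_1 a by simp
    have "wt deg (scl a *\<^sub>R axis j 1) = 1 + scl a ^ hdeg deg"
      using hpow_dil[of "scl a" deg "axis j 1"] scl_pos[OF a(1)] by (simp add: dil_axis j wt_def hpow_axis[OF deg_pos])
    moreover have "scl a \<le> scl a ^ hdeg deg" using s by (intro self_le_power) auto
    ultimately have "scl a ^ Suc k \<le> wt deg (scl a *\<^sub>R axis j 1) ^ Suc k" using s by (intro power_mono) auto
    then have "scl a ^ Suc k * ?\<phi> (scl a) \<le> wt deg (scl a *\<^sub>R axis j 1) ^ Suc k * ?\<phi> (scl a)"
      by (intro mult_right_mono p_nonneg) auto
    also have "\<dots> \<le> D" using D[of "scl a *\<^sub>R axis j 1"] by (simp only: k)
    finally show ?thesis using s by (simp add: field_simps)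
  qed
  let ?a = "\<lambda>n. 1 / real (Suc n)" and ?b = "\<lambda>n. real (Suc n)"
  have si: "set_integrable lborel {u..v} ?q" for u v
    using riesz_density_integrable[OF j, of "axis j 1"]
    unfolding set_integrable_def by (intro integrable_mult_indicator) auto
  have up: "(LINT h:{?a n..?b n}|lborel. ?q h) \<le> 2 * sqrt 2 * (D / scl (?a n)) - \<kappa>" if n: "b \<le> ?b n" for n
  proof -
    have "?a n \<le> 1" by simp
    with b1' have a0: "0 < ?a n" "?a n \<le> b" "?a n \<le> 2" by (simp, linarith, linarith)
    have e1: "(LINT h:{?a n..?b n}|lborel. ?q h) = (LINT h:{?a n..b}|lborel. ?q h) + (LINT h:{b..?b n}|lborel. ?q h)"
    proof -
      have "{?a n..?b n} = {?a n..b} \<union> {b..?b n}" using a0 n by auto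
      moreover have "AE h in lborel. \<not> (h \<in> {?a n..b} \<and> h \<in> {b..?b n})"
        by (rule AE_mp[OF AE_lborel_singleton[of b]]) auto
      ultimately show ?thesis by (simp only:) (rule set_integral_Un_AE[OF _ _ _ si si], auto)
    qed
    have e2: "(LINT h:{?a n..b}|lborel. ?q h) \<le> 2 * sqrt 2 * (scl (?a n) ^ k * (?\<phi> (scl (?a n)) - 0) - scl b ^ k * (?\<phi> (scl b) - 0))"
      using riesz_density_primitive[OF j a0(1,2), of 0] by (simp add: p_nonneg k)
    have e3: "(LINT h:{b..?b n}|lborel. ?q h) \<le> 2 * sqrt 2 * (scl b ^ k * (?\<phi> (scl b) - c) - scl (?b n) ^ k * (?\<phi> (scl (?b n)) - c))"
      using riesz_density_primitive[OF j b n, of c] cb by (simp add: k)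
    have e4: "0 \<le> scl (?b n) ^ k * (?\<phi> (scl (?b n)) - c)"
      using cb[OF n] scl_pos[of "?b n"] by simp
    have "I \<le> r * z - r * (x * c)"
      if "I = I1 + I2" "I1 \<le> r * (w - x * (y - 0))" "I2 \<le> r * (x * (y - c) - v)" "0 \<le> v" "w \<le> z" "r > 0"
      for I I1 I2 r w x y v z :: real
    proof -
      have "r * w \<le> r * z" "0 \<le> r * v" using that by simp_all
      with that(1-3) show ?thesis by (simp add: algebra_simps)
    qed
    note combine = this
    have "scl (?a n) ^ k * (?\<phi> (scl (?a n)) - 0) \<le> D / scl (?a n)" using small[OF a0(1,3)] by simp
    from combine[OF e1 e2 e3 e4 this] show ?thesis unfolding \<kappa>_def by simp
  qed
  have "(\<lambda>n. LINT h:{?a n..?b n}|lborel. ?q h) \<longlonglongrightarrow> (LINT h|lborel. ?q h)"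
    unfolding set_lebesgue_integral_def
  proof (rule integral_dominated_convergence[where w = "\<lambda>h. \<bar>?q h\<bar>"])
    show "integrable lborel (\<lambda>h. \<bar>?q h\<bar>)"
      by (intro integrable_abs riesz_density_integrable j) simp
    show "AE h in lborel. norm (indicator {?a n..?b n} h *\<^sub>R ?q h) \<le> \<bar>?q h\<bar>" for n
      by (simp add: indicator_def)
    show "AE h in lborel. (\<lambda>n. indicator {?a n..?b n} h *\<^sub>R ?q h) \<longlonglongrightarrow> ?q h"
    proof (rule AE_I2)
      fix h :: real
      show "(\<lambda>n. indicator {?a n..?b n} h *\<^sub>R ?q h) \<longlonglongrightarrow> ?q h"
      proof (cases "h > 0")
        case True
        have "\<forall>\<^sub>F n in sequentially. ?a n < h"
          using order_tendstoD(2)[OF LIMSEQ_inverse_real_of_nat True] by (simp add: inverse_eq_divide)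
        moreover have "\<forall>\<^sub>F n in sequentially. h \<le> ?b n"
          using eventually_ge_at_top[of "nat \<lceil>h\<rceil>"] by eventually_elim linarith
        ultimately have "\<forall>\<^sub>F n in sequentially. indicator {?a n..?b n} h *\<^sub>R ?q h = ?q h"
          by eventually_elim simp
        then show ?thesis by (rule tendsto_eventually)
      qed (simp add: riesz_density_def)
    qed
  qed simp_all
  moreover have "(\<lambda>n. 2 * sqrt 2 * (D / scl (?a n)) - \<kappa>) \<longlonglongrightarrow> 2 * sqrt 2 * (D * 0) - \<kappa>"
  proof -
    have "(\<lambda>n. sqrt (?a n / 2)) \<longlonglongrightarrow> sqrt (0 / 2)"
      using LIMSEQ_inverse_real_of_nat by (intro tendsto_intros) (simp_all add: inverse_eq_divide)
    moreover have "1 / scl (?a n) = sqrt (?a n / 2)" for n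
      by (simp add: scl_def real_sqrt_divide real_sqrt_mult)
    ultimately have "(\<lambda>n. 1 / scl (?a n)) \<longlonglongrightarrow> 0" by simp
    then have "(\<lambda>n. 2 * sqrt 2 * (D * (1 / scl (?a n))) - \<kappa>) \<longlonglongrightarrow> 2 * sqrt 2 * (D * 0) - \<kappa>"
      by (intro tendsto_intros)
    then show ?thesis by simp
  qed
  moreover have "\<exists>N. \<forall>n\<ge>N. (LINT h:{?a n..?b n}|lborel. ?q h) \<le> 2 * sqrt 2 * (D / scl (?a n)) - \<kappa>"
  proof (intro exI allI impI)
    fix n assume "nat \<lceil>b\<rceil> \<le> n"
    then show "(LINT h:{?a n..?b n}|lborel. ?q h) \<le> 2 * sqrt 2 * (D / scl (?a n)) - \<kappa>" by (intro up) linarith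
  qed
  ultimately have "(LINT h|lborel. ?q h) \<le> 2 * sqrt 2 * (D * 0) - \<kappa>" by (rule LIMSEQ_le)
  then have "(LINT h|lborel. ?q h) < 0" using \<kappa> by simp
  then show ?thesis by (simp add: riesz_conv_kernel_eq[OF j] divide_less_0_iff)
qed

end

section \<open>Truncated sectors\<close>

lemma norm_dil_le:
  fixes deg :: "'n::finite \<Rightarrow> nat"
  assumes "\<And>k. deg k \<ge> 1" "0 \<le> r" "r \<le> 1"
  shows "norm (dil deg r x) \<le> r * norm x"
proof -
  have "norm (dil deg r x) \<le> norm (r *\<^sub>R x)"
  proof (rule norm_le_componentwise_cart)
    fix k
    have "r ^ deg k \<le> r ^ 1" using assms by (intro power_decreasing) auto
    then show "norm (dil deg r x $ k) \<le> norm ((r *\<^sub>R x) $ k)"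
      using assms(2) by (simp add: abs_mult mult_right_mono)
  qed
  then show ?thesis using assms(2) by simp
qed

context stratified_group
begin

lemma emeasure_left:
  assumes "A \<in> sets borel"
  shows "emeasure lborel (mul a -` A) = emeasure lborel A"
proof -
  have "emeasure (distr lborel borel (mul a)) A = emeasure lborel (mul a -` A \<inter> space lborel)"
    by (rule emeasure_distr) (use assms in simp_all)
  then show ?thesis by (simp add: distr_left)
qed

lemma emeasure_dil:
  assumes r: "r > 0" and A: "A \<in> sets borel"
  shows "emeasure lborel A = ennreal (r ^ homdim deg) * emeasure lborel (dil deg r -` A)"
proof -
  have "dil deg r -` A \<in> sets borel" using measurable_sets[OF measurable_dil[of r] A] by simp
  moreover have "indicator A (dil deg r x) = (indicator (dil deg r -` A) x :: ennreal)" for x by (simp add: indicator_def)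
  ultimately show ?thesis using nn_integral_dil[OF r, of "indicator A"] A by simp
qed

section \<open>Measures of dilation-invariant cones and their truncated translates\<close>

definition dil_cone :: "(real ^ 'n) set \<Rightarrow> bool" where
  "dil_cone A \<longleftrightarrow> A \<in> sets borel \<and> (\<forall>r>0. \<forall>x. dil deg r x \<in> A \<longleftrightarrow> x \<in> A)"

abbreviation "hn x \<equiv> hnorm deg x"

text \<open>The only number needed from a cone: by dilation the part in the ball of radius R has R^Q
  times this measure.\<close>

definition unit_size :: "(real ^ 'n) set \<Rightarrow> real" where
  "unit_size A = measure lborel (A \<inter> {x. hn x < 1})"

lemma emeasure_unit_size:
  assumes "dil_cone A"
  shows "emeasure lborel (A \<inter> {x. hn x < 1}) = ennreal (unit_size A)"
proof -
  have "{x. hn x < 1} \<subseteq> {x. hpow deg x \<le> 1}"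
    by (auto simp: hnorm_power[symmetric] hnorm_nonneg intro!: power_le_one)
  then have "bounded (A \<inter> {x. hn x < 1})"
    by (intro bounded_subset[OF compact_imp_bounded[OF compact_hpow_le[where deg = deg and R = 1, OF deg_pos]]]) auto
  then have "emeasure lborel (A \<inter> {x. hn x < 1}) < \<infinity>" by (rule emeasure_bounded_finite)
  then show ?thesis unfolding unit_size_def by (simp add: emeasure_eq_ennreal_measure)
qed

lemma emeasure_cone_ball:
  assumes A: "dil_cone A" and R: "R > 0"
  shows "emeasure lborel (A \<inter> {x. hn x < R}) = ennreal (R ^ homdim deg * unit_size A)"
proof -
  have Ab [measurable]: "A \<in> sets borel" using A by (simp add: dil_cone_def)
  have "dil deg R -` (A \<inter> {x. hn x < R}) = A \<inter> {x. hn x < 1}"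
    using A R by (auto simp: dil_cone_def hnorm_dil)
  moreover have "A \<inter> {x. hn x < R} \<in> sets borel" by measurable
  ultimately have "emeasure lborel (A \<inter> {x. hn x < R}) = ennreal (R ^ homdim deg) * ennreal (unit_size A)"
    using emeasure_dil[OF R, of "A \<inter> {x. hn x < R}"] emeasure_unit_size[OF A] by simp
  then show ?thesis using R by (simp add: ennreal_mult unit_size_def)
qed

lemma emeasure_cone_annulus:
  assumes A: "dil_cone A" and R: "0 < R\<^sub>1" "R\<^sub>1 \<le> R\<^sub>2"
  shows "emeasure lborel (A \<inter> {x. R\<^sub>1 \<le> hn x \<and> hn x < R\<^sub>2}) = ennreal ((R\<^sub>2 ^ homdim deg - R\<^sub>1 ^ homdim deg) * unit_size A)"
proof -
  have Ab [measurable]: "A \<in> sets borel" using A by (simp add: dil_cone_def)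
  have "A \<inter> {x. R\<^sub>1 \<le> hn x \<and> hn x < R\<^sub>2} = (A \<inter> {x. hn x < R\<^sub>2}) - (A \<inter> {x. hn x < R\<^sub>1})" by auto
  also have "emeasure lborel \<dots> = emeasure lborel (A \<inter> {x. hn x < R\<^sub>2}) - emeasure lborel (A \<inter> {x. hn x < R\<^sub>1})"
    by (rule emeasure_Diff) (use R in \<open>auto simp: emeasure_cone_ball[OF A]\<close>)
  also have "\<dots> = ennreal (R\<^sub>2 ^ homdim deg * unit_size A) - ennreal (R\<^sub>1 ^ homdim deg * unit_size A)"
    using R by (simp add: emeasure_cone_ball[OF A])
  also have "\<dots> = ennreal (R\<^sub>2 ^ homdim deg * unit_size A - R\<^sub>1 ^ homdim deg * unit_size A)"
    using R by (intro ennreal_minus) (simp add: unit_size_def)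
  finally show ?thesis by (simp add: left_diff_distrib)
qed

lemma dil_cone_UNIV: "dil_cone UNIV"
  by (simp add: dil_cone_def)

text \<open>The points whose projection to the unit sphere along their dilation orbit is close to
  e_j.\<close>

definition sector_cone :: "'n \<Rightarrow> real \<Rightarrow> (real ^ 'n) set" where
  "sector_cone j \<delta> = {x. dil deg (1 / hn x) x \<in> ball (axis j 1) \<delta>}"

lemma hnorm_axis: "hn (axis k 1) = 1"
  by (simp add: hnorm_eq hpow_axis[OF deg_pos])

lemma dil_cone_sector_cone: "dil_cone (sector_cone j \<delta>)"
  unfolding dil_cone_def
proof (intro conjI allI impI)
  have "(\<lambda>x. dil deg (1 / hn x) x) \<in> borel_measurable borel"
  proof (rule borel_measurable_euclidean_space[THEN iffD2], rule ballI)
    fix i :: "real ^ 'n" assume "i \<in> Basis"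
    then obtain k where k: "i = axis k 1" by (auto simp: Basis_vec_def)
    have "(\<lambda>x :: real ^ 'n. x $ k) \<in> borel_measurable borel"
      by (intro borel_measurable_continuous_onI continuous_intros)
    then show "(\<lambda>x. dil deg (1 / hn x) x \<bullet> i) \<in> borel_measurable borel"
      unfolding k by (simp add: inner_axis)
  qed
  from measurable_sets[OF this, of "ball (axis j 1) \<delta>"]
  show "sector_cone j \<delta> \<in> sets borel" by (simp add: sector_cone_def vimage_def)
  fix r x assume "(0::real) < r"
  then show "dil deg r x \<in> sector_cone j \<delta> \<longleftrightarrow> x \<in> sector_cone j \<delta>"
    by (simp add: sector_cone_def hnorm_dil)
qed

lemma unit_size_sector_cone_pos:
  assumes \<delta>: "\<delta> > 0"
  shows "unit_size (sector_cone j \<delta>) > 0"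
proof (rule ccontr)
  assume "\<not> unit_size (sector_cone j \<delta>) > 0"
  then have z: "unit_size (sector_cone j \<delta>) \<le> 0" by simp
  let ?A = "sector_cone j \<delta>"
  have Ab [measurable]: "?A \<in> sets borel" using dil_cone_sector_cone by (simp add: dil_cone_def)
  have "emeasure lborel (?A \<inter> {x. hn x < 1}) = 0"
    using z by (simp add: emeasure_unit_size[OF dil_cone_sector_cone] ennreal_neg)
  moreover have "?A \<inter> {x. hn x < 1} \<in> sets lborel" by measurable
  ultimately have ae: "AE x in lborel. x \<notin> ?A \<inter> {x. hn x < 1}"
    by (intro AE_not_in null_setsI)
  \<comment> \<open>The origin is excluded, since the projection to the unit sphere is not
    continuous there. The set is not empty: it contains the dilate of e_j by 1/2.\<close>
  let ?U = "({x. hn x > 0} \<inter> (\<lambda>x. dil deg (1 / hn x) x) -` ball (axis j 1) \<delta>) \<inter> {x. hn x < 1}"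
  have "open ?U"
  proof (rule open_Int)
    show "open ({x. hn x > 0} \<inter> (\<lambda>x. dil deg (1 / hn x) x) -` ball (axis j 1) \<delta>)"
    proof (rule continuous_open_preimage)
      show "continuous_on {x. hn x > 0} (\<lambda>x. dil deg (1 / hn x) x)"
        unfolding dil_def by (intro continuous_intros continuous_hnorm) auto
      show "open {x. hn x > 0}" by (intro open_Collect_less continuous_hnorm continuous_on_const)
    qed simp
    show "open {x. hn x < 1}" by (intro open_Collect_less continuous_hnorm continuous_on_const)
  qed
  moreover have "dil deg (1 / 2) (axis j 1) \<in> ?U"
    using \<delta> by (simp add: hnorm_dil hnorm_axis)
  then have "?U \<noteq> {}" by blast
  ultimately have "\<exists>x\<in>?U. x \<notin> ?A \<inter> {x. hn x < 1}" by (rule AE_open_point[OF ae])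
  then show False by (auto simp: sector_cone_def)
qed

text \<open>A left translate of the truncated cone, written as a preimage so that measurability and
  measure follow at once from continuity and invariance of translations.\<close>

definition sector :: "'n \<Rightarrow> real \<Rightarrow> real \<Rightarrow> real ^ 'n \<Rightarrow> (real ^ 'n) set" where
  "sector j \<delta> R g = mul (- g) -` (sector_cone j \<delta> \<inter> {x. R \<le> hn x})"

lemma hdist_eq: "hdist mul deg g g' = hn (mul (- g) g')"
  using hnorm_uminus[of deg "mul (- g) g'"] by (simp add: hdist_def neg_mul del: hnorm_uminus)

lemma sets_sector: "sector j \<delta> R g \<in> sets borel"
proof -
  have [measurable]: "sector_cone j \<delta> \<in> sets borel" using dil_cone_sector_cone by (simp add: dil_cone_def)
  have "sector_cone j \<delta> \<inter> {x. R \<le> hn x} \<in> sets borel" by measurable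
  from measurable_sets[OF _ this, of "mul (- g)" borel] show ?thesis by (simp add: sector_def)
qed

lemma sector_tip:
  assumes "\<delta> > 0" "R > 0"
  shows "mul g (dil deg R (axis j 1)) \<in> sector j \<delta> R g" "hdist mul deg g (mul g (dil deg R (axis j 1))) = R"
  using assms by (simp_all add: sector_def sector_cone_def hdist_eq hnorm_dil hnorm_axis)

lemma INF_sector:
  assumes "\<delta> > 0" "R > 0"
  shows "(INF g'\<in>sector j \<delta> R g. hdist mul deg g g') = R"
proof (rule cInf_eq_minimum)
  show "R \<in> hdist mul deg g ` sector j \<delta> R g" using sector_tip[OF assms, of g j] by (metis imageI)
  show "R \<le> x" if "x \<in> hdist mul deg g ` sector j \<delta> R g" for x
    using that by (auto simp: hdist_eq sector_def)
qed

lemma emeasure_annulus_sector: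
  assumes R: "0 < R" "R \<le> R\<^sub>1" "R\<^sub>1 < R\<^sub>2"
  defines "A \<equiv> \<lambda>g. hball mul deg g R\<^sub>2 - hball mul deg g R\<^sub>1"
  shows "emeasure lebesgue (A g) = ennreal ((R\<^sub>2 ^ homdim deg - R\<^sub>1 ^ homdim deg) * unit_size UNIV)"
    and "emeasure lebesgue (A g \<inter> sector j \<delta> R g) = ennreal ((R\<^sub>2 ^ homdim deg - R\<^sub>1 ^ homdim deg) * unit_size (sector_cone j \<delta>))"
proof -
  have main: "emeasure lebesgue (mul (- g) -` (C \<inter> {x. R\<^sub>1 \<le> hn x \<and> hn x < R\<^sub>2})) =
      ennreal ((R\<^sub>2 ^ homdim deg - R\<^sub>1 ^ homdim deg) * unit_size C)" if C: "dil_cone C" for C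
  proof -
    have [measurable]: "C \<in> sets borel" using C by (simp add: dil_cone_def)
    have b: "C \<inter> {x. R\<^sub>1 \<le> hn x \<and> hn x < R\<^sub>2} \<in> sets borel" by measurable
    then have "mul (- g) -` (C \<inter> {x. R\<^sub>1 \<le> hn x \<and> hn x < R\<^sub>2}) \<in> sets borel"
      using measurable_sets[OF _ b, of "mul (- g)" borel] by simp
    then have "emeasure lebesgue (mul (- g) -` (C \<inter> {x. R\<^sub>1 \<le> hn x \<and> hn x < R\<^sub>2})) =
        emeasure lborel (mul (- g) -` (C \<inter> {x. R\<^sub>1 \<le> hn x \<and> hn x < R\<^sub>2}))" by simp
    also have "\<dots> = emeasure lborel (C \<inter> {x. R\<^sub>1 \<le> hn x \<and> hn x < R\<^sub>2})" by (rule emeasure_left[OF b])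
    also have "\<dots> = ennreal ((R\<^sub>2 ^ homdim deg - R\<^sub>1 ^ homdim deg) * unit_size C)"
      by (rule emeasure_cone_annulus[OF C]) (use R in auto)
    finally show ?thesis .
  qed
  have "A g = mul (- g) -` (UNIV \<inter> {x. R\<^sub>1 \<le> hn x \<and> hn x < R\<^sub>2})"
    by (auto simp: A_def hball_def hdist_eq)
  then show "emeasure lebesgue (A g) = ennreal ((R\<^sub>2 ^ homdim deg - R\<^sub>1 ^ homdim deg) * unit_size UNIV)"
    using main[OF dil_cone_UNIV] by (simp only:)
  have "A g \<inter> sector j \<delta> R g = mul (- g) -` (sector_cone j \<delta> \<inter> {x. R\<^sub>1 \<le> hn x \<and> hn x < R\<^sub>2})"
    using R by (auto simp: A_def hball_def hdist_eq sector_def)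
  then show "emeasure lebesgue (A g \<inter> sector j \<delta> R g) = ennreal ((R\<^sub>2 ^ homdim deg - R\<^sub>1 ^ homdim deg) * unit_size (sector_cone j \<delta>))"
    using main[OF dil_cone_sector_cone] by (simp only:)
qed

text \<open>Its part in the annulus from R to r has measure proportional to r^Q - R^Q, which is
  unbounded in r as Q >= 1.\<close>

lemma emeasure_sector_infinite:
  assumes \<delta>: "\<delta> > 0" and R: "R \<ge> 1"
  shows "emeasure lebesgue (sector j \<delta> R g) = \<infinity>"
proof (rule ccontr)
  assume "emeasure lebesgue (sector j \<delta> R g) \<noteq> \<infinity>"
  then obtain m where m: "m \<ge> 0" "emeasure lebesgue (sector j \<delta> R g) = ennreal m"
    by (cases "emeasure lebesgue (sector j \<delta> R g)") auto
  define u where "u = unit_size (sector_cone j \<delta>)"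
  have u: "u > 0" unfolding u_def by (rule unit_size_sector_cone_pos[OF \<delta>])
  define Q where "Q = homdim deg"
  have Q: "Q \<ge> 1" using homdim_ge_deg[of j] deg_pos[of j] by (simp add: Q_def)
  \<comment> \<open>Chosen so that (r - R^Q) u = m + u, which exceeds the supposed finite measure m,
    while r^Q >= r.\<close>
  define r where "r = R ^ Q + m / u + 1"
  have mu: "m / u \<ge> 0" using m(1) u by simp
  have "R \<le> R ^ Q" using R Q by (intro self_le_power) auto
  then have rR: "R < r" using mu by (simp add: r_def)
  have "ennreal ((r ^ Q - R ^ Q) * u) \<le> ennreal m"
  proof -
    let ?A = "hball mul deg g r - hball mul deg g R"
    have "?A \<inter> sector j \<delta> R g \<subseteq> sector j \<delta> R g" by blast
    then have "emeasure lebesgue (?A \<inter> sector j \<delta> R g) \<le> emeasure lebesgue (sector j \<delta> R g)"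
      using sets_sector[of j \<delta> R g] by (intro emeasure_mono) simp_all
    then show ?thesis
      unfolding emeasure_annulus_sector(2)[OF less_le_trans[OF zero_less_one R] order_refl rR] m(2) Q_def u_def .
  qed
  then have "(r ^ Q - R ^ Q) * u \<le> m" using m(1) by simp
  moreover have "r \<le> r ^ Q" using R rR Q by (intro self_le_power) auto
  ultimately have "(r - R ^ Q) * u \<le> m" using u by (meson diff_right_mono mult_right_mono less_imp_le order_trans)
  then have "m + u \<le> m" using u by (simp add: r_def algebra_simps)
  then show False using u by simp
qed

end

context heat
begin

text \<open>Continuity of the kernel at both e_j and -e_j, and of the homogeneous norm at e_j, on
  one common ball.\<close>

lemma riesz_kernel_near_axis:
  assumes j: "deg j = 1"
  obtains \<kappa> \<delta> where "\<kappa> > 0" "\<delta> > 0" "\<And>u. u \<in> ball (axis j 1) \<delta> \<Longrightarrow> RK j u \<le> - \<kappa>"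
    "\<And>u. u \<in> ball (axis j 1) \<delta> \<Longrightarrow> RK j (- u) \<ge> \<kappa>" "\<And>u. u \<in> ball (axis j 1) \<delta> \<Longrightarrow> hn u \<ge> 1 / 2"
proof -
  let ?e = "axis j 1 :: real ^ 'n"
  \<comment> \<open>Half of the absolute value at e_j, so that a neighbourhood keeps the sign with
    this margin.\<close>
  define \<kappa> where "\<kappa> = - RK j ?e / 2"
  have \<kappa>: "\<kappa> > 0" using riesz_kernel_axis_neg[OF j] by (simp add: \<kappa>_def)
  have op: "open {x. hpow deg x > 1 / 2}"
    by (intro open_Collect_less continuous_on_const smooth_continuous_on smooth_hpow)
  have "continuous_on {x. hpow deg x > 1 / 2} (RK j)"
    by (rule continuous_on_subset[OF riesz_kernel_continuous[OF j, of "1 / 2"]]) auto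
  then have c: "isCont (RK j) x" if "hpow deg x > 1 / 2" for x
    using that op by (simp add: continuous_on_eq_continuous_at)
  have c1: "isCont (RK j) ?e" and c2: "isCont (RK j) (- ?e)"
    by (rule c, simp add: hpow_axis[OF deg_pos])+
  have "isCont (\<lambda>u. RK j (- u)) ?e"
    by (rule isCont_o2[where f = uminus, OF _ c2]) (intro continuous_intros)
  then have "((\<lambda>u. RK j (- u)) \<longlongrightarrow> RK j (- ?e)) (nhds ?e)"
    using tendsto_at_iff_tendsto_nhds[of "\<lambda>u. RK j (- u)" ?e] by (simp add: isCont_def)
  then have "\<forall>\<^sub>F u in nhds ?e. \<kappa> < RK j (- u)"
    by (rule order_tendstoD(1)) (use riesz_kernel_axis_neg[OF j] in \<open>simp add: \<kappa>_def riesz_kernel_uminus_axis[OF j]\<close>)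
  moreover have "(RK j \<longlongrightarrow> RK j ?e) (nhds ?e)"
    using c1 by (simp add: tendsto_at_iff_tendsto_nhds[symmetric] isCont_def)
  then have "\<forall>\<^sub>F u in nhds ?e. RK j u < - \<kappa>"
    by (rule order_tendstoD(2)) (use riesz_kernel_axis_neg[OF j] in \<open>simp add: \<kappa>_def\<close>)
  moreover have "isCont (hnorm deg) ?e"
    using continuous_hnorm[of UNIV deg] by (simp add: continuous_on_eq_continuous_at)
  then have "(hnorm deg \<longlongrightarrow> 1) (nhds ?e)"
    using tendsto_at_iff_tendsto_nhds[of "hnorm deg" ?e] by (simp add: isCont_def hnorm_axis)
  then have "\<forall>\<^sub>F u in nhds ?e. 1 / 2 < hn u"
    by (rule order_tendstoD(1)) simp
  ultimately have "\<forall>\<^sub>F u in nhds ?e. \<kappa> < RK j (- u) \<and> RK j u < - \<kappa> \<and> 1 / 2 < hn u"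
    by eventually_elim simp
  then obtain \<delta> where "\<delta> > 0" "\<And>u. dist u ?e < \<delta> \<Longrightarrow> \<kappa> < RK j (- u) \<and> RK j u < - \<kappa> \<and> 1 / 2 < hn u"
    unfolding eventually_nhds_metric by blast
  then show ?thesis using that[of \<kappa> \<delta>] \<kappa> by (auto simp: dist_commute less_imp_le)
qed

text \<open>Dilating by the reciprocal of the size of \<open>x\<close> turns left translation of \<open>x\<close> by a point of the
  unit ball into left translation by a point close to the identity.\<close>

lemma riesz_kernel_sector:
  assumes j: "deg j = 1"
  obtains \<delta> R C where "\<delta> > 0" "R > 1" "C > 0"
    "\<And>b x. hn b < 1 \<Longrightarrow> x \<in> sector_cone j \<delta> \<Longrightarrow> R \<le> hn x \<Longrightarrow>
      RK j (mul b x) \<le> - (C * hn (mul b x) powr - real (homdim deg)) \<and>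
      RK j (- mul b x) \<ge> C * hn (mul b x) powr - real (homdim deg) \<and> hn (mul b x) > 0"
proof -
  let ?e = "axis j 1 :: real ^ 'n" and ?Q = "homdim deg"
  obtain \<kappa> \<epsilon> where \<kappa>: "\<kappa> > 0" and \<epsilon>: "\<epsilon> > 0" "\<And>u. u \<in> ball ?e \<epsilon> \<Longrightarrow> RK j u \<le> - \<kappa>"
    "\<And>u. u \<in> ball ?e \<epsilon> \<Longrightarrow> RK j (- u) \<ge> \<kappa>" "\<And>u. u \<in> ball ?e \<epsilon> \<Longrightarrow> hn u \<ge> 1 / 2"
    using riesz_kernel_near_axis[OF j] by blast
  have "continuous_on UNIV (\<lambda>z. mul (fst z) (snd z))"
    by (intro continuous_mul continuous_intros)
  then have "isCont (\<lambda>z. mul (fst z) (snd z)) (0, ?e)" by (simp add: continuous_on_eq_continuous_at)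
  then obtain \<eta> where \<eta>: "\<eta> > 0" "\<And>z. dist z (0, ?e) < \<eta> \<Longrightarrow> dist (mul (fst z) (snd z)) ?e < \<epsilon>"
    unfolding continuous_at_eps_delta using \<epsilon>(1) by auto
  \<comment> \<open>The distance of a pair is at most the sum of the two coordinate distances, each
    less than half of \<eta>.\<close>
  define \<delta> where "\<delta> = \<eta> / 2"
  have \<delta>: "\<delta> > 0" using \<eta>(1) by (simp add: \<delta>_def)
  have near: "mul a u \<in> ball ?e \<epsilon>" if "norm a < \<delta>" "u \<in> ball ?e \<delta>" for a u
  proof -
    have "dist (a, u) (0, ?e) \<le> dist a 0 + dist u ?e" by (simp add: dist_Pair_Pair sqrt_sum_squares_le_sum)
    then have "dist (a, u) (0, ?e) < \<eta>" using that by (simp add: \<delta>_def dist_commute)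
    from \<eta>(2)[OF this] show ?thesis by (simp add: dist_commute)
  qed
  have "bounded {x. hpow deg x \<le> 1}" by (rule compact_imp_bounded[OF compact_hpow_le[OF deg_pos]])
  then obtain M where M: "M > 0" "\<And>x. hpow deg x \<le> 1 \<Longrightarrow> norm x \<le> M" unfolding bounded_pos by auto
  \<comment> \<open>For r >= R, dilating a point of the unit ball by 1/r brings its norm, at most
    M/r, to at most half of \<delta>. The value 2 ensures R > 1.\<close>
  define R where "R = max 2 (2 * M / \<delta>)"
  have R: "R > 1" by (simp add: R_def)
  \<comment> \<open>The size of the translated point is r times a number that is at least 1/2, and
    (1/2)^Q compensates this.\<close>
  define C where "C = \<kappa> * (1 / 2) ^ ?Q"
  have C: "C > 0" using \<kappa> by (simp add: C_def)
  have "RK j (mul b x) \<le> - (C * hn (mul b x) powr - real ?Q) \<and>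
      RK j (- mul b x) \<ge> C * hn (mul b x) powr - real ?Q \<and> hn (mul b x) > 0"
    if b: "hn b < 1" and x: "x \<in> sector_cone j \<delta>" "R \<le> hn x" for b x
  proof -
    define r where "r = hn x"
    have r: "r > 1" "R \<le> r" using x(2) R by (auto simp: r_def)
    define u where "u = dil deg (1 / r) x"
    define v where "v = mul (dil deg (1 / r) b) u"
    have u: "u \<in> ball ?e \<delta>" using x(1) by (simp add: sector_cone_def u_def r_def)
    have "norm (dil deg (1 / r) b) \<le> 1 / r * norm b" by (rule norm_dil_le[OF deg_pos]) (use r in auto)
    also have "\<dots> \<le> 1 / r * M"
    proof (intro mult_left_mono M(2))
      show "hpow deg b \<le> 1" unfolding hnorm_power[symmetric] using b by (intro power_le_one) (auto simp: hnorm_nonneg)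
    qed (use r in simp)
    also have "1 / r * M < \<delta>"
    proof -
      have "2 * M / \<delta> \<le> r" using r(2) by (simp add: R_def)
      then have "2 * M \<le> r * \<delta>" using \<delta> by (simp add: pos_divide_le_eq)
      then show ?thesis using M(1) r(1) by (simp add: divide_less_eq mult.commute)
    qed
    finally have v: "v \<in> ball ?e \<epsilon>" unfolding v_def by (intro near u)
    have eq: "mul b x = dil deg r v" using r by (simp add: v_def u_def dil_mul)
    have eq': "- mul b x = dil deg r (- v)" by (simp add: eq)
    have r0: "r > 0" using r by simp
    have gv: "hn v \<ge> 1 / 2" by (rule \<epsilon>(4)[OF v])
    have g: "hn (mul b x) = r * hn v" unfolding eq by (rule hnorm_dil[OF r0])
    have gpos: "hn (mul b x) > 0" unfolding g using r0 gv by simp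
    have "C * hn (mul b x) powr - real ?Q \<le> \<kappa> / r ^ ?Q"
    proof -
      have "hn (mul b x) powr - real ?Q = inverse (r * hn v) ^ ?Q"
        using gpos unfolding g by (simp add: powr_minus powr_realpow power_inverse del: inverse_mult_distrib)
      also have "\<dots> \<le> inverse (r * (1 / 2)) ^ ?Q"
        using r0 gv by (intro power_mono le_imp_inverse_le mult_left_mono) auto
      finally have "C * hn (mul b x) powr - real ?Q \<le> C * inverse (r * (1 / 2)) ^ ?Q"
        using C by (intro mult_left_mono) auto
      also have "\<dots> = \<kappa> / r ^ ?Q"
        using r0 by (simp add: C_def field_simps)
      finally show ?thesis .
    qed
    moreover have "RK j (mul b x) \<le> - \<kappa> / r ^ ?Q"
      unfolding eq riesz_kernel_dil[OF j r0] using \<epsilon>(2)[OF v] r0 by (intro divide_right_mono) auto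
    moreover have "RK j (- mul b x) \<ge> \<kappa> / r ^ ?Q"
      unfolding eq' riesz_kernel_dil[OF j r0] using \<epsilon>(3)[OF v] r0 by (intro divide_right_mono) auto
    ultimately show ?thesis using gpos by simp
  qed
  then show ?thesis using that[OF \<delta> R C] by blast
qed

text \<open>All constants come from the picture at the identity and the set attached to
  \<open>g\<close> is its left translate, which is why nothing depends on \<open>g\<close>.\<close>

theorem riesz_sector_bounds:
  assumes j: "deg j = 1"
  shows "\<exists>r\<^sub>o > 1. \<exists>C > 0. \<exists>c > 0. \<exists>c' > 0. \<forall>g. \<exists>G \<in> sets lebesgue.
    G \<noteq> {} \<and> (INF g'\<in>G. hdist mul deg g g') = r\<^sub>o \<and>
    (\<forall>g\<^sub>1 \<in> hball mul deg g 1. \<forall>g\<^sub>2 \<in> G.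
       \<bar>riesz_kernel mul p j g\<^sub>1 g\<^sub>2\<bar> \<ge> C * hdist mul deg g\<^sub>1 g\<^sub>2 powr (- real (homdim deg)) \<and>
       \<bar>riesz_kernel mul p j g\<^sub>2 g\<^sub>1\<bar> \<ge> C * hdist mul deg g\<^sub>1 g\<^sub>2 powr (- real (homdim deg))) \<and>
    (\<exists>\<sigma>. \<forall>g\<^sub>1 \<in> hball mul deg g 1. \<forall>g\<^sub>2 \<in> G. sgn (riesz_kernel mul p j g\<^sub>1 g\<^sub>2) = \<sigma>) \<and>
    (\<exists>\<sigma>. \<forall>g\<^sub>1 \<in> hball mul deg g 1. \<forall>g\<^sub>2 \<in> G. sgn (riesz_kernel mul p j g\<^sub>2 g\<^sub>1) = \<sigma>) \<and>
    emeasure lebesgue G = \<infinity> \<and>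
    (\<forall>R\<^sub>1 R\<^sub>2. 2 * r\<^sub>o < R\<^sub>1 \<and> R\<^sub>1 < R\<^sub>2 \<longrightarrow>
       (let A = hball mul deg g R\<^sub>2 - hball mul deg g R\<^sub>1 in
          ennreal c * emeasure lebesgue A \<le> emeasure lebesgue (A \<inter> G) \<and>
          emeasure lebesgue (A \<inter> G) \<le> ennreal c' * emeasure lebesgue A))"
proof -
  let ?Q = "homdim deg"
  obtain \<delta> R C where \<delta>: "\<delta> > 0" and R: "R > 1" and C: "C > 0"
    and K: "\<And>b x. hn b < 1 \<Longrightarrow> x \<in> sector_cone j \<delta> \<Longrightarrow> R \<le> hn x \<Longrightarrow>
      RK j (mul b x) \<le> - (C * hn (mul b x) powr - real ?Q) \<and>
      RK j (- mul b x) \<ge> C * hn (mul b x) powr - real ?Q \<and> hn (mul b x) > 0"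
    using riesz_kernel_sector[OF j] by metis
  define u where "u = unit_size (sector_cone j \<delta>)"
  define w where "w = unit_size UNIV"
  have u: "u > 0" unfolding u_def by (rule unit_size_sector_cone_pos[OF \<delta>])
  have "ennreal u \<le> ennreal w"
    unfolding u_def w_def emeasure_unit_size[OF dil_cone_sector_cone, symmetric] emeasure_unit_size[OF dil_cone_UNIV, symmetric]
    by (rule emeasure_mono) (use dil_cone_UNIV in auto)
  then have uw: "u \<le> w" using u by (simp add: w_def unit_size_def)
  have w: "w > 0" using u uw by simp
  have R0: "R > 0" "R \<ge> 1" using R by auto
  have kernel: "riesz_kernel mul p j g\<^sub>2 g\<^sub>1 \<le> - (C * hdist mul deg g\<^sub>1 g\<^sub>2 powr - real ?Q) \<and>
      riesz_kernel mul p j g\<^sub>1 g\<^sub>2 \<ge> C * hdist mul deg g\<^sub>1 g\<^sub>2 powr - real ?Q \<and>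
      0 < C * hdist mul deg g\<^sub>1 g\<^sub>2 powr - real ?Q"
    if g1: "g\<^sub>1 \<in> hball mul deg g 1" and g2: "g\<^sub>2 \<in> sector j \<delta> R g" for g g\<^sub>1 g\<^sub>2
  proof -
    \<comment> \<open>The factorisation of g_1^-1 g_2 through \<open>g\<close>: the first factor
      lies in the unit ball, the second in the truncated cone.\<close>
    let ?b = "mul (- g\<^sub>1) g" and ?x = "mul (- g) g\<^sub>2"
    have e: "mul ?b ?x = mul (- g\<^sub>1) g\<^sub>2" by (simp add: assoc)
    have b: "hn ?b < 1" using g1 by (simp add: hball_def hdist_def)
    have x: "?x \<in> sector_cone j \<delta>" "R \<le> hn ?x" using g2 by (auto simp: sector_def)
    have "- mul (- g\<^sub>1) g\<^sub>2 = mul (- g\<^sub>2) g\<^sub>1" by (simp add: neg_mul)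
    with K[OF b x] C show ?thesis by (simp add: e riesz_kernel_def hdist_eq)
  qed
  show ?thesis
  proof (rule exI[of _ R], rule conjI[OF R], rule exI[of _ C], rule conjI[OF C], rule exI[of _ "u / w"],
      rule conjI[OF divide_pos_pos[OF u w]], rule exI[of _ 1], rule conjI[OF zero_less_one], rule allI)
    fix g
    let ?G = "sector j \<delta> R g"
    show "\<exists>G \<in> sets lebesgue.
      G \<noteq> {} \<and> (INF g'\<in>G. hdist mul deg g g') = R \<and>
      (\<forall>g\<^sub>1 \<in> hball mul deg g 1. \<forall>g\<^sub>2 \<in> G.
         \<bar>riesz_kernel mul p j g\<^sub>1 g\<^sub>2\<bar> \<ge> C * hdist mul deg g\<^sub>1 g\<^sub>2 powr (- real ?Q) \<and>
         \<bar>riesz_kernel mul p j g\<^sub>2 g\<^sub>1\<bar> \<ge> C * hdist mul deg g\<^sub>1 g\<^sub>2 powr (- real ?Q)) \<and>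
      (\<exists>\<sigma>. \<forall>g\<^sub>1 \<in> hball mul deg g 1. \<forall>g\<^sub>2 \<in> G. sgn (riesz_kernel mul p j g\<^sub>1 g\<^sub>2) = \<sigma>) \<and>
      (\<exists>\<sigma>. \<forall>g\<^sub>1 \<in> hball mul deg g 1. \<forall>g\<^sub>2 \<in> G. sgn (riesz_kernel mul p j g\<^sub>2 g\<^sub>1) = \<sigma>) \<and>
      emeasure lebesgue G = \<infinity> \<and>
      (\<forall>R\<^sub>1 R\<^sub>2. 2 * R < R\<^sub>1 \<and> R\<^sub>1 < R\<^sub>2 \<longrightarrow>
         (let A = hball mul deg g R\<^sub>2 - hball mul deg g R\<^sub>1 in
            ennreal (u / w) * emeasure lebesgue A \<le> emeasure lebesgue (A \<inter> G) \<and>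
            emeasure lebesgue (A \<inter> G) \<le> ennreal 1 * emeasure lebesgue A))"
    proof (intro bexI[of _ ?G] conjI ballI allI impI)
      show "?G \<in> sets lebesgue" using sets_sector by (simp add: sets_completionI_sets)
      show "?G \<noteq> {}" using sector_tip(1)[OF \<delta> R0(1)] by blast
      show "(INF g'\<in>?G. hdist mul deg g g') = R" by (rule INF_sector[OF \<delta> R0(1)])
      show "emeasure lebesgue ?G = \<infinity>" by (rule emeasure_sector_infinite[OF \<delta> R0(2)])
      show "\<exists>\<sigma>. \<forall>g\<^sub>1 \<in> hball mul deg g 1. \<forall>g\<^sub>2 \<in> ?G. sgn (riesz_kernel mul p j g\<^sub>1 g\<^sub>2) = \<sigma>"
      proof (intro exI[of _ 1] ballI)
        fix g\<^sub>1 g\<^sub>2 assume "g\<^sub>1 \<in> hball mul deg g 1" "g\<^sub>2 \<in> ?G"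
        from kernel[OF this] have "riesz_kernel mul p j g\<^sub>1 g\<^sub>2 > 0" by linarith
        then show "sgn (riesz_kernel mul p j g\<^sub>1 g\<^sub>2) = 1" by simp
      qed
      show "\<exists>\<sigma>. \<forall>g\<^sub>1 \<in> hball mul deg g 1. \<forall>g\<^sub>2 \<in> ?G. sgn (riesz_kernel mul p j g\<^sub>2 g\<^sub>1) = \<sigma>"
      proof (intro exI[of _ "- 1"] ballI)
        fix g\<^sub>1 g\<^sub>2 assume "g\<^sub>1 \<in> hball mul deg g 1" "g\<^sub>2 \<in> ?G"
        from kernel[OF this] have "riesz_kernel mul p j g\<^sub>2 g\<^sub>1 < 0" by linarith
        then show "sgn (riesz_kernel mul p j g\<^sub>2 g\<^sub>1) = - 1" by simp
      qed
    next
      fix g\<^sub>1 g\<^sub>2 assume "g\<^sub>1 \<in> hball mul deg g 1" "g\<^sub>2 \<in> ?G"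
      note k = kernel[OF this]
      show "\<bar>riesz_kernel mul p j g\<^sub>1 g\<^sub>2\<bar> \<ge> C * hdist mul deg g\<^sub>1 g\<^sub>2 powr (- real ?Q)" using k by linarith
      show "\<bar>riesz_kernel mul p j g\<^sub>2 g\<^sub>1\<bar> \<ge> C * hdist mul deg g\<^sub>1 g\<^sub>2 powr (- real ?Q)" using k by linarith
    next
      fix R\<^sub>1 R\<^sub>2 assume R12: "2 * R < R\<^sub>1 \<and> R\<^sub>1 < R\<^sub>2"
      then have r: "R \<le> R\<^sub>1" "R\<^sub>1 < R\<^sub>2" using R by auto
      define d where "d = R\<^sub>2 ^ ?Q - R\<^sub>1 ^ ?Q"
      have "R\<^sub>1 ^ ?Q \<le> R\<^sub>2 ^ ?Q" using r R by (intro power_mono) auto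
      then have d: "d \<ge> 0" by (simp add: d_def)
      note em1 = emeasure_annulus_sector(1)[OF R0(1) r, folded d_def w_def]
      note em2 = emeasure_annulus_sector(2)[OF R0(1) r, where j = j and \<delta> = \<delta>, folded d_def u_def]
      \<comment> \<open>The two measures are exactly d u and d w, so the lower constant is the
        proportion u/w of the cone in the unit ball and the upper constant is 1.\<close>
      have "u / w * (d * w) = d * u" using w by simp
      then have "ennreal (u / w) * ennreal (d * w) \<le> ennreal (d * u)"
        using u w d by (simp add: ennreal_mult[symmetric])
      moreover have "ennreal (d * u) \<le> ennreal 1 * ennreal (d * w)"
        using uw d by (simp add: ennreal_leI mult_left_mono)
      ultimately show "let A = hball mul deg g R\<^sub>2 - hball mul deg g R\<^sub>1 in
            ennreal (u / w) * emeasure lebesgue A \<le> emeasure lebesgue (A \<inter> ?G) \<and>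
            emeasure lebesgue (A \<inter> ?G) \<le> ennreal 1 * emeasure lebesgue A"
        unfolding Let_def em1 em2 by blast
    qed
  qed
qed

end

theorem theorem1p1:
  fixes mul :: "real ^ 'n \<Rightarrow> real ^ 'n \<Rightarrow> real ^ 'n"
    and deg :: "'n::finite \<Rightarrow> nat"
    and p :: "real \<Rightarrow> real ^ 'n \<Rightarrow> real"
    and j :: 'n
  assumes "stratified_group mul deg"
    and "heat_kernel mul deg p"
    and "deg j = 1"
  shows "\<exists>r\<^sub>o > 1. \<exists>C > 0. \<exists>c > 0. \<exists>c' > 0. \<forall>g. \<exists>G \<in> sets lebesgue.
    G \<noteq> {} \<and> (INF g'\<in>G. hdist mul deg g g') = r\<^sub>o \<and>
    (\<forall>g\<^sub>1 \<in> hball mul deg g 1. \<forall>g\<^sub>2 \<in> G.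
       \<bar>riesz_kernel mul p j g\<^sub>1 g\<^sub>2\<bar> \<ge> C * hdist mul deg g\<^sub>1 g\<^sub>2 powr (- real (homdim deg)) \<and>
       \<bar>riesz_kernel mul p j g\<^sub>2 g\<^sub>1\<bar> \<ge> C * hdist mul deg g\<^sub>1 g\<^sub>2 powr (- real (homdim deg))) \<and>
    (\<exists>\<sigma>. \<forall>g\<^sub>1 \<in> hball mul deg g 1. \<forall>g\<^sub>2 \<in> G. sgn (riesz_kernel mul p j g\<^sub>1 g\<^sub>2) = \<sigma>) \<and>
    (\<exists>\<sigma>. \<forall>g\<^sub>1 \<in> hball mul deg g 1. \<forall>g\<^sub>2 \<in> G. sgn (riesz_kernel mul p j g\<^sub>2 g\<^sub>1) = \<sigma>) \<and>
    emeasure lebesgue G = \<infinity> \<and>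
    (\<forall>R\<^sub>1 R\<^sub>2. 2 * r\<^sub>o < R\<^sub>1 \<and> R\<^sub>1 < R\<^sub>2 \<longrightarrow>
       (let A = hball mul deg g R\<^sub>2 - hball mul deg g R\<^sub>1 in
          ennreal c * emeasure lebesgue A \<le> emeasure lebesgue (A \<inter> G) \<and>
          emeasure lebesgue (A \<inter> G) \<le> ennreal c' * emeasure lebesgue A))"
proof -
  from assms(2) obtain T where hs: "heat_semigroup mul deg T"
    and T: "\<And>h f. h > 0 \<Longrightarrow> f \<in> L2 \<Longrightarrow> AE g in lborel. T h f g = gconv mul f (p h) g"
    unfolding heat_kernel_def by blast
  have sp: "smooth (p h)" if "h > 0" for h using assms(2) that unfolding heat_kernel_def by blast
  interpret heat mul deg T p
    using assms(1) hs sp T unfolding heat_def heat_axioms_def csg_def heat_semigroup_def by blast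
  show ?thesis by (rule riesz_sector_bounds[OF assms(3)])
qed

end
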